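(* Suppose $T$ and $C$ commute, and that: (i) there are $\alpha>0$ and $h\in L^2(S)$ with $\beta^*=T^{\alpha}h$; (ii) for some $t,c>1$, $i^{-t}\lesssim\mu_i\lesssim i^{-t}$ and $i^{-c}\lesssim\xi_i\lesssim i^{-c}$ for all $i\in\mathbb N$, where $(\mu_i,\phi_i)_{i\in\mathbb N}$ and $(\xi_i,\phi_i)_{i\in\mathbb N}$ are the simple eigenvalue–eigenfunction pairs of $T$ and $C$, respectively (with the same eigenfunctions $\phi_i$); (iii) there is a constant $d_1>0$ such that $\mathbb E[\langle X,f\rangle_{L^2}^4]\le d_1\,[\mathbb E\langle X,f\rangle_{L^2}^2]^2$ for all $f\in L^2(S)$. Let $\nu\ge\frac12$ be the qualification of the regularization family $(g_\lambda)$ and let $\hat\beta=g_\lambda(J^*\hat C_nJ)J^*\hat R$. Then, for $\lambda=n^{-\frac{t+c}{1+c+2tr}}$ (with $r$ as specified in each part), we have (a) $\|\beta^*-\hat\beta\|_{L^2}\lesssim_p n^{-\frac{rt}{1+c+2tr}}$, where $r=\min\{\alpha,\ \nu+\frac ct(\nu-\frac12)\}$; (b) if $\alpha\ge\frac12$, $\|\beta^*-\hat\beta\|_{\mathcal H}\lesssim_p n^{-\frac{t(r-\frac12)}{1+c+2tr}}$, where $r=\min\{\alpha,\ \nu+\frac ct\nu+\frac12\}$.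
   Context: Setting. $S\subset\mathbb R^d$ is compact, $L^2(S)$ is the real $L^2$ space with inner product $\langle f,g\rangle_{L^2}=\int_S fg$. $X$ is a random element of $L^2(S)$ with $\mathbb E\|X\|_{L^2}^2<\infty$; $\beta^*\in L^2(S)$; $Y=\langle X,\beta^*\rangle_{L^2}+\epsilon$, where $\epsilon$ is real, zero mean, independent of $X$, with finite variance $\sigma^2$. $(X_1,Y_1),\dots,(X_n,Y_n)$ are i.i.d. copies of $(X,Y)$. With $(f\otimes f)g=\langle f,g\rangle_{L^2}f$, set $C=\mathbb E[X\otimes X]$, $\hat C_n=\frac1n\sum_{i=1}^nX_i\otimes X_i$, $\hat R=\frac1n\sum_{i=1}^nY_iX_i$. RKHS. $k:S\times S\to\mathbb R$ is a measurable symmetric positive definite kernel with $\sup_{x\in S}k(x,x)\le\kappa<\infty$, with RKHS $\mathcal H$. $J:\mathcal H\to L^2(S)$ is the inclusion operator, $J^*g=\int_Sk(\cdot,x)g(x)\,dx$ its adjoint, and $T=JJ^*:L^2(S)\to L^2(S)$. $\mathcal H$ is regarded as a subset of $L^2(S)$; $T^{1/2}$ is a partial isometry from $L^2(S)$ onto $\mathcal H$, i.e. $\mathcal R(T^{1/2})=\mathcal H$. Regularization family. $g_\lambda:[0,\eta]\to\mathbb R$, $0<\lambda\le\eta$ ($[0,\eta]$ read as $[0,\infty)$ if $\eta=\infty$), with constants $A,B,D>0$ independent of $\lambda$ such that $\sup_{0<\sigma\le\eta}|\sigma g_\lambda(\sigma)|\le A$, $\sup_{0<\sigma\le\eta}|g_\lambda(\sigma)|\le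 B/\lambda$, $\sup_{0<\sigma\le\eta}|r_\lambda(\sigma)|\le D$, where $r_\lambda(\sigma)=1-\sigma g_\lambda(\sigma)$. The qualification is the maximal $p$ such that $\sup_{0<\sigma\le\eta}|r_\lambda(\sigma)|\sigma^p\le\omega_p\lambda^p$ with $\omega_p$ independent of $\lambda$ (it is $\infty$ if this holds for every $p>0$). Functions of self-adjoint operators are defined by functional calculus, and $\eta$ is such that the spectrum of $J^*\hat C_nJ$ lies in $[0,\eta]$ almost surely for every $n$. Notation. $a\lesssim b$ means $a\le \text{const}\cdot b$ for a positive constant (independent of the index). $W\lesssim_p b$ (for quantities depending on $n$) means: for every $\delta\in(0,1)$ there is a finite constant $c_\delta>0$, independent of $n$, with $P(W\le c_\delta b)\ge\delta$ (for all $n$ for which $\lambda\le\eta$). *)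

theory Defs
  imports "HOL-Probability.Probability"
begin

section \<open>The Hilbert space of square integrable functions\<close>

definition square_integrable :: "('a::euclidean_space \<Rightarrow> real) \<Rightarrow> bool" where
  "square_integrable f \<longleftrightarrow>
     f \<in> borel_measurable lborel \<and> integrable lborel (\<lambda>x. (f x)\<^sup>2)"

definition L2_rel :: "('a::euclidean_space \<Rightarrow> real) \<Rightarrow> ('a \<Rightarrow> real) \<Rightarrow> bool" where
  "L2_rel f g \<longleftrightarrow>
     square_integrable f \<and> square_integrable g \<and> (AE x in lborel. f x = g x)"

lemma square_integrable_zero: "square_integrable (\<lambda>_. 0)"
  by (simp add: square_integrable_def)

lemma square_integrable_measurable [measurable_dest]:
  "square_integrable f \<Longrightarrow> f \<in> borel_measurable lborel"
  by (simp add: square_integrable_def)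

lemma square_integrable_mult:
  assumes "square_integrable f" "square_integrable g"
  shows "integrable lborel (\<lambda>x. f x * g x)"
proof (rule Bochner_Integration.integrable_bound)
  show "integrable lborel (\<lambda>x. (f x)\<^sup>2 + (g x)\<^sup>2)"
    using assms by (simp add: square_integrable_def)
  show "(\<lambda>x. f x * g x) \<in> borel_measurable lborel"
    using assms by (auto simp: square_integrable_def)
  have "\<bar>a * b\<bar> \<le> a\<^sup>2 + b\<^sup>2" for a b :: real
  proof -
    have "2 * (\<bar>a\<bar> * \<bar>b\<bar>) \<le> a\<^sup>2 + b\<^sup>2"
      using sum_squares_bound[of "\<bar>a\<bar>" "\<bar>b\<bar>"] by (simp add: mult.assoc)
    moreover have "0 \<le> \<bar>a\<bar> * \<bar>b\<bar>" by simp
    ultimately show ?thesis unfolding abs_mult by linarith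
  qed
  then show "AE x in lborel. norm (f x * g x) \<le> norm ((f x)\<^sup>2 + (g x)\<^sup>2)"
    by simp
qed

lemma square_integrable_add:
  assumes "square_integrable f" "square_integrable g"
  shows "square_integrable (\<lambda>x. f x + g x)"
proof -
  have "integrable lborel (\<lambda>x. (f x)\<^sup>2 + (g x)\<^sup>2 + 2 * (f x * g x))"
    using assms square_integrable_mult[OF assms]
    by (intro Bochner_Integration.integrable_add) (auto simp: square_integrable_def)
  then show ?thesis
    using assms by (auto simp: square_integrable_def power2_sum mult.assoc)
qed

lemma square_integrable_scale:
  assumes "square_integrable f"
  shows "square_integrable (\<lambda>x. c * f x)"
  using assms by (auto simp: square_integrable_def power_mult_distrib)

text \<open>
  \<open>'a L2\<close> is the real Hilbert space \<open>L\<^sup>2\<close> of the whole Euclidean space \<open>'a\<close>. The set \<open>S\<close> is a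
  term and cannot index a type, so \<open>L\<^sup>2(S)\<close> is rendered below as the closed subspace
  \<open>L2_on S\<close> of the classes vanishing almost everywhere outside \<open>S\<close>, with the inherited inner
  product. Operators on \<open>L\<^sup>2(S)\<close> are extended by zero to its orthogonal complement; this leaves
  nonzero eigenvalues and their eigenspaces unchanged.
\<close>

quotient_type (overloaded) 'a L2 = "'a::euclidean_space \<Rightarrow> real" / partial: L2_rel
proof (rule part_equivpI)
  show "\<exists>f :: 'a \<Rightarrow> real. L2_rel f f"
    using square_integrable_zero by (auto simp: L2_rel_def)
  show "symp (L2_rel :: ('a \<Rightarrow> real) \<Rightarrow> _)"
    by (auto simp: symp_def L2_rel_def elim: AE_mp)
  show "transp (L2_rel :: ('a \<Rightarrow> real) \<Rightarrow> _)"
  proof (rule transpI)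
    fix f g h :: "'a \<Rightarrow> real"
    assume fg: "L2_rel f g" and gh: "L2_rel g h"
    have "AE x in lborel. f x = g x" "AE x in lborel. g x = h x"
      using fg gh by (auto simp: L2_rel_def)
    then have "AE x in lborel. f x = h x" by eventually_elim simp
    then show "L2_rel f h" using fg gh by (auto simp: L2_rel_def)
  qed
qed

instantiation L2 :: (euclidean_space) real_vector
begin

lift_definition zero_L2 :: "'a L2" is "\<lambda>_. 0"
  by (simp add: L2_rel_def square_integrable_zero)

lift_definition plus_L2 :: "'a L2 \<Rightarrow> 'a L2 \<Rightarrow> 'a L2" is "\<lambda>f g x. f x + g x"
  by (auto simp: L2_rel_def square_integrable_add)

lift_definition scaleR_L2 :: "real \<Rightarrow> 'a L2 \<Rightarrow> 'a L2" is "\<lambda>c f x. c * f x"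
  by (auto simp: L2_rel_def square_integrable_scale)

lift_definition uminus_L2 :: "'a L2 \<Rightarrow> 'a L2" is "\<lambda>f x. - f x"
  using square_integrable_scale[where c="-1"] by (auto simp: L2_rel_def)

lift_definition minus_L2 :: "'a L2 \<Rightarrow> 'a L2 \<Rightarrow> 'a L2" is "\<lambda>f g x. f x - g x"
  using square_integrable_add[OF _ square_integrable_scale[where c="-1"]]
  by (auto simp: L2_rel_def)

instance
proof
  fix f g h :: "'a L2" and a b :: real
  show "f + g + h = f + (g + h)"
    by transfer (auto simp: L2_rel_def square_integrable_add add.assoc)
  show "f + g = g + f"
    by transfer (auto simp: L2_rel_def square_integrable_add add.commute)
  show "0 + f = f"
    by transfer (auto simp: L2_rel_def)
  show "- f + f = 0"
    by transfer (auto simp: L2_rel_def square_integrable_zero)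
  show "f - g = f + - g"
    by transfer
      (auto simp: L2_rel_def dest: square_integrable_add[OF _ square_integrable_scale[where c="-1"]])
  show "a *\<^sub>R (f + g) = a *\<^sub>R f + a *\<^sub>R g"
    by transfer (auto simp: L2_rel_def distrib_left intro: square_integrable_add square_integrable_scale)
  show "(a + b) *\<^sub>R f = a *\<^sub>R f + b *\<^sub>R f"
    by transfer
      (auto simp: L2_rel_def distrib_right square_integrable_add square_integrable_scale)
  show "a *\<^sub>R b *\<^sub>R f = (a * b) *\<^sub>R f"
    by transfer (auto simp: L2_rel_def mult.assoc square_integrable_scale)
  show "1 *\<^sub>R f = f"
    by transfer (auto simp: L2_rel_def)
qed

end

instantiation L2 :: (euclidean_space) real_inner
begin

lift_definition inner_L2 :: "'a L2 \<Rightarrow> 'a L2 \<Rightarrow> real" is "\<lambda>f g. LINT x|lborel. f x * g x"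
proof -
  fix f f' g g' :: "'a \<Rightarrow> real"
  assume f: "L2_rel f f'" and g: "L2_rel g g'"
  have "AE x in lborel. f x = f' x" "AE x in lborel. g x = g' x"
    using f g by (auto simp: L2_rel_def)
  then have "AE x in lborel. f x * g x = f' x * g' x" by eventually_elim simp
  then show "(LINT x|lborel. f x * g x) = (LINT x|lborel. f' x * g' x)"
    using f g by (intro integral_cong_AE) (auto simp: L2_rel_def square_integrable_def)
qed

definition norm_L2 :: "'a L2 \<Rightarrow> real" where
  "norm_L2 f = sqrt (inner f f)"

definition sgn_L2 :: "'a L2 \<Rightarrow> 'a L2" where
  "sgn_L2 f = f /\<^sub>R norm f"

definition dist_L2 :: "'a L2 \<Rightarrow> 'a L2 \<Rightarrow> real" where
  "dist_L2 f g = norm (f - g)"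

definition uniformity_L2 :: "('a L2 \<times> 'a L2) filter" where
  "uniformity_L2 = (INF e\<in>{0 <..}. principal {(x, y). dist x y < e})"

definition open_L2 :: "'a L2 set \<Rightarrow> bool" where
  "open_L2 U = (\<forall>x\<in>U. eventually (\<lambda>(x', y). x' = x \<longrightarrow> y \<in> U) uniformity)"

instance
proof
  fix f g h :: "'a L2" and a :: real
  show "dist f g = norm (f - g)" by (rule dist_L2_def)
  show "sgn f = f /\<^sub>R norm f" by (rule sgn_L2_def)
  show "uniformity = (INF e\<in>{0 <..}. principal {(x, y :: 'a L2). dist x y < e})"
    by (rule uniformity_L2_def)
  show "open U = (\<forall>x\<in>U. eventually (\<lambda>(x', y). x' = x \<longrightarrow> y \<in> U) uniformity)"
    for U :: "'a L2 set" by (rule open_L2_def)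
  show "inner f g = inner g f"
    by transfer (simp add: mult.commute)
  show "inner (f + g) h = inner f h + inner g h"
    by transfer (simp add: L2_rel_def distrib_right square_integrable_mult)
  show "inner (a *\<^sub>R f) g = a * inner f g"
    by transfer (simp add: L2_rel_def mult.assoc)
  show "0 \<le> inner f f"
    by transfer simp
  show "inner f f = 0 \<longleftrightarrow> f = 0"
  proof transfer
    fix f :: "'a \<Rightarrow> real" assume f: "L2_rel f f"
    have "(LINT x|lborel. f x * f x) = 0 \<longleftrightarrow> (AE x in lborel. f x * f x = 0)"
      using f by (intro integral_nonneg_eq_0_iff_AE) (auto simp: L2_rel_def square_integrable_mult)
    then show "(LINT x|lborel. f x * f x) = 0 \<longleftrightarrow> L2_rel f (\<lambda>_. 0)"
      using f by (auto simp: L2_rel_def square_integrable_zero)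
  qed
  show "norm f = sqrt (inner f f)" by (rule norm_L2_def)
qed

end

lemma square_integrable_rep_L2: "square_integrable (rep_L2 f)"
  using Quotient_rep_reflp[OF Quotient_L2, of f] by (simp add: L2_rel_def)

lemma abs_rep_L2: "abs_L2 (rep_L2 f) = f"
  using Quotient_abs_rep[OF Quotient_L2] .

lemma abs_L2_eq_iff:
  "square_integrable f \<Longrightarrow> square_integrable g \<Longrightarrow>
     abs_L2 f = abs_L2 g \<longleftrightarrow> (AE x in lborel. f x = g x)"
  using Quotient_rel[OF Quotient_L2, of f g] by (auto simp: L2_rel_def)

lemma rep_abs_L2: "square_integrable f \<Longrightarrow> AE x in lborel. rep_L2 (abs_L2 f) x = f x"
  using abs_L2_eq_iff[of "rep_L2 (abs_L2 f)" f] by (simp add: square_integrable_rep_L2 abs_rep_L2)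

lemma inner_abs_L2:
  "square_integrable f \<Longrightarrow> square_integrable g \<Longrightarrow>
     inner (abs_L2 f) (abs_L2 g) = (LINT x|lborel. f x * g x)"
  by (simp add: inner_L2.abs_eq L2_rel_def)

lemma power2_norm_abs_L2:
  "square_integrable f \<Longrightarrow> (norm (abs_L2 f))\<^sup>2 = (LINT x|lborel. (f x)\<^sup>2)"
  using inner_abs_L2[of f f] by (simp add: power2_norm_eq_inner flip: power2_eq_square)

lemma inner_L2_eq: "inner f g = (LINT x|lborel. rep_L2 f x * rep_L2 g x)"
  using inner_abs_L2[OF square_integrable_rep_L2 square_integrable_rep_L2, of f g]
  by (simp add: abs_rep_L2)

lemma abs_L2_add:
  "square_integrable f \<Longrightarrow> square_integrable g \<Longrightarrow>
     abs_L2 f + abs_L2 g = abs_L2 (\<lambda>x. f x + g x)"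
  by (simp add: plus_L2.abs_eq L2_rel_def)

lemma abs_L2_diff:
  "square_integrable f \<Longrightarrow> square_integrable g \<Longrightarrow>
     abs_L2 f - abs_L2 g = abs_L2 (\<lambda>x. f x - g x)"
  by (simp add: minus_L2.abs_eq L2_rel_def)

lemma abs_L2_scale:
  "square_integrable f \<Longrightarrow> c *\<^sub>R abs_L2 f = abs_L2 (\<lambda>x. c * f x)"
  by (simp add: scaleR_L2.abs_eq L2_rel_def)

lemma square_integrable_diff:
  "square_integrable f \<Longrightarrow> square_integrable g \<Longrightarrow> square_integrable (\<lambda>x. f x - g x)"
  using square_integrable_add[OF _ square_integrable_scale[where c="-1"], of f g] by simp

lemma nn_integral_square_eq_norm:
  assumes "square_integrable f"
  shows "(\<integral>\<^sup>+x. ennreal ((f x)\<^sup>2) \<partial>lborel) = ennreal ((norm (abs_L2 f))\<^sup>2)"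
  using assms by (simp add: nn_integral_eq_integral power2_norm_abs_L2 square_integrable_def)

lemma L2_Cauchy_fast_converges:
  fixes X :: "nat \<Rightarrow> 'a::euclidean_space L2"
  assumes fast: "\<And>n. norm (X (Suc n) - X n) \<le> (1/4) ^ n"
  shows "\<exists>L. \<forall>n. norm (X n - L) \<le> 2 * (1/4) ^ n"
proof -
  define f where "f n = rep_L2 (X n)" for n
  have f: "square_integrable (f n)" for n
    by (simp add: f_def square_integrable_rep_L2)
  have Xf: "X n = abs_L2 (f n)" for n
    by (simp add: f_def abs_rep_L2)
  have [measurable]: "f n \<in> borel_measurable lborel" for n
    using f by (simp add: square_integrable_def)
  have nnf: "(\<integral>\<^sup>+x. ennreal ((f m x - f n x)\<^sup>2) \<partial>lborel) = ennreal ((norm (X m - X n))\<^sup>2)" for m n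
    using nn_integral_square_eq_norm[OF square_integrable_diff[OF f f], of m n]
    by (simp add: Xf abs_L2_diff f)
  have term_le: "(\<integral>\<^sup>+x. ennreal (2 ^ n * (f (Suc n) x - f n x)\<^sup>2) \<partial>lborel) \<le> ennreal ((1/2) ^ n)" for n
  proof -
    have "(\<integral>\<^sup>+x. ennreal (2 ^ n * (f (Suc n) x - f n x)\<^sup>2) \<partial>lborel)
        = ennreal (2 ^ n) * (\<integral>\<^sup>+x. ennreal ((f (Suc n) x - f n x)\<^sup>2) \<partial>lborel)"
      by (subst nn_integral_cmult[symmetric]) (auto simp: ennreal_mult)
    also have "\<dots> = ennreal (2 ^ n * (norm (X (Suc n) - X n))\<^sup>2)"
      by (simp add: nnf ennreal_mult)
    also have "\<dots> \<le> ennreal ((1/2) ^ n)"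
    proof (rule ennreal_leI)
      have "2 ^ n * (norm (X (Suc n) - X n))\<^sup>2 \<le> 2 ^ n * ((1/4) ^ n)\<^sup>2"
        using fast[of n] by (intro mult_left_mono power_mono) auto
      also have "\<dots> = (1/8::real) ^ n"
        by (simp add: power2_eq_square flip: power_mult_distrib)
      also have "\<dots> \<le> (1/2) ^ n" by (rule power_mono) auto
      finally show "2 ^ n * (norm (X (Suc n) - X n))\<^sup>2 \<le> (1/2) ^ n" .
    qed
    finally show ?thesis .
  qed
  have "(\<integral>\<^sup>+x. (\<Sum>n. ennreal (2 ^ n * (f (Suc n) x - f n x)\<^sup>2)) \<partial>lborel)
      = (\<Sum>n. \<integral>\<^sup>+x. ennreal (2 ^ n * (f (Suc n) x - f n x)\<^sup>2) \<partial>lborel)"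
    by (rule nn_integral_suminf) auto
  also have "\<dots> \<le> (\<Sum>n. ennreal ((1/2) ^ n))"
    by (intro suminf_le term_le) auto
  also have "\<dots> = ennreal (\<Sum>n. (1/2) ^ n)"
    by (rule suminf_ennreal2) (auto intro: summable_geometric)
  also have "\<dots> < \<infinity>" by simp
  finally have "(\<integral>\<^sup>+x. (\<Sum>n. ennreal (2 ^ n * (f (Suc n) x - f n x)\<^sup>2)) \<partial>lborel) \<noteq> \<infinity>"
    by simp
  then have "AE x in lborel. (\<Sum>n. ennreal (2 ^ n * (f (Suc n) x - f n x)\<^sup>2)) \<noteq> \<infinity>"
    by (intro nn_integral_PInf_AE) auto
  then have conv: "AE x in lborel. convergent (\<lambda>n. f n x)"
  proof eventually_elim
    case (elim x)
    have s: "summable (\<lambda>n. 2 ^ n * (f (Suc n) x - f n x)\<^sup>2)"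
      using elim by (intro summable_suminf_not_top) auto
    have le: "\<bar>f (Suc n) x - f n x\<bar> \<le> (1/2) ^ n + 2 ^ n * (f (Suc n) x - f n x)\<^sup>2" for n
    proof -
      define a where "a = \<bar>f (Suc n) x - f n x\<bar>"
      define p where "p = (2::real) ^ n"
      have p: "p > 0" and a: "a \<ge> 0" by (auto simp: p_def a_def)
      have "2 * (p * a) \<le> 1 + (p * a)\<^sup>2" using sum_squares_bound[of 1 "p * a"] by simp
      moreover have "0 \<le> p * a" using p a by simp
      ultimately have "p * a \<le> 1 + (p * a)\<^sup>2" by linarith
      then have "a \<le> (1 + (p * a)\<^sup>2) / p" using p by (simp add: pos_le_divide_eq mult.commute)
      also have "\<dots> = 1 / p + p * a\<^sup>2" using p by (simp add: field_simps power2_eq_square)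
      finally show ?thesis by (simp add: a_def p_def power_one_over)
    qed
    have "summable (\<lambda>n. f (Suc n) x - f n x)"
    proof (rule summable_comparison_test'[where N = 0])
      show "summable (\<lambda>n. (1/2) ^ n + 2 ^ n * (f (Suc n) x - f n x)\<^sup>2)"
        by (intro summable_add s summable_geometric) auto
    qed (use le in auto)
    then have "convergent (\<lambda>n. \<Sum>k<n. f (Suc k) x - f k x)"
      by (simp add: summable_iff_convergent)
    then have "convergent (\<lambda>n. (\<Sum>k<n. f (Suc k) x - f k x) + f 0 x)"
      by (intro convergent_add convergent_const)
    then show "convergent (\<lambda>n. f n x)"
      using sum_lessThan_telescope[of "\<lambda>n. f n x"] by simp
  qed
  define F where "F x = lim (\<lambda>n. f n x)" for x
  have [measurable]: "F \<in> borel_measurable lborel"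
    unfolding F_def by (rule borel_measurable_lim_metric) auto
  have lim: "AE x in lborel. (\<lambda>n. f n x) \<longlonglongrightarrow> F x"
    using conv by eventually_elim (simp add: F_def convergent_LIMSEQ_iff)
  have dist_le: "norm (X (n + k) - X n) \<le> 2 * (1/4) ^ n" for n k
  proof -
    have "norm (X (n + k) - X n) \<le> (\<Sum>i<k. (1/4) ^ (n + i))"
    proof (induction k)
      case (Suc k)
      have "norm (X (n + Suc k) - X n) \<le> norm (X (Suc (n + k)) - X (n + k)) + norm (X (n + k) - X n)"
        using norm_triangle_ineq[of "X (Suc (n + k)) - X (n + k)" "X (n + k) - X n"] by simp
      then show ?case using Suc fast[of "n + k"] by simp
    qed simp
    also have "\<dots> = (1/4) ^ n * (\<Sum>i<k. (1/4) ^ i)"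
      by (simp add: power_add sum_distrib_left)
    also have "\<dots> \<le> (1/4) ^ n * 2"
    proof (intro mult_left_mono)
      have "(\<Sum>i<k. (1/4::real) ^ i) \<le> (\<Sum>i. (1/4) ^ i)"
        by (intro sum_le_suminf summable_geometric) auto
      also have "\<dots> = 4/3" by (subst suminf_geometric) auto
      finally show "(\<Sum>i<k. (1/4::real) ^ i) \<le> 2" by simp
    qed simp
    finally show ?thesis by (simp add: mult.commute)
  qed
  have Fatou: "(\<integral>\<^sup>+x. ennreal ((F x - f n x)\<^sup>2) \<partial>lborel) \<le> ennreal ((2 * (1/4) ^ n)\<^sup>2)" for n
  proof -
    have "(\<integral>\<^sup>+x. ennreal ((F x - f n x)\<^sup>2) \<partial>lborel)
        = (\<integral>\<^sup>+x. liminf (\<lambda>m. ennreal ((f m x - f n x)\<^sup>2)) \<partial>lborel)"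
    proof (rule nn_integral_cong_AE, use lim in eventually_elim)
      case (elim x)
      have "(\<lambda>m. ennreal ((f m x - f n x)\<^sup>2)) \<longlonglongrightarrow> ennreal ((F x - f n x)\<^sup>2)"
        by (intro tendsto_intros elim)
      then show ?case by (rule lim_imp_Liminf[OF trivial_limit_sequentially, symmetric])
    qed
    also have "\<dots> \<le> liminf (\<lambda>m. \<integral>\<^sup>+x. ennreal ((f m x - f n x)\<^sup>2) \<partial>lborel)"
      by (rule nn_integral_liminf) auto
    also have "\<dots> \<le> liminf (\<lambda>m. ennreal ((2 * (1/4) ^ n)\<^sup>2))"
    proof (rule Liminf_mono)
      show "\<forall>\<^sub>F m in sequentially. (\<integral>\<^sup>+x. ennreal ((f m x - f n x)\<^sup>2) \<partial>lborel)
          \<le> ennreal ((2 * (1/4) ^ n)\<^sup>2)"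
        using eventually_ge_at_top[of n]
      proof eventually_elim
        case (elim m)
        then obtain k where m: "m = n + k" using le_Suc_ex by blast
        show ?case unfolding nnf m
          by (intro ennreal_leI power_mono dist_le) auto
      qed
    qed
    also have "\<dots> = ennreal ((2 * (1/4) ^ n)\<^sup>2)" by (simp add: Liminf_const)
    finally show ?thesis .
  qed
  have Fdiff: "square_integrable (\<lambda>x. F x - f n x)" for n
    unfolding square_integrable_def
  proof
    show "integrable lborel (\<lambda>x. (F x - f n x)\<^sup>2)"
      using le_less_trans[OF Fatou[of n] ennreal_less_top]
      by (intro integrableI_nonneg) auto
  qed auto
  have F: "square_integrable F"
    using square_integrable_add[OF Fdiff f, of 0 0] by simp
  have "norm (X n - abs_L2 F) \<le> 2 * (1/4) ^ n" for n
  proof -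
    have "ennreal ((norm (abs_L2 F - X n))\<^sup>2) \<le> ennreal ((2 * (1/4) ^ n)\<^sup>2)"
      using Fatou[of n] nn_integral_square_eq_norm[OF Fdiff, of n]
      by (simp add: Xf abs_L2_diff F f)
    then have "(norm (abs_L2 F - X n))\<^sup>2 \<le> (2 * (1/4) ^ n)\<^sup>2"
      by (simp add: ennreal_le_iff)
    then have "norm (abs_L2 F - X n) \<le> 2 * (1/4) ^ n"
      by (rule power2_le_imp_le) simp
    then show ?thesis by (simp add: norm_minus_commute)
  qed
  then show ?thesis by blast
qed

instance L2 :: (euclidean_space) complete_space
proof
  fix X :: "nat \<Rightarrow> 'a L2"
  assume X: "Cauchy X"
  have "\<exists>N. \<forall>m\<ge>N. \<forall>n\<ge>N. norm (X m - X n) < (1/4) ^ k" for k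
    using X by (auto simp: Cauchy_iff)
  then obtain N where N: "\<And>k m n. m \<ge> N k \<Longrightarrow> n \<ge> N k \<Longrightarrow> norm (X m - X n) < (1/4) ^ k"
    by metis
  define s where "s k = (\<Sum>i\<le>k. N i)" for k
  have sN: "s k \<ge> N k" for k
    unfolding s_def using member_le_sum[of k "{..k}" N] by simp
  have sSuc: "s (Suc k) \<ge> N k" for k
    using sN[of k] by (simp add: s_def)
  obtain L where L: "\<And>k. norm (X (s k) - L) \<le> 2 * (1/4) ^ k"
    using L2_Cauchy_fast_converges[of "\<lambda>k. X (s k)"] N sN sSuc by (metis less_imp_le)
  have "X \<longlonglongrightarrow> L"
  proof (rule LIMSEQ_I)
    fix e :: real assume "e > 0"
    then obtain k where k: "(1/4::real) ^ k < e / 3"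
      using real_arch_pow_inv[of "e / 3" "1/4"] by auto
    have "norm (X n - L) < e" if "n \<ge> N k" for n
    proof -
      have "norm (X n - L) \<le> norm (X n - X (s k)) + norm (X (s k) - L)"
        using norm_triangle_ineq[of "X n - X (s k)" "X (s k) - L"] by simp
      also have "\<dots> < (1/4) ^ k + 2 * (1/4) ^ k"
        using N[OF that sN[of k]] L[of k] by linarith
      finally show ?thesis using k by linarith
    qed
    then show "\<exists>m. \<forall>n\<ge>m. norm (X n - L) < e" by blast
  qed
  then show "convergent X" by (rule convergentI)
qed

instance L2 :: (euclidean_space) banach ..


lemma countable_dense_imp_second_countable:
  fixes D :: "'b::metric_space set"
  assumes "countable D" "closure D = UNIV"
  shows "\<exists>B::'b set set. countable B \<and> open = generate_topology B"
proof -
  define B where "B = (\<lambda>(x, n::nat). ball x (1 / real (Suc n))) ` (D \<times> UNIV)"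
  have "topological_basis B"
  proof (rule topological_basisI)
    show "open b" if "b \<in> B" for b using that by (auto simp: B_def)
    fix U :: "'b set" and y assume "open U" "y \<in> U"
    then obtain e where e: "e > 0" "ball y e \<subseteq> U" by (auto simp: open_contains_ball)
    obtain n :: nat where n: "1 / real (Suc n) < e / 2"
      using nat_approx_posE[of "e / 2"] e by auto
    have "y \<in> closure D" using assms by simp
    then obtain x where x: "x \<in> D" "dist x y < 1 / real (Suc n)"
      unfolding closure_approachable by (metis of_nat_0_less_iff zero_less_Suc zero_less_divide_1_iff)
    have "ball x (1 / real (Suc n)) \<subseteq> U"
    proof
      fix z assume z: "z \<in> ball x (1 / real (Suc n))"
      have "dist y z \<le> dist x y + dist x z" by (rule dist_triangle3)
      also have "\<dots> < e" using z x n by simp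
      finally show "z \<in> U" using e by auto
    qed
    then show "\<exists>B'\<in>B. y \<in> B' \<and> B' \<subseteq> U"
      using x by (intro bexI[of _ "ball x (1 / real (Suc n))"])
        (auto simp: B_def intro!: rev_image_eqI[of "(x, n)"])
  qed
  moreover have "countable B" using assms by (simp add: B_def)
  ultimately show ?thesis using topological_basis_imp_subbasis by blast
qed

definition ind_L2 :: "'a::euclidean_space set \<Rightarrow> 'a L2" where
  "ind_L2 A = abs_L2 (indicator A)"

lemma square_integrable_indicator:
  assumes "A \<in> sets borel" "emeasure lborel A < \<infinity>"
  shows "square_integrable (indicator A)"
proof -
  have "(\<lambda>x. (indicator A x :: real)\<^sup>2) = indicator A"
    by (auto simp: indicator_def)
  then show ?thesis
    using assms by (auto simp: square_integrable_def)
qed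

lemma ind_L2_fin:
  "A \<in> sets borel \<Longrightarrow> square_integrable (indicator (A \<inter> cball 0 (real n) :: 'a::euclidean_space set))"
proof (rule square_integrable_indicator)
  assume A: "A \<in> sets borel"
  then show "A \<inter> cball 0 (real n) \<in> sets borel" by auto
  have "emeasure lborel (A \<inter> cball 0 (real n)) \<le> emeasure lborel (cball (0::'a) (real n))"
    using A by (intro emeasure_mono) auto
  also have "\<dots> < \<infinity>" using emeasure_compact_finite[OF compact_cball] .
  finally show "emeasure lborel (A \<inter> cball 0 (real n)) < \<infinity>" .
qed

lemma L2_tendsto_dominated:
  fixes f :: "'a::euclidean_space \<Rightarrow> real"
  assumes s: "\<And>n. square_integrable (s n)" and f: "square_integrable f"
    and lim: "\<And>x. (\<lambda>n. s n x) \<longlonglongrightarrow> f x" and dom: "\<And>n x. \<bar>s n x\<bar> \<le> 2 * \<bar>f x\<bar>"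
  shows "(\<lambda>n. abs_L2 (s n)) \<longlonglongrightarrow> abs_L2 f"
proof -
  have [measurable]: "s n \<in> borel_measurable lborel" "f \<in> borel_measurable lborel" for n
    using s f by (auto simp: square_integrable_def)
  have "(\<lambda>n. LINT x|lborel. (s n x - f x)\<^sup>2) \<longlonglongrightarrow> (LINT x|(lborel :: 'a measure). (0::real))"
  proof (rule integral_dominated_convergence[where w = "\<lambda>x. 9 * (f x)\<^sup>2"])
    show "integrable lborel (\<lambda>x. 9 * (f x)\<^sup>2)"
      using f by (simp add: square_integrable_def)
    show "AE x in lborel. (\<lambda>n. (s n x - f x)\<^sup>2) \<longlonglongrightarrow> 0"
    proof (rule AE_I2)
      fix x
      have "(\<lambda>n. (s n x - f x)\<^sup>2) \<longlonglongrightarrow> (f x - f x)\<^sup>2" by (intro tendsto_intros lim)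
      then show "(\<lambda>n. (s n x - f x)\<^sup>2) \<longlonglongrightarrow> 0" by simp
    qed
    show "AE x in lborel. norm ((s n x - f x)\<^sup>2) \<le> 9 * (f x)\<^sup>2" for n
    proof (rule AE_I2)
      fix x
      have "\<bar>s n x - f x\<bar> \<le> \<bar>3 * f x\<bar>" using dom[of n x] by linarith
      then have "(s n x - f x)\<^sup>2 \<le> (3 * f x)\<^sup>2" by (simp only: abs_le_square_iff)
      then show "norm ((s n x - f x)\<^sup>2) \<le> 9 * (f x)\<^sup>2" by (simp add: power_mult_distrib)
    qed
  qed auto
  then have "(\<lambda>n. (norm (abs_L2 (s n) - abs_L2 f))\<^sup>2) \<longlonglongrightarrow> 0"
    by (simp add: abs_L2_diff s f power2_norm_abs_L2 square_integrable_diff)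
  then have "(\<lambda>n. sqrt ((norm (abs_L2 (s n) - abs_L2 f))\<^sup>2)) \<longlonglongrightarrow> sqrt 0"
    by (rule tendsto_real_sqrt)
  then have "(\<lambda>n. norm (abs_L2 (s n) - abs_L2 f)) \<longlonglongrightarrow> 0" by simp
  then show ?thesis
    by (simp add: LIM_zero_iff tendsto_norm_zero_iff)
qed

lemma abs_L2_sum:
  assumes "finite I" "\<And>i. i \<in> I \<Longrightarrow> square_integrable (f i)"
  shows "abs_L2 (\<lambda>x. \<Sum>i\<in>I. f i x) = (\<Sum>i\<in>I. abs_L2 (f i))"
proof -
  have "square_integrable (\<lambda>x. \<Sum>i\<in>I. f i x)
      \<and> abs_L2 (\<lambda>x. \<Sum>i\<in>I. f i x) = (\<Sum>i\<in>I. abs_L2 (f i))"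
    using assms
  proof (induction I rule: finite_induct)
    case (insert i F)
    then show ?case
      using abs_L2_add[of "f i" "\<lambda>x. \<Sum>i\<in>F. f i x"] by (simp add: square_integrable_add)
  qed (simp add: square_integrable_zero zero_L2_def)
  then show ?thesis ..
qed

lemma L2_closed_subspace_eq_UNIV:
  fixes V :: "'a::euclidean_space L2 set"
  assumes V: "closed V" "subspace V" and G: "Int_stable G" "sets (borel :: 'a measure) = sigma_sets UNIV G"
    and ball: "\<And>n. ind_L2 (cball 0 (real n)) \<in> V"
    and basic: "\<And>A n. A \<in> G \<Longrightarrow> ind_L2 (A \<inter> cball 0 (real n)) \<in> V"
  shows "V = UNIV"
proof -
  have bdd: "ind_L2 (A \<inter> cball 0 (real n)) \<in> V" if "A \<in> sets borel" for A n
  proof -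
    have "A \<in> sigma_sets UNIV G" using that G by simp
    have "G \<subseteq> Pow UNIV" by simp
    from G(1) this \<open>A \<in> sigma_sets UNIV G\<close> show ?thesis
    proof (induction rule: sigma_sets_induct_disjoint)
      fix A assume "A \<in> G" then show "ind_L2 (A \<inter> cball 0 (real n)) \<in> V" by (rule basic)
    next
      show "ind_L2 ({} \<inter> cball 0 (real n)) \<in> V"
        using subspace_0[OF V(2)] by (simp add: ind_L2_def zero_L2_def indicator_def[abs_def])
    next
      fix A assume A: "A \<in> sigma_sets UNIV G" and *: "ind_L2 (A \<inter> cball 0 (real n)) \<in> V"
      then have Ab: "A \<in> sets borel" using G by simp
      have "ind_L2 ((UNIV - A) \<inter> cball 0 (real n))
          = ind_L2 (cball 0 (real n)) - ind_L2 (A \<inter> cball 0 (real n))"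
        unfolding ind_L2_def
        by (subst abs_L2_diff)
          (use ind_L2_fin[of UNIV n] ind_L2_fin[OF Ab] in \<open>auto simp: indicator_def fun_eq_iff intro!: arg_cong[where f = abs_L2]\<close>)
      then show "ind_L2 ((UNIV - A) \<inter> cball 0 (real n)) \<in> V"
        using subspace_diff[OF V(2) ball *] by simp
    next
      fix A :: "nat \<Rightarrow> 'a set"
      assume disj: "disjoint_family A" and A: "range A \<subseteq> sigma_sets UNIV G"
        and *: "\<And>i. ind_L2 (A i \<inter> cball 0 (real n)) \<in> V"
      have Ab: "A i \<in> sets borel" for i using A G by auto
      have U: "(\<Union>i<k. A i) \<in> sets borel" for k using Ab by auto
      have part: "ind_L2 ((\<Union>i<k. A i) \<inter> cball 0 (real n)) \<in> V" for k
      proof (induction k)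
        case 0
        show ?case
          using subspace_0[OF V(2)] by (simp add: ind_L2_def zero_L2_def indicator_def[abs_def])
      next
        case (Suc k)
        have dis: "A k \<inter> A i = {}" if "i < k" for i
          using disj that by (auto simp: disjoint_family_on_def)
        have "ind_L2 ((\<Union>i<Suc k. A i) \<inter> cball 0 (real n))
            = ind_L2 ((\<Union>i<k. A i) \<inter> cball 0 (real n)) + ind_L2 (A k \<inter> cball 0 (real n))"
          unfolding ind_L2_def
          apply (subst abs_L2_add)
            apply (rule ind_L2_fin[OF U])
           apply (rule ind_L2_fin[OF Ab])
          apply (rule arg_cong[where f = abs_L2])
          apply (use dis in \<open>auto simp: indicator_def fun_eq_iff less_Suc_eq\<close>)
          done
        then show ?case using subspace_add[OF V(2) Suc *] by simp
      qed
      have "(\<lambda>k. abs_L2 (indicator ((\<Union>i<k. A i) \<inter> cball 0 (real n))))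
          \<longlonglongrightarrow> abs_L2 (indicator ((\<Union>i. A i) \<inter> cball 0 (real n)))"
      proof (rule L2_tendsto_dominated)
        show "square_integrable (indicator ((\<Union>i<k. A i) \<inter> cball 0 (real n)))" for k
          by (rule ind_L2_fin[OF U])
        show "square_integrable (indicator ((\<Union>i. A i) \<inter> cball 0 (real n)))"
          using Ab by (intro ind_L2_fin) auto
        fix x
        show "(\<lambda>k. indicator ((\<Union>i<k. A i) \<inter> cball 0 (real n)) x :: real)
            \<longlonglongrightarrow> indicator ((\<Union>i. A i) \<inter> cball 0 (real n)) x"
        proof (cases "\<exists>i. x \<in> A i")
          case True
          then obtain i where i: "x \<in> A i" by blast
          have "\<forall>\<^sub>F k in sequentially. (indicator ((\<Union>i<k. A i) \<inter> cball 0 (real n)) x :: real)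
              = indicator ((\<Union>i. A i) \<inter> cball 0 (real n)) x"
            using eventually_gt_at_top[of i]
            by eventually_elim (use i in \<open>auto simp: indicator_def\<close>)
          then show ?thesis by (rule tendsto_eventually)
        qed (simp add: indicator_def)
      next
        fix k x
        show "\<bar>indicator ((\<Union>i<k. A i) \<inter> cball 0 (real n)) x\<bar>
            \<le> 2 * \<bar>indicator ((\<Union>i. A i) \<inter> cball 0 (real n)) x :: real\<bar>"
          by (auto simp: indicator_def)
      qed
      then have "ind_L2 (\<Union> (range A) \<inter> cball 0 (real n)) \<in> V"
        using part by (intro Lim_in_closed_set[OF V(1)]) (auto simp: ind_L2_def)
      then show "ind_L2 (\<Union> (range A) \<inter> cball 0 (real n)) \<in> V" .
    qed
  qed
  have fin: "ind_L2 A \<in> V" if A: "A \<in> sets borel" "emeasure lborel A < \<infinity>" for A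
  proof -
    have "(\<lambda>k. abs_L2 (indicator (A \<inter> cball 0 (real k)))) \<longlonglongrightarrow> abs_L2 (indicator A)"
    proof (rule L2_tendsto_dominated[OF ind_L2_fin[OF A(1)] square_integrable_indicator[OF A]])
      fix x :: 'a
      obtain m :: nat where m: "norm x \<le> real m" using real_arch_simple by blast
      have "\<forall>\<^sub>F k in sequentially. (indicator (A \<inter> cball 0 (real k)) x :: real) = indicator A x"
        using eventually_ge_at_top[of m] by eventually_elim (use m in \<open>auto simp: indicator_def\<close>)
      then show "(\<lambda>k. indicator (A \<inter> cball 0 (real k)) x :: real) \<longlonglongrightarrow> indicator A x"
        by (rule tendsto_eventually)
    qed (auto simp: indicator_def)
    then show ?thesis
      using bdd[OF A(1)] by (intro Lim_in_closed_set[OF V(1)]) (auto simp: ind_L2_def)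
  qed
  have sq: "abs_L2 f \<in> V" if f: "square_integrable f" for f
  proof -
    have [measurable]: "f \<in> borel_measurable lborel" using f by (simp add: square_integrable_def)
    obtain s where s: "\<And>i. simple_function lborel (s i)"
        "\<And>x. x \<in> space lborel \<Longrightarrow> (\<lambda>i. s i x) \<longlonglongrightarrow> f x"
        "\<And>i x. x \<in> space lborel \<Longrightarrow> norm (s i x) \<le> 2 * norm (f x)"
      using borel_measurable_implies_sequence_metric[of f lborel 0] by auto
    have le: "\<bar>s i x\<bar> \<le> 2 * \<bar>f x\<bar>" for i x using s(3)[of x i] by simp
    have sm [measurable]: "s i \<in> borel_measurable lborel" for i
      using borel_measurable_simple_function[OF s(1)] .
    have ssq: "square_integrable (s i)" for i
      unfolding square_integrable_def
    proof
      show "integrable lborel (\<lambda>x. (s i x)\<^sup>2)"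
      proof (rule Bochner_Integration.integrable_bound)
        show "integrable lborel (\<lambda>x. 4 * (f x)\<^sup>2)" using f by (simp add: square_integrable_def)
        have "(s i x)\<^sup>2 \<le> 4 * (f x)\<^sup>2" for x
        proof -
          have "\<bar>s i x\<bar> \<le> \<bar>2 * f x\<bar>" using le[of i x] by (simp add: abs_mult)
          then have "(s i x)\<^sup>2 \<le> (2 * f x)\<^sup>2" by (simp only: abs_le_square_iff)
          then show ?thesis by (simp add: power_mult_distrib)
        qed
        then show "AE x in lborel. norm ((s i x)\<^sup>2) \<le> norm (4 * (f x)\<^sup>2)" by simp
      qed auto
    qed (rule sm)
    have "abs_L2 (s i) \<in> V" for i
    proof -
      define R where "R = range (s i) - {0}"
      define P where "P y = s i -` {y}" for y
      have R: "finite R" using simple_functionD(1)[OF s(1), of i] by (simp add: R_def)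
      have P: "P y \<in> sets borel" for y
        using measurable_sets[OF sm, of "{y}" i] by (simp add: P_def)
      have Pfin: "emeasure lborel (P y) < \<infinity>" if "y \<noteq> 0" for y
      proof -
        have "ennreal (y\<^sup>2) * emeasure lborel (P y) = (\<integral>\<^sup>+x. ennreal (y\<^sup>2) * indicator (P y) x \<partial>lborel)"
          by (rule nn_integral_cmult_indicator[symmetric]) (simp add: P)
        also have "\<dots> \<le> (\<integral>\<^sup>+x. ennreal ((s i x)\<^sup>2) \<partial>lborel)"
          by (intro nn_integral_mono) (auto simp: indicator_def P_def)
        also have "\<dots> < \<infinity>" using nn_integral_square_eq_norm[OF ssq, of i] by simp
        finally show ?thesis using that by (auto simp: ennreal_mult_less_top)
      qed
      have Psq: "square_integrable (\<lambda>x. y * indicator (P y) x)" if "y \<in> R" for y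
        using that by (intro square_integrable_scale square_integrable_indicator P Pfin) (simp add: R_def)
      have "s i = (\<lambda>x. \<Sum>y\<in>R. y * indicator (P y) x)"
      proof
        fix x
        have "(\<Sum>y\<in>R. y * indicator (P y) x) = (\<Sum>y\<in>R. if y = s i x then y else 0)"
          by (rule sum.cong) (auto simp: P_def indicator_def)
        then show "s i x = (\<Sum>y\<in>R. y * indicator (P y) x)"
          using R by (auto simp: R_def)
      qed
      then have "abs_L2 (s i) = (\<Sum>y\<in>R. abs_L2 (\<lambda>x. y * indicator (P y) x))"
        using abs_L2_sum[OF R Psq] by simp
      also have "\<dots> = (\<Sum>y\<in>R. y *\<^sub>R ind_L2 (P y))"
      proof (rule sum.cong[OF refl])
        fix y assume "y \<in> R"
        then have "square_integrable (indicator (P y))"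
          by (intro square_integrable_indicator P Pfin) (simp add: R_def)
        then show "abs_L2 (\<lambda>x. y * indicator (P y) x) = y *\<^sub>R ind_L2 (P y)"
          by (simp add: ind_L2_def abs_L2_scale)
      qed
      also have "\<dots> \<in> V"
        by (intro subspace_sum[OF V(2)] subspace_scale[OF V(2)] fin P Pfin) (simp add: R_def)
      finally show ?thesis .
    qed
    moreover have "(\<lambda>i. abs_L2 (s i)) \<longlonglongrightarrow> abs_L2 f"
      using s(2) by (intro L2_tendsto_dominated ssq f le) auto
    ultimately show ?thesis by (intro Lim_in_closed_set[OF V(1)]) auto
  qed
  have "g \<in> V" for g
    using sq[OF square_integrable_rep_L2, of g] by (simp add: abs_rep_L2)
  then show ?thesis by blast
qed

instance L2 :: (euclidean_space) second_countable_topology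
proof
  obtain B :: "'a set set" where B: "countable B" "topological_basis B"
    using ex_countable_basis by blast
  define G where "G = Inter ` {F. finite F \<and> F \<subseteq> B}"
  have cG: "countable G"
    using countable_Collect_finite_subset[OF B(1)] by (simp add: G_def conj_commute)
  have UG: "UNIV \<in> G" unfolding G_def by (rule image_eqI[of _ _ "{}"]) auto
  have GI: "Int_stable G"
  proof (rule Int_stableI)
    fix a b assume "a \<in> G" "b \<in> G"
    then obtain F F' where "a = \<Inter>F" "b = \<Inter>F'" "finite F" "finite F'" "F \<subseteq> B" "F' \<subseteq> B"
      by (auto simp: G_def)
    then show "a \<inter> b \<in> G" unfolding G_def by (intro image_eqI[of _ _ "F \<union> F'"]) auto
  qed
  have Bopen: "open b" if "b \<in> B" for b using B(2) that by (rule topological_basis_open)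
  have Gopen: "open a" if "a \<in> G" for a
    using that Bopen by (auto simp: G_def intro!: open_Inter)
  have BG: "B \<subseteq> G"
  proof
    fix b assume "b \<in> B" then show "b \<in> G" unfolding G_def by (intro image_eqI[of _ _ "{b}"]) auto
  qed
  have Gsig: "sets (borel :: 'a measure) = sigma_sets UNIV G"
  proof
    have "sets (borel :: 'a measure) = sigma_sets UNIV B"
      by (subst borel_eq_countable_basis[OF B]) simp
    also have "\<dots> \<subseteq> sigma_sets UNIV G" by (rule sigma_sets_mono'[OF BG])
    finally show "sets (borel :: 'a measure) \<subseteq> sigma_sets UNIV G" .
    show "sigma_sets UNIV G \<subseteq> sets (borel :: 'a measure)"
    proof -
      have "G \<subseteq> sets borel" using Gopen by auto
      then show ?thesis using sets.sigma_sets_subset[of G borel] by simp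
    qed
  qed
  define E :: "'a L2 set" where "E = (\<lambda>(A, n::nat). ind_L2 (A \<inter> cball 0 (real n))) ` (G \<times> UNIV)"
  have cE: "countable E" using cG by (simp add: E_def)
  define comb where "comb l = (\<Sum>(q, e)\<leftarrow>l. real_of_rat q *\<^sub>R e)" for l :: "(rat \<times> 'a L2) list"
  define D where "D = comb ` lists (UNIV \<times> E)"
  have cD: "countable D" using cE by (simp add: D_def)
  have D_add: "x + y \<in> D" if xD: "x \<in> D" "y \<in> D" for x y
  proof -
    obtain l m where "x = comb l" "y = comb m" "l \<in> lists (UNIV \<times> E)" "m \<in> lists (UNIV \<times> E)"
      using xD unfolding D_def by blast
    then show ?thesis unfolding D_def by (intro image_eqI[of _ _ "l @ m"]) (auto simp: comb_def)
  qed
  have comb_scale: "real_of_rat q *\<^sub>R comb l = comb (map (\<lambda>(p, e). (q * p, e)) l)" for q l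
    by (induction l) (auto simp: comb_def scaleR_add_right of_rat_mult)
  have D_scale: "real_of_rat q *\<^sub>R x \<in> D" if xD: "x \<in> D" for x q
  proof -
    obtain l where l: "x = comb l" "l \<in> lists (UNIV \<times> E)" using xD unfolding D_def by blast
    have "map (\<lambda>(p, e). (q * p, e)) l \<in> lists (UNIV \<times> E)" using l(2) by (induction l) auto
    then show ?thesis unfolding D_def l(1) comb_scale by blast
  qed
  have ED: "E \<subseteq> D"
  proof
    fix e assume "e \<in> E" then show "e \<in> D"
      unfolding D_def by (intro image_eqI[of _ _ "[(1, e)]"]) (auto simp: comb_def)
  qed
  have D0: "0 \<in> D" unfolding D_def by (intro image_eqI[of _ _ "[]"]) (auto simp: comb_def)
  have "subspace (closure D)"
  proof (rule subspaceI)
    show "0 \<in> closure D" using D0 closure_subset by blast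
  next
    fix x y assume "x \<in> closure D" "y \<in> closure D"
    then obtain f g where "\<And>n::nat. f n \<in> D" "f \<longlonglongrightarrow> x" "\<And>n::nat. g n \<in> D" "g \<longlonglongrightarrow> y"
      unfolding closure_sequential by blast
    then show "x + y \<in> closure D"
      unfolding closure_sequential by (intro exI[of _ "\<lambda>n. f n + g n"]) (auto intro: D_add tendsto_add)
  next
    fix c :: real and x assume "x \<in> closure D"
    then obtain f where f: "\<And>n::nat. f n \<in> D" "f \<longlonglongrightarrow> x"
      unfolding closure_sequential by blast
    have "c \<in> closure \<rat>" by (simp add: Rats_closure_real)
    then obtain q where q: "\<And>n::nat. q n \<in> \<rat>" "q \<longlonglongrightarrow> c"
      unfolding closure_sequential by blast
    have "q n *\<^sub>R f n \<in> D" for n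
      using q(1)[of n] f(1)[of n] by (auto elim!: Rats_cases simp: D_scale)
    then show "c *\<^sub>R x \<in> closure D"
      unfolding closure_sequential using q f
      by (intro exI[of _ "\<lambda>n. q n *\<^sub>R f n"]) (auto intro: tendsto_scaleR)
  qed
  then have "closure D = UNIV"
  proof (rule L2_closed_subspace_eq_UNIV[OF closed_closure _ GI Gsig])
    have E: "ind_L2 (A \<inter> cball 0 (real n)) \<in> closure D" if "A \<in> G" for A n
    proof -
      have "ind_L2 (A \<inter> cball 0 (real n)) \<in> E" using that by (auto simp: E_def)
      then show ?thesis using ED closure_subset by blast
    qed
    then show "ind_L2 (A \<inter> cball 0 (real n)) \<in> closure D" if "A \<in> G" for A n using that .
    show "ind_L2 (cball 0 (real n)) \<in> closure D" for n using E[OF UG, of n] by simp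
  qed
  with cD show "\<exists>B::'a L2 set set. countable B \<and> open = generate_topology B"
    by (rule countable_dense_imp_second_countable)
qed

definition L2_on :: "'a::euclidean_space set \<Rightarrow> 'a L2 set" where
  "L2_on S = {f. AE x in lborel. x \<notin> S \<longrightarrow> rep_L2 f x = 0}"


section \<open>Operators on Hilbert spaces\<close>

definition tensor_square :: "'v::real_inner \<Rightarrow> 'v \<Rightarrow> 'v" where
  "tensor_square f g = inner f g *\<^sub>R f"

definition eigenspace :: "('v::real_vector \<Rightarrow> 'v) \<Rightarrow> real \<Rightarrow> 'v set" where
  "eigenspace A s = {v. A v = s *\<^sub>R v}"

definition orthogonal_projection :: "'v::real_inner set \<Rightarrow> 'v \<Rightarrow> 'v" where
  "orthogonal_projection V x = (THE p. p \<in> V \<and> (\<forall>v\<in>V. inner (x - p) v = 0))"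

text \<open>
  Functional calculus \<open>f(A)\<close> of a compact self-adjoint operator \<open>A\<close>: the spectral measure is
  concentrated on the eigenvalues, so \<open>f(A)\<close> is the sum of \<open>f(s)\<close> times the orthogonal projection
  onto the eigenspace of \<open>s\<close>, over all eigenvalues \<open>s\<close> (zero included if \<open>A\<close> is not injective).
  It is used only for \<open>T\<close> and for the finite-rank operators \<open>J\<^sup>* C\<^sub>n J\<close>, \<open>C\<^sub>n\<close> being the empirical
  covariance operator, and it makes sense for functions \<open>f\<close> that are not measurable.
\<close>

definition functional_calculus ::
    "(real \<Rightarrow> real) \<Rightarrow> ('v::real_inner \<Rightarrow> 'v) \<Rightarrow> 'v \<Rightarrow> 'v" where
  "functional_calculus f A x =
     (\<Sum>\<^sub>\<infinity>s\<in>{s. eigenspace A s \<noteq> {0}}. f s *\<^sub>R orthogonal_projection (eigenspace A s) x)"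

definition real_spectrum :: "('v::real_normed_vector \<Rightarrow> 'v) \<Rightarrow> real set" where
  "real_spectrum A =
     {s. \<not> (\<exists>B. bounded_linear B \<and> (\<forall>v. B (A v - s *\<^sub>R v) = v) \<and> (\<forall>v. A (B v) - s *\<^sub>R B v = v))}"

text \<open>
  \<open>(\<mu>\<^sub>i, \<phi>\<^sub>i)\<close>, \<open>i \<ge> 1\<close>, enumerates without repetition the nonzero eigenvalues of \<open>A\<close>, all of them
  simple, with eigenfunctions. A nontrivial kernel of \<open>A\<close> is allowed.
\<close>

definition simple_eigenpairs ::
    "('v::real_vector \<Rightarrow> 'v) \<Rightarrow> (nat \<Rightarrow> real) \<Rightarrow> (nat \<Rightarrow> 'v) \<Rightarrow> bool" where
  "simple_eigenpairs A \<mu> \<phi> \<longleftrightarrow>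
     (\<forall>i\<ge>1. \<mu> i \<noteq> 0 \<and> \<phi> i \<noteq> 0 \<and> eigenspace A (\<mu> i) = span {\<phi> i}) \<and>
     inj_on \<mu> {1..} \<and>
     (\<forall>s. s \<noteq> 0 \<and> eigenspace A s \<noteq> {0} \<longrightarrow> s \<in> \<mu> ` {1..})"

definition power_decay :: "real \<Rightarrow> (nat \<Rightarrow> real) \<Rightarrow> bool" where
  "power_decay t \<mu> \<longleftrightarrow>
     (\<exists>a>0. \<exists>b>0. \<forall>i\<ge>1. a * real i powr (-t) \<le> \<mu> i \<and> \<mu> i \<le> b * real i powr (-t))"


section \<open>Reproducing kernel Hilbert spaces\<close>

definition bounded_pd_kernel :: "'a::euclidean_space set \<Rightarrow> ('a \<Rightarrow> 'a \<Rightarrow> real) \<Rightarrow> real \<Rightarrow> bool" where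
  "bounded_pd_kernel S k \<kappa> \<longleftrightarrow>
     (\<lambda>(x, y). k x y) \<in> borel_measurable (restrict_space borel (S \<times> S)) \<and>
     (\<forall>x\<in>S. \<forall>y\<in>S. k x y = k y x) \<and>
     (\<forall>F a. finite F \<and> F \<subseteq> S \<longrightarrow> 0 \<le> (\<Sum>x\<in>F. \<Sum>y\<in>F. a x * a y * k x y)) \<and>
     (\<forall>x\<in>S. k x x \<le> \<kappa>)"

text \<open>
  The Hilbert space \<open>'h\<close> is the RKHS of \<open>k\<close> on \<open>S\<close>: its elements \<open>f\<close> are identified with the
  functions \<open>evalf f\<close> on \<open>S\<close>, it contains the sections of \<open>k\<close>, and these reproduce point values.
\<close>

definition is_RKHS ::
    "'a set \<Rightarrow> ('a \<Rightarrow> 'a \<Rightarrow> real) \<Rightarrow> ('h::{real_inner, banach} \<Rightarrow> 'a \<Rightarrow> real) \<Rightarrow> bool" where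
  "is_RKHS S k evalf \<longleftrightarrow>
     (\<forall>f g. \<forall>x\<in>S. evalf (f + g) x = evalf f x + evalf g x) \<and>
     (\<forall>c f. \<forall>x\<in>S. evalf (c *\<^sub>R f) x = c * evalf f x) \<and>
     (\<forall>f. (\<forall>x\<in>S. evalf f x = 0) \<longrightarrow> f = 0) \<and>
     (\<forall>x\<in>S. \<exists>K. (\<forall>y\<in>S. evalf K y = k y x) \<and> (\<forall>f. inner f K = evalf f x))"

text \<open>
  The inclusion operator \<open>J\<close>. Regarding the RKHS as a subset of \<open>L\<^sup>2(S)\<close> means that \<open>J\<close> is injective;
  an RKHS norm of some \<open>\<beta>\<close> in \<open>L\<^sup>2(S)\<close> is then the norm of the unique \<open>b\<close> with \<open>J b = \<beta>\<close>.
\<close>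

definition RKHS_inclusion ::
    "'a::euclidean_space set \<Rightarrow> ('h \<Rightarrow> 'a \<Rightarrow> real) \<Rightarrow> 'h \<Rightarrow> 'a L2" where
  "RKHS_inclusion S evalf f = abs_L2 (\<lambda>x. indicator S x * evalf f x)"

text \<open>\<open>T = J J\<^sup>*\<close>.\<close>

definition kernel_operator ::
    "'a::euclidean_space set \<Rightarrow> ('h::real_inner \<Rightarrow> 'a \<Rightarrow> real) \<Rightarrow> 'a L2 \<Rightarrow> 'a L2" where
  "kernel_operator S evalf = RKHS_inclusion S evalf \<circ> adjoint (RKHS_inclusion S evalf)"


section \<open>Covariance operators and the estimator\<close>

text \<open>
  \<open>\<bbbE>[X \<otimes> X]\<close>, applied to \<open>f\<close>. The library's Bochner integral needs a second countable codomain,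
  which the space of bounded operators is not, so the expectation is taken in the strong sense.
\<close>

definition covariance :: "'w measure \<Rightarrow> ('w \<Rightarrow> 'a::euclidean_space L2) \<Rightarrow> 'a L2 \<Rightarrow> 'a L2" where
  "covariance M X f = (LINT \<omega>|M. tensor_square (X \<omega>) f)"

definition empirical_covariance ::
    "(nat \<Rightarrow> 'w \<Rightarrow> 'a::euclidean_space L2) \<Rightarrow> nat \<Rightarrow> 'w \<Rightarrow> 'a L2 \<Rightarrow> 'a L2" where
  "empirical_covariance Xs n \<omega> f = (1 / real n) *\<^sub>R (\<Sum>i=1..n. tensor_square (Xs i \<omega>) f)"

definition empirical_cross_covariance ::
    "(nat \<Rightarrow> 'w \<Rightarrow> 'a::euclidean_space L2) \<Rightarrow> (nat \<Rightarrow> 'w \<Rightarrow> real) \<Rightarrow> nat \<Rightarrow> 'w \<Rightarrow> 'a L2" where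
  "empirical_cross_covariance Xs Ys n \<omega> = (1 / real n) *\<^sub>R (\<Sum>i=1..n. Ys i \<omega> *\<^sub>R Xs i \<omega>)"

text \<open>\<open>J\<^sup>* C\<^sub>n J\<close>\<close>

definition RKHS_empirical_covariance ::
    "'a::euclidean_space set \<Rightarrow> ('h::real_inner \<Rightarrow> 'a \<Rightarrow> real) \<Rightarrow>
     (nat \<Rightarrow> 'w \<Rightarrow> 'a L2) \<Rightarrow> nat \<Rightarrow> 'w \<Rightarrow> 'h \<Rightarrow> 'h" where
  "RKHS_empirical_covariance S evalf Xs n \<omega> =
     adjoint (RKHS_inclusion S evalf) \<circ> empirical_covariance Xs n \<omega> \<circ> RKHS_inclusion S evalf"

definition spectral_estimator ::
    "'a::euclidean_space set \<Rightarrow> ('h::real_inner \<Rightarrow> 'a \<Rightarrow> real) \<Rightarrow> (real \<Rightarrow> real) \<Rightarrow>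
     (nat \<Rightarrow> 'w \<Rightarrow> 'a L2) \<Rightarrow> (nat \<Rightarrow> 'w \<Rightarrow> real) \<Rightarrow> nat \<Rightarrow> 'w \<Rightarrow> 'h" where
  "spectral_estimator S evalf q Xs Ys n \<omega> =
     functional_calculus q (RKHS_empirical_covariance S evalf Xs n \<omega>)
       (adjoint (RKHS_inclusion S evalf) (empirical_cross_covariance Xs Ys n \<omega>))"


section \<open>Regularization families\<close>

text \<open>\<open>\<eta>\<close> may be infinite; only the values \<open>g l s\<close> with \<open>0 < l \<le> \<eta>\<close> and \<open>0 \<le> s \<le> \<eta>\<close> matter.\<close>

definition regularization_family :: "ereal \<Rightarrow> (real \<Rightarrow> real \<Rightarrow> real) \<Rightarrow> bool" where
  "regularization_family \<eta> g \<longleftrightarrow>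
     (\<exists>A>0. \<exists>B>0. \<exists>D>0. \<forall>l. 0 < l \<and> ereal l \<le> \<eta> \<longrightarrow>
        (\<forall>s. 0 < s \<and> ereal s \<le> \<eta> \<longrightarrow>
           \<bar>s * g l s\<bar> \<le> A \<and> \<bar>g l s\<bar> \<le> B / l \<and> \<bar>1 - s * g l s\<bar> \<le> D))"

definition qualifies :: "ereal \<Rightarrow> (real \<Rightarrow> real \<Rightarrow> real) \<Rightarrow> real \<Rightarrow> bool" where
  "qualifies \<eta> g p \<longleftrightarrow>
     (\<exists>w. \<forall>l. 0 < l \<and> ereal l \<le> \<eta> \<longrightarrow>
        (\<forall>s. 0 < s \<and> ereal s \<le> \<eta> \<longrightarrow> \<bar>1 - s * g l s\<bar> * s powr p \<le> w * l powr p))"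

definition has_qualification :: "ereal \<Rightarrow> (real \<Rightarrow> real \<Rightarrow> real) \<Rightarrow> ereal \<Rightarrow> bool" where
  "has_qualification \<eta> g \<nu> \<longleftrightarrow>
     (case \<nu> of
        ereal p \<Rightarrow> p > 0 \<and> qualifies \<eta> g p \<and> (\<forall>q>p. \<not> qualifies \<eta> g q)
      | PInfty \<Rightarrow> (\<forall>p>0. qualifies \<eta> g p)
      | MInfty \<Rightarrow> False)"


section \<open>Stochastic boundedness\<close>

text \<open>
  \<open>W\<^sub>n \<lesssim>\<^sub>p b\<^sub>n\<close> for \<open>n \<in> I\<close>. The functions \<open>g\<^sub>\<lambda>\<close> are not assumed measurable, so
  \<open>{W\<^sub>n \<le> c b\<^sub>n}\<close> need not be an event; it is required to contain an event of probability at least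
  \<open>\<delta>\<close>, which for measurable \<open>W\<^sub>n\<close> says exactly \<open>P(W\<^sub>n \<le> c b\<^sub>n) \<ge> \<delta>\<close>.
\<close>

definition lesssim_p ::
    "'w measure \<Rightarrow> nat set \<Rightarrow> (nat \<Rightarrow> 'w \<Rightarrow> real) \<Rightarrow> (nat \<Rightarrow> real) \<Rightarrow> bool" where
  "lesssim_p M I W b \<longleftrightarrow>
     (\<forall>\<delta>. 0 < \<delta> \<and> \<delta> < 1 \<longrightarrow>
        (\<exists>c>0. \<forall>n\<in>I. \<exists>E\<in>sets M. E \<subseteq> {\<omega> \<in> space M. W n \<omega> \<le> c * b n} \<and> measure M E \<ge> \<delta>))"

definition reg_param :: "real \<Rightarrow> real \<Rightarrow> real \<Rightarrow> nat \<Rightarrow> real" where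
  "reg_param t c r n = real n powr (- (t + c) / (1 + c + 2 * t * r))"

end

(* Both T and C are diagonal in the orthonormal system (phi_j), and the compact operator C has no further
   eigenvalues, so X lies almost surely in its closed span. In the induced orthonormal system (e_j) of the
   RKHS the operator J* C J is diagonal with eigenvalues a_j = mu_j xi_j of order j^-(t+c), and at the chosen
   lambda its effective dimension is of order lambda^(-1/(t+c)), which is at most sqrt n.

   For fixed delta put l = K lambda with K large depending on delta. Under the fourth moment condition,
   Markov's inequality bounds, with probability at least delta and for every n, the Hilbert-Schmidt norm of
   J* (C - C_n) J weighted by (a_j + l)^(-1/2) on both sides, so a_j + l and J* C_n J + l are comparable as
   quadratic forms, and likewise the noise term. A one-sided weighted bound carries the comparison over to
   higher integer powers by induction, and a dyadic form of the Loewner-Heinz argument to the fractional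
   power required by the source condition. Bias and noise are then functions of J* C_n J alone and are
   controlled by the qualification and by the bounds on g_lambda.

   In part (a) beta need not lie in the RKHS, so it is first truncated to the modes with a_j >= lambda. *)

theory Submission
  imports Defs
begin

section \<open>Hilbert space geometry\<close>

text \<open>One exponent governs both rates. For q = t(2r-1)/(2(t+c)) the powers mu_j^(r-1/2) and
  a_j^q have the same order, so the coefficients of beta in (e_j) are a_j^q times a square summable
  sequence; \<lambda> is the value at which the noise level \<lambda>^(-1/(t+c))/n equals
  \<lambda>^(2q+1). The obstacle is that squaring is not operator monotone: comparability of a_j + l
  and J* C_n J + l says nothing about the higher powers that a large q requires. The one-sided
  weighted deviation has second moment of order \<lambda>^(2q+1), which is just small enough to be
  absorbed at every integer step up to q. For r < 1/2 the exponent q is negative. The truncated beta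
  then has RKHS norm of order \<lambda>^q, and this bound replaces the source condition. The part
  cut off acts as noise with nonzero mean, so the averages are controlled by second moments in which
  the mean is kept. Since the g_\<lambda> need not be measurable, the events speak only of the
  sample, and the filter is handled pathwise with constants fixed before n. Its value at 0 is
  uncontrolled, but the sample vector lies in the range of J* C_n J.\<close>

lemma parallelogram:
  fixes x y :: "'v::real_inner"
  shows "(norm (x - y))\<^sup>2 + (norm (x + y))\<^sup>2 = 2 * (norm x)\<^sup>2 + 2 * (norm y)\<^sup>2"
  by (simp add: power2_norm_eq_inner algebra_simps inner_commute)

text \<open>The midpoint of two almost nearest points stays in \<open>V\<close>, so the
  parallelogram identity makes a minimizing sequence Cauchy. The limit attains the distance, and
  perturbing it along \<open>v\<close> forces orthogonality.\<close>

lemma projection_exists: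
  fixes V :: "'v::{real_inner,banach} set"
  assumes "closed V" "subspace V"
  shows "\<exists>p\<in>V. \<forall>v\<in>V. inner (x - p) v = 0"
proof -
  define d where "d = Inf ((\<lambda>v. (norm (x - v))\<^sup>2) ` V)"
  have ne: "V \<noteq> {}" using subspace_0[OF assms(2)] by blast
  have bdd: "bdd_below ((\<lambda>v. (norm (x - v))\<^sup>2) ` V)" by (intro bdd_belowI2[of _ 0]) simp
  have d: "d \<le> (norm (x - v))\<^sup>2" if "v \<in> V" for v
    unfolding d_def using that by (intro cINF_lower bdd)
  have "\<exists>v\<in>V. (norm (x - v))\<^sup>2 < d + inverse (real (Suc n))" for n
  proof -
    have "Inf ((\<lambda>v. (norm (x - v))\<^sup>2) ` V) < d + inverse (real (Suc n))" by (simp add: d_def)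
    then show ?thesis using cINF_less_iff[OF ne bdd] by auto
  qed
  then obtain f where f: "\<And>n. f n \<in> V" "\<And>n. (norm (x - f n))\<^sup>2 < d + inverse (real (Suc n))" by metis
  have par: "(norm (f m - f n))\<^sup>2 \<le> 2 * (inverse (real (Suc m)) + inverse (real (Suc n)))" for m n
  proof -
    have "(1/2) *\<^sub>R (f m + f n) \<in> V"
      using f(1) assms(2) by (intro subspace_scale subspace_add) auto
    then have "d \<le> (norm (x - (1/2) *\<^sub>R (f m + f n)))\<^sup>2" by (rule d)
    also have "x - (1/2) *\<^sub>R (f m + f n) = (1/2) *\<^sub>R ((x - f m) + (x - f n))"
      by (simp add: scaleR_add_right scaleR_diff_right flip: scaleR_add_left)
    also have "(norm \<dots>)\<^sup>2 = (1/4) * (norm ((x - f m) + (x - f n)))\<^sup>2"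
      by (simp add: power_mult_distrib power_divide)
    finally have "4 * d \<le> (norm ((x - f m) + (x - f n)))\<^sup>2" by simp
    moreover have "norm ((x - f m) - (x - f n)) = norm (f m - f n)"
      by (simp add: norm_minus_commute)
    ultimately show ?thesis
      using parallelogram[of "x - f m" "x - f n"] f(2)[of m] f(2)[of n] by (simp add: algebra_simps)
  qed
  have "Cauchy f"
  proof (rule metric_CauchyI)
    fix e :: real assume "e > 0"
    then obtain N where N: "inverse (real (Suc N)) < e\<^sup>2 / 4"
      using reals_Archimedean[of "e\<^sup>2 / 4"] by auto
    have "dist (f m) (f n) < e" if "m \<ge> N" "n \<ge> N" for m n
    proof -
      have "inverse (real (Suc m)) \<le> inverse (real (Suc N))" "inverse (real (Suc n)) \<le> inverse (real (Suc N))"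
        using that by (auto intro!: le_imp_inverse_le)
      then have "(norm (f m - f n))\<^sup>2 < e\<^sup>2" using par[of m n] N by argo
      then show ?thesis using \<open>e > 0\<close> by (simp add: dist_norm power2_less_imp_less)
    qed
    then show "\<exists>M. \<forall>m\<ge>M. \<forall>n\<ge>M. dist (f m) (f n) < e" by blast
  qed
  then obtain p where p: "f \<longlonglongrightarrow> p" by (auto simp: Cauchy_convergent_iff convergent_def)
  have pV: "p \<in> V" using closed_sequentially[OF assms(1)] f(1) p by blast
  have "(\<lambda>n. (norm (x - f n))\<^sup>2) \<longlonglongrightarrow> (norm (x - p))\<^sup>2" by (intro tendsto_intros p)
  moreover have "(\<lambda>n. d + inverse (real (Suc n))) \<longlonglongrightarrow> d + 0"
    by (intro tendsto_intros LIMSEQ_inverse_real_of_nat)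
  ultimately have "(norm (x - p))\<^sup>2 \<le> d + 0"
    by (rule LIMSEQ_le) (use f(2) less_imp_le in blast)
  then have nd: "(norm (x - p))\<^sup>2 \<le> d" by simp
  have "inner (x - p) v = 0" if v: "v \<in> V" for v
  proof (cases "v = 0")
    case False
    \<comment> \<open>The minimizer over \<open>s\<close> of the squared norm of
      \<open>x - (p + s *\<^sub>R v)\<close>, so that minimality of \<open>p\<close> leaves no room
      for a nonzero inner product.\<close>
    define s where "s = inner (x - p) v / (norm v)\<^sup>2"
    have "p + s *\<^sub>R v \<in> V" using pV v assms(2) by (intro subspace_add subspace_scale)
    then have "(norm (x - p))\<^sup>2 \<le> (norm (x - (p + s *\<^sub>R v)))\<^sup>2" by (intro order_trans[OF nd d])
    also have "\<dots> = (norm (x - p))\<^sup>2 - 2 * s * inner (x - p) v + s\<^sup>2 * (norm v)\<^sup>2"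
      unfolding power2_norm_eq_inner
      by (simp add: algebra_simps inner_commute power2_eq_square)
    also have "s\<^sup>2 * (norm v)\<^sup>2 = s * inner (x - p) v"
      using False by (simp add: s_def power2_eq_square)
    finally have "s * inner (x - p) v \<le> 0" by simp
    then have "(inner (x - p) v)\<^sup>2 / (norm v)\<^sup>2 \<le> 0" by (simp add: s_def power2_eq_square)
    then show ?thesis using False by (simp add: divide_le_0_iff)
  qed simp
  with pV show ?thesis by blast
qed

lemma orthogonal_projection_eqI:
  assumes "subspace V" "p \<in> V" "\<forall>v\<in>V. inner (x - p) v = 0"
  shows "orthogonal_projection V x = p"
  unfolding orthogonal_projection_def
proof (rule the_equality)
  fix q assume q: "q \<in> V \<and> (\<forall>v\<in>V. inner (x - q) v = 0)"
  then have "q - p \<in> V" using assms by (auto intro: subspace_diff)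
  then have "inner (x - p) (q - p) = 0" "inner (x - q) (q - p) = 0" using q assms by auto
  then have "inner (q - p) (q - p) = 0" by (simp add: algebra_simps)
  then show "q = p" by simp
qed (use assms in auto)

text \<open>The kernel of a nonzero \<open>L\<close> has codimension one: the component
  \<open>w\<close> of any vector outside it, taken orthogonal to the kernel, represents
  \<open>L\<close> after rescaling.\<close>

lemma riesz_representation:
  fixes L :: "'v::{real_inner,banach} \<Rightarrow> real"
  assumes "bounded_linear L"
  shows "\<exists>y. \<forall>x. L x = inner x y"
proof (cases "\<forall>x. L x = 0")
  case True
  then show ?thesis by (intro exI[of _ 0]) simp
next
  case False
  interpret L: bounded_linear L by fact
  define V where "V = {x. L x = 0}"
  have "subspace V" by (auto simp: V_def subspace_def L.add L.scale L.zero)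
  moreover have "closed V"
    unfolding V_def by (intro closed_Collect_eq continuous_intros L.continuous_on)
  moreover obtain x0 where x0: "L x0 \<noteq> 0" using False by blast
  ultimately obtain p where p: "p \<in> V" "\<And>v. v \<in> V \<Longrightarrow> inner (x0 - p) v = 0"
    using projection_exists[of V x0] by blast
  define w where "w = x0 - p"
  have w: "L w = L x0" using p(1) by (simp add: w_def V_def L.diff)
  then have w0: "inner w w \<noteq> 0" using x0 L.zero by auto
  have "L x = inner x ((L w / inner w w) *\<^sub>R w)" for x
  proof -
    have "x - (L x / L w) *\<^sub>R w \<in> V" using w x0 by (simp add: V_def L.diff L.scale)
    then have "inner w (x - (L x / L w) *\<^sub>R w) = 0" using p(2) by (simp add: w_def)
    then show ?thesis using w w0 x0 by (simp add: inner_diff_right inner_commute field_simps)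
  qed
  then show ?thesis by blast
qed

text \<open>\<open>adjoint\<close> is a choice among candidates, so its defining equation holds only
  once a candidate is known to exist; Riesz representation supplies one.\<close>

lemma adjoint_inner:
  fixes f :: "'v::{real_inner,banach} \<Rightarrow> 'u::real_inner"
  assumes "bounded_linear f"
  shows "inner (f x) y = inner x (adjoint f y)"
proof -
  have "\<forall>y. \<exists>w. \<forall>x. inner (f x) y = inner x w"
  proof
    fix y
    have "bounded_linear (\<lambda>x. inner (f x) y)"
      using bounded_linear_compose[OF bounded_linear_inner_left assms] .
    then show "\<exists>w. \<forall>x. inner (f x) y = inner x w" by (rule riesz_representation)
  qed
  then have "\<exists>f'. \<forall>x y. inner (f x) y = inner x (f' y)" by metis
  from someI_ex[OF this] show ?thesis unfolding adjoint_def by blast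
qed

lemma bounded_linear_adjoint:
  fixes f :: "'v::{real_inner,banach} \<Rightarrow> 'u::real_inner"
  assumes f: "bounded_linear f"
  shows "bounded_linear (adjoint f)"
proof -
  interpret f: bounded_linear f by fact
  obtain K where K: "\<And>x. norm (f x) \<le> norm x * K" "K \<ge> 0" using f.nonneg_bounded by blast
  note adj = adjoint_inner[OF f, symmetric]
  show ?thesis
  proof (rule bounded_linear_intro[where K = K])
    show "adjoint f (x + y) = adjoint f x + adjoint f y" for x y
      by (simp add: vector_eq_ldot[symmetric] inner_add_right adj)
    show "adjoint f (r *\<^sub>R x) = r *\<^sub>R adjoint f x" for r x
      by (simp add: vector_eq_ldot[symmetric] adj)
    show "norm (adjoint f y) \<le> norm y * K" for y
    proof (cases "adjoint f y = 0")
      case False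
      have "norm (adjoint f y) * norm (adjoint f y) = inner (adjoint f y) (adjoint f y)"
        by (simp flip: power2_norm_eq_inner power2_eq_square)
      also have "\<dots> = inner (f (adjoint f y)) y" by (simp only: adj)
      also have "\<dots> \<le> norm (f (adjoint f y)) * norm y" by (rule norm_cauchy_schwarz)
      also have "\<dots> \<le> (norm (adjoint f y) * K) * norm y" by (intro mult_right_mono K) simp
      finally show ?thesis using False by (simp add: mult.assoc mult.commute)
    qed (simp add: K(2))
  qed
qed

text \<open>Cauchy-Schwarz for the semidefinite form of \<open>A\<close> at the pair
  \<open>x\<close>, \<open>A x\<close>: it reads N^2 <= p r, and r <= m N. Working inside an
  invariant \<open>W\<close> makes it applicable on the orthogonal complement of known
  eigenvectors.\<close>

lemma form_norm_bound:
  fixes A :: "'v::real_inner \<Rightarrow> 'v"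
  assumes lin: "linear A" and sym: "\<And>x y. inner (A x) y = inner x (A y)"
    and W: "subspace W" "A ` W \<subseteq> W" and pos: "\<And>x. x \<in> W \<Longrightarrow> 0 \<le> inner (A x) x"
    and m: "\<And>x. x \<in> W \<Longrightarrow> inner (A x) x \<le> m * (norm x)\<^sup>2" and x: "x \<in> W"
  shows "(norm (A x))\<^sup>2 \<le> m * inner (A x) x"
proof -
  define N where "N = (norm (A x))\<^sup>2"
  define p where "p = inner (A x) x"
  define r where "r = inner (A (A x)) (A x)"
  have AxW: "A x \<in> W" using x W by blast
  have N: "inner (A (A x)) x = N" "inner (A x) (A x) = N"
    by (simp_all add: N_def power2_norm_eq_inner sym)
  have r: "0 \<le> r" "r \<le> m * N" using pos[OF AxW] m[OF AxW] by (simp_all add: r_def N_def)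
  have q: "0 \<le> p + 2 * s * N + s\<^sup>2 * r" for s
  proof -
    have "x + s *\<^sub>R A x \<in> W" using x AxW W(1) by (intro subspace_add subspace_scale)
    then have "0 \<le> inner (A (x + s *\<^sub>R A x)) (x + s *\<^sub>R A x)" by (rule pos)
    also have "\<dots> = p + 2 * s * N + s\<^sup>2 * r"
      by (simp add: linear_add[OF lin] linear_scale[OF lin] inner_add_left inner_add_right N
          p_def r_def power2_eq_square algebra_simps)
    finally show ?thesis .
  qed
  have p0: "0 \<le> p" using pos[OF x] by (simp add: p_def)
  have N0: "0 \<le> N" by (simp add: N_def)
  show ?thesis
  proof (cases "N = 0")
    case True
    have "0 \<le> m * p"
    proof (cases "x = 0")
      case False
      have "0 \<le> m * (norm x)\<^sup>2" using m[OF x] pos[OF x] by linarith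
      then have "0 \<le> m" using False by (simp add: zero_le_mult_iff)
      then show ?thesis using p0 by simp
    qed (simp add: p_def)
    then show ?thesis using True by (simp add: N_def p_def)
  next
    case False
    then have "N > 0" using N0 by simp
    show ?thesis
    proof (cases "r = 0")
      case True
      \<comment> \<open>For \<open>r = 0\<close> the quadratic is linear with slope
        \<open>2 * N\<close>; this point gives it the value -1, a contradiction.\<close>
      have "0 \<le> p + 2 * (- (p + 1) / (2 * N)) * N" using q[of "- (p + 1) / (2 * N)"] True by simp
      then show ?thesis using \<open>N > 0\<close> by (simp add: field_simps)
    next
      case False
      then have "r > 0" using r by simp
      have "0 \<le> p + 2 * (- N / r) * N + (- N / r)\<^sup>2 * r" by (rule q)
      also have "\<dots> = p - N\<^sup>2 / r" using \<open>r > 0\<close> by (simp add: field_simps power2_eq_square)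
      finally have "N\<^sup>2 \<le> p * r" using \<open>r > 0\<close> by (simp add: field_simps)
      also have "\<dots> \<le> p * (m * N)" using r p0 by (intro mult_left_mono) auto
      finally have "N \<le> p * m" using \<open>N > 0\<close> by (simp add: power2_eq_square)
      then show ?thesis by (simp add: N_def p_def mult.commute)
    qed
  qed
qed

text \<open>
  The Rayleigh quotient attains its maximum on \<open>W\<close>: for a maximizing sequence \<open>f\<close> with
  supremum \<open>m\<close>, the form bound gives \<open>A f - m f \<longlonglongrightarrow> 0\<close>, and \<open>A f\<close> has a convergent subsequence.
\<close>

lemma compact_form_eigenvector:
  fixes A :: "'v::real_inner \<Rightarrow> 'v"
  assumes A: "bounded_linear A" and sym: "\<And>x y. inner (A x) y = inner x (A y)"
    and W: "closed W" "subspace W" "A ` W \<subseteq> W" and pos: "\<And>x. x \<in> W \<Longrightarrow> 0 \<le> inner (A x) x"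
    and K: "compact K" "\<And>x. norm x \<le> 1 \<Longrightarrow> A x \<in> K"
    and nz: "w \<in> W" "A w \<noteq> 0"
  shows "\<exists>v m. v \<in> W \<and> norm v = 1 \<and> m > 0 \<and> A v = m *\<^sub>R v"
proof -
  interpret A: bounded_linear A by fact
  define U where "U = {x \<in> W. norm x = 1}"
  obtain B where B: "\<And>x. norm (A x) \<le> norm x * B" using A.bounded by blast
  have bdd: "bdd_above ((\<lambda>x. inner (A x) x) ` U)"
  proof (rule bdd_aboveI2[where M = B])
    fix x assume "x \<in> U"
    then show "inner (A x) x \<le> B"
      using norm_cauchy_schwarz[of "A x" x] B[of x] by (simp add: U_def)
  qed
  define m where "m = Sup ((\<lambda>x. inner (A x) x) ` U)"
  have w0: "w \<noteq> 0" using nz A.zero by auto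
  have normalized: "(1 / norm x) *\<^sub>R x \<in> U" if "x \<in> W" "x \<noteq> 0" for x
    using that W(2) by (auto simp: U_def intro: subspace_scale)
  have ne: "U \<noteq> {}" using normalized[OF nz(1) w0] by blast
  have mU: "inner (A x) x \<le> m" if "x \<in> U" for x
    unfolding m_def using that by (intro cSUP_upper bdd)
  have mle: "inner (A x) x \<le> m * (norm x)\<^sup>2" if "x \<in> W" for x
  proof (cases "x = 0")
    case False
    have "inner (A ((1 / norm x) *\<^sub>R x)) ((1 / norm x) *\<^sub>R x) \<le> m"
      by (rule mU[OF normalized[OF that False]])
    then show ?thesis using False by (simp add: A.scaleR field_simps power2_eq_square)
  qed simp
  have fb: "(norm (A x))\<^sup>2 \<le> m * inner (A x) x" if "x \<in> W" for x
    using form_norm_bound[OF bounded_linear.linear[OF A] sym W(2,3) pos mle that] by blast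
  have "m > 0"
  proof (rule ccontr)
    assume "\<not> m > 0"
    then have "m * inner (A w) w \<le> 0" using pos[OF nz(1)] by (simp add: mult_nonpos_nonneg)
    moreover have "(norm (A w))\<^sup>2 \<le> m * inner (A w) w" using fb[OF nz(1)] by blast
    ultimately show False using nz(2) by (meson norm_eq_zero order_trans power2_less_eq_zero_iff)
  qed
  have "\<exists>x\<in>U. m - inverse (real (Suc n)) < inner (A x) x" for n
  proof -
    have "m - inverse (real (Suc n)) < Sup ((\<lambda>x. inner (A x) x) ` U)" by (simp add: m_def)
    then show ?thesis using less_cSUP_iff[OF ne bdd] by auto
  qed
  then obtain f where f: "\<And>n. f n \<in> U" "\<And>n. m - inverse (real (Suc n)) < inner (A (f n)) (f n)"
    by metis
  have fU: "f n \<in> W" "norm (f n) = 1" for n using f(1)[of n] by (auto simp: U_def)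
  have small: "(norm (A (f n) - m *\<^sub>R f n))\<^sup>2 \<le> m * inverse (real (Suc n))" for n
  proof -
    have "(norm (A (f n) - m *\<^sub>R f n))\<^sup>2
        = (norm (A (f n)))\<^sup>2 - 2 * m * inner (A (f n)) (f n) + m\<^sup>2 * (norm (f n))\<^sup>2"
      unfolding power2_norm_eq_inner
      by (simp add: algebra_simps inner_commute power2_eq_square)
    also have "\<dots> \<le> m * (m - inner (A (f n)) (f n))"
      using fb[OF fU(1)[of n]] by (simp add: fU power2_eq_square algebra_simps)
    also have "\<dots> \<le> m * inverse (real (Suc n))"
      using f(2)[of n] \<open>m > 0\<close> by (intro mult_left_mono) linarith+
    finally show ?thesis .
  qed
  have "\<forall>n. A (f n) \<in> K" by (intro allI K) (simp add: fU)
  then obtain y r where r: "strict_mono (r :: nat \<Rightarrow> nat)" "(\<lambda>n. A (f (r n))) \<longlonglongrightarrow> y"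
    using compact_imp_seq_compact[OF K(1)] by (force elim!: seq_compactE simp: comp_def)
  have "(\<lambda>n. (norm (A (f n) - m *\<^sub>R f n))\<^sup>2) \<longlonglongrightarrow> 0"
  proof (rule tendsto_sandwich[OF _ _ tendsto_const])
    show "(\<lambda>n. m * inverse (real (Suc n))) \<longlonglongrightarrow> 0"
      using tendsto_mult[OF tendsto_const LIMSEQ_inverse_real_of_nat, of m] by simp
  qed (use small in \<open>auto intro!: always_eventually\<close>)
  then have "(\<lambda>n. sqrt ((norm (A (f n) - m *\<^sub>R f n))\<^sup>2)) \<longlonglongrightarrow> sqrt 0" by (rule tendsto_real_sqrt)
  then have "(\<lambda>n. A (f n) - m *\<^sub>R f n) \<longlonglongrightarrow> 0" by (simp add: tendsto_norm_zero_iff)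
  from LIMSEQ_subseq_LIMSEQ[OF this r(1)] have "(\<lambda>n. A (f (r n)) - m *\<^sub>R f (r n)) \<longlonglongrightarrow> 0"
    by (simp add: comp_def)
  from tendsto_diff[OF r(2) this] have "(\<lambda>n. m *\<^sub>R f (r n)) \<longlonglongrightarrow> y" by simp
  from tendsto_scaleR[OF tendsto_const this, of "1 / m"]
  have lim: "(\<lambda>n. f (r n)) \<longlonglongrightarrow> (1 / m) *\<^sub>R y" using \<open>m > 0\<close> by simp
  define v where "v = (1 / m) *\<^sub>R y"
  have "v \<in> W" unfolding v_def by (rule closed_sequentially[OF W(1) _ lim]) (rule fU)
  moreover have "norm v = 1"
    using tendsto_norm[OF lim, folded v_def] by (simp only: fU LIMSEQ_const_iff)
  moreover have "A v = y"
    unfolding v_def by (rule LIMSEQ_unique[OF A.tendsto[OF lim] r(2)])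
  then have "A v = m *\<^sub>R v" using \<open>m > 0\<close> by (simp add: v_def)
  ultimately show ?thesis using \<open>m > 0\<close> by blast
qed

text \<open>By induction the set is a Minkowski sum of segments. It encloses the image of the unit
  ball under a finite rank operator, although the ball itself is not compact.\<close>

lemma compact_bounded_combinations:
  fixes z :: "'i \<Rightarrow> 'v::real_normed_vector"
  assumes "finite I"
  shows "compact {\<Sum>i\<in>I. a i *\<^sub>R z i |a. \<forall>i\<in>I. \<bar>a i\<bar> \<le> R}"
  using assms
proof (induction I rule: finite_induct)
  case (insert k I)
  have "{\<Sum>i\<in>insert k I. a i *\<^sub>R z i |a. \<forall>i\<in>insert k I. \<bar>a i\<bar> \<le> R}
      = {x + y |x y. x \<in> (\<lambda>s. s *\<^sub>R z k) ` {-R..R}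
          \<and> y \<in> {\<Sum>i\<in>I. a i *\<^sub>R z i |a. \<forall>i\<in>I. \<bar>a i\<bar> \<le> R}}"
    (is "?L = ?R")
  proof
    show "?L \<subseteq> ?R" using insert by fastforce
    show "?R \<subseteq> ?L"
    proof
      fix y assume "y \<in> ?R"
      then obtain s a where y: "y = s *\<^sub>R z k + (\<Sum>i\<in>I. a i *\<^sub>R z i)" "\<bar>s\<bar> \<le> R"
          "\<forall>i\<in>I. \<bar>a i\<bar> \<le> R"
        by auto
      have "(\<Sum>i\<in>I. (a(k := s)) i *\<^sub>R z i) = (\<Sum>i\<in>I. a i *\<^sub>R z i)"
        using insert by (intro sum.cong) auto
      then have "y = (\<Sum>i\<in>insert k I. (a(k := s)) i *\<^sub>R z i)" using insert y by simp
      moreover have "\<forall>i\<in>insert k I. \<bar>(a(k := s)) i\<bar> \<le> R" using y by simp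
      ultimately show "y \<in> ?L" by blast
    qed
  qed
  moreover have "compact ((\<lambda>s. s *\<^sub>R z k) ` {-R..R})"
    by (intro compact_continuous_image continuous_intros) auto
  ultimately show ?case using insert.IH by (simp only: compact_sums)
qed simp

lemma
  fixes V :: "'v::{real_inner,banach} set"
  assumes V: "closed V" "subspace V"
  shows orthogonal_projection_mem: "orthogonal_projection V x \<in> V"
    and orthogonal_projection_orth: "v \<in> V \<Longrightarrow> inner (x - orthogonal_projection V x) v = 0"
    and linear_orthogonal_projection: "linear (orthogonal_projection V)"
    and orthogonal_projection_sym:
      "inner (orthogonal_projection V x) y = inner x (orthogonal_projection V y)"
proof -
  have *: "orthogonal_projection V x \<in> V \<and> (\<forall>v\<in>V. inner (x - orthogonal_projection V x) v = 0)" for x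
    using projection_exists[OF V] orthogonal_projection_eqI[OF V(2)] by metis
  show mem: "orthogonal_projection V x \<in> V" for x using * by blast
  show orth: "inner (x - orthogonal_projection V x) v = 0" if "v \<in> V" for x v using * that by blast
  show "linear (orthogonal_projection V)"
  proof (rule linearI)
    show "orthogonal_projection V (x + y) = orthogonal_projection V x + orthogonal_projection V y" for x y
      using orth[of _ x] orth[of _ y]
      by (intro orthogonal_projection_eqI V subspace_add mem ballI)
        (simp add: inner_add_left inner_diff_left)
    show "orthogonal_projection V (c *\<^sub>R x) = c *\<^sub>R orthogonal_projection V x" for c x
      using orth[of _ x]
      by (intro orthogonal_projection_eqI V subspace_scale mem ballI) (simp add: inner_diff_left)
  qed
  show "inner (orthogonal_projection V x) y = inner x (orthogonal_projection V y)"
    using orth[OF mem, of x y] orth[OF mem, of y x]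
    by (metis inner_commute inner_diff_left right_minus_eq)
qed

section \<open>Finite spectral resolutions\<close>

text \<open>An empirical operator has finite rank, so finitely many orthogonal projections carry its
  whole functional calculus and every spectral estimate is a finite sum over
  \<open>Sp\<close>.\<close>

locale spectral_resolution =
  fixes A :: "'v::real_inner \<Rightarrow> 'v" and Sp :: "real set" and E :: "real \<Rightarrow> 'v \<Rightarrow> 'v"
  assumes finite_Sp: "finite Sp"
    and linear_E: "linear (E s)"
    and sym_E: "inner (E s x) y = inner x (E s y)"
    and E_E: "s \<in> Sp \<Longrightarrow> t \<in> Sp \<Longrightarrow> E s (E t x) = (if s = t then E t x else 0)"
    and total: "(\<Sum>s\<in>Sp. E s x) = x"
    and A_eq: "A x = (\<Sum>s\<in>Sp. s *\<^sub>R E s x)"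
begin

definition calc :: "(real \<Rightarrow> real) \<Rightarrow> 'v \<Rightarrow> 'v" where
  "calc f x = (\<Sum>s\<in>Sp. f s *\<^sub>R E s x)"

text \<open>The quadratic form of f(A) at \<open>x\<close>. Inequalities between functions of
  \<open>A\<close> thereby become pointwise inequalities on \<open>Sp\<close>.\<close>

definition wnorm2 :: "(real \<Rightarrow> real) \<Rightarrow> 'v \<Rightarrow> real" where
  "wnorm2 f x = (\<Sum>s\<in>Sp. f s * (norm (E s x))\<^sup>2)"

lemma calc_sym: "inner (calc f x) y = inner x (calc f y)"
  by (simp add: calc_def inner_sum_left inner_sum_right sym_E)

lemma E_calc: "s \<in> Sp \<Longrightarrow> E s (calc f x) = f s *\<^sub>R E s x"
proof -
  assume s: "s \<in> Sp"
  have "E s (calc f x) = (\<Sum>t\<in>Sp. f t *\<^sub>R E s (E t x))"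
    by (simp add: calc_def linear_sum[OF linear_E] linear_scale[OF linear_E])
  also have "\<dots> = (\<Sum>t\<in>Sp. if s = t then f t *\<^sub>R E t x else 0)"
    using s by (intro sum.cong) (auto simp: E_E)
  finally show ?thesis using s finite_Sp by simp
qed

lemma calc_calc: "calc f (calc g x) = calc (\<lambda>s. f s * g s) x"
  by (simp add: calc_def[of f] calc_def[of "\<lambda>s. f s * g s"] E_calc)

lemma calc_add: "calc f x + calc g x = calc (\<lambda>s. f s + g s) x"
  by (simp add: calc_def scaleR_add_left sum.distrib)

lemma calc_diff: "calc f x - calc g x = calc (\<lambda>s. f s - g s) x"
  by (simp add: calc_def scaleR_diff_left sum_subtractf)

lemma linear_calc: "linear (calc f)"
  by (rule linearI)
    (simp_all add: calc_def linear_add[OF linear_E] linear_scale[OF linear_E] scaleR_add_right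
      sum.distrib scaleR_sum_right mult.commute)

lemma calc_one: "calc (\<lambda>s. 1) x = x"
  by (simp add: calc_def total)

lemma A_calc: "A x = calc (\<lambda>s. s) x"
  by (simp add: calc_def A_eq)

lemma calc_cong: "(\<And>s. s \<in> Sp \<Longrightarrow> f s = g s) \<Longrightarrow> calc f x = calc g x"
  by (simp add: calc_def)

lemma inner_calc: "inner (calc f x) x = wnorm2 f x"
proof -
  have "inner (E s x) x = (norm (E s x))\<^sup>2" if "s \<in> Sp" for s
    using E_E[OF that that, of x] sym_E[of s x "E s x"]
    by (simp add: power2_norm_eq_inner inner_commute)
  then show ?thesis by (simp add: calc_def wnorm2_def inner_sum_left)
qed

lemma norm_calc: "(norm (calc f x))\<^sup>2 = wnorm2 (\<lambda>s. (f s)\<^sup>2) x"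
proof -
  have "(norm (calc f x))\<^sup>2 = inner (calc f (calc f x)) x"
    by (simp add: power2_norm_eq_inner calc_sym inner_commute)
  then show ?thesis by (simp add: calc_calc inner_calc power2_eq_square)
qed

lemma wnorm2_one: "wnorm2 (\<lambda>s. 1) x = (norm x)\<^sup>2"
  using norm_calc[of "\<lambda>s. 1" x] by (simp add: calc_one)

lemma wnorm2_calc: "wnorm2 f (calc g x) = wnorm2 (\<lambda>s. f s * (g s)\<^sup>2) x"
  by (simp add: wnorm2_def E_calc power_mult_distrib mult.assoc)

lemma wnorm2_mono: "(\<And>s. s \<in> Sp \<Longrightarrow> f s \<le> g s) \<Longrightarrow> wnorm2 f x \<le> wnorm2 g x"
  unfolding wnorm2_def by (intro sum_mono mult_right_mono) auto

lemma wnorm2_le: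
  assumes "\<And>s. s \<in> Sp \<Longrightarrow> f s \<le> c"
  shows "wnorm2 f x \<le> c * (norm x)\<^sup>2"
proof -
  have "wnorm2 f x \<le> wnorm2 (\<lambda>s. c * 1) x" using assms by (intro wnorm2_mono) simp
  also have "\<dots> = c * wnorm2 (\<lambda>s. 1) x" unfolding wnorm2_def sum_distrib_left by (simp add: mult.assoc)
  finally show ?thesis by (simp add: wnorm2_one)
qed

lemma wnorm2_scale: "wnorm2 (\<lambda>s. c * f s) x = c * wnorm2 f x"
  by (simp add: wnorm2_def sum_distrib_left mult.assoc)

end

lemma closed_eigenspace:
  assumes "bounded_linear A"
  shows "closed (eigenspace A s)"
  unfolding eigenspace_def
  using bounded_linear.continuous_on[OF assms continuous_on_id]
  by (intro closed_Collect_eq continuous_intros) (simp_all add: id_def)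

lemma subspace_eigenspace:
  assumes "linear A"
  shows "subspace (eigenspace A s)"
  by (auto simp: subspace_def eigenspace_def linear_0[OF assms] linear_add[OF assms]
      linear_scale[OF assms] scaleR_add_right mult.commute)

lemma eigenspaces_orthogonal:
  assumes sym: "\<And>x y. inner (A x) y = inner x (A y)"
    and "v \<in> eigenspace A s" "w \<in> eigenspace A t" "s \<noteq> t"
  shows "inner v w = 0"
  using sym[of v w] assms(2-4) by (simp add: eigenspace_def)

text \<open>
  The eigenspaces exhaust the space because the operator is compact on the orthogonal
  complement of their span, where it has no eigenvector left.
\<close>

lemma finite_rank_spectral_resolution:
  fixes z :: "'i \<Rightarrow> 'v::{real_inner,banach}"
  assumes I: "finite I" and c: "c \<ge> 0"
    and A: "\<And>x. A x = c *\<^sub>R (\<Sum>i\<in>I. inner (z i) x *\<^sub>R z i)"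
  shows "spectral_resolution A {s. eigenspace A s \<noteq> {0}} (\<lambda>s. orthogonal_projection (eigenspace A s))"
    and "eigenspace A s \<noteq> {0} \<Longrightarrow> 0 \<le> s"
proof -
  have bl: "bounded_linear A"
  proof -
    have "bounded_linear (\<lambda>x. c *\<^sub>R (\<Sum>i\<in>I. inner (z i) x *\<^sub>R z i))"
      by (intro bounded_linear_const_scaleR bounded_linear_sum
          bounded_linear_compose[OF bounded_linear_scaleR_left bounded_linear_inner_right])
    then show ?thesis by (simp add: A[abs_def])
  qed
  have sym: "inner (A x) y = inner x (A y)" for x y
    by (simp add: A inner_sum_left inner_sum_right inner_commute mult.commute)
  have pos: "0 \<le> inner (A x) x" for x
  proof -
    have "inner (A x) x = c * (\<Sum>i\<in>I. (inner (z i) x)\<^sup>2)"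
      by (simp add: A inner_sum_left power2_eq_square)
    then show ?thesis using c by (simp add: sum_nonneg)
  qed
  note lin = bounded_linear.linear[OF bl]
  note cl = closed_eigenspace[OF bl] and ss = subspace_eigenspace[OF lin]
  define Sp where "Sp = {s. eigenspace A s \<noteq> {0}}"
  define P where "P s = orthogonal_projection (eigenspace A s)" for s
  note mem = orthogonal_projection_mem[OF cl ss, folded P_def]
  note orth = orthogonal_projection_orth[OF cl ss, folded P_def]
  have Sp: "\<exists>v. v \<in> eigenspace A s \<and> norm v = 1" if s: "s \<in> Sp" for s
  proof -
    obtain v where "v \<in> eigenspace A s" "v \<noteq> 0"
      using s subspace_0[OF ss, of s] unfolding Sp_def by auto
    then show ?thesis
      by (intro exI[of _ "(1 / norm v) *\<^sub>R v"]) (simp add: subspace_scale[OF ss])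
  qed
  show "0 \<le> s" if "eigenspace A s \<noteq> {0}" for s
  proof -
    obtain v where v: "v \<in> eigenspace A s" "norm v = 1" using Sp[of s] \<open>eigenspace A s \<noteq> {0}\<close> by (auto simp: Sp_def)
    then have "inner (A v) v = s"
      using power2_norm_eq_inner[of v] by (simp add: eigenspace_def)
    then show ?thesis using pos[of v] by simp
  qed
  \<comment> \<open>Eigenvectors of distinct nonzero eigenvalues are orthogonal, hence independent,
    and they lie in the span of the finitely many \<open>z i\<close>.\<close>
  have fin: "finite Sp"
  proof -
    obtain g where g: "\<And>s. s \<in> Sp \<Longrightarrow> g s \<in> eigenspace A s \<and> norm (g s) = 1" using Sp by metis
    define B where "B = g ` (Sp - {0})"
    have g_orth: "inner (g s) (g t) = 0" if "s \<in> Sp" "t \<in> Sp" "s \<noteq> t" for s t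
      using eigenspaces_orthogonal[OF sym] g that by blast
    have inj: "inj_on g (Sp - {0})"
    proof (rule inj_onI, rule ccontr)
      fix s t assume st: "s \<in> Sp - {0}" "t \<in> Sp - {0}" "g s = g t" "s \<noteq> t"
      then have "inner (g s) (g s) = 0" using g_orth[of s t] by simp
      then show False using g[of s] st by simp
    qed
    have "independent B"
    proof (rule pairwise_orthogonal_independent)
      show "pairwise orthogonal B"
        using g_orth by (auto simp: B_def pairwise_def orthogonal_def)
      show "0 \<notin> B" using g by (force simp: B_def)
    qed
    moreover have "B \<subseteq> span (z ` I)"
    proof
      fix b assume "b \<in> B"
      then obtain s where s: "s \<in> Sp" "s \<noteq> 0" "b = g s" by (auto simp: B_def)
      then have "A b = s *\<^sub>R b" using g by (simp add: eigenspace_def)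
      then have "b = (1 / s) *\<^sub>R A b" using s by simp
      also have "\<dots> \<in> span (z ` I)"
        unfolding A by (intro span_scale span_sum span_base) auto
      finally show "b \<in> span (z ` I)" .
    qed
    ultimately have "finite B"
      using independent_span_bound[of "z ` I" B] I by simp
    then have "finite (Sp - {0})" using inj by (simp add: B_def finite_image_iff)
    then show ?thesis by simp
  qed
  have Po: "P s v = 0" if "v \<in> eigenspace A t" "s \<noteq> t" for s t v
    unfolding P_def
    by (rule orthogonal_projection_eqI[OF ss])
      (use that eigenspaces_orthogonal[OF sym] subspace_0[OF ss] in auto)
  have Pi: "P s v = v" if "v \<in> eigenspace A s" for s v
    unfolding P_def by (rule orthogonal_projection_eqI[OF ss]) (use that in auto)
  have total: "(\<Sum>s\<in>Sp. P s x) = x" for x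
  proof -
    define W where "W = {w. \<forall>s\<in>Sp. \<forall>v\<in>eigenspace A s. inner w v = 0}"
    have "W = (\<Inter>s\<in>Sp. \<Inter>v\<in>eigenspace A s. {w. inner w v = 0})" by (auto simp: W_def)
    then have "closed W" by (simp only:) (intro closed_INT ballI closed_Collect_eq continuous_intros)
    moreover have "subspace W" by (auto simp: W_def subspace_def inner_add_left)
    moreover have "A ` W \<subseteq> W"
      by (auto simp: W_def sym eigenspace_def)
    moreover define K where
      "K = {\<Sum>i\<in>I. a i *\<^sub>R z i |a. \<forall>i\<in>I. \<bar>a i\<bar> \<le> c * (\<Sum>i\<in>I. norm (z i))}"
    have "compact K" unfolding K_def by (rule compact_bounded_combinations[OF I])
    moreover have "A x \<in> K" if x: "norm x \<le> 1" for x
    proof -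
      have "\<bar>c * inner (z i) x\<bar> \<le> c * (\<Sum>i\<in>I. norm (z i))" if "i \<in> I" for i
      proof -
        have "\<bar>inner (z i) x\<bar> \<le> norm (z i) * norm x" by (rule Cauchy_Schwarz_ineq2)
        also have "\<dots> \<le> norm (z i) * 1" using x by (intro mult_left_mono) auto
        also have "\<dots> \<le> (\<Sum>i\<in>I. norm (z i))" using member_le_sum[OF that, of "\<lambda>i. norm (z i)"] I by simp
        finally show ?thesis using c by (simp add: abs_mult mult_left_mono)
      qed
      moreover have "A x = (\<Sum>i\<in>I. (c * inner (z i) x) *\<^sub>R z i)" by (simp add: A scaleR_sum_right)
      ultimately show ?thesis unfolding K_def by auto
    qed
    moreover have "v \<notin> W" if "norm v = 1" "A v = m *\<^sub>R v" for v m
    proof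
      assume "v \<in> W"
      moreover have v: "v \<in> eigenspace A m" using that by (simp add: eigenspace_def)
      moreover have "v \<noteq> 0" using that by auto
      then have "m \<in> Sp" using v by (auto simp: Sp_def)
      ultimately have "inner v v = 0" unfolding W_def by blast
      with \<open>v \<noteq> 0\<close> show False by simp
    qed
    ultimately have A0: "A w = 0" if "w \<in> W" for w
      using compact_form_eigenvector[OF bl sym, of W K w] pos that by blast
    define y where "y = x - (\<Sum>s\<in>Sp. P s x)"
    have "y \<in> W"
      unfolding W_def
    proof (intro CollectI ballI)
      fix t v assume t: "t \<in> Sp" "v \<in> eigenspace A t"
      have "inner (\<Sum>s\<in>Sp. P s x) v = (\<Sum>s\<in>Sp. if t = s then inner (P t x) v else 0)"
        unfolding inner_sum_left
        by (intro sum.cong) (use eigenspaces_orthogonal[OF sym mem t(2)] in auto)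
      also have "\<dots> = inner (P t x) v" using t fin by simp
      finally show "inner y v = 0" using orth[OF t(2), of x] by (simp add: y_def inner_diff_left)
    qed
    then have "y \<in> eigenspace A 0" using A0 by (simp add: eigenspace_def)
    \<comment> \<open>The eigenvalue 0 also belongs to \<open>Sp\<close> if it occurs, so a nonzero
      \<open>y\<close> in the kernel would be orthogonal to itself.\<close>
    have "y = 0"
    proof (rule ccontr)
      assume "y \<noteq> 0"
      then have "0 \<in> Sp" using \<open>y \<in> eigenspace A 0\<close> by (auto simp: Sp_def)
      then have "inner y y = 0" using \<open>y \<in> W\<close> \<open>y \<in> eigenspace A 0\<close> unfolding W_def by blast
      with \<open>y \<noteq> 0\<close> show False by simp
    qed
    then show ?thesis by (simp add: y_def)
  qed
  have "spectral_resolution A Sp P"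
  proof (rule spectral_resolution.intro)
    show "finite Sp" by (rule fin)
    show "linear (P s)" for s unfolding P_def by (rule linear_orthogonal_projection[OF cl ss])
    show "inner (P s x) y = inner x (P s y)" for s x y
      unfolding P_def by (rule orthogonal_projection_sym[OF cl ss])
    show "P s (P t x) = (if s = t then P t x else 0)" for s t x
      using Pi[OF mem] Po[OF mem] by simp
    show "(\<Sum>s\<in>Sp. P s x) = x" for x by (rule total)
    show "A x = (\<Sum>s\<in>Sp. s *\<^sub>R P s x)" for x
    proof -
      have "A x = (\<Sum>s\<in>Sp. A (P s x))"
        using linear_sum[OF lin, of "\<lambda>s. P s x" Sp] by (simp only: total)
      also have "\<dots> = (\<Sum>s\<in>Sp. s *\<^sub>R P s x)"
        using mem by (intro sum.cong) (auto simp: eigenspace_def)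
      finally show ?thesis .
    qed
  qed
  then show "spectral_resolution A {s. eigenspace A s \<noteq> {0}} (\<lambda>s. orthogonal_projection (eigenspace A s))"
    by (simp add: Sp_def P_def[abs_def])
qed

section \<open>Orthonormal sequences\<close>

definition orthonormal :: "(nat \<Rightarrow> 'v::real_inner) \<Rightarrow> bool" where
  "orthonormal e \<longleftrightarrow> (\<forall>i j. inner (e i) (e j) = (if i = j then 1 else 0))"

text \<open>A weak form of membership in the closed span of \<open>e\<close>, which need not be a
  complete system. Testing against every \<open>f\<close> lets the property pass through adjoints
  and finite sums without norm convergence.\<close>

definition expands :: "(nat \<Rightarrow> 'v::real_inner) \<Rightarrow> 'v \<Rightarrow> bool" where
  "expands e v \<longleftrightarrow> (\<forall>f. (\<lambda>j. inner v (e j) * inner (e j) f) sums inner v f)"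

lemma inner_orthonormal:
  "orthonormal e \<Longrightarrow> inner (e i) (e j) = (if i = j then 1 else 0)"
  by (simp add: orthonormal_def)

lemma inner_orthonormal_sum:
  assumes "orthonormal e"
  shows "inner (\<Sum>i<n. c i *\<^sub>R e i) (e j) = (if j < n then c j else 0)"
  by (simp add: inner_sum_left inner_orthonormal[OF assms] if_distrib cong: if_cong)

lemma norm_orthonormal_sum:
  assumes "orthonormal e" "finite I"
  shows "(norm (\<Sum>i\<in>I. c i *\<^sub>R e i))\<^sup>2 = (\<Sum>i\<in>I. (c i)\<^sup>2)"
  unfolding power2_norm_eq_inner inner_sum_left inner_sum_right
  using assms(2) by (simp add: inner_orthonormal[OF assms(1)] if_distrib power2_eq_square cong: if_cong)

lemma norm_diff_orthonormal_sum:
  assumes "orthonormal e" "finite I"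
  shows "(norm (v - (\<Sum>i\<in>I. inner v (e i) *\<^sub>R e i)))\<^sup>2 = (norm v)\<^sup>2 - (\<Sum>i\<in>I. (inner v (e i))\<^sup>2)"
proof -
  have "(norm (v - (\<Sum>i\<in>I. inner v (e i) *\<^sub>R e i)))\<^sup>2 = (norm v)\<^sup>2
      - 2 * inner v (\<Sum>i\<in>I. inner v (e i) *\<^sub>R e i) + (norm (\<Sum>i\<in>I. inner v (e i) *\<^sub>R e i))\<^sup>2"
    unfolding power2_norm_eq_inner by (simp add: inner_diff_left inner_diff_right inner_commute)
  then show ?thesis
    by (simp only: norm_orthonormal_sum[OF assms]) (simp add: inner_sum_right power2_eq_square)
qed

lemma bessel:
  assumes "orthonormal e" "finite I"
  shows "(\<Sum>i\<in>I. (inner v (e i))\<^sup>2) \<le> (norm v)\<^sup>2"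
  using norm_diff_orthonormal_sum[OF assms, of v] zero_le_power2[of "norm (v - (\<Sum>i\<in>I. inner v (e i) *\<^sub>R e i))"]
  by linarith

text \<open>Testing with \<open>v\<close> itself gives Parseval's identity, which says that the
  squared norms of the remainders tend to 0.\<close>

lemma expands_imp_sums:
  assumes e: "orthonormal e" and v: "expands e v"
  shows "(\<lambda>j. inner v (e j) *\<^sub>R e j) sums v"
proof -
  have "(\<lambda>n. \<Sum>j<n. inner v (e j) * inner (e j) v) \<longlonglongrightarrow> (norm v)\<^sup>2"
    using v unfolding expands_def sums_def power2_norm_eq_inner by blast
  then have "(\<lambda>n. (norm v)\<^sup>2 - (\<Sum>j<n. inner v (e j) * inner (e j) v)) \<longlonglongrightarrow> 0"
    using tendsto_diff[OF tendsto_const, of _ "(norm v)\<^sup>2" sequentially "(norm v)\<^sup>2"] by simp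
  then have "(\<lambda>n. sqrt ((norm (v - (\<Sum>j<n. inner v (e j) *\<^sub>R e j)))\<^sup>2)) \<longlonglongrightarrow> sqrt 0"
    by (intro tendsto_real_sqrt)
      (simp only: norm_diff_orthonormal_sum[OF e finite_lessThan], simp add: power2_eq_square inner_commute)
  then have "(\<lambda>n. v - (\<Sum>j<n. inner v (e j) *\<^sub>R e j)) \<longlonglongrightarrow> 0"
    by (simp add: tendsto_norm_zero_iff)
  from tendsto_diff[OF tendsto_const this, of v] show ?thesis by (simp add: sums_def)
qed

lemma sums_inner_orthonormal:
  assumes e: "orthonormal e" and v: "(\<lambda>j. c j *\<^sub>R e j) sums v"
  shows "inner v (e j) = c j"
proof -
  have "(\<lambda>n. inner (\<Sum>i<n. c i *\<^sub>R e i) (e j)) \<longlonglongrightarrow> inner v (e j)"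
    using v unfolding sums_def by (intro tendsto_intros)
  moreover have "(\<lambda>n. inner (\<Sum>i<n. c i *\<^sub>R e i) (e j)) \<longlonglongrightarrow> c j"
    by (rule tendsto_eventually, rule eventually_sequentiallyI[of "Suc j"])
      (simp add: inner_orthonormal_sum[OF e])
  ultimately show ?thesis by (rule LIMSEQ_unique)
qed

lemma sums_imp_expands:
  assumes e: "orthonormal e" and v: "(\<lambda>j. c j *\<^sub>R e j) sums v"
  shows "expands e v"
  unfolding expands_def
proof
  fix f
  have "(\<lambda>j. inner (c j *\<^sub>R e j) f) sums inner v f"
    using bounded_linear.sums[OF bounded_linear_inner_left v] .
  then show "(\<lambda>j. inner v (e j) * inner (e j) f) sums inner v f"
    by (simp add: sums_inner_orthonormal[OF e v])
qed

text \<open>By Pythagoras the squared norm of a block of the series is the same block of the scalar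
  series, so the Cauchy property transfers.\<close>

lemma orthonormal_series_converges:
  fixes e :: "nat \<Rightarrow> 'v::{real_inner,banach}"
  assumes e: "orthonormal e" and c: "summable (\<lambda>j. (c j)\<^sup>2)"
  shows "\<exists>v. (\<lambda>j. c j *\<^sub>R e j) sums v"
proof -
  have "summable (\<lambda>j. c j *\<^sub>R e j)"
    unfolding summable_Cauchy
  proof (intro allI impI)
    fix r :: real assume "r > 0"
    then obtain N where N: "\<And>m n. m \<ge> N \<Longrightarrow> norm (\<Sum>j=m..<n. (c j)\<^sup>2) < r\<^sup>2"
      using c unfolding summable_Cauchy by (metis zero_less_power)
    have "norm (\<Sum>j=m..<n. c j *\<^sub>R e j) < r" if "m \<ge> N" for m n
    proof (rule power2_less_imp_less)
      show "(norm (\<Sum>j=m..<n. c j *\<^sub>R e j))\<^sup>2 < r\<^sup>2"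
        using N[OF that, of n] by (simp add: norm_orthonormal_sum[OF e])
    qed (use \<open>r > 0\<close> in simp)
    then show "\<exists>N. \<forall>m\<ge>N. \<forall>n. norm (\<Sum>j=m..<n. c j *\<^sub>R e j) < r" by blast
  qed
  then show ?thesis by (auto simp: summable_def)
qed

lemma summable_power2_inner:
  assumes "orthonormal e"
  shows "summable (\<lambda>j. (inner v (e j))\<^sup>2)"
  by (rule summableI_nonneg_bounded[where x = "(norm v)\<^sup>2"]) (auto intro: bessel[OF assms])

text \<open>The double orthogonal complement is the closed span. For the converse, \<open>u\<close>
  is the Fourier series of \<open>v\<close>; the difference \<open>v - u\<close> is orthogonal to
  all \<open>e j\<close>, hence to \<open>u\<close>, and by hypothesis to \<open>v\<close>.\<close>

lemma expands_iff:
  fixes e :: "nat \<Rightarrow> 'v::{real_inner,banach}"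
  assumes e: "orthonormal e"
  shows "expands e v \<longleftrightarrow> (\<forall>w. (\<forall>j. inner w (e j) = 0) \<longrightarrow> inner v w = 0)"
proof
  assume v: "expands e v"
  show "\<forall>w. (\<forall>j. inner w (e j) = 0) \<longrightarrow> inner v w = 0"
  proof (intro allI impI)
    fix w assume "\<forall>j. inner w (e j) = 0"
    then have "(\<lambda>j. inner v (e j) * inner (e j) w) = (\<lambda>j. 0)" by (simp add: inner_commute)
    then have "(\<lambda>j. 0) sums inner v w" using v unfolding expands_def by metis
    then show "inner v w = 0" using sums_unique2 sums_zero by blast
  qed
next
  assume *: "\<forall>w. (\<forall>j. inner w (e j) = 0) \<longrightarrow> inner v w = 0"
  obtain u where u: "(\<lambda>j. inner v (e j) *\<^sub>R e j) sums u"
    using orthonormal_series_converges[OF e summable_power2_inner[OF e]] by blast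
  have "\<forall>j. inner (v - u) (e j) = 0"
    by (simp add: inner_diff_left sums_inner_orthonormal[OF e u])
  moreover have "inner u (v - u) = 0"
  proof -
    have "(\<lambda>j. inner u (e j) * inner (e j) (v - u)) sums inner u (v - u)"
      using sums_imp_expands[OF e u] by (simp add: expands_def)
    moreover have "inner (e j) (v - u) = 0" for j
      using \<open>\<forall>j. inner (v - u) (e j) = 0\<close> by (simp add: inner_commute)
    ultimately have "(\<lambda>j. 0) sums inner u (v - u)" by simp
    then show ?thesis using sums_unique2 sums_zero by blast
  qed
  ultimately have "inner (v - u) (v - u) = 0" using * by (simp add: inner_diff_left)
  then have "v = u" by simp
  then show "expands e v" using sums_imp_expands[OF e u] by simp
qed

lemma
  shows expands_0: "expands e 0"
    and expands_add: "expands e v \<Longrightarrow> expands e w \<Longrightarrow> expands e (v + w)"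
    and expands_scaleR: "expands e v \<Longrightarrow> expands e (c *\<^sub>R v)"
  by (auto simp: expands_def inner_add_left distrib_right mult.assoc intro: sums_add sums_mult)

lemma expands_diff: "expands e v \<Longrightarrow> expands e w \<Longrightarrow> expands e (v - w)"
  using expands_add[of e v "(-1) *\<^sub>R w"] expands_scaleR[of e w "-1"] by simp

lemma expands_sum: "(\<And>i. i \<in> I \<Longrightarrow> expands e (v i)) \<Longrightarrow> expands e (\<Sum>i\<in>I. v i)"
  by (induction I rule: infinite_finite_induct) (auto intro: expands_0 expands_add)

section \<open>Interpolation of quadratic forms\<close>

lemma sum_power_inj_le:
  fixes \<rho> :: real
  assumes \<rho>: "0 < \<rho>" "\<rho> < 1" and "finite K" "inj_on h K"
  shows "(\<Sum>k\<in>K. \<rho> ^ h k) \<le> 1 / (1 - \<rho>)"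
proof -
  have "(\<Sum>k\<in>K. \<rho> ^ h k) = (\<Sum>n\<in>h ` K. \<rho> ^ n)" using assms(4) by (simp add: sum.reindex)
  also have "\<dots> \<le> (\<Sum>n. \<rho> ^ n)"
    using \<rho> assms(3) by (intro sum_le_suminf summable_geometric) auto
  also have "\<dots> = 1 / (1 - \<rho>)" using \<rho> by (intro suminf_geometric) auto
  finally show ?thesis .
qed

text \<open>A discrete version of the fact that the integral of \<tau>^\<theta> min(y/\<tau>, 1)
  d\<tau>/\<tau> is a multiple of y^\<theta>. Away from \<tau> = y the terms decay geometrically on
  both sides, with ratio 2^(-d) for d = min(\<theta>, 1 - \<theta>), uniformly in the finite set
  \<open>K\<close>.\<close>

lemma dyadic_min_sum_bound:
  fixes \<theta> :: real
  assumes \<theta>: "0 < \<theta>" "\<theta> < 1"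
  obtains G where "G > 0"
    "\<And>y K. 0 < y \<Longrightarrow> finite K \<Longrightarrow>
       (\<Sum>k\<in>K. (2 powr real_of_int k) powr \<theta> * min (y / 2 powr real_of_int k) 1) \<le> G * y powr \<theta>"
proof -
  define d where "d = min \<theta> (1 - \<theta>)"
  define \<rho> where "\<rho> = 2 powr (- d)"
  have d: "0 < d" "d \<le> \<theta>" "d \<le> 1 - \<theta>" using \<theta> by (auto simp: d_def)
  have \<rho>: "0 < \<rho>" "\<rho> < 1" using d(1) by (auto simp: \<rho>_def powr_less_one)
  have \<rho>_pow: "\<rho> ^ nat k = 2 powr (- d * k)" if "k \<ge> 0" for k :: int
    using that by (simp add: \<rho>_def powr_powr flip: powr_realpow)
  have main: "(\<Sum>k\<in>K. (2 powr real_of_int k) powr \<theta> * min (y / 2 powr real_of_int k) 1)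
      \<le> 2 / (1 - \<rho>) * y powr \<theta>"
    if y: "0 < y" and K: "finite K" for y K
  proof -
    define k0 where "k0 = \<lfloor>log 2 y\<rfloor>"
    define L where "L = log 2 y"
    have yL: "y = 2 powr L" using y by (simp add: L_def)
    have k0: "real_of_int k0 \<le> L" "L < real_of_int k0 + 1" by (auto simp: k0_def L_def)
    define trm where "trm k = (2 powr real_of_int k) powr \<theta> * min (y / 2 powr real_of_int k) 1" for k
    have low: "trm k \<le> \<rho> ^ nat (k0 - k) * y powr \<theta>" if "k \<le> k0" for k
    proof -
      have "trm k \<le> (2 powr real_of_int k) powr \<theta> * 1"
        unfolding trm_def by (intro mult_left_mono) auto
      also have "\<dots> = 2 powr ((k - L) * \<theta>) * y powr \<theta>"
        by (simp add: yL powr_powr flip: powr_add) (simp add: algebra_simps)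
      also have "2 powr ((k - L) * \<theta>) \<le> 2 powr (- d * (k0 - k))"
      proof (intro powr_mono)
        have "(L - k) * \<theta> \<ge> (k0 - k) * d"
          using k0 d that \<theta> by (intro mult_mono) auto
        then show "(k - L) * \<theta> \<le> - d * (k0 - k)" by (simp add: algebra_simps)
      qed simp
      finally show ?thesis using that \<rho>_pow[of "k0 - k"] by (simp add: mult_right_mono)
    qed
    \<comment> \<open>The exponent is one less than \<open>k - k0\<close> because
      \<open>log 2 y\<close> may come arbitrarily close to \<open>k0 + 1\<close>.\<close>
    have high: "trm k \<le> \<rho> ^ nat (k - k0 - 1) * y powr \<theta>" if "k > k0" for k
    proof -
      have "trm k \<le> (2 powr real_of_int k) powr \<theta> * (y / 2 powr real_of_int k)"
        unfolding trm_def by (intro mult_left_mono) auto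
      also have "\<dots> = 2 powr ((L - k) * (1 - \<theta>)) * y powr \<theta>"
        by (simp add: yL powr_powr flip: powr_add powr_diff) (simp add: algebra_simps)
      also have "2 powr ((L - k) * (1 - \<theta>)) \<le> 2 powr (- d * (k - k0 - 1))"
      proof (intro powr_mono)
        have "real_of_int k0 + 1 \<le> k" using that by linarith
        then have "(k - L) * (1 - \<theta>) \<ge> (k - k0 - 1) * d"
          using k0 d by (intro mult_mono) auto
        then show "(L - k) * (1 - \<theta>) \<le> - d * (k - k0 - 1)" by (simp add: algebra_simps)
      qed simp
      finally show ?thesis using that \<rho>_pow[of "k - k0 - 1"] by (simp add: mult_right_mono)
    qed
    have "(\<Sum>k\<in>K. trm k) = (\<Sum>k\<in>K \<inter> {..k0}. trm k) + (\<Sum>k\<in>K - {..k0}. trm k)"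
      using K by (subst sum.union_disjoint[symmetric]) (auto intro: sum.cong)
    also have "(\<Sum>k\<in>K \<inter> {..k0}. trm k) \<le> (\<Sum>k\<in>K \<inter> {..k0}. \<rho> ^ nat (k0 - k)) * y powr \<theta>"
      unfolding sum_distrib_right by (intro sum_mono low) auto
    also have "\<dots> \<le> 1 / (1 - \<rho>) * y powr \<theta>"
      using K by (intro mult_right_mono sum_power_inj_le \<rho>) (auto simp: inj_on_def)
    also have "(\<Sum>k\<in>K - {..k0}. trm k) \<le> (\<Sum>k\<in>K - {..k0}. \<rho> ^ nat (k - k0 - 1)) * y powr \<theta>"
      unfolding sum_distrib_right by (intro sum_mono high) auto
    also have "\<dots> \<le> 1 / (1 - \<rho>) * y powr \<theta>"
      using K by (intro mult_right_mono sum_power_inj_le \<rho>) (auto simp: inj_on_def)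
    finally show ?thesis by (simp add: trm_def)
  qed
  show thesis
    by (rule that[of "2 / (1 - \<rho>)"]) (use \<rho> main in auto)
qed

text \<open>A single dyadic level suffices: \<tau> <= x <= 2\<tau> gives x/(x + \<tau>) >= 1/3 at
  worst and in fact at least 1/2, and (2\<tau>)^\<theta> <= 2\<tau>^\<theta>; together these cost
  the factor 4.\<close>

lemma dyadic_lower:
  fixes x \<theta> :: real
  assumes x: "0 < x" and \<theta>: "0 < \<theta>" "\<theta> < 1"
  defines "\<tau> \<equiv> 2 powr real_of_int \<lfloor>log 2 x\<rfloor>"
  shows "x powr \<theta> \<le> 4 * (\<tau> powr \<theta> * (x / (x + \<tau>)))"
proof -
  define L where "L = log 2 x"
  have xL: "x = 2 powr L" using x by (simp add: L_def)
  have "\<lfloor>L\<rfloor> \<le> L" "L < \<lfloor>L\<rfloor> + 1" by auto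
  then have "2 powr real_of_int \<lfloor>L\<rfloor> \<le> 2 powr L" "2 powr L \<le> 2 powr (1 + real_of_int \<lfloor>L\<rfloor>)"
    by (intro powr_mono; linarith)+
  then have \<tau>: "\<tau> \<le> x" "x \<le> 2 * \<tau>" "0 < \<tau>"
    by (simp_all add: \<tau>_def xL[symmetric] L_def[symmetric] powr_add)
  have "x powr \<theta> \<le> (2 * \<tau>) powr \<theta>" using \<tau> x \<theta> by (intro powr_mono2) auto
  also have "\<dots> \<le> 2 * \<tau> powr \<theta>"
    using powr_mono[of \<theta> 1 "2::real"] \<theta> \<tau> by (simp add: powr_mult mult_right_mono)
  also have "\<dots> = 4 * (\<tau> powr \<theta> * (1 / 2))" by simp
  also have "\<dots> \<le> 4 * (\<tau> powr \<theta> * (x / (x + \<tau>)))"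
    using \<tau> x by (intro mult_left_mono) (auto simp: field_simps)
  finally show ?thesis .
qed

context spectral_resolution
begin

text \<open>
  The Loewner--Heinz type step: a comparison of two quadratic forms at exponent \<open>1\<close> (and trivially
  at exponent \<open>0\<close>) carries over to exponent \<open>\<theta>\<close>. Both sides are compared with the dyadic sum over
  \<open>\<tau> = 2\<^sup>k\<close> of the K-functional, evaluated at the splitting of \<open>w\<close> by the spectral projection
  onto \<open>y \<le> \<tau>\<close>.
\<close>

lemma form_interpolation:
  fixes x :: "nat \<Rightarrow> real" and e :: "nat \<Rightarrow> 'v"
  assumes \<theta>: "0 < \<theta>" "\<theta> < 1" and G: "G > 0"
    "\<And>y K. 0 < y \<Longrightarrow> finite K \<Longrightarrow>
       (\<Sum>k\<in>K. (2 powr real_of_int k) powr \<theta> * min (y / 2 powr real_of_int k) 1) \<le> G * y powr \<theta>"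
    and e: "orthonormal e" and J: "finite J"
    and x: "\<And>j. x j > 0" and y: "\<And>s. s \<in> Sp \<Longrightarrow> y s > 0" and C: "C \<ge> 0"
    and H: "\<And>u. (\<Sum>j\<in>J. x j * (inner u (e j))\<^sup>2) \<le> C * wnorm2 y u"
  shows "(\<Sum>j\<in>J. x j powr \<theta> * (inner w (e j))\<^sup>2) \<le> 8 * (1 + C) * G * wnorm2 (\<lambda>s. y s powr \<theta>) w"
proof -
  have K: "(\<Sum>j\<in>J. x j / (x j + \<tau>) * (inner w (e j))\<^sup>2) \<le> 2 * (1 + C) * wnorm2 (\<lambda>s. min (y s / \<tau>) 1) w"
    if \<tau>: "\<tau> > 0" for \<tau>
  proof -
    define p where "p s = (if y s \<le> \<tau> then 1 else 0 :: real)" for s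
    define u where "u = calc p w"
    define v where "v = calc (\<lambda>s. 1 - p s) w"
    have w: "w = u + v" by (simp add: u_def v_def calc_add calc_one)
    have "(\<Sum>j\<in>J. x j / (x j + \<tau>) * (inner w (e j))\<^sup>2)
        \<le> (\<Sum>j\<in>J. 2 / \<tau> * (x j * (inner u (e j))\<^sup>2) + 2 * (inner v (e j))\<^sup>2)"
    proof (rule sum_mono)
      fix j
      define r where "r = x j / (x j + \<tau>)"
      have r: "0 \<le> r" "r \<le> 1" "r \<le> x j / \<tau>"
        using x[of j] \<tau> by (auto simp: r_def divide_simps)
      have "(inner w (e j))\<^sup>2 \<le> 2 * (inner u (e j))\<^sup>2 + 2 * (inner v (e j))\<^sup>2"
        using zero_le_power2[of "inner u (e j) - inner v (e j)"]
        by (simp add: w inner_add_left power2_eq_square algebra_simps)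
      then have "r * (inner w (e j))\<^sup>2 \<le> r * (2 * (inner u (e j))\<^sup>2) + r * (2 * (inner v (e j))\<^sup>2)"
        unfolding distrib_left[symmetric] by (rule mult_left_mono[OF _ r(1)])
      also have "\<dots> \<le> x j / \<tau> * (2 * (inner u (e j))\<^sup>2) + 1 * (2 * (inner v (e j))\<^sup>2)"
        by (intro add_mono mult_right_mono r) auto
      finally show "x j / (x j + \<tau>) * (inner w (e j))\<^sup>2
          \<le> 2 / \<tau> * (x j * (inner u (e j))\<^sup>2) + 2 * (inner v (e j))\<^sup>2"
        by (simp add: r_def mult_ac)
    qed
    also have "\<dots> = 2 / \<tau> * (\<Sum>j\<in>J. x j * (inner u (e j))\<^sup>2) + 2 * (\<Sum>j\<in>J. (inner v (e j))\<^sup>2)"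
      by (simp add: sum.distrib sum_distrib_left)
    also have "\<dots> \<le> 2 / \<tau> * (C * wnorm2 y u) + 2 * (norm v)\<^sup>2"
      using \<tau> by (intro add_mono mult_left_mono H bessel[OF e J]) auto
    also have "\<dots> = wnorm2 (\<lambda>s. 2 / \<tau> * C * (y s * (p s)\<^sup>2)) w + wnorm2 (\<lambda>s. 2 * (1 - p s)\<^sup>2) w"
      unfolding u_def v_def wnorm2_calc norm_calc wnorm2_scale by simp
    also have "\<dots> = wnorm2 (\<lambda>s. 2 / \<tau> * C * (y s * (p s)\<^sup>2) + 2 * (1 - p s)\<^sup>2) w"
      by (simp add: wnorm2_def sum.distrib distrib_right)
    also have "\<dots> \<le> wnorm2 (\<lambda>s. 2 * (1 + C) * min (y s / \<tau>) 1) w"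
    proof (rule wnorm2_mono)
      fix s assume "s \<in> Sp"
      then show "2 / \<tau> * C * (y s * (p s)\<^sup>2) + 2 * (1 - p s)\<^sup>2 \<le> 2 * (1 + C) * min (y s / \<tau>) 1"
        using y[of s] \<tau> C by (auto simp: p_def field_simps min_def)
    qed
    finally show ?thesis by (simp only: wnorm2_scale)
  qed
  \<comment> \<open>Only the dyadic levels of the finitely many \<open>x j\<close> are summed; the
    bound \<open>G\<close> does not depend on this set. The constant 8 is the 4 of
    \<open>dyadic_lower\<close> times the 2 of the splitting.\<close>
  define K where "K = (\<lambda>j. \<lfloor>log 2 (x j)\<rfloor>) ` J"
  define T where "T k = 2 powr real_of_int k" for k
  have finK: "finite K" using J by (simp add: K_def)
  have T: "T k > 0" for k by (simp add: T_def)
  have "(\<Sum>j\<in>J. x j powr \<theta> * (inner w (e j))\<^sup>2)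
      \<le> (\<Sum>j\<in>J. (\<Sum>k\<in>K. 4 * (T k powr \<theta> * (x j / (x j + T k)))) * (inner w (e j))\<^sup>2)"
  proof (intro sum_mono mult_right_mono)
    fix j assume j: "j \<in> J"
    let ?k = "\<lfloor>log 2 (x j)\<rfloor>"
    have "x j powr \<theta> \<le> 4 * (T ?k powr \<theta> * (x j / (x j + T ?k)))"
      unfolding T_def by (rule dyadic_lower[OF x \<theta>])
    also have "\<dots> \<le> (\<Sum>k\<in>K. 4 * (T k powr \<theta> * (x j / (x j + T k))))"
      using j finK T x[of j]
      by (intro member_le_sum) (auto simp: K_def less_imp_le intro!: mult_nonneg_nonneg divide_nonneg_nonneg add_nonneg_nonneg)
    finally show "x j powr \<theta> \<le> (\<Sum>k\<in>K. 4 * (T k powr \<theta> * (x j / (x j + T k))))" .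
  qed simp
  also have "\<dots> = (\<Sum>k\<in>K. 4 * T k powr \<theta> * (\<Sum>j\<in>J. x j / (x j + T k) * (inner w (e j))\<^sup>2))"
    by (simp add: sum_distrib_left sum_distrib_right mult_ac) (rule sum.swap)
  also have "\<dots> \<le> (\<Sum>k\<in>K. 4 * T k powr \<theta> * (2 * (1 + C) * wnorm2 (\<lambda>s. min (y s / T k) 1) w))"
    by (intro sum_mono mult_left_mono K T) auto
  also have "\<dots> = 8 * (1 + C) * (\<Sum>k\<in>K. wnorm2 (\<lambda>s. T k powr \<theta> * min (y s / T k) 1) w)"
    unfolding sum_distrib_left wnorm2_scale by (intro sum.cong refl) (simp add: algebra_simps)
  also have "(\<Sum>k\<in>K. wnorm2 (\<lambda>s. T k powr \<theta> * min (y s / T k) 1) w)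
      = wnorm2 (\<lambda>s. \<Sum>k\<in>K. T k powr \<theta> * min (y s / T k) 1) w"
    unfolding wnorm2_def sum_distrib_right by (rule sum.swap)
  also have "\<dots> \<le> wnorm2 (\<lambda>s. G * y s powr \<theta>) w"
    unfolding T_def by (intro wnorm2_mono G(2) y finK)
  finally show ?thesis using C by (simp add: wnorm2_scale mult_left_mono mult.assoc)
qed

text \<open>With \<open>A b + v\<close> as data the error is the residual filter applied to
  \<open>b\<close> minus the filter applied to \<open>v\<close>. Pairing the weighted error with
  itself and moving the filters to the other side means that \<open>b\<close> and \<open>v\<close>
  need to be known only through their form bounds.\<close>

lemma calc_error_bound:
  assumes b: "\<And>w. (inner b w)\<^sup>2 \<le> wnorm2 \<psi> w" and v: "\<And>w. (inner v w)\<^sup>2 \<le> wnorm2 \<zeta> w"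
    and c1: "0 \<le> c1" "\<And>s. s \<in> Sp \<Longrightarrow> \<psi> s * (\<rho> s * (1 - s * g s))\<^sup>2 \<le> c1\<^sup>2"
    and c2: "0 \<le> c2" "\<And>s. s \<in> Sp \<Longrightarrow> \<zeta> s * (\<rho> s * g s)\<^sup>2 \<le> c2\<^sup>2"
  shows "norm (calc \<rho> (b - calc g (A b + v))) \<le> c1 + c2"
proof -
  define x where "x = calc \<rho> (b - calc g (A b + v))"
  have "calc \<rho> (b - calc g (A b + v)) = calc (\<lambda>s. \<rho> s * (1 - s * g s)) b - calc (\<lambda>s. \<rho> s * g s) v"
  proof -
    have "b - calc g (A b + v) = calc (\<lambda>s. 1 - s * g s) b - calc g v"
      using calc_diff[of "\<lambda>s. 1" b "\<lambda>s. g s * s"]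
      by (simp add: linear_add[OF linear_calc] A_calc calc_calc calc_one mult.commute)
    then show ?thesis by (simp add: linear_diff[OF linear_calc] calc_calc)
  qed
  then have "inner x x = inner b (calc (\<lambda>s. \<rho> s * (1 - s * g s)) x) - inner v (calc (\<lambda>s. \<rho> s * g s) x)"
    unfolding x_def[symmetric] by (simp add: inner_diff_left calc_sym)
  also have "\<dots> \<le> \<bar>inner b (calc (\<lambda>s. \<rho> s * (1 - s * g s)) x)\<bar> + \<bar>inner v (calc (\<lambda>s. \<rho> s * g s) x)\<bar>"
    by linarith
  also have "\<bar>inner b (calc (\<lambda>s. \<rho> s * (1 - s * g s)) x)\<bar> \<le> c1 * norm x"
  proof (rule power2_le_imp_le)
    have "(inner b (calc (\<lambda>s. \<rho> s * (1 - s * g s)) x))\<^sup>2 \<le> c1\<^sup>2 * (norm x)\<^sup>2"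
      by (rule order_trans[OF b]) (unfold wnorm2_calc, rule wnorm2_le[OF c1(2)])
    then show "\<bar>inner b (calc (\<lambda>s. \<rho> s * (1 - s * g s)) x)\<bar>\<^sup>2 \<le> (c1 * norm x)\<^sup>2"
      by (simp add: power_mult_distrib)
  qed (use c1 in simp)
  also have "\<bar>inner v (calc (\<lambda>s. \<rho> s * g s) x)\<bar> \<le> c2 * norm x"
  proof (rule power2_le_imp_le)
    have "(inner v (calc (\<lambda>s. \<rho> s * g s) x))\<^sup>2 \<le> c2\<^sup>2 * (norm x)\<^sup>2"
      by (rule order_trans[OF v]) (unfold wnorm2_calc, rule wnorm2_le[OF c2(2)])
    then show "\<bar>inner v (calc (\<lambda>s. \<rho> s * g s) x)\<bar>\<^sup>2 \<le> (c2 * norm x)\<^sup>2"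
      by (simp add: power_mult_distrib)
  qed (use c2 in simp)
  finally have "norm x * norm x \<le> (c1 + c2) * norm x"
    by (simp add: algebra_simps flip: power2_norm_eq_inner power2_eq_square)
  then have "norm x \<le> c1 + c2" using c1 c2 by (cases "norm x = 0") auto
  then show ?thesis by (simp add: x_def)
qed

end

section \<open>Empirical second moment operators close to a diagonal form\<close>

text \<open>Weighted Cauchy-Schwarz on partial sums followed by the limit; convergence of the paired
  series is the only convergence used.\<close>

lemma sums_power2_le:
  fixes p q w :: "nat \<Rightarrow> real"
  assumes S: "(\<lambda>k. p k * q k) sums S" and w: "\<And>k. w k > 0"
    and P: "\<And>N. (\<Sum>k<N. (p k)\<^sup>2 / w k) \<le> P" and Q: "\<And>N. (\<Sum>k<N. w k * (q k)\<^sup>2) \<le> Q"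
  shows "S\<^sup>2 \<le> P * Q"
proof -
  have P0: "0 \<le> P" using P[of 0] by simp
  have "(\<Sum>k<N. p k * q k)\<^sup>2 \<le> P * Q" for N
  proof -
    have "(\<Sum>k<N. p k * q k)\<^sup>2 = (\<Sum>k<N. (p k / sqrt (w k)) * (sqrt (w k) * q k))\<^sup>2"
      using w by (simp add: less_imp_neq[OF w, symmetric])
    also have "\<dots> \<le> (\<Sum>k<N. (p k / sqrt (w k))\<^sup>2) * (\<Sum>k<N. (sqrt (w k) * q k)\<^sup>2)"
      by (rule Cauchy_Schwarz_ineq_sum)
    also have "\<dots> = (\<Sum>k<N. (p k)\<^sup>2 / w k) * (\<Sum>k<N. w k * (q k)\<^sup>2)"
      using w by (simp add: power_divide power_mult_distrib less_imp_le)
    also have "\<dots> \<le> P * Q"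
      using w by (intro mult_mono P Q P0 sum_nonneg) (simp add: less_imp_le)
    finally show ?thesis .
  qed
  moreover have "(\<lambda>N. (\<Sum>k<N. p k * q k)\<^sup>2) \<longlonglongrightarrow> S\<^sup>2"
    using S unfolding sums_def by (intro tendsto_intros)
  ultimately show ?thesis by (intro LIMSEQ_le_const2) auto
qed

text \<open>Records the loss per induction step in \<open>power_comparison\<close>: 2 from splitting
  a square, and 4 as that 2 times the 2 of \<open>qform_le\<close>. It depends on bounds uniform in
  the sample size only.\<close>

primrec comparison_const :: "real \<Rightarrow> real \<Rightarrow> nat \<Rightarrow> real" where
  "comparison_const \<Lambda> B 0 = 1"
| "comparison_const \<Lambda> B (Suc m) = 2 * comparison_const \<Lambda> B m + 4 * \<Lambda> ^ (2 * m) * B"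

text \<open>The deterministic situation on a good sample. \<open>R j\<close> dominates row j of the
  squared deviation matrix, weighted in its column index. Weighting the rows too gives the squared
  two-sided Hilbert-Schmidt norm, at most 1/4; summing the rows unweighted gives the one-sided bound
  \<open>B\<close>.\<close>

locale empirical_form = spectral_resolution A Sp E
  for A :: "'v::real_inner \<Rightarrow> 'v" and Sp E +
  fixes e :: "nat \<Rightarrow> 'v" and a :: "nat \<Rightarrow> real" and l \<Lambda> B :: real
    and z :: "nat \<Rightarrow> 'v" and n :: nat and R :: "nat \<Rightarrow> real"
  assumes orthonormal_e: "orthonormal e" and a_pos: "a j > 0" and l_pos: "l > 0"
    and a_le: "a j + l \<le> \<Lambda>" and Sp_nonneg: "s \<in> Sp \<Longrightarrow> 0 \<le> s"
    and A_sample: "A x = (1 / real n) *\<^sub>R (\<Sum>i=1..n. inner (z i) x *\<^sub>R z i)"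
    and z_expands: "i \<in> {1..n} \<Longrightarrow> expands e (z i)"
    and R_ge: "(\<Sum>k<N. ((if j = k then a j else 0)
        - 1 / real n * (\<Sum>i=1..n. inner (z i) (e j) * inner (z i) (e k)))\<^sup>2 / (a k + l)) \<le> R j"
    and R_quarter: "(\<Sum>j<N. R j / (a j + l)) \<le> 1 / 4"
    and R_sum: "(\<Sum>j<N. R j) \<le> B"
begin

text \<open>Coordinate j of the population operator minus the empirical operator, applied to
  \<open>u\<close>.\<close>

definition "dev u j = a j * inner u (e j) - inner (A u) (e j)"

definition "qform u = (\<Sum>j. (a j + l) * (inner u (e j))\<^sup>2)"

lemma al_pos: "a j + l > 0"
  using a_pos[of j] l_pos by linarith

lemma A_expands: "expands e (A u)"
  unfolding A_sample by (intro expands_scaleR expands_sum z_expands)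

text \<open>\<open>u\<close> may have a component orthogonal to every \<open>e j\<close>; the
  expansion over k is valid because the vectors \<open>z i\<close> lie in the closed span and do not
  see that component.\<close>

lemma dev_sums:
  "(\<lambda>k. ((if j = k then a j else 0)
      - 1 / real n * (\<Sum>i=1..n. inner (z i) (e j) * inner (z i) (e k))) * inner u (e k)) sums dev u j"
proof -
  have "(\<lambda>k. if k = j then a j * inner u (e j) else 0) sums (a j * inner u (e j))"
    using sums_single[of j "\<lambda>_. a j * inner u (e j)"] by simp
  moreover have "(\<lambda>k. 1 / real n * (\<Sum>i=1..n. inner (z i) (e j) * (inner (z i) (e k) * inner (e k) u)))
      sums (1 / real n * (\<Sum>i=1..n. inner (z i) (e j) * inner (z i) u))"
    using z_expands by (intro sums_mult sums_sum) (auto simp: expands_def)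
  ultimately have "(\<lambda>k. (if k = j then a j * inner u (e j) else 0)
      - 1 / real n * (\<Sum>i=1..n. inner (z i) (e j) * (inner (z i) (e k) * inner (e k) u))) sums
      (a j * inner u (e j) - 1 / real n * (\<Sum>i=1..n. inner (z i) (e j) * inner (z i) u))"
    by (rule sums_diff)
  moreover have "a j * inner u (e j) - 1 / real n * (\<Sum>i=1..n. inner (z i) (e j) * inner (z i) u) = dev u j"
    by (simp add: dev_def A_sample inner_sum_left mult_ac)
  moreover have "(\<lambda>k. (if k = j then a j * inner u (e j) else 0)
      - 1 / real n * (\<Sum>i=1..n. inner (z i) (e j) * (inner (z i) (e k) * inner (e k) u)))
      = (\<lambda>k. ((if j = k then a j else 0)
      - 1 / real n * (\<Sum>i=1..n. inner (z i) (e j) * inner (z i) (e k))) * inner u (e k))"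
  proof
    fix k
    have "1 / real n * (\<Sum>i=1..n. inner (z i) (e j) * (inner (z i) (e k) * inner (e k) u))
        = 1 / real n * (\<Sum>i=1..n. inner (z i) (e j) * inner (z i) (e k)) * inner u (e k)"
      by (simp add: sum_distrib_right mult.assoc inner_commute[of "e k" u])
    then show "(if k = j then a j * inner u (e j) else 0)
      - 1 / real n * (\<Sum>i=1..n. inner (z i) (e j) * (inner (z i) (e k) * inner (e k) u))
      = ((if j = k then a j else 0)
      - 1 / real n * (\<Sum>i=1..n. inner (z i) (e j) * inner (z i) (e k))) * inner u (e k)"
      by (simp only: left_diff_distrib) auto
  qed
  ultimately show ?thesis by simp
qed

lemma summable_qform: "summable (\<lambda>j. (a j + l) * (inner u (e j))\<^sup>2)"
proof (rule summable_comparison_test'[where N = 0])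
  show "summable (\<lambda>j. \<Lambda> * (inner u (e j))\<^sup>2)"
    by (intro summable_mult summable_power2_inner orthonormal_e)
  show "norm ((a j + l) * (inner u (e j))\<^sup>2) \<le> \<Lambda> * (inner u (e j))\<^sup>2" for j
    using a_le[of j] al_pos[of j] by (simp add: abs_mult mult_right_mono)
qed

lemma qform_partial: "(\<Sum>j<N. (a j + l) * (inner u (e j))\<^sup>2) \<le> qform u"
  unfolding qform_def by (intro sum_le_suminf summable_qform) (simp_all add: al_pos less_imp_le)

lemma qform_nonneg: "0 \<le> qform u"
  using qform_partial[where N = 0 and u = u] by simp

lemma dev_le: "(dev u j)\<^sup>2 \<le> R j * qform u"
  by (rule sums_power2_le[OF dev_sums al_pos R_ge qform_partial])

text \<open>The two forms differ at \<open>u\<close> by the sum of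
  \<open>dev u j * inner u (e j)\<close>. By Cauchy-Schwarz and \<open>R_quarter\<close> this is at
  most half of \<open>qform u\<close>, which is absorbed on the left; this is the origin of the
  factor 2.\<close>

lemma qform_le: "qform u \<le> 2 * wnorm2 (\<lambda>s. s + l) u"
proof -
  have sq: "summable (\<lambda>j. (inner u (e j))\<^sup>2)" by (rule summable_power2_inner[OF orthonormal_e])
  have sa: "summable (\<lambda>j. a j * (inner u (e j))\<^sup>2)"
    using summable_diff[OF summable_qform[of u] summable_mult[OF sq, of l]] by (simp add: distrib_right)
  have "(\<lambda>j. a j * (inner u (e j))\<^sup>2 - inner (A u) (e j) * inner (e j) u) sums
      ((\<Sum>j. a j * (inner u (e j))\<^sup>2) - inner (A u) u)"
    using A_expands[of u] by (intro sums_diff summable_sums sa) (auto simp: expands_def)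
  moreover have "dev u j * inner u (e j) = a j * (inner u (e j))\<^sup>2 - inner (A u) (e j) * inner (e j) u" for j
    by (simp add: dev_def left_diff_distrib power2_eq_square inner_commute[of "e j" u])
  ultimately have "(\<lambda>j. dev u j * inner u (e j)) sums ((\<Sum>j. a j * (inner u (e j))\<^sup>2) - inner (A u) u)"
    by simp
  then have "((\<Sum>j. a j * (inner u (e j))\<^sup>2) - inner (A u) u)\<^sup>2 \<le> (1/4 * qform u) * qform u"
  proof (rule sums_power2_le[OF _ al_pos _ qform_partial])
    fix N
    have "(\<Sum>j<N. (dev u j)\<^sup>2 / (a j + l)) \<le> (\<Sum>j<N. R j / (a j + l) * qform u)"
      using dev_le[of u] by (intro sum_mono) (simp add: divide_right_mono al_pos less_imp_le)
    also have "\<dots> \<le> 1/4 * qform u"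
      unfolding sum_distrib_right[symmetric] by (intro mult_right_mono R_quarter qform_nonneg)
    finally show "(\<Sum>j<N. (dev u j)\<^sup>2 / (a j + l)) \<le> 1/4 * qform u" .
  qed
  then have "((\<Sum>j. a j * (inner u (e j))\<^sup>2) - inner (A u) u)\<^sup>2 \<le> (qform u / 2)\<^sup>2"
    by (simp add: power2_eq_square)
  then have "(\<Sum>j. a j * (inner u (e j))\<^sup>2) - inner (A u) u \<le> qform u / 2"
    by (rule power2_le_imp_le) (simp add: qform_nonneg)
  moreover have "qform u = (\<Sum>j. a j * (inner u (e j))\<^sup>2) + l * (\<Sum>j. (inner u (e j))\<^sup>2)"
    unfolding qform_def distrib_right by (simp add: suminf_add[symmetric] suminf_mult sa sq)
  moreover have "l * (\<Sum>j. (inner u (e j))\<^sup>2) \<le> l * (norm u)\<^sup>2"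
    using l_pos bessel[OF orthonormal_e] by (intro mult_left_mono suminf_le_const sq) auto
  moreover have "wnorm2 (\<lambda>s. s + l) u = inner (A u) u + l * (norm u)\<^sup>2"
    by (simp add: A_calc inner_calc wnorm2_one[symmetric] wnorm2_scale[symmetric])
      (simp add: wnorm2_def distrib_right sum.distrib)
  ultimately show ?thesis by linarith
qed

lemma partial_le_wnorm2: "(\<Sum>j<N. (a j + l) * (inner u (e j))\<^sup>2) \<le> 2 * wnorm2 (\<lambda>s. s + l) u"
  using qform_partial qform_le order_trans by blast

text \<open>Comparability of forms does not survive squaring, so each step uses vectors: (A + l) u
  agrees coordinatewise with (a_j + l) u_j up to \<open>dev u j\<close>. The induction hypothesis is
  applied to (A + l) u, and the deviation is paid for by the assumption that \<open>B\<close> is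
  small compared with a power of \<open>l\<close>.\<close>

lemma power_comparison:
  assumes "\<And>k. k < m \<Longrightarrow> B \<le> B' * l ^ (2 * k + 1)" and B': "0 \<le> B'"
  shows "0 \<le> comparison_const \<Lambda> B' m \<and>
    (\<forall>u N. (\<Sum>j<N. (a j + l) ^ (2 * m) * (inner u (e j))\<^sup>2)
      \<le> comparison_const \<Lambda> B' m * wnorm2 (\<lambda>s. (s + l) ^ (2 * m)) u)"
  using assms(1)
proof (induction m)
  case 0
  then show ?case by (simp add: wnorm2_one bessel[OF orthonormal_e])
next
  case (Suc m)
  have \<Lambda>: "\<Lambda> \<ge> 0" using al_pos[of 0] a_le[of 0] by linarith
  define c where "c = comparison_const \<Lambda> B' m"
  have c: "0 \<le> c" and IH: "\<And>u N. (\<Sum>j<N. (a j + l) ^ (2 * m) * (inner u (e j))\<^sup>2) \<le> c * wnorm2 (\<lambda>s. (s + l) ^ (2 * m)) u"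
    using Suc.IH Suc.prems by (auto simp: c_def)
  have main: "(\<Sum>j<N. (a j + l) ^ (2 * Suc m) * (inner u (e j))\<^sup>2)
      \<le> comparison_const \<Lambda> B' (Suc m) * wnorm2 (\<lambda>s. (s + l) ^ (2 * Suc m)) u" for u N
  proof -
    define p where "p = calc (\<lambda>s. s + l) u"
    have p: "inner p (e j) = inner (A u) (e j) + l * inner u (e j)" for j
      unfolding p_def A_calc
      by (simp add: calc_def scaleR_add_left sum.distrib inner_add_left flip: scaleR_sum_right)
        (simp add: total)
    have "(\<Sum>j<N. (a j + l) ^ (2 * Suc m) * (inner u (e j))\<^sup>2)
        \<le> (\<Sum>j<N. 2 * ((a j + l) ^ (2 * m) * (inner p (e j))\<^sup>2) + 2 * \<Lambda> ^ (2 * m) * (dev u j)\<^sup>2)"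
    proof (rule sum_mono)
      fix j
      define r where "r = (a j + l) ^ (2 * m)"
      have r: "0 \<le> r" "r \<le> \<Lambda> ^ (2 * m)"
        using al_pos[of j] a_le[of j] by (auto simp: r_def intro: power_mono)
      \<comment> \<open>The exchange of the diagonal operator for the empirical one, at the price of
        one deviation term.\<close>
      have "(a j + l) * inner u (e j) = inner p (e j) + dev u j"
        by (simp add: p dev_def algebra_simps)
      then have "((a j + l) * inner u (e j))\<^sup>2 \<le> 2 * (inner p (e j))\<^sup>2 + 2 * (dev u j)\<^sup>2"
        using zero_le_power2[of "inner p (e j) - dev u j"] by (simp add: power2_eq_square algebra_simps)
      then have "r * ((a j + l) * inner u (e j))\<^sup>2 \<le> r * (2 * (inner p (e j))\<^sup>2) + r * (2 * (dev u j)\<^sup>2)"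
        unfolding distrib_left[symmetric] by (rule mult_left_mono[OF _ r(1)])
      also have "\<dots> \<le> r * (2 * (inner p (e j))\<^sup>2) + \<Lambda> ^ (2 * m) * (2 * (dev u j)\<^sup>2)"
        by (intro add_left_mono mult_right_mono r) auto
      finally show "(a j + l) ^ (2 * Suc m) * (inner u (e j))\<^sup>2
          \<le> 2 * ((a j + l) ^ (2 * m) * (inner p (e j))\<^sup>2) + 2 * \<Lambda> ^ (2 * m) * (dev u j)\<^sup>2"
        by (simp add: r_def power_mult_distrib power2_eq_square mult_ac)
    qed
    also have "\<dots> = 2 * (\<Sum>j<N. (a j + l) ^ (2 * m) * (inner p (e j))\<^sup>2)
        + 2 * \<Lambda> ^ (2 * m) * (\<Sum>j<N. (dev u j)\<^sup>2)"
      by (simp add: sum.distrib sum_distrib_left)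
    also have "\<dots> \<le> 2 * (c * wnorm2 (\<lambda>s. (s + l) ^ (2 * m)) p) + 2 * \<Lambda> ^ (2 * m) * (B * qform u)"
    proof (intro add_mono mult_left_mono IH)
      have "(\<Sum>j<N. (dev u j)\<^sup>2) \<le> (\<Sum>j<N. R j) * qform u"
        unfolding sum_distrib_right by (intro sum_mono dev_le)
      also have "\<dots> \<le> B * qform u" by (intro mult_right_mono R_sum qform_nonneg)
      finally show "(\<Sum>j<N. (dev u j)\<^sup>2) \<le> B * qform u" .
    qed (use \<Lambda> in auto)
    also have "wnorm2 (\<lambda>s. (s + l) ^ (2 * m)) p = wnorm2 (\<lambda>s. (s + l) ^ (2 * Suc m)) u"
      by (simp add: p_def wnorm2_calc power2_eq_square mult_ac)
    also have "2 * (c * wnorm2 (\<lambda>s. (s + l) ^ (2 * Suc m)) u) + 2 * \<Lambda> ^ (2 * m) * (B * qform u)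
        \<le> 2 * (c * wnorm2 (\<lambda>s. (s + l) ^ (2 * Suc m)) u)
          + 2 * \<Lambda> ^ (2 * m) * (B' * 2 * wnorm2 (\<lambda>s. (s + l) ^ (2 * Suc m)) u)"
    proof (intro add_left_mono mult_left_mono)
      \<comment> \<open>The smallness of \<open>B\<close> contributes l^(2m+1) and
        \<open>qform_le\<close> one factor s + l; since \<open>Sp\<close> is nonnegative, l <= s + l
        raises the product to the full power 2m + 2.\<close>
      have "B * qform u \<le> (B' * l ^ (2 * m + 1)) * (2 * wnorm2 (\<lambda>s. s + l) u)"
        using Suc.prems[of m] B' l_pos by (intro mult_mono qform_le qform_nonneg) auto
      also have "\<dots> = B' * 2 * wnorm2 (\<lambda>s. l ^ (2 * m + 1) * (s + l)) u" by (simp add: wnorm2_scale)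
      also have "\<dots> \<le> B' * 2 * wnorm2 (\<lambda>s. (s + l) ^ (2 * m + 1) * (s + l)) u"
        using B' l_pos Sp_nonneg
        by (intro mult_left_mono wnorm2_mono mult_right_mono power_mono) (auto intro: add_nonneg_nonneg)
      finally show "B * qform u \<le> B' * 2 * wnorm2 (\<lambda>s. (s + l) ^ (2 * Suc m)) u"
        by (simp add: mult_ac)
    qed (use \<Lambda> in auto)
    finally show ?thesis by (simp add: c_def algebra_simps del: power_Suc)
  qed
  have "0 \<le> comparison_const \<Lambda> B' (Suc m)" using c B' \<Lambda> by (simp add: c_def[symmetric])
  with main show ?case by blast
qed

text \<open>Cauchy-Schwarz with weights a_j + l leaves \<open>qform w\<close>, which is then read in
  terms of the empirical operator.\<close>

lemma noise_form_bound:
  assumes "expands e v" "\<And>N. (\<Sum>j<N. (inner v (e j))\<^sup>2 / (a j + l)) \<le> V"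
  shows "(inner v w)\<^sup>2 \<le> wnorm2 (\<lambda>s. 2 * V * (s + l)) w"
proof -
  have "0 \<le> V" using assms(2)[of 0] by simp
  have "(\<lambda>j. inner v (e j) * inner w (e j)) sums inner v w"
    using assms(1) unfolding expands_def inner_commute[of w] by blast
  then have "(inner v w)\<^sup>2 \<le> V * qform w"
    by (rule sums_power2_le[OF _ al_pos assms(2) qform_partial])
  also have "\<dots> \<le> V * (2 * wnorm2 (\<lambda>s. s + l) w)" using \<open>0 \<le> V\<close> by (intro mult_left_mono qform_le)
  finally show ?thesis by (simp add: wnorm2_scale)
qed

text \<open>Here \<open>m\<close> is the least integer above \<open>q\<close>. The comparison at the
  even power 2m is interpolated with \<theta> = q/m < 1, which yields power 2q on both sides;
  Cauchy-Schwarz against the coefficients \<open>h\<close> turns it into a bound for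
  \<open>b\<close>.\<close>

lemma source_form_bound:
  fixes q :: real
  assumes q: "0 \<le> q" and b: "expands e b" "\<And>j. inner b (e j) = a j powr q * h j"
    and h: "\<And>N. (\<Sum>j<N. (h j)\<^sup>2) \<le> H"
    and m: "m = nat \<lfloor>q\<rfloor> + 1" and \<theta>: "\<theta> = q / real m"
    and G: "G > 0" "\<And>y K. 0 < q \<Longrightarrow> 0 < y \<Longrightarrow> finite K \<Longrightarrow>
       (\<Sum>k\<in>K. (2 powr real_of_int k) powr \<theta> * min (y / 2 powr real_of_int k) 1) \<le> G * y powr \<theta>"
    and B': "0 \<le> B'" "\<And>k. k < m \<Longrightarrow> B \<le> B' * l ^ (2 * k + 1)"
  shows "(inner b w)\<^sup>2 \<le> wnorm2 (\<lambda>s. H * (1 + 8 * (1 + comparison_const \<Lambda> B' m) * G) * (s + l) powr (2 * q)) w"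
proof -
  define C where "C = comparison_const \<Lambda> B' m"
  have C: "0 \<le> C" "\<And>u N. (\<Sum>j<N. (a j + l) ^ (2 * m) * (inner u (e j))\<^sup>2) \<le> C * wnorm2 (\<lambda>s. (s + l) ^ (2 * m)) u"
    using power_comparison[OF B'(2,1)] by (auto simp: C_def)
  have H: "0 \<le> H" using h[of 0] by simp
  have sl: "s + l > 0" if "s \<in> Sp" for s using Sp_nonneg[OF that] l_pos by linarith
  have W0: "0 \<le> wnorm2 (\<lambda>s. (s + l) powr (2 * q)) w"
    unfolding wnorm2_def by (intro sum_nonneg mult_nonneg_nonneg) auto
  have m0: "real m > q" "m > 0" using q unfolding m by linarith+
  have pw: "(x ^ (2 * m)) powr \<theta> = x powr (2 * q)" if "x > 0" for x :: real
    using that m0 by (simp add: \<theta> powr_powr flip: powr_realpow)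
  have form: "(\<Sum>j<N. (a j + l) powr (2 * q) * (inner w (e j))\<^sup>2)
      \<le> (1 + 8 * (1 + C) * G) * wnorm2 (\<lambda>s. (s + l) powr (2 * q)) w" for N
  \<comment> \<open>For \<open>q = 0\<close> the interpolation parameter would be 0, outside the
    open interval; Bessel's inequality takes its place, and the summand 1 in the constant pays for
    it.\<close>
  proof (cases "q = 0")
    case True
    have "(\<Sum>j<N. (a j + l) powr (2 * q) * (inner w (e j))\<^sup>2) = (\<Sum>j<N. (inner w (e j))\<^sup>2)"
      using True less_imp_neq[OF al_pos] by (intro sum.cong) auto
    also have "\<dots> \<le> (norm w)\<^sup>2" by (rule bessel[OF orthonormal_e]) simp
    also have "\<dots> = wnorm2 (\<lambda>s. 1) w" by (simp only: wnorm2_one)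
    also have "\<dots> = wnorm2 (\<lambda>s. (s + l) powr (2 * q)) w"
      unfolding wnorm2_def by (intro sum.cong refl) (use True sl in force)
    also have "\<dots> \<le> (1 + 8 * (1 + C) * G) * \<dots>"
      using W0 C(1) G(1) by (simp add: distrib_right)
    finally show ?thesis .
  next
    case False
    then have \<theta>01: "0 < \<theta>" "\<theta> < 1" using q m0 by (auto simp: \<theta>)
    have "(\<Sum>j<N. ((a j + l) ^ (2 * m)) powr \<theta> * (inner w (e j))\<^sup>2)
        \<le> 8 * (1 + C) * G * wnorm2 (\<lambda>s. ((s + l) ^ (2 * m)) powr \<theta>) w"
      by (rule form_interpolation[OF \<theta>01 G(1) _ orthonormal_e _ _ _ C])
        (use False q G(2) al_pos sl in auto)
    moreover have "wnorm2 (\<lambda>s. ((s + l) ^ (2 * m)) powr \<theta>) w = wnorm2 (\<lambda>s. (s + l) powr (2 * q)) w"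
      unfolding wnorm2_def by (intro sum.cong refl) (simp add: pw sl)
    ultimately show ?thesis using W0 by (simp add: pw al_pos distrib_right)
  qed
  have "(\<lambda>j. h j * (a j powr q * inner w (e j))) sums inner b w"
    using b(1)[unfolded expands_def b(2), rule_format, of w]
    by (simp add: inner_commute[of "e _" w] mult_ac)
  then have "(inner b w)\<^sup>2 \<le> H * ((1 + 8 * (1 + C) * G) * wnorm2 (\<lambda>s. (s + l) powr (2 * q)) w)"
  proof (rule sums_power2_le[where w = "\<lambda>_. 1"])
    fix N
    have "(\<Sum>j<N. 1 * (a j powr q * inner w (e j))\<^sup>2) \<le> (\<Sum>j<N. (a j + l) powr (2 * q) * (inner w (e j))\<^sup>2)"
    proof (rule sum_mono)
      fix j
      have "(a j powr q)\<^sup>2 = a j powr (2 * q)"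
        by (simp add: power2_eq_square flip: powr_add)
      also have "\<dots> \<le> (a j + l) powr (2 * q)" using a_pos[of j] l_pos q by (intro powr_mono2) auto
      finally show "1 * (a j powr q * inner w (e j))\<^sup>2 \<le> (a j + l) powr (2 * q) * (inner w (e j))\<^sup>2"
        by (simp add: power_mult_distrib mult_right_mono)
    qed
    also note form
    finally show "(\<Sum>j<N. 1 * (a j powr q * inner w (e j))\<^sup>2)
        \<le> (1 + 8 * (1 + C) * G) * wnorm2 (\<lambda>s. (s + l) powr (2 * q)) w" .
  qed (use h in auto)
  then show ?thesis by (simp only: C_def wnorm2_scale mult.assoc)
qed

end

section \<open>Averages of independent random variables\<close>

context prob_space
begin

text \<open>Off-diagonal products factor by independence into the squared mean, while the diagonal
  contributes s/n. The mean is kept because the residuals of a truncated target are not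
  centred.\<close>

lemma iid_average_second_moment:
  fixes W :: "nat \<Rightarrow> 'a \<Rightarrow> 'b"
  assumes indep: "indep_vars (\<lambda>_. N) W {1..}"
    and ident: "\<And>i. 1 \<le> i \<Longrightarrow> distr M N (W i) = distr M N W0" and W0: "W0 \<in> measurable M N"
    and F: "F \<in> borel_measurable N" "integrable M (\<lambda>\<omega>. (F (W0 \<omega>))\<^sup>2)" and n: "1 \<le> n"
  shows "(\<integral>\<^sup>+\<omega>. ennreal ((1 / real n * (\<Sum>i=1..n. F (W i \<omega>)))\<^sup>2) \<partial>M)
    \<le> ennreal ((expectation (\<lambda>\<omega>. F (W0 \<omega>)))\<^sup>2 + expectation (\<lambda>\<omega>. (F (W0 \<omega>))\<^sup>2) / real n)"
proof -
  define m where "m = expectation (\<lambda>\<omega>. F (W0 \<omega>))"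
  define s where "s = expectation (\<lambda>\<omega>. (F (W0 \<omega>))\<^sup>2)"
  have W: "W i \<in> measurable M N" if "1 \<le> i" for i
    using indep that by (auto simp: indep_vars_def)
  have F2: "(\<lambda>p. (F p)\<^sup>2) \<in> borel_measurable N" using F(1) by measurable
  have FW0: "(\<lambda>\<omega>. F (W0 \<omega>)) \<in> borel_measurable M" using F(1) W0 by measurable
  have int0: "integrable M (\<lambda>\<omega>. F (W0 \<omega>))"
    by (rule square_integrable_imp_integrable[OF FW0 F(2)])
  have sq: "integrable M (\<lambda>\<omega>. (F (W i \<omega>))\<^sup>2)" "expectation (\<lambda>\<omega>. (F (W i \<omega>))\<^sup>2) = s"
    if i: "1 \<le> i" for i
  proof -
    show "integrable M (\<lambda>\<omega>. (F (W i \<omega>))\<^sup>2)"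
      using F(2) integrable_distr_eq[OF W[OF i] F2] integrable_distr_eq[OF W0 F2] ident[OF i] by simp
    show "expectation (\<lambda>\<omega>. (F (W i \<omega>))\<^sup>2) = s"
      using integral_distr[OF W[OF i] F2] integral_distr[OF W0 F2] ident[OF i] by (simp add: s_def)
  qed
  have lin: "integrable M (\<lambda>\<omega>. F (W i \<omega>))" "expectation (\<lambda>\<omega>. F (W i \<omega>)) = m" if i: "1 \<le> i" for i
  proof -
    show "integrable M (\<lambda>\<omega>. F (W i \<omega>))"
      using int0 integrable_distr_eq[OF W[OF i] F(1)] integrable_distr_eq[OF W0 F(1)] ident[OF i] by simp
    show "expectation (\<lambda>\<omega>. F (W i \<omega>)) = m"
      using integral_distr[OF W[OF i] F(1)] integral_distr[OF W0 F(1)] ident[OF i] by (simp add: m_def)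
  qed
  have indepF: "indep_vars (\<lambda>_. borel) (\<lambda>i \<omega>. F (W i \<omega>)) {1..}"
    using indep_vars_compose2[OF indep, of "\<lambda>_. F" "\<lambda>_. borel"] F(1) by simp
  have prd: "integrable M (\<lambda>\<omega>. F (W i \<omega>) * F (W j \<omega>))
      \<and> expectation (\<lambda>\<omega>. F (W i \<omega>) * F (W j \<omega>)) = (if i = j then s else m\<^sup>2)"
    if ij: "1 \<le> i" "1 \<le> j" for i j
  proof (cases "i = j")
    case True
    then show ?thesis using sq[OF ij(1)] by (simp add: power2_eq_square)
  next
    case False
    have I: "indep_vars (\<lambda>_. borel) (\<lambda>i \<omega>. F (W i \<omega>)) {i, j}"
      by (rule indep_vars_subset[OF indepF]) (use ij in auto)
    have "\<And>k. k \<in> {i, j} \<Longrightarrow> integrable M (\<lambda>\<omega>. F (W k \<omega>))" using lin ij by auto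
    then show ?thesis
      using indep_vars_lebesgue_integral[OF _ I] indep_vars_integrable[OF _ I] False lin(2) ij
      by (simp add: power2_eq_square)
  qed
  have eq: "(1 / real n * (\<Sum>i=1..n. F (W i \<omega>)))\<^sup>2
      = (1 / (real n)\<^sup>2) * (\<Sum>i=1..n. \<Sum>j=1..n. F (W i \<omega>) * F (W j \<omega>))" for \<omega>
    by (simp add: power2_eq_square sum_product)
  have int: "integrable M (\<lambda>\<omega>. (1 / (real n)\<^sup>2) * (\<Sum>i=1..n. \<Sum>j=1..n. F (W i \<omega>) * F (W j \<omega>)))"
    by (intro integrable_mult_right Bochner_Integration.integrable_sum) (use prd in auto)
  have "expectation (\<lambda>\<omega>. (1 / (real n)\<^sup>2) * (\<Sum>i=1..n. \<Sum>j=1..n. F (W i \<omega>) * F (W j \<omega>)))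
      = (1 / (real n)\<^sup>2) * (\<Sum>i=1..n. \<Sum>j=1..n. if i = j then s else m\<^sup>2)"
    using prd by (subst integral_mult_right_zero, subst Bochner_Integration.integral_sum)
      (auto intro!: Bochner_Integration.integrable_sum sum.cong simp: Bochner_Integration.integral_sum)
  \<comment> \<open>The squared mean is added on the diagonal as well, which only enlarges the
    double sum and makes it a complete square.\<close>
  also have "(\<Sum>i=1..n. \<Sum>j=1..n. if i = j then s else m\<^sup>2) \<le> (\<Sum>i=1..n. \<Sum>j=1..n. m\<^sup>2 + (if i = j then s else 0))"
    by (intro sum_mono) auto
  also have "\<dots> = (real n)\<^sup>2 * m\<^sup>2 + real n * s"
    by (simp add: sum.distrib power2_eq_square algebra_simps)
  finally have "expectation (\<lambda>\<omega>. (1 / (real n)\<^sup>2) * (\<Sum>i=1..n. \<Sum>j=1..n. F (W i \<omega>) * F (W j \<omega>)))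
      \<le> (1 / (real n)\<^sup>2) * ((real n)\<^sup>2 * m\<^sup>2 + real n * s)"
    by (simp add: divide_right_mono)
  also have "\<dots> = m\<^sup>2 + s / real n" using n by (simp add: field_simps power2_eq_square)
  finally have "expectation (\<lambda>\<omega>. (1 / real n * (\<Sum>i=1..n. F (W i \<omega>)))\<^sup>2) \<le> m\<^sup>2 + s / real n"
    unfolding eq .
  moreover have "integrable M (\<lambda>\<omega>. (1 / real n * (\<Sum>i=1..n. F (W i \<omega>)))\<^sup>2)" unfolding eq by (rule int)
  then have "(\<integral>\<^sup>+\<omega>. ennreal ((1 / real n * (\<Sum>i=1..n. F (W i \<omega>)))\<^sup>2) \<partial>M)
      = ennreal (expectation (\<lambda>\<omega>. (1 / real n * (\<Sum>i=1..n. F (W i \<omega>)))\<^sup>2))"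
    by (rule nn_integral_eq_integral) simp
  ultimately show ?thesis unfolding m_def s_def by (simp only: ennreal_leI)
qed

text \<open>Stated for extended values because it is applied to infinite series whose finiteness is
  part of the conclusion.\<close>

lemma markov_ennreal:
  assumes f: "f \<in> borel_measurable M" and le: "(\<integral>\<^sup>+\<omega>. f \<omega> \<partial>M) \<le> ennreal B" and B: "0 \<le> B" and c: "0 < c"
  shows "prob {\<omega> \<in> space M. f \<omega> \<le> ennreal c} \<ge> 1 - B / c"
proof -
  let ?A = "{\<omega> \<in> space M. f \<omega> \<le> ennreal c}"
  have A: "?A \<in> sets M" using f by measurable
  have "ennreal c * emeasure M (space M - ?A) = (\<integral>\<^sup>+\<omega>. ennreal c * indicator (space M - ?A) \<omega> \<partial>M)"
    using A by (subst nn_integral_cmult_indicator) auto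
  also have "\<dots> \<le> (\<integral>\<^sup>+\<omega>. f \<omega> \<partial>M)"
    by (intro nn_integral_mono) (auto simp: indicator_def not_le less_imp_le)
  also note le
  finally have "c * prob (space M - ?A) \<le> B"
    using c B by (simp add: emeasure_eq_measure flip: ennreal_mult)
  then show ?thesis using A c prob_compl[OF A] by (simp add: field_simps)
qed

lemma prob_Int_ge:
  assumes "A \<in> sets M" "B \<in> sets M" "prob A \<ge> 1 - a" "prob B \<ge> 1 - b"
  shows "prob (A \<inter> B) \<ge> 1 - (a + b)"
proof -
  have "prob (A \<union> B) = prob A + prob B - prob (A \<inter> B)" using assms by (simp add: measure_Un3 fmeasurable_eq_sets)
  moreover have "prob (A \<union> B) \<le> 1" by simp
  ultimately show ?thesis using assms by linarith
qed

end

lemma ennreal_suminf_le: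
  fixes f :: "nat \<Rightarrow> ennreal"
  assumes "\<And>N. (\<Sum>k<N. f k) \<le> B"
  shows "(\<Sum>k. f k) \<le> B"
  by (rule suminf_le_const[OF summableI assms])

lemma ennreal_partial_sum_le:
  assumes "(\<Sum>k. ennreal (f k)) \<le> ennreal B" "\<And>k. 0 \<le> f k" "0 \<le> B"
  shows "(\<Sum>k<N. f k) \<le> B"
proof -
  have "ennreal (\<Sum>k<N. f k) = (\<Sum>k<N. ennreal (f k))" using assms(2) by simp
  also have "\<dots> \<le> (\<Sum>k. ennreal (f k))" by (intro sum_le_suminf summableI) auto
  also note assms(1)
  finally show ?thesis using assms(3) by (simp add: ennreal_le_iff)
qed

text \<open>One family of row sums serves both bounds: the row weight is constant along a row and
  factors out. Each row is finite because the one-sided total is.\<close>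

lemma double_sum_control:
  fixes D :: "nat \<Rightarrow> nat \<Rightarrow> real"
  assumes w: "\<And>k. w k > 0" and c: "0 \<le> c1" "0 \<le> c2"
    and 1: "(\<Sum>j. \<Sum>k. ennreal ((D j k)\<^sup>2 / (w j * w k))) \<le> ennreal c1"
    and 2: "(\<Sum>j. \<Sum>k. ennreal ((D j k)\<^sup>2 / w k)) \<le> ennreal c2"
  shows "\<exists>R. (\<forall>j N. (\<Sum>k<N. (D j k)\<^sup>2 / w k) \<le> R j) \<and> (\<forall>N. (\<Sum>j<N. R j / w j) \<le> c1) \<and> (\<forall>N. (\<Sum>j<N. R j) \<le> c2)"
proof -
  define r where "r j = (\<Sum>k. ennreal ((D j k)\<^sup>2 / w k))" for j
  define R where "R j = enn2real (r j)" for j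
  have "r j \<le> (\<Sum>j. r j)" for j
    using sum_le_suminf[OF summableI, of "{j}" r] by simp
  also have "(\<Sum>j. r j) \<le> ennreal c2" using 2 by (simp add: r_def)
  finally have rfin: "r j < top" for j by (rule le_less_trans) simp
  then have rR: "r j = ennreal (R j)" for j by (simp add: R_def)
  have R0: "0 \<le> R j" for j by (simp add: R_def)
  have "(\<Sum>k. ennreal ((D j k)\<^sup>2 / (w j * w k))) = ennreal (R j / w j)" for j
  proof -
    have "(\<Sum>k. ennreal ((D j k)\<^sup>2 / (w j * w k))) = (\<Sum>k. ennreal (1 / w j) * ennreal ((D j k)\<^sup>2 / w k))"
      using w by (simp add: less_imp_le flip: ennreal_mult)
    also have "\<dots> = ennreal (1 / w j) * r j" unfolding r_def by (rule ennreal_suminf_cmult)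
    also have "\<dots> = ennreal (R j / w j)"
      using w[of j] R0[of j] by (simp add: rR less_imp_le flip: ennreal_mult)
    finally show ?thesis .
  qed
  then have "(\<Sum>j<N. R j / w j) \<le> c1" for N
    using 1 w R0 c by (intro ennreal_partial_sum_le) (auto simp: less_imp_le)
  moreover have "(\<Sum>j<N. R j) \<le> c2" for N
    using 2 R0 c by (intro ennreal_partial_sum_le) (auto simp: rR[symmetric] r_def)
  moreover have "(\<Sum>k<N. (D j k)\<^sup>2 / w k) \<le> R j" for j N
    using w R0 by (intro ennreal_partial_sum_le) (auto simp: rR[symmetric] r_def less_imp_le)
  ultimately show ?thesis by blast
qed

text \<open>Each matrix entry is a centred average with variance at most
  \<open>d * (a j * a k) / n\<close>. This product form lets the weighted double sums factor into
  \<open>Nl\<^sup>2\<close> for two-sided weights and \<open>tr * Nl\<close> for one-sided ones,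
  while the noise gives its squared mean plus \<open>d' * Nl / n\<close>. Three applications of
  Markov's inequality finish; the factor 4 comes from the threshold 1/4.\<close>

lemma (in prob_space) sampling_event:
  fixes W :: "nat \<Rightarrow> 'a \<Rightarrow> 'b" and z :: "nat \<Rightarrow> 'b \<Rightarrow> real" and y :: "'b \<Rightarrow> real"
  assumes indep: "indep_vars (\<lambda>_. N) W {1..}"
    and ident: "\<And>i. 1 \<le> i \<Longrightarrow> distr M N (W i) = distr M N W0" and W0: "W0 \<in> measurable M N"
    and z: "\<And>j. z j \<in> borel_measurable N" and y: "y \<in> borel_measurable N"
    and zz: "\<And>j k. integrable M (\<lambda>\<omega>. (z j (W0 \<omega>) * z k (W0 \<omega>))\<^sup>2)"
      "\<And>j k. expectation (\<lambda>\<omega>. (z j (W0 \<omega>) * z k (W0 \<omega>))\<^sup>2) \<le> d * (a j * a k)"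
      "\<And>j k. expectation (\<lambda>\<omega>. z j (W0 \<omega>) * z k (W0 \<omega>)) = (if j = k then a j else 0)"
    and yz: "\<And>j. integrable M (\<lambda>\<omega>. (y (W0 \<omega>) * z j (W0 \<omega>))\<^sup>2)"
      "\<And>j. expectation (\<lambda>\<omega>. (y (W0 \<omega>) * z j (W0 \<omega>))\<^sup>2) \<le> d' * a j"
    and n: "1 \<le> n" and a: "\<And>j. a j > 0" and l: "l > 0" and d: "d \<ge> 0" "d' \<ge> 0"
    and Nl: "\<And>m. (\<Sum>j<m. a j / (a j + l)) \<le> Nl" and tr: "\<And>m. (\<Sum>j<m. a j) \<le> tr"
    and bias: "\<And>m. (\<Sum>j<m. (expectation (\<lambda>\<omega>. y (W0 \<omega>) * z j (W0 \<omega>)))\<^sup>2 / (a j + l)) \<le> b"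
    and B2: "B2 > 0" and V: "V > 0"
  shows "\<exists>F\<in>sets M. prob F \<ge> 1 - (d * Nl\<^sup>2 / real n * 4 + d * Nl * tr / real n / B2 + (b + d' * Nl / real n) / V)
    \<and> (\<forall>\<omega>\<in>F.
       (\<exists>R. (\<forall>j m. (\<Sum>k<m. ((if j = k then a j else 0)
              - 1 / real n * (\<Sum>i=1..n. z j (W i \<omega>) * z k (W i \<omega>)))\<^sup>2 / (a k + l)) \<le> R j)
          \<and> (\<forall>m. (\<Sum>j<m. R j / (a j + l)) \<le> 1 / 4) \<and> (\<forall>m. (\<Sum>j<m. R j) \<le> B2))
       \<and> (\<forall>m. (\<Sum>j<m. (1 / real n * (\<Sum>i=1..n. y (W i \<omega>) * z j (W i \<omega>)))\<^sup>2 / (a j + l)) \<le> V))"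
proof -
  have W: "W i \<in> measurable M N" if "i \<in> {1..n}" for i
    using indep that by (auto simp: indep_vars_def)
  have al: "a j + l > 0" for j using a[of j] l by linarith
  define D where "D j k \<omega> = (if j = k then a j else 0)
      - 1 / real n * (\<Sum>i=1..n. z j (W i \<omega>) * z k (W i \<omega>))" for j k \<omega>
  define v where "v j \<omega> = 1 / real n * (\<Sum>i=1..n. y (W i \<omega>) * z j (W i \<omega>))" for j \<omega>
  have zW: "(\<lambda>\<omega>. z j (W i \<omega>)) \<in> borel_measurable M" "(\<lambda>\<omega>. y (W i \<omega>)) \<in> borel_measurable M"
    if "i \<in> {1..n}" for i j
    using W[OF that] z y by measurable
  have [measurable]: "D j k \<in> borel_measurable M" for j k
    unfolding D_def using zW by measurable
  have [measurable]: "v j \<in> borel_measurable M" for j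
    unfolding v_def using zW by measurable
  have Nl0: "0 \<le> Nl" using Nl[of 0] by simp
  have tr0: "0 \<le> tr" using tr[of 0] by simp
  have b0: "0 \<le> b" using bias[of 0] by simp
  have D2: "(\<integral>\<^sup>+\<omega>. ennreal ((D j k \<omega>)\<^sup>2) \<partial>M) \<le> ennreal (d * (a j * a k) / real n)" for j k
  proof -
    define F where "F p = (if j = k then a j else 0) - z j p * z k p" for p
    have Fm: "F \<in> borel_measurable N" unfolding F_def using z by measurable
    have zz1: "integrable M (\<lambda>\<omega>. z j (W0 \<omega>) * z k (W0 \<omega>))"
      by (rule square_integrable_imp_integrable[OF _ zz(1)]) (use z W0 in measurable)
    have Feq: "(F (W0 \<omega>))\<^sup>2 = (if j = k then a j else 0)\<^sup>2
        - 2 * (if j = k then a j else 0) * (z j (W0 \<omega>) * z k (W0 \<omega>)) + (z j (W0 \<omega>) * z k (W0 \<omega>))\<^sup>2" for \<omega>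
      by (simp add: F_def power2_eq_square algebra_simps)
    have F2: "integrable M (\<lambda>\<omega>. (F (W0 \<omega>))\<^sup>2)"
      unfolding Feq using zz1 zz(1)[of j k] by (intro Bochner_Integration.integrable_add Bochner_Integration.integrable_diff integrable_mult_right) auto
    have EF: "expectation (\<lambda>\<omega>. F (W0 \<omega>)) = 0"
      unfolding F_def using zz1 zz(3)[of j k] by (simp add: Bochner_Integration.integral_diff prob_space)
    have "expectation (\<lambda>\<omega>. (F (W0 \<omega>))\<^sup>2) = (if j = k then a j else 0)\<^sup>2
        - 2 * (if j = k then a j else 0) * (if j = k then a j else 0) + expectation (\<lambda>\<omega>. (z j (W0 \<omega>) * z k (W0 \<omega>))\<^sup>2)"
      unfolding Feq using zz1 zz(1)[of j k] zz(3)[of j k]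
      by (simp add: Bochner_Integration.integral_diff Bochner_Integration.integral_add prob_space)
    \<comment> \<open>Centring can only lower the second moment: the diagonal corrections add up to
      minus a square.\<close>
    also have "\<dots> \<le> d * (a j * a k)"
    proof -
      have "(if j = k then a j else 0)\<^sup>2 - 2 * (if j = k then a j else 0) * (if j = k then a j else 0) \<le> 0"
        by (auto simp: power2_eq_square)
      then show ?thesis using zz(2)[of j k] by linarith
    qed
    finally have EF2: "expectation (\<lambda>\<omega>. (F (W0 \<omega>))\<^sup>2) \<le> d * (a j * a k)" .
    have DF: "D j k \<omega> = 1 / real n * (\<Sum>i=1..n. F (W i \<omega>))" for \<omega>
      using n by (simp add: D_def F_def sum_subtractf field_simps)
    have "(\<integral>\<^sup>+\<omega>. ennreal ((D j k \<omega>)\<^sup>2) \<partial>M)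
        \<le> ennreal ((expectation (\<lambda>\<omega>. F (W0 \<omega>)))\<^sup>2 + expectation (\<lambda>\<omega>. (F (W0 \<omega>))\<^sup>2) / real n)"
      unfolding DF by (rule iid_average_second_moment[OF indep ident W0 Fm F2 n])
    also have "\<dots> \<le> ennreal (d * (a j * a k) / real n)"
      unfolding EF by (intro ennreal_leI) (simp add: divide_right_mono EF2)
    finally show ?thesis .
  qed
  have v2: "(\<integral>\<^sup>+\<omega>. ennreal ((v j \<omega>)\<^sup>2) \<partial>M)
      \<le> ennreal ((expectation (\<lambda>\<omega>. y (W0 \<omega>) * z j (W0 \<omega>)))\<^sup>2 + d' * a j / real n)" for j
  proof -
    have "(\<integral>\<^sup>+\<omega>. ennreal ((v j \<omega>)\<^sup>2) \<partial>M) \<le> ennreal ((expectation (\<lambda>\<omega>. y (W0 \<omega>) * z j (W0 \<omega>)))\<^sup>2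
        + expectation (\<lambda>\<omega>. (y (W0 \<omega>) * z j (W0 \<omega>))\<^sup>2) / real n)"
      unfolding v_def
      by (rule iid_average_second_moment[OF indep ident W0 _ yz(1) n]) (use y z in measurable)
    also have "\<dots> \<le> ennreal ((expectation (\<lambda>\<omega>. y (W0 \<omega>) * z j (W0 \<omega>)))\<^sup>2 + d' * a j / real n)"
      by (intro ennreal_leI add_left_mono divide_right_mono yz) simp
    finally show ?thesis .
  qed
  define S1 where "S1 \<omega> = (\<Sum>j. \<Sum>k. ennreal ((D j k \<omega>)\<^sup>2 / ((a j + l) * (a k + l))))" for \<omega>
  define S2 where "S2 \<omega> = (\<Sum>j. \<Sum>k. ennreal ((D j k \<omega>)\<^sup>2 / (a k + l)))" for \<omega>
  define S3 where "S3 \<omega> = (\<Sum>j. ennreal ((v j \<omega>)\<^sup>2 / (a j + l)))" for \<omega>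
  have S_meas [measurable]: "S1 \<in> borel_measurable M" "S2 \<in> borel_measurable M" "S3 \<in> borel_measurable M"
    unfolding S1_def S2_def S3_def by measurable
  have scale: "(\<integral>\<^sup>+\<omega>. ennreal ((g \<omega>)\<^sup>2 / w) \<partial>M) \<le> ennreal (B / w)"
    if "(\<integral>\<^sup>+\<omega>. ennreal ((g \<omega>)\<^sup>2) \<partial>M) \<le> ennreal B" "g \<in> borel_measurable M" "w > 0" "0 \<le> B" for g :: "'a \<Rightarrow> real" and B w
  proof -
    have "(\<integral>\<^sup>+\<omega>. ennreal ((g \<omega>)\<^sup>2 / w) \<partial>M) = (\<integral>\<^sup>+\<omega>. ennreal (1 / w) * ennreal ((g \<omega>)\<^sup>2) \<partial>M)"
      using that by (simp add: less_imp_le flip: ennreal_mult)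
    also have "\<dots> = ennreal (1 / w) * (\<integral>\<^sup>+\<omega>. ennreal ((g \<omega>)\<^sup>2) \<partial>M)"
      using that(2) by (intro nn_integral_cmult) measurable
    also have "\<dots> \<le> ennreal (1 / w) * ennreal B" by (intro mult_left_mono that) simp
    also have "\<dots> = ennreal (B / w)" using that by (simp add: less_imp_le flip: ennreal_mult)
    finally show ?thesis .
  qed
  \<comment> \<open>Both weightings are instances: all that is used of \<open>u\<close> is that a_j
    a_k / u_jk splits into a factor in j and a factor in k.\<close>
  have dbl: "(\<integral>\<^sup>+\<omega>. (\<Sum>j. \<Sum>k. ennreal ((D j k \<omega>)\<^sup>2 / u j k)) \<partial>M) \<le> ennreal (d / real n * (P * Q))"
    if u: "\<And>j k. u j k > 0" and pq: "\<And>j k. a j * a k / u j k = p j * q k" "\<And>j. 0 \<le> p j" "\<And>j. 0 \<le> q j"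
      and P: "\<And>m. (\<Sum>j<m. p j) \<le> P" and Q: "\<And>m. (\<Sum>j<m. q j) \<le> Q" for u p q P Q
  proof -
    have P0: "0 \<le> P" using P[of 0] by simp
    have Q0: "0 \<le> Q" using Q[of 0] by simp
    have "(\<integral>\<^sup>+\<omega>. (\<Sum>j. \<Sum>k. ennreal ((D j k \<omega>)\<^sup>2 / u j k)) \<partial>M)
        = (\<Sum>j. \<Sum>k. \<integral>\<^sup>+\<omega>. ennreal ((D j k \<omega>)\<^sup>2 / u j k) \<partial>M)"
      by (simp add: nn_integral_suminf)
    also have "\<dots> \<le> (\<Sum>j. \<Sum>k. ennreal (d / real n * (p j * q k)))"
    proof (intro suminf_le summableI)
      fix j k
      have "(\<integral>\<^sup>+\<omega>. ennreal ((D j k \<omega>)\<^sup>2 / u j k) \<partial>M) \<le> ennreal (d * (a j * a k) / real n / u j k)"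
        using a d by (intro scale D2 u) (auto simp: less_imp_le)
      also have "d * (a j * a k) / real n / u j k = d / real n * (p j * q k)"
        by (simp add: pq(1)[of j k, symmetric])
      finally show "(\<integral>\<^sup>+\<omega>. ennreal ((D j k \<omega>)\<^sup>2 / u j k) \<partial>M) \<le> ennreal (d / real n * (p j * q k))" .
    qed
    also have "\<dots> \<le> (\<Sum>j. ennreal (d / real n * (p j * Q)))"
    proof (intro suminf_le summableI ennreal_suminf_le)
      fix j m
      have "(\<Sum>k<m. ennreal (d / real n * (p j * q k))) = ennreal (d / real n * (p j * (\<Sum>k<m. q k)))"
        using d pq by (subst sum_ennreal) (auto simp: sum_distrib_left)
      also have "\<dots> \<le> ennreal (d / real n * (p j * Q))"
        using d pq Q by (intro ennreal_leI mult_left_mono) auto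
      finally show "(\<Sum>k<m. ennreal (d / real n * (p j * q k))) \<le> ennreal (d / real n * (p j * Q))" .
    qed
    also have "\<dots> \<le> ennreal (d / real n * (P * Q))"
    proof (rule ennreal_suminf_le)
      fix m
      have "(\<Sum>j<m. ennreal (d / real n * (p j * Q))) = ennreal (d / real n * ((\<Sum>j<m. p j) * Q))"
        using d pq Q0 by (subst sum_ennreal) (auto simp: sum_distrib_left sum_distrib_right)
      also have "\<dots> \<le> ennreal (d / real n * (P * Q))"
        using d Q0 P by (intro ennreal_leI mult_left_mono mult_right_mono) auto
      finally show "(\<Sum>j<m. ennreal (d / real n * (p j * Q))) \<le> ennreal (d / real n * (P * Q))" .
    qed
    finally show ?thesis .
  qed
  have E1: "(\<integral>\<^sup>+\<omega>. S1 \<omega> \<partial>M) \<le> ennreal (d / real n * (Nl * Nl))"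
    unfolding S1_def
    by (rule dbl[of "\<lambda>j k. (a j + l) * (a k + l)" "\<lambda>j. a j / (a j + l)" "\<lambda>k. a k / (a k + l)"])
      (use al a Nl in \<open>auto simp: less_imp_le\<close>)
  have E2: "(\<integral>\<^sup>+\<omega>. S2 \<omega> \<partial>M) \<le> ennreal (d / real n * (tr * Nl))"
    unfolding S2_def
    by (rule dbl[of "\<lambda>j k. a k + l" "\<lambda>j. a j" "\<lambda>k. a k / (a k + l)"])
      (use al a Nl tr in \<open>auto simp: less_imp_le\<close>)
  have E3: "(\<integral>\<^sup>+\<omega>. S3 \<omega> \<partial>M) \<le> ennreal (b + d' * Nl / real n)"
  proof -
    define c where "c j = (expectation (\<lambda>\<omega>. y (W0 \<omega>) * z j (W0 \<omega>)))\<^sup>2" for j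
    have "(\<integral>\<^sup>+\<omega>. S3 \<omega> \<partial>M) = (\<Sum>j. \<integral>\<^sup>+\<omega>. ennreal ((v j \<omega>)\<^sup>2 / (a j + l)) \<partial>M)"
      unfolding S3_def by (simp add: nn_integral_suminf)
    also have "\<dots> \<le> (\<Sum>j. ennreal ((c j + d' * a j / real n) / (a j + l)))"
    proof (intro suminf_le summableI scale al)
      show "(\<integral>\<^sup>+\<omega>. ennreal ((v j \<omega>)\<^sup>2) \<partial>M) \<le> ennreal (c j + d' * a j / real n)" for j
        unfolding c_def by (rule v2)
      show "0 \<le> c j + d' * a j / real n" for j using d a[of j] by (auto simp: c_def less_imp_le)
    qed simp
    also have "\<dots> \<le> ennreal (b + d' * Nl / real n)"
    proof (rule ennreal_suminf_le)
      fix m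
      have "(\<Sum>j<m. ennreal ((c j + d' * a j / real n) / (a j + l)))
          = ennreal ((\<Sum>j<m. c j / (a j + l)) + d' / real n * (\<Sum>j<m. a j / (a j + l)))"
        using d a al
        by (subst sum_ennreal)
          (auto simp: add_divide_distrib sum.distrib sum_distrib_left c_def less_imp_le)
      also have "\<dots> \<le> ennreal (b + d' / real n * Nl)"
        using d bias Nl by (intro ennreal_leI add_mono mult_left_mono) (auto simp: c_def)
      finally show "(\<Sum>j<m. ennreal ((c j + d' * a j / real n) / (a j + l))) \<le> ennreal (b + d' * Nl / real n)"
        by simp
    qed
    finally show ?thesis .
  qed
  define F1 where "F1 = {\<omega> \<in> space M. S1 \<omega> \<le> ennreal (1/4)}"
  define F2 where "F2 = {\<omega> \<in> space M. S2 \<omega> \<le> ennreal B2}"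
  define F3 where "F3 = {\<omega> \<in> space M. S3 \<omega> \<le> ennreal V}"
  have sets: "F1 \<in> sets M" "F2 \<in> sets M" "F3 \<in> sets M"
    unfolding F1_def F2_def F3_def by measurable
  have "prob F1 \<ge> 1 - d / real n * (Nl * Nl) / (1/4)"
    unfolding F1_def using d Nl0 by (intro markov_ennreal E1) auto
  moreover have "prob F2 \<ge> 1 - d / real n * (tr * Nl) / B2"
    unfolding F2_def using d Nl0 tr0 B2 by (intro markov_ennreal E2) auto
  moreover have "prob F3 \<ge> 1 - (b + d' * Nl / real n) / V"
    unfolding F3_def using d Nl0 b0 V by (intro markov_ennreal E3) auto
  ultimately have "prob (F1 \<inter> F2 \<inter> F3)
      \<ge> 1 - (d / real n * (Nl * Nl) / (1/4) + d / real n * (tr * Nl) / B2 + (b + d' * Nl / real n) / V)"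
    using sets by (intro prob_Int_ge) auto
  moreover have "\<exists>R. (\<forall>j m. (\<Sum>k<m. (D j k \<omega>)\<^sup>2 / (a k + l)) \<le> R j)
      \<and> (\<forall>m. (\<Sum>j<m. R j / (a j + l)) \<le> 1 / 4) \<and> (\<forall>m. (\<Sum>j<m. R j) \<le> B2)" if "\<omega> \<in> F1 \<inter> F2 \<inter> F3" for \<omega>
    using that B2 by (intro double_sum_control al) (auto simp: F1_def F2_def S1_def S2_def)
  moreover have "(\<Sum>j<m. (v j \<omega>)\<^sup>2 / (a j + l)) \<le> V" if "\<omega> \<in> F1 \<inter> F2 \<inter> F3" for \<omega> m
    using that V al by (intro ennreal_partial_sum_le) (auto simp: F3_def S3_def less_imp_le)
  ultimately show ?thesis
    using sets unfolding D_def v_def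
    by (intro bexI[of _ "F1 \<inter> F2 \<inter> F3"] conjI ballI) (auto simp: power2_eq_square mult_ac)
qed

section \<open>The inclusion operator of a reproducing kernel Hilbert space\<close>

lemma rep_L2_add: "AE x in lborel. rep_L2 (f + g) x = rep_L2 f x + rep_L2 g x"
proof -
  have "f + g = abs_L2 (\<lambda>x. rep_L2 f x + rep_L2 g x)"
    using abs_L2_add[OF square_integrable_rep_L2[of f] square_integrable_rep_L2[of g]] by (simp add: abs_rep_L2)
  then show ?thesis
    using rep_abs_L2[OF square_integrable_add[OF square_integrable_rep_L2[of f] square_integrable_rep_L2[of g]]]
    by simp
qed

lemma rep_L2_scaleR: "AE x in lborel. rep_L2 (c *\<^sub>R f) x = c * rep_L2 f x"
proof -
  have "c *\<^sub>R f = abs_L2 (\<lambda>x. c * rep_L2 f x)"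
    using abs_L2_scale[OF square_integrable_rep_L2[of f], of c] by (simp add: abs_rep_L2)
  then show ?thesis
    using rep_abs_L2[OF square_integrable_scale[OF square_integrable_rep_L2[of f]], of c] by simp
qed

lemma L2_on_add: "f \<in> L2_on S \<Longrightarrow> g \<in> L2_on S \<Longrightarrow> f + g \<in> L2_on S"
proof -
  assume "f \<in> L2_on S" "g \<in> L2_on S"
  then have "AE x in lborel. x \<notin> S \<longrightarrow> rep_L2 f x = 0" "AE x in lborel. x \<notin> S \<longrightarrow> rep_L2 g x = 0"
    by (auto simp: L2_on_def)
  then have "AE x in lborel. x \<notin> S \<longrightarrow> rep_L2 (f + g) x = 0"
    using rep_L2_add[of f g] by eventually_elim simp
  then show ?thesis by (simp add: L2_on_def)
qed

lemma L2_on_scaleR: "f \<in> L2_on S \<Longrightarrow> c *\<^sub>R f \<in> L2_on S"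
proof -
  assume "f \<in> L2_on S"
  then have "AE x in lborel. x \<notin> S \<longrightarrow> rep_L2 f x = 0" by (auto simp: L2_on_def)
  then have "AE x in lborel. x \<notin> S \<longrightarrow> rep_L2 (c *\<^sub>R f) x = 0"
    using rep_L2_scaleR[of c f] by eventually_elim simp
  then show ?thesis by (simp add: L2_on_def)
qed

lemma L2_on_diff: "f \<in> L2_on S \<Longrightarrow> g \<in> L2_on S \<Longrightarrow> f - g \<in> L2_on S"
  using L2_on_add[of f S "(-1) *\<^sub>R g"] L2_on_scaleR[of g S "-1"] by simp

locale compact_RKHS =
  fixes S :: "'a::euclidean_space set" and k :: "'a \<Rightarrow> 'a \<Rightarrow> real" and \<kappa> :: real
    and evalf :: "'h::{real_inner, banach} \<Rightarrow> 'a \<Rightarrow> real"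
  assumes compact_S: "compact S" and kernel: "bounded_pd_kernel S k \<kappa>" and RKHS: "is_RKHS S k evalf"
begin

abbreviation "J \<equiv> RKHS_inclusion S evalf"

lemma evalf_add: "x \<in> S \<Longrightarrow> evalf (f + g) x = evalf f x + evalf g x"
  and evalf_scaleR: "x \<in> S \<Longrightarrow> evalf (c *\<^sub>R f) x = c * evalf f x"
  and evalf_eq_0: "(\<And>x. x \<in> S \<Longrightarrow> evalf f x = 0) \<Longrightarrow> f = 0"
  using RKHS unfolding is_RKHS_def by blast+

definition "sec = (SOME K. \<forall>x\<in>S. (\<forall>y\<in>S. evalf (K x) y = k y x) \<and> (\<forall>f. inner f (K x) = evalf f x))"

lemma evalf_sec: "x \<in> S \<Longrightarrow> y \<in> S \<Longrightarrow> evalf (sec x) y = k y x"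
  and inner_sec: "x \<in> S \<Longrightarrow> inner f (sec x) = evalf f x"
proof -
  have "\<forall>x\<in>S. \<exists>K. (\<forall>y\<in>S. evalf K y = k y x) \<and> (\<forall>f. inner f K = evalf f x)"
    using RKHS unfolding is_RKHS_def by blast
  then have "\<exists>K. \<forall>x\<in>S. (\<forall>y\<in>S. evalf (K x) y = k y x) \<and> (\<forall>f. inner f (K x) = evalf f x)"
    by (rule bchoice)
  from someI_ex[OF this]
  show "x \<in> S \<Longrightarrow> y \<in> S \<Longrightarrow> evalf (sec x) y = k y x" "x \<in> S \<Longrightarrow> inner f (sec x) = evalf f x"
    unfolding sec_def by blast+
qed

text \<open>A vector orthogonal to every kernel section has all its point values equal to 0, hence
  vanishes.\<close>

lemma closure_span_sec: "closure (span (sec ` S)) = UNIV"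
proof -
  define V where "V = closure (span (sec ` S))"
  have V: "closed V" by (simp add: V_def)
  have "subspace V"
  proof (rule subspaceI)
    show "0 \<in> V" unfolding V_def using closure_subset span_0 by blast
  next
    fix f g assume "f \<in> V" "g \<in> V"
    then obtain F G where "\<And>n::nat. F n \<in> span (sec ` S)" "F \<longlonglongrightarrow> f" "\<And>n::nat. G n \<in> span (sec ` S)" "G \<longlonglongrightarrow> g"
      unfolding V_def closure_sequential by blast
    then show "f + g \<in> V"
      unfolding V_def closure_sequential
      by (intro exI[of _ "\<lambda>n. F n + G n"]) (auto intro: span_add tendsto_add)
  next
    fix c f assume "f \<in> V"
    then obtain F where "\<And>n::nat. F n \<in> span (sec ` S)" "F \<longlonglongrightarrow> f"
      unfolding V_def closure_sequential by blast
    then show "c *\<^sub>R f \<in> V"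
      unfolding V_def closure_sequential
      by (intro exI[of _ "\<lambda>n. c *\<^sub>R F n"]) (auto intro: span_scale tendsto_scaleR)
  qed
  note V = V this
  have "f \<in> V" for f
  proof -
    obtain p where p: "p \<in> V" "\<And>v. v \<in> V \<Longrightarrow> inner (f - p) v = 0" using projection_exists[OF V] by blast
    have "f - p = 0"
    proof (rule evalf_eq_0)
      fix x assume x: "x \<in> S"
      then have "sec x \<in> V" unfolding V_def by (intro set_mp[OF closure_subset] span_base) auto
      then show "evalf (f - p) x = 0" using p(2) inner_sec[OF x] by metis
    qed
    then show ?thesis using p(1) by simp
  qed
  then show ?thesis by (auto simp: V_def)
qed

lemma S_borel: "S \<in> sets borel"
  using compact_S by (simp add: borel_compact)

text \<open>Sections inherit measurability from joint measurability of the kernel, linear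
  combinations keep it, and norm limits are pointwise limits because evaluation is an inner product.
  Density of the sections covers every element.\<close>

lemma evalf_measurable: "(\<lambda>x. indicator S x * evalf f x) \<in> borel_measurable borel"
proof -
  define Q where "Q = {f. (\<lambda>x. indicator S x * evalf f x) \<in> borel_measurable borel}"
  have S2: "S \<times> S \<in> sets borel"
    using compact_Times[OF compact_S compact_S] by (simp add: borel_compact)
  have kk: "(\<lambda>p. indicator (S \<times> S) p *\<^sub>R (case p of (x, y) \<Rightarrow> k x y)) \<in> borel_measurable borel"
    using kernel S2 unfolding bounded_pd_kernel_def
    by (subst borel_measurable_restrict_space_iff[symmetric]) auto
  have secQ: "sec x \<in> Q" if x: "x \<in> S" for x
  proof -
    have "(\<lambda>y. (y, x)) \<in> borel \<rightarrow>\<^sub>M borel"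
      by (intro borel_measurable_continuous_onI continuous_intros)
    from measurable_compose[OF this kk]
    have "(\<lambda>y. indicator (S \<times> S) (y, x) * k y x) \<in> borel_measurable borel" by simp
    also have "(\<lambda>y. indicator (S \<times> S) (y, x) * k y x) = (\<lambda>y. indicator S y * evalf (sec x) y)"
      using x by (auto simp: fun_eq_iff indicator_def evalf_sec)
    finally show ?thesis by (simp add: Q_def)
  qed
  have add: "f + g \<in> Q" if "f \<in> Q" "g \<in> Q" for f g
  proof -
    have "(\<lambda>x. indicator S x * evalf (f + g) x) = (\<lambda>x. indicator S x * evalf f x + indicator S x * evalf g x)"
      by (auto simp: fun_eq_iff indicator_def evalf_add)
    then show ?thesis using that by (simp add: Q_def)
  qed
  have scale: "c *\<^sub>R f \<in> Q" if "f \<in> Q" for c f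
  proof -
    have "(\<lambda>x. indicator S x * evalf (c *\<^sub>R f) x) = (\<lambda>x. c * (indicator S x * evalf f x))"
      by (auto simp: fun_eq_iff indicator_def evalf_scaleR)
    then show ?thesis using that by (simp add: Q_def)
  qed
  have zero: "0 \<in> Q"
  proof -
    have "indicator S x * evalf 0 x = 0" for x
      using evalf_scaleR[of x 0 0] by (auto simp: indicator_def)
    then have "(\<lambda>x. indicator S x * evalf 0 x) = (\<lambda>x. 0)" by blast
    then show ?thesis by (simp add: Q_def)
  qed
  have "subspace Q" using add scale zero by (intro subspaceI)
  then have "span (sec ` S) \<subseteq> Q" using secQ by (intro span_minimal) auto
  moreover obtain F where F: "\<And>n::nat. F n \<in> span (sec ` S)" "F \<longlonglongrightarrow> f"
    using closure_span_sec unfolding closure_sequential[of f, THEN iffD1] by (metis UNIV_I closure_sequential)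
  ultimately have FQ: "(\<lambda>x. indicator S x * evalf (F n) x) \<in> borel_measurable borel" for n
    by (auto simp: Q_def)
  show ?thesis
  proof (rule borel_measurable_LIMSEQ_real[OF _ FQ])
    fix x
    show "(\<lambda>n. indicator S x * evalf (F n) x) \<longlonglongrightarrow> indicator S x * evalf f x"
    proof (cases "x \<in> S")
      case True
      have "(\<lambda>n. inner (F n) (sec x)) \<longlonglongrightarrow> inner f (sec x)" by (intro tendsto_intros F)
      then show ?thesis using True by (simp add: inner_sec)
    qed simp
  qed
qed

text \<open>Cauchy-Schwarz against the section at \<open>x\<close>, whose squared norm is
  \<open>k x x\<close> by the reproducing property.\<close>

lemma evalf_bound:
  assumes "x \<in> S"
  shows "(evalf f x)\<^sup>2 \<le> \<kappa> * (norm f)\<^sup>2"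
proof -
  have "(norm (sec x))\<^sup>2 = k x x"
    using assms by (simp add: power2_norm_eq_inner inner_sec evalf_sec)
  also have "\<dots> \<le> \<kappa>" using kernel assms unfolding bounded_pd_kernel_def by blast
  finally have "(norm (sec x))\<^sup>2 * (norm f)\<^sup>2 \<le> \<kappa> * (norm f)\<^sup>2" by (intro mult_right_mono) auto
  moreover have "(evalf f x)\<^sup>2 \<le> (norm f * norm (sec x))\<^sup>2"
    unfolding inner_sec[OF assms, symmetric] by (rule abs_le_square_iff[THEN iffD1]) (simp add: Cauchy_Schwarz_ineq2)
  ultimately show ?thesis by (simp add: power_mult_distrib mult.commute)
qed

lemma emeasure_S: "emeasure lborel S < \<infinity>"
  using emeasure_compact_finite[OF compact_S] .

lemma indicator_evalf_le: "(indicator S x * evalf f x)\<^sup>2 \<le> \<kappa> * (norm f)\<^sup>2 * indicator S x"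
  using evalf_bound[of x f] by (auto simp: indicator_def)

lemma square_integrable_evalf: "square_integrable (\<lambda>x. indicator S x * evalf f x)"
  unfolding square_integrable_def
proof
  show "integrable lborel (\<lambda>x. (indicator S x * evalf f x)\<^sup>2)"
  proof (rule Bochner_Integration.integrable_bound)
    show "integrable lborel (\<lambda>x. \<kappa> * (norm f)\<^sup>2 * indicator S x :: real)"
      using emeasure_S S_borel by (intro integrable_mult_right integrable_real_indicator) auto
    show "AE x in lborel. norm ((indicator S x * evalf f x)\<^sup>2) \<le> norm (\<kappa> * (norm f)\<^sup>2 * indicator S x)"
      using indicator_evalf_le[of _ f] by (intro AE_I2) (simp add: order_trans[OF _ abs_ge_self])
    show "(\<lambda>x. (indicator S x * evalf f x)\<^sup>2) \<in> borel_measurable lborel"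
      using evalf_measurable[of f] by measurable
  qed
qed (use evalf_measurable in simp)

lemma J_mem: "J f \<in> L2_on S"
  unfolding L2_on_def mem_Collect_eq RKHS_inclusion_def
  using rep_abs_L2[OF square_integrable_evalf[of f]] by (elim AE_mp) auto

lemma bounded_linear_J: "bounded_linear J"
proof (rule bounded_linear_intro)
  show "J (f + g) = J f + J g" for f g
    unfolding RKHS_inclusion_def abs_L2_add[OF square_integrable_evalf square_integrable_evalf]
    by (rule arg_cong[where f = abs_L2]) (auto simp: fun_eq_iff indicator_def evalf_add)
  show "J (c *\<^sub>R f) = c *\<^sub>R J f" for c f
    unfolding RKHS_inclusion_def abs_L2_scale[OF square_integrable_evalf]
    by (rule arg_cong[where f = abs_L2]) (auto simp: fun_eq_iff indicator_def evalf_scaleR)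
  show "norm (J f) \<le> norm f * sqrt (\<kappa> * measure lborel S)" for f
  proof -
    have "(norm (J f))\<^sup>2 = (LINT x|lborel. (indicator S x * evalf f x)\<^sup>2)"
      unfolding RKHS_inclusion_def by (rule power2_norm_abs_L2[OF square_integrable_evalf])
    also have "\<dots> \<le> (LINT x|lborel. \<kappa> * (norm f)\<^sup>2 * indicator S x)"
      using square_integrable_evalf[of f] emeasure_S S_borel
      by (intro integral_mono indicator_evalf_le integrable_mult_right integrable_real_indicator)
        (auto simp: square_integrable_def)
    also have "\<dots> = (norm f)\<^sup>2 * (\<kappa> * measure lborel S)" by simp
    finally have "sqrt ((norm (J f))\<^sup>2) \<le> sqrt ((norm f)\<^sup>2 * (\<kappa> * measure lborel S))"
      by (rule real_sqrt_le_mono)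
    then show ?thesis by (simp add: real_sqrt_mult)
  qed
qed

end

section \<open>Eigenfunctions\<close>

text \<open>Eigenpairs are numbered from 1 and their eigenfunctions have arbitrary norm; from here
  on indices start at 0 and norms are 1.\<close>

definition normalized :: "(nat \<Rightarrow> 'v::real_normed_vector) \<Rightarrow> nat \<Rightarrow> 'v" where
  "normalized \<phi> j = (1 / norm (\<phi> (Suc j))) *\<^sub>R \<phi> (Suc j)"

lemma simple_eigenpairs_orthonormal:
  fixes T :: "'v::real_inner \<Rightarrow> 'v"
  assumes sym: "\<And>x y. inner (T x) y = inner x (T y)" and ep: "simple_eigenpairs T \<mu> \<phi>"
  defines "\<psi> \<equiv> normalized \<phi>"
  shows "orthonormal \<psi>" "inj (\<lambda>j. \<mu> (Suc j))"
    "eigenspace T (\<mu> (Suc j)) = span {\<psi> j}"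
    "s \<noteq> 0 \<Longrightarrow> eigenspace T s \<noteq> {0} \<Longrightarrow> s \<in> range (\<lambda>j. \<mu> (Suc j))"
proof -
  have \<phi>: "\<phi> (Suc j) \<noteq> 0" "eigenspace T (\<mu> (Suc j)) = span {\<phi> (Suc j)}" for j
    using ep by (auto simp: simple_eigenpairs_def)
  have "inj_on \<mu> {1..}" using ep by (simp add: simple_eigenpairs_def)
  then show inj: "inj (\<lambda>j. \<mu> (Suc j))" by (auto simp: inj_def dest: inj_onD)
  show "eigenspace T (\<mu> (Suc j)) = span {\<psi> j}" for j
  proof -
    have "\<phi> (Suc j) = norm (\<phi> (Suc j)) *\<^sub>R \<psi> j" using \<phi>(1)[of j] by (simp add: \<psi>_def normalized_def)
    then have "\<phi> (Suc j) \<in> span {\<psi> j}" by (metis insertI1 span_base span_scale)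
    moreover have "\<psi> j \<in> span {\<phi> (Suc j)}" unfolding \<psi>_def normalized_def by (intro span_scale span_base) simp
    ultimately show ?thesis unfolding \<phi>(2) span_eq by simp
  qed
  then have eig: "\<psi> j \<in> eigenspace T (\<mu> (Suc j))" for j by (simp add: span_base)
  show "orthonormal \<psi>"
    unfolding orthonormal_def
  proof (intro allI)
    fix i j
    show "inner (\<psi> i) (\<psi> j) = (if i = j then 1 else 0)"
    proof (cases "i = j")
      case True
      then show ?thesis using \<phi>(1)[of j] by (simp add: \<psi>_def normalized_def flip: power2_norm_eq_inner)
    next
      case False
      then show ?thesis
        using eigenspaces_orthogonal[OF sym eig eig, of i j] inj by (auto simp: inj_def)
    qed
  qed
  show "s \<in> range (\<lambda>j. \<mu> (Suc j))" if "s \<noteq> 0" "eigenspace T s \<noteq> {0}"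
  proof -
    have "s \<in> \<mu> ` {1..}" using ep that unfolding simple_eigenpairs_def by blast
    then obtain i where "i \<ge> 1" "s = \<mu> i" by auto
    then show ?thesis by (intro image_eqI[of _ _ "i - 1"]) auto
  qed
qed

text \<open>The functional calculus sums over an unordered set of eigenvalues. By Pythagoras any
  finite set containing a long initial segment leaves a remainder no larger than that segment does,
  so ordered convergence is unconditional.\<close>

lemma orthonormal_has_sum:
  assumes e: "orthonormal e" and x: "(\<lambda>j. c j *\<^sub>R e j) sums x"
  shows "((\<lambda>j. c j *\<^sub>R e j) has_sum x) UNIV"
  unfolding has_sum_def
proof (rule tendstoI)
  fix r :: real assume "r > 0"
  note c = sums_inner_orthonormal[OF e x]
  have "(\<lambda>n. \<Sum>j<n. inner x (e j) * inner (e j) x) \<longlonglongrightarrow> (norm x)\<^sup>2"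
    using sums_imp_expands[OF e x] unfolding expands_def sums_def power2_norm_eq_inner by blast
  then have "(\<lambda>n. \<Sum>j<n. (c j)\<^sup>2) \<longlonglongrightarrow> (norm x)\<^sup>2"
    by (simp add: inner_commute[of "e _" x] c power2_eq_square)
  then have "\<forall>\<^sub>F n in sequentially. dist (\<Sum>j<n. (c j)\<^sup>2) ((norm x)\<^sup>2) < r\<^sup>2"
    using \<open>r > 0\<close> by (intro tendstoD) auto
  then obtain n where "dist (\<Sum>j<n. (c j)\<^sup>2) ((norm x)\<^sup>2) < r\<^sup>2"
    by (meson eventually_sequentially order_refl)
  then have n: "(norm x)\<^sup>2 - (\<Sum>j<n. (c j)\<^sup>2) < r\<^sup>2" by (simp add: dist_real_def abs_if split: if_splits)
  have "dist (\<Sum>j\<in>Y. c j *\<^sub>R e j) x < r" if Y: "finite Y" "{..<n} \<subseteq> Y" for Y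
  proof -
    have "(norm (x - (\<Sum>j\<in>Y. c j *\<^sub>R e j)))\<^sup>2 = (norm x)\<^sup>2 - (\<Sum>j\<in>Y. (c j)\<^sup>2)"
      using norm_diff_orthonormal_sum[OF e Y(1), of x] by (simp add: c)
    also have "\<dots> \<le> (norm x)\<^sup>2 - (\<Sum>j<n. (c j)\<^sup>2)"
      using sum_mono2[OF Y, of "\<lambda>j. (c j)\<^sup>2"] by simp
    also note n
    finally show ?thesis using \<open>r > 0\<close> by (simp add: dist_norm norm_minus_commute power2_less_imp_less)
  qed
  then show "\<forall>\<^sub>F Y in finite_subsets_at_top UNIV. dist (\<Sum>j\<in>Y. c j *\<^sub>R e j) x < r"
    unfolding eventually_finite_subsets_at_top by (intro exI[of _ "{..<n}"]) auto
qed

lemma functional_calculus_powr_sums: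
  fixes T :: "'v::{real_inner,banach} \<Rightarrow> 'v"
  assumes T: "linear T" and sym: "\<And>x y. inner (T x) y = inner x (T y)" and ep: "simple_eigenpairs T \<mu> \<phi>"
    and pos: "\<And>j. 0 < \<mu> (Suc j)" and bdd: "\<And>j. \<mu> (Suc j) \<le> B" and \<alpha>: "0 < \<alpha>"
  defines "\<psi> \<equiv> normalized \<phi>"
  shows "(\<lambda>j. (\<mu> (Suc j) powr \<alpha> * inner h (\<psi> j)) *\<^sub>R \<psi> j) sums functional_calculus (\<lambda>s. s powr \<alpha>) T h"
proof -
  note eig = simple_eigenpairs_orthonormal[OF sym ep, folded \<psi>_def]
  define m where "m j = \<mu> (Suc j)" for j
  have "summable (\<lambda>j. (m j powr \<alpha> * inner h (\<psi> j))\<^sup>2)"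
  proof (rule summable_comparison_test'[where N = 0])
    show "summable (\<lambda>j. (B powr \<alpha>)\<^sup>2 * (inner h (\<psi> j))\<^sup>2)"
      by (intro summable_mult summable_power2_inner eig(1))
    show "norm ((m j powr \<alpha> * inner h (\<psi> j))\<^sup>2) \<le> (B powr \<alpha>)\<^sup>2 * (inner h (\<psi> j))\<^sup>2" for j
      using pos[of j] bdd[of j] \<alpha>
      by (auto simp: m_def power_mult_distrib intro!: mult_right_mono power_mono powr_mono2)
  qed
  from orthonormal_series_converges[OF eig(1) this]
  obtain x where x: "(\<lambda>j. (m j powr \<alpha> * inner h (\<psi> j)) *\<^sub>R \<psi> j) sums x" ..
  have proj: "orthogonal_projection (eigenspace T (m j)) h = inner h (\<psi> j) *\<^sub>R \<psi> j" for j
  proof (rule orthogonal_projection_eqI[OF subspace_eigenspace[OF T]])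
    show "inner h (\<psi> j) *\<^sub>R \<psi> j \<in> eigenspace T (m j)"
      by (simp add: m_def eig(3) span_base span_scale)
    show "\<forall>v\<in>eigenspace T (m j). inner (h - inner h (\<psi> j) *\<^sub>R \<psi> j) v = 0"
      by (auto simp: m_def eig(3) span_singleton inner_diff_left inner_orthonormal[OF eig(1)])
  qed
  have "functional_calculus (\<lambda>s. s powr \<alpha>) T h
      = (\<Sum>\<^sub>\<infinity>s\<in>range m. s powr \<alpha> *\<^sub>R orthogonal_projection (eigenspace T s) h)"
    unfolding functional_calculus_def
  proof (rule infsum_cong_neutral)
    fix s assume "s \<in> range m - {s. eigenspace T s \<noteq> {0}}"
    then obtain j where "span {\<psi> j} = {0}" by (auto simp: m_def eig(3))
    then have "\<psi> j = 0" using span_base[of "\<psi> j" "{\<psi> j}"] by auto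
    then show "s powr \<alpha> *\<^sub>R orthogonal_projection (eigenspace T s) h = 0"
      using inner_orthonormal[OF eig(1), of j j] by simp
  next
    \<comment> \<open>The only eigenvalue not listed is 0, and \<open>0 powr \<alpha>\<close> is 0,
      so the kernel of \<open>T\<close> contributes nothing.\<close>
    fix s assume "s \<in> {s. eigenspace T s \<noteq> {0}} - range m"
    then have "s = 0" using eig(4)[of s] by (auto simp: m_def)
    then show "s powr \<alpha> *\<^sub>R orthogonal_projection (eigenspace T s) h = 0" by simp
  qed simp
  also have "\<dots> = (\<Sum>\<^sub>\<infinity>j. (m j powr \<alpha> * inner h (\<psi> j)) *\<^sub>R \<psi> j)"
    using eig(2) by (subst infsum_reindex) (auto simp: m_def[abs_def] comp_def proj[unfolded m_def])
  also have "\<dots> = x" by (rule infsumI[OF orthonormal_has_sum[OF eig(1) x]])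
  finally show ?thesis using x by (simp add: m_def)
qed

text \<open>The singular system of \<open>J\<close>, built from eigenvectors of J J*: left vectors
  \<open>\<psi> j\<close>, right vectors \<open>e j\<close> and singular values
  \<open>sqrt (m j)\<close>.\<close>

locale diagonal_inclusion =
  fixes J :: "'h::{real_inner,banach} \<Rightarrow> 'l::real_inner" and \<psi> :: "nat \<Rightarrow> 'l" and m :: "nat \<Rightarrow> real"
  assumes J: "bounded_linear J" and \<psi>: "orthonormal \<psi>" and m: "m j > 0"
    and eig: "J (adjoint J (\<psi> j)) = m j *\<^sub>R \<psi> j"
begin

definition "e j = (1 / sqrt (m j)) *\<^sub>R adjoint J (\<psi> j)"

lemma J_e: "J (e j) = sqrt (m j) *\<^sub>R \<psi> j"
  using m[of j] by (simp add: e_def linear_scale[OF bounded_linear.linear[OF J]] eig real_div_sqrt)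

lemma inner_psi_J: "inner (\<psi> j) (J f) = sqrt (m j) * inner (e j) f"
  using adjoint_inner[OF J, of f "\<psi> j"] m[of j] by (simp add: e_def inner_commute)

lemma orthonormal_e: "orthonormal e"
  unfolding orthonormal_def
proof (intro allI)
  fix i j
  have "sqrt (m i) * inner (e i) (e j) = sqrt (m j) * inner (\<psi> i) (\<psi> j)"
    using inner_psi_J[of i "e j"] by (simp add: J_e)
  then show "inner (e i) (e j) = (if i = j then 1 else 0)"
    using m[of i] by (auto simp: inner_orthonormal[OF \<psi>] split: if_splits)
qed

lemma inner_adjoint_e: "inner (adjoint J x) (e j) = sqrt (m j) * inner x (\<psi> j)"
  using adjoint_inner[OF J, of "e j" x] by (simp add: J_e inner_commute)

text \<open>The singular values cancel between the coordinate of the image and the coordinate of the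
  test vector, so the expansion is that of \<open>x\<close> tested against
  \<open>J f\<close>.\<close>

lemma expands_adjoint:
  assumes "expands \<psi> x"
  shows "expands e (adjoint J x)"
  unfolding expands_def
proof
  fix f
  have "(\<lambda>j. inner x (\<psi> j) * inner (\<psi> j) (J f)) sums inner x (J f)"
    using assms by (simp add: expands_def)
  moreover have "inner (adjoint J x) (e j) * inner (e j) f = inner x (\<psi> j) * inner (\<psi> j) (J f)" for j
    by (simp add: inner_adjoint_e inner_psi_J)
  moreover have "inner (adjoint J x) f = inner x (J f)"
    using adjoint_inner[OF J, of f x] by (simp add: inner_commute)
  ultimately show "(\<lambda>j. inner (adjoint J x) (e j) * inner (e j) f) sums inner (adjoint J x) f"
    by simp
qed

lemma norm_J_le:
  assumes y: "expands e y" and B: "\<And>N. (\<Sum>j<N. m j * (inner y (e j))\<^sup>2) \<le> B"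
  shows "(norm (J y))\<^sup>2 \<le> B"
proof -
  have "(\<lambda>N. (norm (J (\<Sum>j<N. inner y (e j) *\<^sub>R e j)))\<^sup>2) \<longlonglongrightarrow> (norm (J y))\<^sup>2"
    using expands_imp_sums[OF orthonormal_e y] unfolding sums_def
    by (intro tendsto_intros bounded_linear.tendsto[OF J])
  moreover have "(norm (J (\<Sum>j<N. inner y (e j) *\<^sub>R e j)))\<^sup>2 \<le> B" for N
  proof -
    have "J (\<Sum>j<N. inner y (e j) *\<^sub>R e j) = (\<Sum>j<N. (inner y (e j) * sqrt (m j)) *\<^sub>R \<psi> j)"
      by (simp add: linear_sum[OF bounded_linear.linear[OF J]] linear_scale[OF bounded_linear.linear[OF J]] J_e)
    then show ?thesis
      using B[of N] m by (simp add: norm_orthonormal_sum[OF \<psi>] power_mult_distrib less_imp_le mult.commute)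
  qed
  ultimately show ?thesis by (intro LIMSEQ_le_const2) auto
qed

end

section \<open>The covariance operator\<close>

locale square_integrable_element = prob_space M
  for M :: "'w measure" +
  fixes X :: "'w \<Rightarrow> 'a::euclidean_space L2"
  assumes X_meas [measurable]: "X \<in> borel_measurable M" and X_sq: "integrable M (\<lambda>\<omega>. (norm (X \<omega>))\<^sup>2)"
begin

abbreviation "C \<equiv> covariance M X"

lemma norm_tensor_square: "norm (tensor_square f g) \<le> (norm f)\<^sup>2 * norm g"
proof -
  have "norm (tensor_square f g) = \<bar>inner f g\<bar> * norm f" by (simp add: tensor_square_def)
  also have "\<dots> \<le> (norm f * norm g) * norm f" by (intro mult_right_mono Cauchy_Schwarz_ineq2) simp
  finally show ?thesis by (simp add: power2_eq_square mult_ac)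
qed

lemma integrable_tensor: "integrable M (\<lambda>\<omega>. tensor_square (X \<omega>) f)"
proof (rule Bochner_Integration.integrable_bound)
  show "integrable M (\<lambda>\<omega>. (norm (X \<omega>))\<^sup>2 * norm f)" using X_sq by simp
  show "(\<lambda>\<omega>. tensor_square (X \<omega>) f) \<in> borel_measurable M" unfolding tensor_square_def by measurable
  show "AE \<omega> in M. norm (tensor_square (X \<omega>) f) \<le> norm ((norm (X \<omega>))\<^sup>2 * norm f)"
    using norm_tensor_square by (intro AE_I2) (simp add: abs_mult)
qed

lemma inner_C: "inner (C f) g = expectation (\<lambda>\<omega>. inner (X \<omega>) f * inner (X \<omega>) g)"
proof -
  have "inner (C f) g = expectation (\<lambda>\<omega>. inner (tensor_square (X \<omega>) f) g)"
    unfolding covariance_def by (rule integral_inner_left[symmetric]) (rule integrable_tensor)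
  then show ?thesis by (simp add: tensor_square_def)
qed

lemma integrable_inner_inner: "integrable M (\<lambda>\<omega>. inner (X \<omega>) f * inner (X \<omega>) g)"
  using integrable_inner_left[OF integrable_tensor, of f g] by (simp add: tensor_square_def)

lemma C_sym: "inner (C f) g = inner f (C g)"
  by (simp add: inner_C inner_commute[of f] mult.commute)

lemma C_pos: "0 \<le> inner (C f) f"
  by (simp add: inner_C)

lemma bounded_linear_C: "bounded_linear C"
proof (rule bounded_linear_intro)
  show "C (f + g) = C f + C g" for f g
  proof -
    have "C f + C g = expectation (\<lambda>\<omega>. tensor_square (X \<omega>) f + tensor_square (X \<omega>) g)"
      unfolding covariance_def
      by (rule Bochner_Integration.integral_add[symmetric]) (rule integrable_tensor)+
    then show ?thesis by (simp add: covariance_def tensor_square_def inner_add_right scaleR_add_left)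
  qed
  show "C (c *\<^sub>R f) = c *\<^sub>R C f" for c f
    unfolding covariance_def
    by (subst integral_scaleR_right[symmetric]) (simp add: tensor_square_def)
  show "norm (C f) \<le> norm f * expectation (\<lambda>\<omega>. (norm (X \<omega>))\<^sup>2)" for f
  proof -
    have "norm (C f) \<le> expectation (\<lambda>\<omega>. norm (tensor_square (X \<omega>) f))"
      unfolding covariance_def by (rule integral_norm_bound)
    also have "\<dots> \<le> expectation (\<lambda>\<omega>. (norm (X \<omega>))\<^sup>2 * norm f)"
      using integrable_tensor X_sq norm_tensor_square by (intro integral_mono integrable_norm) auto
    finally show ?thesis by (simp add: mult.commute)
  qed
qed

text \<open>Approximating \<open>X\<close> by simple functions makes \<open>C\<close> a norm limit of finite-rank operators.\<close>

lemma C_ball_approx: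
  assumes "r > 0"
  shows "\<exists>K. compact K \<and> (\<forall>f. norm f \<le> 1 \<longrightarrow> (\<exists>y\<in>K. dist (C f) y < r))"
proof -
  obtain s where s: "\<And>i. simple_function M (s i)"
      "\<And>\<omega>. \<omega> \<in> space M \<Longrightarrow> (\<lambda>i. s i \<omega>) \<longlonglongrightarrow> X \<omega>"
      "\<And>i \<omega>. \<omega> \<in> space M \<Longrightarrow> norm (s i \<omega>) \<le> 2 * norm (X \<omega>)"
    using borel_measurable_implies_sequence_metric[OF X_meas, of 0] by simp metis
  have s_meas [measurable]: "s i \<in> borel_measurable M" for i
    using borel_measurable_simple_function[OF s(1)] .
  \<comment> \<open>This dominates the difference of the two tensor squares applied to a unit
    vector. It is integrable and tends to 0, with 9 = 3^2 because the approximants have norm at most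
    twice that of \<open>X\<close>.\<close>
  define D where "D i \<omega> = norm (X \<omega> - s i \<omega>) * (norm (X \<omega>) + norm (s i \<omega>))" for i \<omega>
  have D_le: "D i \<omega> \<le> 9 * (norm (X \<omega>))\<^sup>2" if "\<omega> \<in> space M" for i \<omega>
  proof -
    have "D i \<omega> \<le> (norm (X \<omega>) + norm (s i \<omega>)) * (norm (X \<omega>) + norm (s i \<omega>))"
      unfolding D_def by (intro mult_right_mono norm_triangle_ineq4) simp
    also have "\<dots> \<le> (3 * norm (X \<omega>)) * (3 * norm (X \<omega>))"
      using s(3)[OF that, of i] by (intro mult_mono) auto
    finally show ?thesis by (simp add: power2_eq_square)
  qed
  have D0: "0 \<le> D i \<omega>" for i \<omega> by (simp add: D_def)
  have D_int: "integrable M (D i)" for i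
  proof (rule Bochner_Integration.integrable_bound)
    show "integrable M (\<lambda>\<omega>. 9 * (norm (X \<omega>))\<^sup>2)" using X_sq by simp
    show "D i \<in> borel_measurable M" unfolding D_def by measurable
    show "AE \<omega> in M. norm (D i \<omega>) \<le> norm (9 * (norm (X \<omega>))\<^sup>2)"
      using D_le D0 by (intro AE_I2) simp
  qed
  have "(\<lambda>i. expectation (D i)) \<longlonglongrightarrow> expectation (\<lambda>\<omega>. 0)"
  proof (rule integral_dominated_convergence[where w = "\<lambda>\<omega>. 9 * (norm (X \<omega>))\<^sup>2"])
    show "D i \<in> borel_measurable M" for i using D_int[of i] by simp
    show "AE \<omega> in M. (\<lambda>i. D i \<omega>) \<longlonglongrightarrow> 0"
    proof (rule AE_I2)
      fix \<omega> assume "\<omega> \<in> space M"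
      then have "(\<lambda>i. D i \<omega>) \<longlonglongrightarrow> norm (X \<omega> - X \<omega>) * (norm (X \<omega>) + norm (X \<omega>))"
        unfolding D_def by (intro tendsto_intros s(2))
      then show "(\<lambda>i. D i \<omega>) \<longlonglongrightarrow> 0" by simp
    qed
    show "AE \<omega> in M. norm (D i \<omega>) \<le> 9 * (norm (X \<omega>))\<^sup>2" for i
      using D_le D0 by (intro AE_I2) simp
  qed (use X_sq in auto)
  then have "\<forall>\<^sub>F i in sequentially. dist (expectation (D i)) 0 < r"
    using assms by (intro tendstoD) auto
  then obtain i where i: "dist (expectation (D i)) 0 < r"
    by (meson eventually_sequentially order_refl)
  have sq_i: "integrable M (\<lambda>\<omega>. (norm (s i \<omega>))\<^sup>2)"
  proof (rule Bochner_Integration.integrable_bound)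
    show "integrable M (\<lambda>\<omega>. 4 * (norm (X \<omega>))\<^sup>2)" using X_sq by simp
    show "AE \<omega> in M. norm ((norm (s i \<omega>))\<^sup>2) \<le> norm (4 * (norm (X \<omega>))\<^sup>2)"
    proof (rule AE_I2)
      fix \<omega> assume "\<omega> \<in> space M"
      then have "(norm (s i \<omega>))\<^sup>2 \<le> (2 * norm (X \<omega>))\<^sup>2" by (intro power_mono s(3)) auto
      then show "norm ((norm (s i \<omega>))\<^sup>2) \<le> norm (4 * (norm (X \<omega>))\<^sup>2)" by (simp add: power_mult_distrib)
    qed
  qed measurable
  interpret s: square_integrable_element M "s i" by unfold_locales (use sq_i in auto)
  define R where "R = s i ` space M"
  have finR: "finite R" using simple_functionD(1)[OF s(1)] by (simp add: R_def)
  define p where "p y = prob (s i -` {y} \<inter> space M)" for y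
  have Cs: "s.C f = (\<Sum>y\<in>R. (p y * inner y f) *\<^sub>R y)" for f
  proof -
    have set: "s i -` {y} \<inter> space M \<in> sets M" for y by measurable
    have "s.C f = (LINT \<omega>|M. (\<Sum>y\<in>R. indicator (s i -` {y} \<inter> space M) \<omega> *\<^sub>R (inner y f *\<^sub>R y)))"
      unfolding covariance_def
    proof (rule Bochner_Integration.integral_cong[OF refl])
      fix \<omega> assume \<omega>: "\<omega> \<in> space M"
      have "(\<Sum>y\<in>R. indicator (s i -` {y} \<inter> space M) \<omega> *\<^sub>R (inner y f *\<^sub>R y))
          = (\<Sum>y\<in>R. if s i \<omega> = y then inner y f *\<^sub>R y else 0)"
        using \<omega> by (intro sum.cong) (auto simp: indicator_def)
      also have "\<dots> = inner (s i \<omega>) f *\<^sub>R s i \<omega>" using \<omega> finR by (auto simp: R_def)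
      finally show "tensor_square (s i \<omega>) f
          = (\<Sum>y\<in>R. indicator (s i -` {y} \<inter> space M) \<omega> *\<^sub>R (inner y f *\<^sub>R y))"
        by (simp add: tensor_square_def)
    qed
    also have "\<dots> = (\<Sum>y\<in>R. LINT \<omega>|M. indicator (s i -` {y} \<inter> space M) \<omega> *\<^sub>R (inner y f *\<^sub>R y))"
      using set by (intro Bochner_Integration.integral_sum integrable_scaleR_left integrable_real_indicator)
        (auto simp: emeasure_eq_measure)
    also have "\<dots> = (\<Sum>y\<in>R. (p y * inner y f) *\<^sub>R y)"
    proof (intro sum.cong refl)
      fix y
      have "integrable M (indicator (s i -` {y} \<inter> space M) :: _ \<Rightarrow> real)"
        using set by (intro integrable_real_indicator) (auto simp: emeasure_eq_measure)
      then have "(LINT \<omega>|M. indicator (s i -` {y} \<inter> space M) \<omega> *\<^sub>R (inner y f *\<^sub>R y))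
          = expectation (indicator (s i -` {y} \<inter> space M)) *\<^sub>R (inner y f *\<^sub>R y)"
        by (intro integral_scaleR_left)
      then show "(LINT \<omega>|M. indicator (s i -` {y} \<inter> space M) \<omega> *\<^sub>R (inner y f *\<^sub>R y))
          = (p y * inner y f) *\<^sub>R y"
        using set by (simp add: p_def)
    qed
    finally show ?thesis .
  qed
  define K where "K = {\<Sum>y\<in>R. a y *\<^sub>R y |a. \<forall>y\<in>R. \<bar>a y\<bar> \<le> (\<Sum>y\<in>R. norm y)}"
  have "compact K" unfolding K_def by (rule compact_bounded_combinations[OF finR])
  moreover have "\<exists>y\<in>K. dist (C f) y < r" if f: "norm f \<le> 1" for f
  proof
    have "\<bar>p y * inner y f\<bar> \<le> (\<Sum>y\<in>R. norm y)" if "y \<in> R" for y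
    proof -
      have "\<bar>inner y f\<bar> \<le> norm y * norm f" by (rule Cauchy_Schwarz_ineq2)
      also have "\<dots> \<le> norm y * 1" using f by (intro mult_left_mono) auto
      finally have "\<bar>p y * inner y f\<bar> \<le> 1 * norm y"
        unfolding abs_mult by (intro mult_mono) (auto simp: p_def)
      also have "\<dots> \<le> (\<Sum>y\<in>R. norm y)" using member_le_sum[OF that, of norm] finR by simp
      finally show ?thesis .
    qed
    then show "s.C f \<in> K" unfolding Cs K_def by (intro CollectI exI[of _ "\<lambda>y. p y * inner y f"]) auto
    have "dist (C f) (s.C f) = norm (LINT \<omega>|M. tensor_square (X \<omega>) f - tensor_square (s i \<omega>) f)"
      unfolding covariance_def dist_norm
      by (simp add: Bochner_Integration.integral_diff integrable_tensor s.integrable_tensor)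
    also have "\<dots> \<le> (LINT \<omega>|M. norm (tensor_square (X \<omega>) f - tensor_square (s i \<omega>) f))"
      by (rule integral_norm_bound)
    also have "\<dots> \<le> expectation (D i)"
    proof (intro integral_mono integrable_norm D_int)
      show "integrable M (\<lambda>\<omega>. tensor_square (X \<omega>) f - tensor_square (s i \<omega>) f)"
        by (intro Bochner_Integration.integrable_diff integrable_tensor s.integrable_tensor)
      fix \<omega>
      define x where "x = X \<omega>"
      define y where "y = s i \<omega>"
      have "tensor_square x f - tensor_square y f = inner (x - y) f *\<^sub>R x + inner y f *\<^sub>R (x - y)"
        by (simp add: tensor_square_def inner_diff_left scaleR_diff_left scaleR_diff_right)
      then have "norm (tensor_square x f - tensor_square y f)
          \<le> \<bar>inner (x - y) f\<bar> * norm x + \<bar>inner y f\<bar> * norm (x - y)"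
        using norm_triangle_ineq[of "inner (x - y) f *\<^sub>R x" "inner y f *\<^sub>R (x - y)"] by simp
      also have "\<dots> \<le> norm (x - y) * norm x + norm y * norm (x - y)"
      proof (intro add_mono mult_right_mono)
        have "\<bar>inner z f\<bar> \<le> norm z" for z
        proof -
          have "\<bar>inner z f\<bar> \<le> norm z * norm f" by (rule Cauchy_Schwarz_ineq2)
          also have "\<dots> \<le> norm z * 1" using f by (intro mult_left_mono) auto
          finally show ?thesis by simp
        qed
        then show "\<bar>inner (x - y) f\<bar> \<le> norm (x - y)" "\<bar>inner y f\<bar> \<le> norm y" by auto
      qed auto
      finally show "norm (tensor_square (X \<omega>) f - tensor_square (s i \<omega>) f) \<le> D i \<omega>"
        by (simp add: D_def x_def y_def algebra_simps)
    qed
    also have "\<dots> < r" using i by (simp add: dist_real_def)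
    finally show "dist (C f) (s.C f) < r" .
  qed
  ultimately show ?thesis by blast
qed

text \<open>Total boundedness: a finite r/3-net of an approximating compact set becomes an r-net of
  the closure after two further errors of r/3.\<close>

lemma compact_C_ball: "compact (closure (C ` {f. norm f \<le> 1}))"
  unfolding compact_eq_totally_bounded complete_eq_closed
proof
  show "closed (closure (C ` {f. norm f \<le> 1}))" by simp
  show "\<forall>r>0. \<exists>k. finite k \<and> closure (C ` {f. norm f \<le> 1}) \<subseteq> (\<Union>x\<in>k. ball x r)"
  proof (intro allI impI)
    fix r :: real assume r: "r > 0"
    then obtain K where K: "compact K" "\<And>f. norm f \<le> 1 \<Longrightarrow> \<exists>y\<in>K. dist (C f) y < r / 3"
      using C_ball_approx[of "r / 3"] by auto
    have "\<forall>e>0. \<exists>k. finite k \<and> K \<subseteq> (\<Union>x\<in>k. ball x e)"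
      using K(1) unfolding compact_eq_totally_bounded by blast
    then obtain k where k: "finite k" "K \<subseteq> (\<Union>x\<in>k. ball x (r / 3))" using r by (meson divide_pos_pos zero_less_numeral)
    have "closure (C ` {f. norm f \<le> 1}) \<subseteq> (\<Union>x\<in>k. ball x r)"
    proof
      fix y assume "y \<in> closure (C ` {f. norm f \<le> 1})"
      then obtain f where f: "norm f \<le> 1" "dist (C f) y < r / 3"
        using r unfolding closure_approachable by (metis (mono_tags, lifting) divide_pos_pos imageE mem_Collect_eq zero_less_numeral)
      obtain u where u: "u \<in> K" "dist (C f) u < r / 3" using K(2)[OF f(1)] by blast
      obtain x where x: "x \<in> k" "dist x u < r / 3" using k(2) u(1) by auto
      have "dist x y \<le> dist x u + dist (C f) u + dist (C f) y"
        using dist_triangle[of x y u] dist_triangle[of u y "C f"] by (simp add: dist_commute)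
      then have "dist x y < r" using f u x by linarith
      then show "y \<in> (\<Union>x\<in>k. ball x r)" using x by auto
    qed
    then show "\<exists>k. finite k \<and> closure (C ` {f. norm f \<le> 1}) \<subseteq> (\<Union>x\<in>k. ball x r)" using k by blast
  qed
qed

text \<open>On the orthogonal complement \<open>W\<close> of the system, \<open>C\<close> is
  positive, compact and without nonzero eigenvalues, hence 0; so \<open>X\<close> has zero variance
  in each direction of \<open>W\<close>.\<close>

lemma X_expands_AE:
  assumes \<psi>: "orthonormal \<psi>" and eig: "\<And>j. C (\<psi> j) = x j *\<^sub>R \<psi> j"
    and complete: "\<And>v c. c \<noteq> 0 \<Longrightarrow> v \<noteq> 0 \<Longrightarrow> C v = c *\<^sub>R v \<Longrightarrow> \<exists>j. inner v (\<psi> j) \<noteq> 0"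
  shows "AE \<omega> in M. expands \<psi> (X \<omega>)"
proof -
  define W where "W = {w. \<forall>j. inner w (\<psi> j) = 0}"
  have "W = (\<Inter>j. {w. inner w (\<psi> j) = 0})" by (auto simp: W_def)
  then have W: "closed W" by (simp only:) (intro closed_INT ballI closed_Collect_eq continuous_intros)
  have subW: "subspace W" by (auto simp: W_def subspace_def inner_add_left)
  have CW: "C ` W \<subseteq> W" by (auto simp: W_def C_sym eig)
  have C0: "C w = 0" if "w \<in> W" for w
  proof (rule ccontr)
    assume "C w \<noteq> 0"
    have "\<exists>v m. v \<in> W \<and> norm v = 1 \<and> m > 0 \<and> C v = m *\<^sub>R v"
    proof (rule compact_form_eigenvector[OF bounded_linear_C C_sym W subW CW C_pos compact_C_ball])
      show "C f \<in> closure (C ` {f. norm f \<le> 1})" if "norm f \<le> 1" for f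
        using that by (intro set_mp[OF closure_subset]) auto
    qed (use that \<open>C w \<noteq> 0\<close> in auto)
    then obtain v c where "v \<in> W" "norm v = 1" "c > 0" "C v = c *\<^sub>R v" by blast
    moreover from this have "v \<noteq> 0" by auto
    ultimately show False using complete[of c v] by (auto simp: W_def)
  qed
  have AE0: "AE \<omega> in M. inner (X \<omega>) w = 0" if "w \<in> W" for w
  proof -
    have "expectation (\<lambda>\<omega>. inner (X \<omega>) w * inner (X \<omega>) w) = 0"
      using inner_C[of w w] C0[OF that] by simp
    then have "AE \<omega> in M. inner (X \<omega>) w * inner (X \<omega>) w = 0"
      by (subst (asm) integral_nonneg_eq_0_iff_AE) (auto simp: integrable_inner_inner)
    then show ?thesis by simp
  qed
  \<comment> \<open>Separability replaces uncountably many null sets, one for each direction, by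
    countably many.\<close>
  obtain Q where Q: "countable Q" "Q \<subseteq> W" "W \<subseteq> closure Q" using separable[of W] by blast
  have "AE \<omega> in M. \<forall>w\<in>Q. inner (X \<omega>) w = 0"
    using AE0 Q by (intro AE_ball_countable') auto
  then show ?thesis
  proof eventually_elim
    case (elim \<omega>)
    have "closed {w. inner (X \<omega>) w = 0}" by (intro closed_Collect_eq continuous_intros)
    then have "closure Q \<subseteq> {w. inner (X \<omega>) w = 0}" using elim by (intro closure_minimal) auto
    then show ?case using Q(3) unfolding expands_iff[OF \<psi>] W_def by blast
  qed
qed

end

section \<open>Rates\<close>

lemma power_decay_pos: "power_decay s f \<Longrightarrow> 1 \<le> i \<Longrightarrow> 0 < f i"
  unfolding power_decay_def by (metis less_le_trans mult_pos_pos of_nat_0_less_iff powr_gt_zero less_le_trans zero_less_one not_less0 gr0I less_irrefl)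

lemma power_decay_powr:
  assumes "power_decay s f"
  shows "power_decay (s * p) (\<lambda>i. f i powr p)"
proof -
  obtain a b where ab: "a > 0" "b > 0" "\<And>i. i \<ge> 1 \<Longrightarrow> a * real i powr (-s) \<le> f i \<and> f i \<le> b * real i powr (-s)"
    using assms unfolding power_decay_def by blast
  have pw: "(d * real i powr (-s)) powr p = d powr p * real i powr (- (s * p))" if "d > 0" for d i
    using that by (simp add: powr_mult powr_powr)
  show ?thesis
  proof (cases "p \<ge> 0")
    case True
    have "a powr p * real i powr (- (s * p)) \<le> f i powr p \<and> f i powr p \<le> b powr p * real i powr (- (s * p))"
      if i: "i \<ge> 1" for i
      using ab(3)[OF i] power_decay_pos[OF assms i] ab(1,2) True i
      by (auto simp: pw[symmetric] intro!: powr_mono2)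
    then show ?thesis using ab unfolding power_decay_def by (intro exI[of _ "a powr p"] exI[of _ "b powr p"] conjI) auto
  next
    case False
    have "b powr p * real i powr (- (s * p)) \<le> f i powr p \<and> f i powr p \<le> a powr p * real i powr (- (s * p))"
      if i: "i \<ge> 1" for i
      using ab(3)[OF i] power_decay_pos[OF assms i] ab(1,2) False i
      by (auto simp: pw[symmetric] intro!: powr_mono2')
    then show ?thesis using ab unfolding power_decay_def by (intro exI[of _ "b powr p"] exI[of _ "a powr p"] conjI) auto
  qed
qed

lemma power_decay_mult:
  assumes "power_decay s f" "power_decay r g"
  shows "power_decay (s + r) (\<lambda>i. f i * g i)"
proof -
  obtain a b where ab: "a > 0" "b > 0" "\<And>i. i \<ge> 1 \<Longrightarrow> a * real i powr (-s) \<le> f i \<and> f i \<le> b * real i powr (-s)"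
    using assms(1) unfolding power_decay_def by blast
  obtain c d where cd: "c > 0" "d > 0" "\<And>i. i \<ge> 1 \<Longrightarrow> c * real i powr (-r) \<le> g i \<and> g i \<le> d * real i powr (-r)"
    using assms(2) unfolding power_decay_def by blast
  have "(a * c) * real i powr (- (s + r)) \<le> f i * g i \<and> f i * g i \<le> (b * d) * real i powr (- (s + r))"
    if i: "i \<ge> 1" for i
  proof -
    have eq: "(u * v) * real i powr (- (s + r)) = (u * real i powr (-s)) * (v * real i powr (-r))" for u v
    proof -
      have "real i powr (- (s + r)) = real i powr (-s) * real i powr (-r)"
        by (simp add: powr_add[symmetric])
      then show ?thesis by simp
    qed
    show ?thesis
      unfolding eq using ab(1,2) cd(1,2) ab(3)[OF i] cd(3)[OF i] power_decay_pos[OF assms(1) i] power_decay_pos[OF assms(2) i]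
      by (auto intro!: mult_mono)
  qed
  then show ?thesis
    using ab cd unfolding power_decay_def by (intro exI[of _ "a * c"] exI[of _ "b * d"] conjI) auto
qed

lemma power_decay_le:
  assumes "power_decay s f" "power_decay s g"
  shows "\<exists>C>0. \<forall>i\<ge>1. f i \<le> C * g i"
proof -
  obtain b where b: "b > 0" "\<And>i. i \<ge> 1 \<Longrightarrow> f i \<le> b * real i powr (-s)"
    using assms(1) unfolding power_decay_def by blast
  obtain c where c: "c > 0" "\<And>i. i \<ge> 1 \<Longrightarrow> c * real i powr (-s) \<le> g i"
    using assms(2) unfolding power_decay_def by blast
  have "f i \<le> b / c * g i" if "i \<ge> 1" for i
  proof -
    have "f i \<le> b / c * (c * real i powr (-s))" using b(2)[OF that] c(1) by simp
    also have "\<dots> \<le> b / c * g i" using c(2)[OF that] b(1) c(1) by (intro mult_left_mono) auto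
    finally show ?thesis .
  qed
  then show ?thesis using b c by (intro exI[of _ "b / c"]) auto
qed

lemma power_decay_bounded:
  assumes "power_decay s f" "0 \<le> s"
  shows "\<exists>C>0. \<forall>i\<ge>1. f i \<le> C"
proof -
  obtain b where b: "b > 0" "\<And>i. i \<ge> 1 \<Longrightarrow> f i \<le> b * real i powr (-s)"
    using assms(1) unfolding power_decay_def by blast
  have "f i \<le> b" if "i \<ge> 1" for i
  proof -
    have "real i powr (-s) \<le> 1" using that assms(2) powr_mono[of "-s" 0 "real i"] by simp
    then have "b * real i powr (-s) \<le> b * 1" using b(1) by (intro mult_left_mono) auto
    then show ?thesis using b(2)[OF that] by simp
  qed
  then show ?thesis using b by blast
qed

lemma power_decay_summable:
  assumes "power_decay s f" "1 < s"
  shows "summable (\<lambda>j. f (Suc j))"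
proof -
  obtain b where b: "b > 0" "\<And>i. i \<ge> 1 \<Longrightarrow> f i \<le> b * real i powr (-s)"
    using assms(1) unfolding power_decay_def by blast
  show ?thesis
  proof (rule summable_comparison_test'[where N = 0])
    have "summable (\<lambda>i. real i powr (-s))" using assms(2) by (simp add: summable_real_powr_iff)
    then show "summable (\<lambda>j. b * real (Suc j) powr (-s))"
      by (intro summable_mult) (subst summable_Suc_iff)
    show "norm (f (Suc j)) \<le> b * real (Suc j) powr (-s)" for j
      using b(2)[of "Suc j"] power_decay_pos[OF assms(1), of "Suc j"] by simp
  qed
qed

text \<open>The index at which \<open>f\<close> falls to the level \<open>l\<close> is of order m =
  l^(-1/\<gamma>). In the scaled index y = i/m each term is at most a constant times 1/(1 +
  y^\<gamma>), hence times 1/(1 + y^2) because \<gamma> >= 2, and the latter is dominated by a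
  telescoping sum of size m.\<close>

lemma effective_dimension:
  assumes "power_decay \<gamma> f" and \<gamma>: "2 \<le> \<gamma>"
  shows "\<exists>C>0. \<forall>l>0. \<forall>N. (\<Sum>j<N. f (Suc j) / (f (Suc j) + l)) \<le> C * l powr (- (1 / \<gamma>))"
proof -
  obtain b where b: "b > 0" "\<And>i. i \<ge> 1 \<Longrightarrow> f i \<le> b * real i powr (- \<gamma>)"
    using assms(1) unfolding power_decay_def by blast
  define c where "c = max 1 b"
  have c: "c \<ge> 1" "c \<ge> b" "c > 0" by (auto simp: c_def)
  have "(\<Sum>j<N. f (Suc j) / (f (Suc j) + l)) \<le> 4 * c * l powr (- (1 / \<gamma>))" if l: "l > 0" for l N
  proof -
    define m where "m = l powr (- (1 / \<gamma>))"
    have m: "m > 0" using l by (simp add: m_def)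
    have lm: "l = m powr (- \<gamma>)" using l \<gamma> by (simp add: m_def powr_powr)
    have "f (Suc j) / (f (Suc j) + l) \<le> 4 * c * m\<^sup>2 * (1 / (m + real j) - 1 / (m + real (Suc j)))" for j
    proof -
      define i where "i = real (Suc j)"
      have i: "i \<ge> 1" by (simp add: i_def)
      define y where "y = i / m"
      have y: "y > 0" using i m by (simp add: y_def)
      have f0: "f (Suc j) > 0" using power_decay_pos[OF assms(1)] by simp
      have "f (Suc j) \<le> b * i powr (- \<gamma>)" using b(2)[of "Suc j"] by (simp add: i_def)
      also have "\<dots> \<le> c * i powr (- \<gamma>)" using c by (intro mult_right_mono) auto
      finally have f1: "f (Suc j) \<le> c * i powr (- \<gamma>)" .
      have "l = y powr \<gamma> * i powr (- \<gamma>)"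
        using i m by (simp add: lm y_def powr_divide powr_minus field_simps)
      then have ly: "l / i powr (- \<gamma>) = y powr \<gamma>" using i by simp
      have "f (Suc j) / (f (Suc j) + l) = 1 - l / (f (Suc j) + l)" using f0 l by (simp add: field_simps)
      also have "\<dots> \<le> 1 - l / (c * i powr (- \<gamma>) + l)"
        using f1 f0 l c i by (intro diff_left_mono divide_left_mono mult_pos_pos add_pos_pos) auto
      also have "\<dots> = (c * i powr (- \<gamma>)) / (c * i powr (- \<gamma>) + l)"
      proof -
        have "c * i powr (- \<gamma>) + l > 0" using c i l by (intro add_pos_pos mult_pos_pos) auto
        then show ?thesis by (simp add: field_simps)
      qed
      also have "\<dots> = c / (c + y powr \<gamma>)"
      proof -
        have "i powr (- \<gamma>) > 0" using i by simp
        then have "(c * i powr (- \<gamma>)) / (c * i powr (- \<gamma>) + l) = c / (c + l / i powr (- \<gamma>))"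
          using c l by (simp add: field_simps)
        then show ?thesis by (simp add: ly)
      qed
      also have "\<dots> \<le> c / (1 + y powr \<gamma>)"
        using c y by (intro divide_left_mono mult_pos_pos add_pos_nonneg) auto
      also have "\<dots> \<le> c * (2 / (1 + y\<^sup>2))"
      proof -
        have "1 + y\<^sup>2 \<le> 2 * (1 + y powr \<gamma>)"
        proof (cases "y \<ge> 1")
          case True
          then have "y powr 2 \<le> y powr \<gamma>" using \<gamma> by (intro powr_mono) auto
          then show ?thesis using y True by (simp add: powr_numeral) (smt (verit) powr_ge_zero)
        next
          case False
          then have "y\<^sup>2 \<le> 1" using y by (intro power_le_one) auto
          then show ?thesis by (smt (verit) powr_ge_zero)
        qed
        moreover have "1 + y powr \<gamma> > 0" by (simp add: add_pos_nonneg)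
        moreover have "1 + y\<^sup>2 > 0" by (simp add: add_pos_nonneg)
        ultimately have "1 / (1 + y powr \<gamma>) \<le> 2 / (1 + y\<^sup>2)" by (simp add: field_simps)
        then show ?thesis using c by (metis less_eq_real_def mult.right_neutral mult_left_mono times_divide_eq_right)
      qed
      also have "2 / (1 + y\<^sup>2) = 2 * m\<^sup>2 / (m\<^sup>2 + i\<^sup>2)" using m by (simp add: y_def field_simps)
      \<comment> \<open>The product of consecutive factors is chosen because its reciprocal is a
        difference; (m + i)^2 <= 2 (m^2 + i^2) makes the replacement possible.\<close>
      also have "\<dots> \<le> 4 * m\<^sup>2 / ((m + (i - 1)) * (m + i))"
      proof -
        have "(m + (i - 1)) * (m + i) \<le> (m + i) * (m + i)" using m i by (intro mult_right_mono) auto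
        also have "\<dots> \<le> 2 * (m\<^sup>2 + i\<^sup>2)"
          using zero_le_power2[of "m - i"] by (simp add: power2_eq_square algebra_simps)
        finally have "(m + (i - 1)) * (m + i) \<le> 2 * (m\<^sup>2 + i\<^sup>2)" .
        then have "4 * m\<^sup>2 / (2 * (m\<^sup>2 + i\<^sup>2)) \<le> 4 * m\<^sup>2 / ((m + (i - 1)) * (m + i))"
          using m i by (intro divide_left_mono mult_pos_pos) (auto intro: add_pos_pos add_pos_nonneg)
        moreover have "4 * m\<^sup>2 / (2 * (m\<^sup>2 + i\<^sup>2)) = 2 * m\<^sup>2 / (m\<^sup>2 + i\<^sup>2)"
          using mult_divide_mult_cancel_left[of 2 "2 * m\<^sup>2" "m\<^sup>2 + i\<^sup>2"] by simp
        ultimately show ?thesis by simp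
      qed
      also have "\<dots> = 4 * m\<^sup>2 * (1 / (m + real j) - 1 / (m + real (Suc j)))"
        using m by (simp add: i_def field_simps)
      finally show ?thesis using c by (simp add: mult_left_mono mult_ac)
    qed
    then have "(\<Sum>j<N. f (Suc j) / (f (Suc j) + l))
        \<le> (\<Sum>j<N. 4 * c * m\<^sup>2 * (1 / (m + real j) - 1 / (m + real (Suc j))))"
      by (intro sum_mono)
    also have "\<dots> = 4 * c * m\<^sup>2 * (1 / m - 1 / (m + real N))"
      unfolding sum_distrib_left[symmetric] by (subst sum_lessThan_telescope') simp
    also have "\<dots> \<le> 4 * c * m\<^sup>2 * (1 / m)" using c m by (intro mult_left_mono) auto
    also have "\<dots> = 4 * c * m" using m by (simp add: power2_eq_square)
    finally show ?thesis by (simp add: m_def)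
  qed
  then show ?thesis using c by (intro exI[of _ "4 * c"]) auto
qed

text \<open>For s up to K\<tau> the weight is of order \<tau>^p and boundedness of the residual
  suffices. Beyond that the qualification at p' >= p applies, the excess power being traded by
  s^(p-p') <= \<tau>^(p-p'). At s = 0 the filter is set to 0 and the residual is 1.\<close>

lemma residual_bound:
  fixes g :: "real \<Rightarrow> real \<Rightarrow> real" and p p' :: real
  assumes lam: "0 < \<tau>" "ereal \<tau> \<le> \<eta>" and K: "1 \<le> K" and D: "0 \<le> D"
    and r: "\<And>s. 0 < s \<Longrightarrow> ereal s \<le> \<eta> \<Longrightarrow> \<bar>1 - s * g \<tau> s\<bar> \<le> D"
    and w: "\<And>s. 0 < s \<Longrightarrow> ereal s \<le> \<eta> \<Longrightarrow> \<bar>1 - s * g \<tau> s\<bar> * s powr p' \<le> w * \<tau> powr p'"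
    and p: "0 \<le> p" "p \<le> p'" and s: "0 \<le> s" "ereal s \<le> \<eta>"
  shows "(s + K * \<tau>) powr p * \<bar>1 - s * (if s = 0 then 0 else g \<tau> s)\<bar>
    \<le> (2 powr p * (\<bar>w\<bar> + (1 + D) * K powr p)) * \<tau> powr p"
proof -
  have K0: "K > 0" using K by simp
  have pos: "0 \<le> 2 powr p * \<bar>w\<bar> * \<tau> powr p" "0 \<le> 2 powr p * (D * K powr p) * \<tau> powr p"
    "0 \<le> 2 powr p * K powr p * \<tau> powr p" using D by auto
  have expand: "(2 powr p * (\<bar>w\<bar> + (1 + D) * K powr p)) * \<tau> powr p
      = 2 powr p * \<bar>w\<bar> * \<tau> powr p + 2 powr p * K powr p * \<tau> powr p + 2 powr p * (D * K powr p) * \<tau> powr p"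
    by (simp add: algebra_simps)
  have one: "1 \<le> (2::real) powr p" using p by (simp add: ge_one_powr_ge_zero)
  consider "s = 0" | "0 < s" "s \<le> K * \<tau>" | "K * \<tau> < s" using s by linarith
  then show ?thesis
  proof cases
    case 1
    have "1 * (K powr p * \<tau> powr p) \<le> 2 powr p * (K powr p * \<tau> powr p)" using one by (intro mult_right_mono) auto
    moreover have "(s + K * \<tau>) powr p * \<bar>1 - s * (if s = 0 then 0 else g \<tau> s)\<bar> = K powr p * \<tau> powr p"
      using 1 lam K0 by (simp add: powr_mult)
    ultimately show ?thesis using pos unfolding expand by linarith
  next
    case 2
    have "(s + K * \<tau>) powr p \<le> (2 * (K * \<tau>)) powr p" using 2 p by (intro powr_mono2) auto
    then have "(s + K * \<tau>) powr p * \<bar>1 - s * g \<tau> s\<bar> \<le> (2 * (K * \<tau>)) powr p * D"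
      using r[OF 2(1) s(2)] by (intro mult_mono) auto
    also have "\<dots> = 2 powr p * (D * K powr p) * \<tau> powr p" using lam K0 by (simp add: powr_mult)
    finally have "(s + K * \<tau>) powr p * \<bar>1 - s * g \<tau> s\<bar> \<le> 2 powr p * (D * K powr p) * \<tau> powr p" .
    moreover have eq: "(if s = 0 then 0 else g \<tau> s) = g \<tau> s" using 2(1) by simp
    ultimately show ?thesis unfolding expand eq using pos by linarith
  next
    case 3
    have "1 * \<tau> \<le> K * \<tau>" using K lam by (intro mult_right_mono) auto
    then have ls: "\<tau> \<le> s" "0 < s" using 3 lam by linarith+
    have "0 < K * \<tau>" using lam K0 by simp
    then have "(s + K * \<tau>) powr p \<le> (2 * s) powr p" using 3 p ls by (intro powr_mono2) auto
    also have "\<dots> = 2 powr p * (s powr p' * s powr (p - p'))" using ls by (simp add: powr_mult powr_add[symmetric])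
    also have "\<dots> \<le> 2 powr p * (s powr p' * \<tau> powr (p - p'))"
      using ls p lam by (intro mult_left_mono powr_mono2') auto
    finally have "(s + K * \<tau>) powr p * \<bar>1 - s * g \<tau> s\<bar>
        \<le> (2 powr p * (s powr p' * \<tau> powr (p - p'))) * \<bar>1 - s * g \<tau> s\<bar>"
      by (intro mult_right_mono) auto
    also have "\<dots> = 2 powr p * \<tau> powr (p - p') * (\<bar>1 - s * g \<tau> s\<bar> * s powr p')" by simp
    also have "\<dots> \<le> 2 powr p * \<tau> powr (p - p') * (w * \<tau> powr p')"
      using w[OF ls(2) s(2)] by (intro mult_left_mono) auto
    also have "\<dots> \<le> 2 powr p * \<tau> powr (p - p') * (\<bar>w\<bar> * \<tau> powr p')" by (intro mult_left_mono mult_right_mono) auto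
    also have "\<dots> = 2 powr p * \<bar>w\<bar> * \<tau> powr p" using lam by (simp add: powr_diff)
    finally have "(s + K * \<tau>) powr p * \<bar>1 - s * g \<tau> s\<bar> \<le> 2 powr p * \<bar>w\<bar> * \<tau> powr p" .
    moreover have eq: "(if s = 0 then 0 else g \<tau> s) = g \<tau> s" using ls(2) by simp
    ultimately show ?thesis unfolding expand eq using pos by linarith
  qed
qed

lemma qualification_exponent:
  assumes "has_qualification \<eta> g \<nu>" "ereal p \<le> \<nu>" "0 \<le> p"
  obtains p' where "p \<le> p'" "qualifies \<eta> g p'"
proof (cases \<nu>)
  case (real q)
  then show thesis using assms that[of q] by (auto simp: has_qualification_def)
next
  case PInf
  then show thesis using assms that[of "p + 1"] by (auto simp: has_qualification_def)
next
  case MInf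
  then show thesis using assms by auto
qed

text \<open>Each identity compares exponents of n. The third conclusion balances variance against
  squared bias and defines the rate. The fourth says that the squared effective dimension is at most
  of order n, which holds since 1 + c + 2tr >= 2. The last two translate powers of \<tau> into the
  stated rates.\<close>

lemma reg_param_facts:
  fixes t c r :: real
  assumes t: "1 < t" "1 < c" and r: "0 \<le> r" and n: "1 \<le> n"
  defines "\<tau> \<equiv> reg_param t c r n" and "q \<equiv> t * (2 * r - 1) / (2 * (t + c))"
  shows "0 < \<tau>" "\<tau> \<le> 1" "\<tau> powr (- (1 / (t + c))) / real n = \<tau> powr (2 * q + 1)"
    "\<tau> powr (- (2 / (t + c))) \<le> real n"
    "\<tau> powr (r * t / (t + c)) = real n powr (- (r * t) / (1 + c + 2 * t * r))"
    "\<tau> powr q = real n powr (- (t * (r - 1 / 2)) / (1 + c + 2 * t * r))"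
proof -
  define D where "D = 1 + c + 2 * t * r"
  have "0 \<le> t * r" using t r by simp
  then have D: "D \<ge> 2" using t unfolding D_def by linarith
  have \<gamma>: "t + c > 0" using t by simp
  have n1: "real n \<ge> 1" using n by simp
  have lam: "\<tau> = real n powr (- ((t + c) / D))" unfolding \<tau>_def reg_param_def D_def by (simp only: minus_divide_left)
  have pw: "\<tau> powr p = real n powr (- ((t + c) * p / D))" for p by (simp add: lam powr_powr)
  show "0 < \<tau>" using n1 by (simp add: lam)
  show "\<tau> \<le> 1"
    using n1 \<gamma> D powr_mono[of "- ((t + c) / D)" 0 "real n"] by (simp add: lam)
  have "\<tau> powr (- (1 / (t + c))) / real n = real n powr (1 / D - 1)"
    using \<gamma> n1 by (simp add: pw powr_diff)
  also have "1 / D - 1 = - ((t + c) * (2 * q + 1) / D)"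
  proof -
    have "(t + c) * (2 * q + 1) = D - 1" using \<gamma> by (simp add: q_def D_def field_simps)
    then show ?thesis using D by (simp only:) (simp add: diff_divide_distrib)
  qed
  finally show "\<tau> powr (- (1 / (t + c))) / real n = \<tau> powr (2 * q + 1)" by (simp add: pw)
  have "\<tau> powr (- (2 / (t + c))) = real n powr (2 / D)"
  proof -
    have "(t + c) * (2 / (t + c)) = 2"
      using \<gamma> by (subst times_divide_eq_right) (rule nonzero_mult_div_cancel_left, simp)
    then show ?thesis by (simp only: pw mult_minus_right) simp
  qed
  also have "\<dots> \<le> real n powr 1" using n1 D by (intro powr_mono) (auto simp: field_simps)
  finally show "\<tau> powr (- (2 / (t + c))) \<le> real n" using n1 by simp
  show "\<tau> powr (r * t / (t + c)) = real n powr (- (r * t) / (1 + c + 2 * t * r))"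
    using \<gamma> by (simp add: pw D_def)
  have "(t + c) * q = t * (r - 1 / 2)" using \<gamma> by (simp add: q_def field_simps)
  then show "\<tau> powr q = real n powr (- (t * (r - 1 / 2)) / (1 + c + 2 * t * r))"
    by (simp only: pw D_def minus_divide_left)
qed

text \<open>Closedness makes the set Borel, so that the almost sure expansion can be transported
  from \<open>X\<close> to the sample through equality in law.\<close>

lemma closed_expands:
  fixes e :: "nat \<Rightarrow> 'v::{real_inner,banach}"
  assumes "orthonormal e"
  shows "closed {v. expands e v}"
proof -
  have "{v. expands e v} = (\<Inter>w\<in>{w. \<forall>j. inner w (e j) = 0}. {v. inner v w = 0})"
    by (auto simp: expands_iff[OF assms])
  then show ?thesis by (simp only:) (intro closed_INT ballI closed_Collect_eq continuous_intros)
qed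

section \<open>The regression model\<close>

locale functional_regression = prob_space M + compact_RKHS S k \<kappa> evalf
  for M :: "'w measure" and S :: "'a::euclidean_space set" and k \<kappa>
    and evalf :: "'h::{real_inner, banach} \<Rightarrow> 'a \<Rightarrow> real" +
  fixes X :: "'w \<Rightarrow> 'a L2" and \<epsilon> Y :: "'w \<Rightarrow> real"
    and Xs :: "nat \<Rightarrow> 'w \<Rightarrow> 'a L2" and Ys :: "nat \<Rightarrow> 'w \<Rightarrow> real"
    and \<beta>\<^sub>0 h :: "'a L2" and \<sigma> :: real and g :: "real \<Rightarrow> real \<Rightarrow> real" and \<eta> \<nu> :: ereal
    and \<alpha> t c d\<^sub>1 :: real and \<mu> \<xi> :: "nat \<Rightarrow> real" and \<phi> :: "nat \<Rightarrow> 'a L2"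
  assumes X: "X \<in> borel_measurable M" "\<forall>\<omega>\<in>space M. X \<omega> \<in> L2_on S" "integrable M (\<lambda>\<omega>. (norm (X \<omega>))\<^sup>2)"
    and beta: "\<beta>\<^sub>0 \<in> L2_on S"
    and noise: "\<epsilon> \<in> borel_measurable M" "integrable M \<epsilon>" "expectation \<epsilon> = 0"
      "integrable M (\<lambda>\<omega>. (\<epsilon> \<omega>)\<^sup>2)" "variance \<epsilon> = \<sigma>\<^sup>2"
      "indep_set {X -` A \<inter> space M |A. A \<in> sets borel} {\<epsilon> -` A \<inter> space M |A. A \<in> sets borel}"
    and model: "\<forall>\<omega>\<in>space M. Y \<omega> = inner (X \<omega>) \<beta>\<^sub>0 + \<epsilon> \<omega>"
    and iid: "indep_vars (\<lambda>_. borel \<Otimes>\<^sub>M borel) (\<lambda>i \<omega>. (Xs i \<omega>, Ys i \<omega>)) {1..}"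
      "\<forall>i\<ge>1. distr M (borel \<Otimes>\<^sub>M borel) (\<lambda>\<omega>. (Xs i \<omega>, Ys i \<omega>)) =
              distr M (borel \<Otimes>\<^sub>M borel) (\<lambda>\<omega>. (X \<omega>, Y \<omega>))"
    and reg: "0 < \<eta>" "regularization_family \<eta> g"
    and spec: "\<forall>n\<ge>1. AE \<omega> in M.
      \<forall>s\<in>real_spectrum (RKHS_empirical_covariance S evalf Xs n \<omega>). 0 \<le> s \<and> ereal s \<le> \<eta>"
    and source: "\<alpha> > 0" "h \<in> L2_on S"
      "\<beta>\<^sub>0 = functional_calculus (\<lambda>s. s powr \<alpha>) (kernel_operator S evalf) h"
    and decay: "t > 1" "c > 1" "power_decay t \<mu>" "power_decay c \<xi>"
      "simple_eigenpairs (kernel_operator S evalf) \<mu> \<phi>" "simple_eigenpairs (covariance M X) \<xi> \<phi>"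
    and moment: "d\<^sub>1 > 0"
      "\<forall>f\<in>L2_on S. integrable M (\<lambda>\<omega>. (inner (X \<omega>) f) ^ 4) \<and>
         (LINT \<omega>|M. (inner (X \<omega>) f) ^ 4) \<le> d\<^sub>1 * (LINT \<omega>|M. (inner (X \<omega>) f)\<^sup>2)\<^sup>2"
    and qual: "has_qualification \<eta> g \<nu>" "\<nu> \<ge> ereal (1 / 2)"
begin

sublocale square_integrable_element M X
  by unfold_locales (use X in auto)

definition \<psi> :: "nat \<Rightarrow> 'a L2" where "\<psi> = normalized \<phi>"
definition m :: "nat \<Rightarrow> real" where "m j = \<mu> (Suc j)"
definition x :: "nat \<Rightarrow> real" where "x j = \<xi> (Suc j)"
definition a :: "nat \<Rightarrow> real" where "a j = m j * x j"

abbreviation "T \<equiv> kernel_operator S evalf"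

lemma T_eq: "T f = J (adjoint J f)"
  by (simp add: kernel_operator_def)

lemma T_sym: "inner (T f) v = inner f (T v)"
  unfolding T_eq using adjoint_inner[OF bounded_linear_J]
  by (metis inner_commute)

lemma linear_T: "linear T"
  unfolding kernel_operator_def
  by (intro linear_compose bounded_linear.linear bounded_linear_J bounded_linear_adjoint)

lemmas T_eig = simple_eigenpairs_orthonormal[OF T_sym decay(5), folded \<psi>_def]
lemmas C_eig = simple_eigenpairs_orthonormal[OF C_sym decay(6), folded \<psi>_def]

lemma m_pos: "m j > 0" and x_pos: "x j > 0"
  using power_decay_pos[OF decay(3)] power_decay_pos[OF decay(4)] by (simp_all add: m_def x_def)

lemma a_pos: "a j > 0"
  using m_pos x_pos by (simp add: a_def)

lemma T_psi: "T (\<psi> j) = m j *\<^sub>R \<psi> j"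
  using T_eig(3)[of j] span_base[of "\<psi> j" "{\<psi> j}"] by (auto simp: eigenspace_def m_def)

lemma C_psi: "C (\<psi> j) = x j *\<^sub>R \<psi> j"
  using C_eig(3)[of j] span_base[of "\<psi> j" "{\<psi> j}"] by (auto simp: eigenspace_def x_def)

sublocale diagonal_inclusion J \<psi> m
  by (rule diagonal_inclusion.intro)
    (simp_all only: bounded_linear_J T_eig(1) m_pos T_psi T_eq[symmetric])

text \<open>Eigenvectors with nonzero eigenvalue lie in the range of \<open>J\<close>; membership is
  required before the moment condition may be applied to them.\<close>

lemma psi_mem: "\<psi> j \<in> L2_on S"
proof -
  have "\<psi> j = (1 / m j) *\<^sub>R J (adjoint J (\<psi> j))" using eig[of j] m_pos[of j] by simp
  then show ?thesis by (metis L2_on_scaleR J_mem)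
qed

lemma expands_X: "AE \<omega> in M. expands \<psi> (X \<omega>)"
proof (rule X_expands_AE[OF \<psi> C_psi])
  fix v s assume v: "s \<noteq> 0" "v \<noteq> 0" "C v = s *\<^sub>R v"
  then have "v \<in> eigenspace C s" by (simp add: eigenspace_def)
  moreover from this v have "s \<in> range (\<lambda>j. \<xi> (Suc j))" using C_eig(4)[of s] by auto
  ultimately obtain j where "v \<in> span {\<psi> j}" using C_eig(3) by auto
  then obtain r where "v = r *\<^sub>R \<psi> j" by (auto simp: span_singleton)
  then show "\<exists>j. inner v (\<psi> j) \<noteq> 0"
    using v(2) inner_orthonormal[OF \<psi>, of j j] by (intro exI[of _ j]) auto
qed

lemma W_meas: "1 \<le> i \<Longrightarrow> (\<lambda>\<omega>. (Xs i \<omega>, Ys i \<omega>)) \<in> M \<rightarrow>\<^sub>M borel \<Otimes>\<^sub>M borel"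
  using iid(1) by (auto simp: indep_vars_def)

lemma Y_meas [measurable]: "Y \<in> borel_measurable M"
proof -
  have "(\<lambda>\<omega>. inner (X \<omega>) \<beta>\<^sub>0 + \<epsilon> \<omega>) \<in> borel_measurable M" using noise(1) by measurable
  then show ?thesis using model by (subst measurable_cong[where g = "\<lambda>\<omega>. inner (X \<omega>) \<beta>\<^sub>0 + \<epsilon> \<omega>"]) auto
qed

lemma W0_meas: "(\<lambda>\<omega>. (X \<omega>, Y \<omega>)) \<in> M \<rightarrow>\<^sub>M borel \<Otimes>\<^sub>M borel"
  by measurable

text \<open>The property depends on the pair (X, Y) through a measurable set, and the pairs have
  equal distributions.\<close>

lemma expands_sample:
  assumes i: "1 \<le> i"
  shows "AE \<omega> in M. expands e (adjoint J (Xs i \<omega>))"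
proof -
  let ?N = "borel \<Otimes>\<^sub>M borel :: ('a L2 \<times> real) measure"
  have V: "{p \<in> space ?N. expands \<psi> (fst p)} \<in> sets ?N"
  proof -
    have "fst -` {v. expands \<psi> v} \<inter> space ?N \<in> sets ?N"
      using closed_expands[OF \<psi>] by (intro measurable_sets[OF measurable_fst]) (simp add: borel_closed)
    also have "fst -` {v. expands \<psi> v} \<inter> space ?N = {p \<in> space ?N. expands \<psi> (fst p)}" by auto
    finally show ?thesis .
  qed
  have "AE p in distr M ?N (\<lambda>\<omega>. (X \<omega>, Y \<omega>)). expands \<psi> (fst p)"
    using expands_X by (subst AE_distr_iff[OF W0_meas V]) simp
  then have "AE p in distr M ?N (\<lambda>\<omega>. (Xs i \<omega>, Ys i \<omega>)). expands \<psi> (fst p)"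
    by (subst iid(2)[rule_format, OF i])
  then have "AE \<omega> in M. expands \<psi> (Xs i \<omega>)" by (subst (asm) AE_distr_iff[OF W_meas[OF i] V]) simp
  then show ?thesis by eventually_elim (rule expands_adjoint)
qed

text \<open>Preimages under a function of the variable are preimages under the variable itself, and
  each preimage family is stable under intersection, so independence extends to the generated
  sigma-algebras.\<close>

lemma indep_X_noise:
  assumes f: "f \<in> borel_measurable borel" and r: "r \<in> borel_measurable borel"
  shows "indep_var borel (\<lambda>\<omega>. f (X \<omega>) :: real) borel (\<lambda>\<omega>. r (\<epsilon> \<omega>))"
proof -
  have st: "Int_stable {v -` A \<inter> space M |A. A \<in> sets borel}" for v :: "'w \<Rightarrow> real"
  proof (rule Int_stableI)
    fix a b assume "a \<in> {v -` A \<inter> space M |A. A \<in> sets borel}" "b \<in> {v -` A \<inter> space M |A. A \<in> sets borel}"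
    then obtain A B where AB: "a = v -` A \<inter> space M" "b = v -` B \<inter> space M" "A \<in> sets borel" "B \<in> sets borel"
      by blast
    then show "a \<inter> b \<in> {v -` A \<inter> space M |A. A \<in> sets borel}"
      by (intro CollectI exI[of _ "A \<inter> B"]) auto
  qed
  have sub: "{(\<lambda>\<omega>. p (v \<omega>)) -` A \<inter> space M |A. A \<in> sets borel} \<subseteq> {v -` A \<inter> space M |A. A \<in> sets borel}"
    if "p \<in> borel_measurable borel" for p :: "'z::topological_space \<Rightarrow> real" and v :: "'w \<Rightarrow> 'z"
  proof
    fix a assume "a \<in> {(\<lambda>\<omega>. p (v \<omega>)) -` A \<inter> space M |A. A \<in> sets borel}"
    then obtain A where A: "A \<in> sets borel" "a = (\<lambda>\<omega>. p (v \<omega>)) -` A \<inter> space M" by blast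
    have "p -` A \<in> sets borel" using measurable_sets[OF that A(1)] by simp
    then show "a \<in> {v -` A \<inter> space M |A. A \<in> sets borel}"
      unfolding A(2) by (intro CollectI exI[of _ "p -` A"]) auto
  qed
  have "indep_set {(\<lambda>\<omega>. f (X \<omega>)) -` A \<inter> space M |A. A \<in> sets borel} {(\<lambda>\<omega>. r (\<epsilon> \<omega>)) -` A \<inter> space M |A. A \<in> sets borel}"
    using noise(6) unfolding indep_set_def
    by (rule indep_sets_mono_sets) (use sub[OF f, of X] sub[OF r, of \<epsilon>] in \<open>simp split: bool.split\<close>)
  then show ?thesis
    unfolding indep_var_eq using X(1) noise(1) f r indep_set_sigma_sets[OF _ st st] by auto
qed

lemma noise_sq: "expectation (\<lambda>\<omega>. (\<epsilon> \<omega>)\<^sup>2) = \<sigma>\<^sup>2"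
  using noise(3,5) by simp

lemma inner_X_sq: "integrable M (\<lambda>\<omega>. (inner (X \<omega>) f)\<^sup>2)"
  using integrable_inner_inner[of f f] by (simp add: power2_eq_square)

lemma inner_X_int: "integrable M (\<lambda>\<omega>. inner (X \<omega>) f)"
  by (rule square_integrable_imp_integrable[OF _ inner_X_sq]) measurable

lemma noise_X:
  shows "integrable M (\<lambda>\<omega>. \<epsilon> \<omega> * inner (X \<omega>) f)" "expectation (\<lambda>\<omega>. \<epsilon> \<omega> * inner (X \<omega>) f) = 0"
    "integrable M (\<lambda>\<omega>. (\<epsilon> \<omega> * inner (X \<omega>) f)\<^sup>2)"
    "expectation (\<lambda>\<omega>. (\<epsilon> \<omega> * inner (X \<omega>) f)\<^sup>2) = \<sigma>\<^sup>2 * expectation (\<lambda>\<omega>. (inner (X \<omega>) f)\<^sup>2)"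
proof -
  have 1: "indep_var borel (\<lambda>\<omega>. inner (X \<omega>) f) borel \<epsilon>"
    by (rule indep_X_noise[of "\<lambda>v. inner v f" "\<lambda>r. r"]) measurable
  show "integrable M (\<lambda>\<omega>. \<epsilon> \<omega> * inner (X \<omega>) f)"
    using indep_var_integrable[OF 1 inner_X_int noise(2)] by (simp add: mult.commute)
  show "expectation (\<lambda>\<omega>. \<epsilon> \<omega> * inner (X \<omega>) f) = 0"
    using indep_var_lebesgue_integral[OF 1 inner_X_int noise(2)] noise(3) by (simp add: mult.commute)
  have 2: "indep_var borel (\<lambda>\<omega>. (inner (X \<omega>) f)\<^sup>2) borel (\<lambda>\<omega>. (\<epsilon> \<omega>)\<^sup>2)"
    by (rule indep_X_noise[of "\<lambda>v. (inner v f)\<^sup>2" "\<lambda>r. r\<^sup>2"]) measurable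
  show "integrable M (\<lambda>\<omega>. (\<epsilon> \<omega> * inner (X \<omega>) f)\<^sup>2)"
    using indep_var_integrable[OF 2 inner_X_sq noise(4)] by (simp add: power_mult_distrib mult.commute)
  show "expectation (\<lambda>\<omega>. (\<epsilon> \<omega> * inner (X \<omega>) f)\<^sup>2) = \<sigma>\<^sup>2 * expectation (\<lambda>\<omega>. (inner (X \<omega>) f)\<^sup>2)"
    using indep_var_lebesgue_integral[OF 2 inner_X_sq noise(4)] noise_sq
    by (simp add: power_mult_distrib mult.commute)
qed

text \<open>The arithmetic-geometric inequality with weights B/A and A/B balances the two fourth
  moments so that exactly the product A B remains. Positive upper bounds are used in place of the
  second moments so that the weights make sense when a variance vanishes.\<close>

lemma moment_product:
  assumes uv: "u \<in> L2_on S" "v \<in> L2_on S" and AB: "A > 0" "B > 0"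
    and le: "expectation (\<lambda>\<omega>. (inner (X \<omega>) u)\<^sup>2) \<le> A" "expectation (\<lambda>\<omega>. (inner (X \<omega>) v)\<^sup>2) \<le> B"
  shows "integrable M (\<lambda>\<omega>. (inner (X \<omega>) u * inner (X \<omega>) v)\<^sup>2)"
    "expectation (\<lambda>\<omega>. (inner (X \<omega>) u * inner (X \<omega>) v)\<^sup>2) \<le> d\<^sub>1 * (A * B)"
proof -
  define D where "D \<omega> = (B / A) / 2 * (inner (X \<omega>) u) ^ 4 + (A / B) / 2 * (inner (X \<omega>) v) ^ 4" for \<omega>
  have int: "integrable M (\<lambda>\<omega>. (inner (X \<omega>) u) ^ 4)" "integrable M (\<lambda>\<omega>. (inner (X \<omega>) v) ^ 4)"
    using moment(2) uv by auto
  have D_int: "integrable M D" unfolding D_def using int by simp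
  have le_D: "(inner (X \<omega>) u * inner (X \<omega>) v)\<^sup>2 \<le> D \<omega>" for \<omega>
  proof -
    define p where "p = (inner (X \<omega>) u)\<^sup>2"
    define q where "q = (inner (X \<omega>) v)\<^sup>2"
    have "0 \<le> (sqrt (B / A) * p - sqrt (A / B) * q)\<^sup>2" by simp
    also have "\<dots> = (B / A) * p\<^sup>2 + (A / B) * q\<^sup>2 - 2 * ((sqrt (B / A) * sqrt (A / B)) * (p * q))"
      using AB by (simp add: power2_diff power_mult_distrib)
    also have "sqrt (B / A) * sqrt (A / B) = 1" using AB by (simp flip: real_sqrt_mult)
    finally have "p * q \<le> (B / A) / 2 * p\<^sup>2 + (A / B) / 2 * q\<^sup>2" by simp
    then show ?thesis by (simp add: D_def p_def q_def power_mult_distrib flip: power_mult)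
  qed
  show "integrable M (\<lambda>\<omega>. (inner (X \<omega>) u * inner (X \<omega>) v)\<^sup>2)"
    by (rule Bochner_Integration.integrable_bound[OF D_int])
      (use le_D in \<open>auto intro!: AE_I2 simp: order_trans[OF _ abs_ge_self]\<close>)
  then have "expectation (\<lambda>\<omega>. (inner (X \<omega>) u * inner (X \<omega>) v)\<^sup>2) \<le> expectation D"
    by (intro integral_mono D_int le_D)
  also have "\<dots> = (B / A) / 2 * expectation (\<lambda>\<omega>. (inner (X \<omega>) u) ^ 4) + (A / B) / 2 * expectation (\<lambda>\<omega>. (inner (X \<omega>) v) ^ 4)"
    unfolding D_def using int by simp
  also have "\<dots> \<le> (B / A) / 2 * (d\<^sub>1 * A\<^sup>2) + (A / B) / 2 * (d\<^sub>1 * B\<^sup>2)"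
  proof (intro add_mono mult_left_mono)
    have "(expectation (\<lambda>\<omega>. (inner (X \<omega>) u)\<^sup>2))\<^sup>2 \<le> A\<^sup>2" by (intro power_mono le) simp
    then show "expectation (\<lambda>\<omega>. (inner (X \<omega>) u) ^ 4) \<le> d\<^sub>1 * A\<^sup>2"
      using moment uv(1) by (meson mult_left_mono less_imp_le order_trans)
    have "(expectation (\<lambda>\<omega>. (inner (X \<omega>) v)\<^sup>2))\<^sup>2 \<le> B\<^sup>2" by (intro power_mono le) simp
    then show "expectation (\<lambda>\<omega>. (inner (X \<omega>) v) ^ 4) \<le> d\<^sub>1 * B\<^sup>2"
      using moment uv(2) by (meson mult_left_mono less_imp_le order_trans)
  qed (use AB in auto)
  also have "\<dots> = d\<^sub>1 * (A * B)" using AB by (simp add: power2_eq_square)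
  finally show "expectation (\<lambda>\<omega>. (inner (X \<omega>) u * inner (X \<omega>) v)\<^sup>2) \<le> d\<^sub>1 * (A * B)" .
qed

lemma X_psi_psi: "expectation (\<lambda>\<omega>. inner (X \<omega>) u * inner (X \<omega>) (\<psi> j)) = x j * inner u (\<psi> j)"
  using inner_C[of u "\<psi> j"] by (simp add: C_sym C_psi)

text \<open>Coordinate j of the adjoint image of the covariate, written as a function of the
  observed pair so that the results on i.i.d. averages apply to it.\<close>

definition zf :: "nat \<Rightarrow> 'a L2 \<times> real \<Rightarrow> real" where
  "zf j p = sqrt (m j) * inner (fst p) (\<psi> j)"

text \<open>The residual of an observation when \<open>w\<close> is used as slope function.\<close>

definition yf :: "'a L2 \<Rightarrow> 'a L2 \<times> real \<Rightarrow> real" where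
  "yf w p = snd p - inner (fst p) w"

lemma zf_meas: "zf j \<in> borel_measurable (borel \<Otimes>\<^sub>M borel)"
  unfolding zf_def by measurable

lemma yf_meas: "yf w \<in> borel_measurable (borel \<Otimes>\<^sub>M borel)"
  unfolding yf_def by measurable

lemma zf_moments:
  "integrable M (\<lambda>\<omega>. (zf j (X \<omega>, Y \<omega>) * zf i (X \<omega>, Y \<omega>))\<^sup>2)"
  "expectation (\<lambda>\<omega>. (zf j (X \<omega>, Y \<omega>) * zf i (X \<omega>, Y \<omega>))\<^sup>2) \<le> d\<^sub>1 * (a j * a i)"
  "expectation (\<lambda>\<omega>. zf j (X \<omega>, Y \<omega>) * zf i (X \<omega>, Y \<omega>)) = (if j = i then a j else 0)"
proof -
  have s2: "expectation (\<lambda>\<omega>. (inner (X \<omega>) (\<psi> j))\<^sup>2) \<le> x j" for j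
    using X_psi_psi[of "\<psi> j" j] by (simp add: power2_eq_square inner_orthonormal[OF \<psi>])
  note mp = moment_product[OF psi_mem[of j] psi_mem[of i] x_pos[of j] x_pos[of i] s2 s2]
  have eq: "(zf j (X \<omega>, Y \<omega>) * zf i (X \<omega>, Y \<omega>))\<^sup>2 = (m j * m i) * (inner (X \<omega>) (\<psi> j) * inner (X \<omega>) (\<psi> i))\<^sup>2" for \<omega>
    using m_pos[of i] m_pos[of j] by (simp add: zf_def power_mult_distrib)
  show "integrable M (\<lambda>\<omega>. (zf j (X \<omega>, Y \<omega>) * zf i (X \<omega>, Y \<omega>))\<^sup>2)"
    unfolding eq by (intro integrable_mult_right mp)
  have "expectation (\<lambda>\<omega>. (zf j (X \<omega>, Y \<omega>) * zf i (X \<omega>, Y \<omega>))\<^sup>2)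
      = (m j * m i) * expectation (\<lambda>\<omega>. (inner (X \<omega>) (\<psi> j) * inner (X \<omega>) (\<psi> i))\<^sup>2)"
    unfolding eq by simp
  also have "\<dots> \<le> (m j * m i) * (d\<^sub>1 * (x j * x i))"
    using mp(2) m_pos[of i] m_pos[of j] by (intro mult_left_mono) auto
  finally show "expectation (\<lambda>\<omega>. (zf j (X \<omega>, Y \<omega>) * zf i (X \<omega>, Y \<omega>))\<^sup>2) \<le> d\<^sub>1 * (a j * a i)"
    by (simp add: a_def mult_ac)
  have "expectation (\<lambda>\<omega>. zf j (X \<omega>, Y \<omega>) * zf i (X \<omega>, Y \<omega>))
      = expectation (\<lambda>\<omega>. (sqrt (m j) * sqrt (m i)) * (inner (X \<omega>) (\<psi> j) * inner (X \<omega>) (\<psi> i)))"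
    by (simp add: zf_def mult_ac)
  also have "\<dots> = (sqrt (m j) * sqrt (m i)) * (x i * inner (\<psi> j) (\<psi> i))" by (simp add: X_psi_psi)
  finally show "expectation (\<lambda>\<omega>. zf j (X \<omega>, Y \<omega>) * zf i (X \<omega>, Y \<omega>)) = (if j = i then a j else 0)"
    using m_pos[of j] by (auto simp: inner_orthonormal[OF \<psi>] a_def)
qed

text \<open>The residual is the independent noise plus the inner product of \<open>X\<close> with
  \<open>\<beta>\<^sub>0 - w\<close>. The noise part is centred against \<open>X\<close>, so the
  mean is a coordinate of the covariance applied to the approximation error alone.\<close>

lemma residual_moments:
  assumes u: "w \<in> L2_on S" and U: "norm (\<beta>\<^sub>0 - w) \<le> U"
  defines "d' \<equiv> 2 * d\<^sub>1 * (expectation (\<lambda>\<omega>. (norm (X \<omega>))\<^sup>2) * U\<^sup>2 + 1) + 2 * \<sigma>\<^sup>2"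
  shows "integrable M (\<lambda>\<omega>. (yf w (X \<omega>, Y \<omega>) * zf j (X \<omega>, Y \<omega>))\<^sup>2)"
    "expectation (\<lambda>\<omega>. (yf w (X \<omega>, Y \<omega>) * zf j (X \<omega>, Y \<omega>))\<^sup>2) \<le> d' * a j"
    "expectation (\<lambda>\<omega>. yf w (X \<omega>, Y \<omega>) * zf j (X \<omega>, Y \<omega>)) = sqrt (m j) * (x j * inner (\<beta>\<^sub>0 - w) (\<psi> j))"
proof -
  define b where "b = \<beta>\<^sub>0 - w"
  have bS: "b \<in> L2_on S" unfolding b_def by (intro L2_on_diff beta u)
  define E2 where "E2 = expectation (\<lambda>\<omega>. (norm (X \<omega>))\<^sup>2)"
  \<comment> \<open>The summand 1 keeps the bound positive, as \<open>moment_product\<close>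
    requires, even when \<open>U\<close> or the second moment is 0.\<close>
  define A where "A = E2 * U\<^sup>2 + 1"
  have E2: "0 \<le> E2" by (simp add: E2_def)
  have A: "A > 0" using E2 by (simp add: A_def add_nonneg_pos)
  have "expectation (\<lambda>\<omega>. (inner (X \<omega>) b)\<^sup>2) \<le> expectation (\<lambda>\<omega>. (norm (X \<omega>))\<^sup>2 * U\<^sup>2)"
  proof (intro integral_mono inner_X_sq)
    fix \<omega>
    have "\<bar>inner (X \<omega>) b\<bar> \<le> norm (X \<omega>) * norm b" by (rule Cauchy_Schwarz_ineq2)
    also have "\<dots> \<le> norm (X \<omega>) * U" using U by (intro mult_left_mono) (auto simp: b_def)
    finally have "\<bar>inner (X \<omega>) b\<bar>\<^sup>2 \<le> (norm (X \<omega>) * U)\<^sup>2" by (intro power_mono) auto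
    then show "(inner (X \<omega>) b)\<^sup>2 \<le> (norm (X \<omega>))\<^sup>2 * U\<^sup>2" by (simp add: power_mult_distrib)
  qed (use X in simp)
  then have Eb: "expectation (\<lambda>\<omega>. (inner (X \<omega>) b)\<^sup>2) \<le> A" by (simp add: A_def E2_def)
  have s2: "expectation (\<lambda>\<omega>. (inner (X \<omega>) (\<psi> j))\<^sup>2) = x j"
    using X_psi_psi[of "\<psi> j" j] by (simp add: power2_eq_square inner_orthonormal[OF \<psi>])
  note mp = moment_product[OF bS psi_mem[of j] A x_pos[of j] Eb eq_refl[OF s2]]
  have y: "yf w (X \<omega>, Y \<omega>) = inner (X \<omega>) b + \<epsilon> \<omega>" if "\<omega> \<in> space M" for \<omega>
    using model that by (simp add: yf_def b_def inner_diff_right)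
  have yz: "yf w (X \<omega>, Y \<omega>) * zf j (X \<omega>, Y \<omega>)
      = sqrt (m j) * (inner (X \<omega>) b * inner (X \<omega>) (\<psi> j) + \<epsilon> \<omega> * inner (X \<omega>) (\<psi> j))" if "\<omega> \<in> space M" for \<omega>
    using y[OF that] by (simp add: zf_def algebra_simps)
  have yz_meas: "(\<lambda>\<omega>. yf w (X \<omega>, Y \<omega>) * zf j (X \<omega>, Y \<omega>)) \<in> borel_measurable M"
    unfolding yf_def zf_def by measurable
  define D where "D \<omega> = m j * (2 * (inner (X \<omega>) b * inner (X \<omega>) (\<psi> j))\<^sup>2 + 2 * (\<epsilon> \<omega> * inner (X \<omega>) (\<psi> j))\<^sup>2)" for \<omega>
  have D_int: "integrable M D" unfolding D_def using mp(1) noise_X(3) by simp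
  have le_D: "(yf w (X \<omega>, Y \<omega>) * zf j (X \<omega>, Y \<omega>))\<^sup>2 \<le> D \<omega>" if "\<omega> \<in> space M" for \<omega>
  proof -
    have sq: "(p + q)\<^sup>2 \<le> 2 * p\<^sup>2 + 2 * q\<^sup>2" for p q :: real
      using zero_le_power2[of "p - q"] by (simp add: power2_eq_square algebra_simps)
    have "(yf w (X \<omega>, Y \<omega>) * zf j (X \<omega>, Y \<omega>))\<^sup>2
        = m j * (inner (X \<omega>) b * inner (X \<omega>) (\<psi> j) + \<epsilon> \<omega> * inner (X \<omega>) (\<psi> j))\<^sup>2"
      unfolding yz[OF that] power_mult_distrib[of "sqrt (m j)"] using m_pos[of j] by simp
    also have "\<dots> \<le> D \<omega>"
      unfolding D_def using m_pos[of j] by (intro mult_left_mono sq) simp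
    finally show ?thesis .
  qed
  show int: "integrable M (\<lambda>\<omega>. (yf w (X \<omega>, Y \<omega>) * zf j (X \<omega>, Y \<omega>))\<^sup>2)"
    by (rule Bochner_Integration.integrable_bound[OF D_int])
      (use le_D yz_meas in \<open>auto intro!: AE_I2 simp: order_trans[OF _ abs_ge_self]\<close>)
  have "expectation (\<lambda>\<omega>. (yf w (X \<omega>, Y \<omega>) * zf j (X \<omega>, Y \<omega>))\<^sup>2) \<le> expectation D"
    by (intro integral_mono int D_int le_D)
  also have "\<dots> = m j * (2 * expectation (\<lambda>\<omega>. (inner (X \<omega>) b * inner (X \<omega>) (\<psi> j))\<^sup>2)
      + 2 * expectation (\<lambda>\<omega>. (\<epsilon> \<omega> * inner (X \<omega>) (\<psi> j))\<^sup>2))"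
    unfolding D_def using mp(1) noise_X(3) by simp
  also have "\<dots> \<le> m j * (2 * (d\<^sub>1 * (A * x j)) + 2 * (\<sigma>\<^sup>2 * x j))"
    using mp(2) m_pos[of j] by (intro mult_left_mono add_mono) (auto simp: noise_X(4) s2)
  also have "\<dots> = d' * a j" by (simp add: d'_def A_def E2_def a_def algebra_simps)
  finally show "expectation (\<lambda>\<omega>. (yf w (X \<omega>, Y \<omega>) * zf j (X \<omega>, Y \<omega>))\<^sup>2) \<le> d' * a j" .
  have "expectation (\<lambda>\<omega>. yf w (X \<omega>, Y \<omega>) * zf j (X \<omega>, Y \<omega>))
      = expectation (\<lambda>\<omega>. sqrt (m j) * (inner (X \<omega>) b * inner (X \<omega>) (\<psi> j) + \<epsilon> \<omega> * inner (X \<omega>) (\<psi> j)))"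
    by (intro Bochner_Integration.integral_cong refl yz)
  also have "\<dots> = sqrt (m j) * (x j * inner b (\<psi> j))"
    by (simp add: integrable_inner_inner noise_X X_psi_psi)
  finally show "expectation (\<lambda>\<omega>. yf w (X \<omega>, Y \<omega>) * zf j (X \<omega>, Y \<omega>)) = sqrt (m j) * (x j * inner (\<beta>\<^sub>0 - w) (\<psi> j))"
    by (simp add: b_def)
qed

lemma AE_event:
  assumes "AE \<omega> in M. P \<omega>"
  shows "\<exists>F\<in>sets M. prob F = 1 \<and> (\<forall>\<omega>\<in>F. P \<omega>)"
proof -
  obtain N where N: "{\<omega> \<in> space M. \<not> P \<omega>} \<subseteq> N" "emeasure M N = 0" "N \<in> sets M"
    using AE_E[OF assms] by blast
  then have "prob (space M - N) = 1" using prob_compl[OF N(3)] by (simp add: emeasure_eq_measure)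
  then show ?thesis using N by (intro bexI[of _ "space M - N"]) auto
qed

lemma decay_a: "power_decay (t + c) (\<lambda>i. \<mu> i * \<xi> i)"
  by (rule power_decay_mult[OF decay(3,4)])

lemma a_eq: "a j = \<mu> (Suc j) * \<xi> (Suc j)"
  by (simp add: a_def m_def x_def)

lemma summable_a: "summable a"
  using power_decay_summable[OF decay_a] decay(1,2) by (simp add: a_eq[abs_def])

text \<open>All that the pathwise analysis needs to know about the sample, at inflated level
  \<open>K * L\<close> but with right-hand sides in powers of \<open>L\<close>. The filter does not
  occur, so such samples can be collected in an event even if the estimator is not
  measurable.\<close>

definition good_sample :: "real \<Rightarrow> real \<Rightarrow> real \<Rightarrow> real \<Rightarrow> nat \<Rightarrow> real \<Rightarrow> 'h \<Rightarrow> 'w \<Rightarrow> bool" where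
  "good_sample K B V q n L b \<omega> \<longleftrightarrow>
      (\<forall>s\<in>real_spectrum (RKHS_empirical_covariance S evalf Xs n \<omega>). 0 \<le> s \<and> ereal s \<le> \<eta>) \<and>
      (\<forall>i\<in>{1..n}. expands e (adjoint J (Xs i \<omega>))) \<and>
      (\<exists>R. (\<forall>j N. (\<Sum>i<N. ((if j = i then a j else 0) - 1 / real n * (\<Sum>r=1..n.
              inner (adjoint J (Xs r \<omega>)) (e j) * inner (adjoint J (Xs r \<omega>)) (e i)))\<^sup>2 / (a i + K * L)) \<le> R j)
          \<and> (\<forall>N. (\<Sum>j<N. R j / (a j + K * L)) \<le> 1 / 4) \<and> (\<forall>N. (\<Sum>j<N. R j) \<le> B * L powr (2 * q + 1))) \<and>
      (\<forall>N. (\<Sum>j<N. (1 / real n * (\<Sum>r=1..n. (Ys r \<omega> - inner (Xs r \<omega>) (J b))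
              * inner (adjoint J (Xs r \<omega>)) (e j)))\<^sup>2 / (a j + K * L)) \<le> V * L powr (2 * q + 1))"

definition est :: "nat \<Rightarrow> real \<Rightarrow> 'w \<Rightarrow> 'h" where
  "est n L \<omega> = spectral_estimator S evalf (g L) Xs Ys n \<omega>"

text \<open>The parameter selects the norm: 0 stands for the RKHS norm of part (b), and 1/2 for the
  energy form weighted by a_j + L, from which the L2 norm of part (a) is recovered.\<close>

definition small_error :: "real \<Rightarrow> real \<Rightarrow> real \<Rightarrow> real \<Rightarrow> 'h \<Rightarrow> bool" where
  "small_error p0 C\<^sub>e q L v \<longleftrightarrow> expands e v \<and> (p0 = 0 \<longrightarrow> norm v \<le> C\<^sub>e * L powr q) \<and>
     (p0 = 1 / 2 \<longrightarrow> (\<forall>N. (\<Sum>j<N. (a j + L) * (inner v (e j))\<^sup>2) \<le> C\<^sub>e * L powr (2 * q + 1)))"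

text \<open>The failure probability 1 - \<delta> is split into three equal shares: \<open>K\<close>
  pays for the two-sided deviation, \<open>B\<close> for the one-sided deviation and
  \<open>V\<close> for the noise. The remaining requirements hold almost surely and cost
  nothing.\<close>

lemma core_event:
  fixes L :: "nat \<Rightarrow> real" and b :: "nat \<Rightarrow> 'h" and q U C\<^sub>b \<delta> :: real
  assumes L: "\<And>n. 1 \<le> n \<Longrightarrow> 0 < L n"
      "\<And>n. 1 \<le> n \<Longrightarrow> L n powr (- (1 / (t + c))) / real n = L n powr (2 * q + 1)"
      "\<And>n. 1 \<le> n \<Longrightarrow> L n powr (- (2 / (t + c))) \<le> real n"
    and U: "\<And>n. 1 \<le> n \<Longrightarrow> norm (\<beta>\<^sub>0 - J (b n)) \<le> U" and Cb: "0 \<le> C\<^sub>b"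
    and bias: "\<And>n N. 1 \<le> n \<Longrightarrow>
      (\<Sum>j<N. a j * x j * (inner (\<beta>\<^sub>0 - J (b n)) (\<psi> j))\<^sup>2 / (a j + L n)) \<le> C\<^sub>b * L n powr (2 * q + 1)"
    and \<delta>: "\<delta> < 1"
  shows "\<exists>K\<ge>1. \<exists>B>0. \<exists>V>0. \<forall>n\<ge>1. \<exists>F\<in>sets M. prob F \<ge> \<delta> \<and> (\<forall>\<omega>\<in>F. good_sample K B V q n (L n) (b n) \<omega>)"
proof -
  define \<gamma> where "\<gamma> = t + c"
  have \<gamma>: "\<gamma> \<ge> 2" using decay(1,2) by (simp add: \<gamma>_def)
  obtain C\<^sub>0 where C0: "C\<^sub>0 > 0" "\<And>l N. l > 0 \<Longrightarrow> (\<Sum>j<N. a j / (a j + l)) \<le> C\<^sub>0 * l powr (- (1 / \<gamma>))"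
    using effective_dimension[OF decay_a] \<gamma> unfolding a_eq[symmetric] \<gamma>_def by blast
  define tr where "tr = (\<Sum>j. a j)"
  have tr: "(\<Sum>j<N. a j) \<le> tr" for N
    unfolding tr_def using summable_a a_pos by (intro sum_le_suminf) (auto simp: less_imp_le)
  have tr0: "0 \<le> tr" using tr[of 0] by simp
  define d' where "d' = 2 * d\<^sub>1 * (expectation (\<lambda>\<omega>. (norm (X \<omega>))\<^sup>2) * U\<^sup>2 + 1) + 2 * \<sigma>\<^sup>2"
  have d': "0 \<le> d'" using moment(1) unfolding d'_def by (intro add_nonneg_nonneg mult_nonneg_nonneg) auto
  have d1: "0 \<le> d\<^sub>1" using moment(1) by simp
  \<comment> \<open>Inflating the level by \<open>K\<close> shrinks the squared effective dimension
    by K^(-2/\<gamma>); the power \<gamma>/2 solves for the share allotted to the two-sided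
    deviation. The maximum keeps the level from dropping below \<open>L n\<close>.\<close>
  define K where "K = max 1 ((12 * d\<^sub>1 * C\<^sub>0\<^sup>2 / (1 - \<delta>)) powr (\<gamma> / 2))"
  have K: "K \<ge> 1" by (simp add: K_def)
  have K2: "12 * d\<^sub>1 * C\<^sub>0\<^sup>2 * K powr (- (2 / \<gamma>)) \<le> 1 - \<delta>"
  proof -
    define v where "v = 12 * d\<^sub>1 * C\<^sub>0\<^sup>2 / (1 - \<delta>)"
    have v: "v > 0" using moment(1) C0 \<delta> by (simp add: v_def)
    have "v = (v powr (\<gamma> / 2)) powr (2 / \<gamma>)" using v \<gamma> by (simp add: powr_powr)
    also have "\<dots> \<le> K powr (2 / \<gamma>)" using \<gamma> by (intro powr_mono2) (auto simp: K_def v_def)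
    finally have "12 * d\<^sub>1 * C\<^sub>0\<^sup>2 \<le> (1 - \<delta>) * K powr (2 / \<gamma>)"
      using \<delta> by (simp add: v_def divide_le_eq mult.commute)
    then have "12 * d\<^sub>1 * C\<^sub>0\<^sup>2 * K powr (- (2 / \<gamma>)) \<le> (1 - \<delta>) * K powr (2 / \<gamma>) * K powr (- (2 / \<gamma>))"
      by (intro mult_right_mono) auto
    also have "\<dots> = 1 - \<delta>" using K by (simp add: powr_add[symmetric] mult.assoc)
    finally show ?thesis .
  qed
  \<comment> \<open>Three times the expected size divided by 1 - \<delta>, as Markov's inequality
    with a third of the budget requires; adding 1 guarantees positivity. The same holds for
    \<open>V\<close>.\<close>
  define B where "B = 3 * d\<^sub>1 * C\<^sub>0 * tr / (1 - \<delta>) + 1"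
  define V where "V = 3 * (C\<^sub>b + d' * C\<^sub>0) / (1 - \<delta>) + 1"
  have scale: "(1 - \<delta>) * (Z / (1 - \<delta>) + 1) = Z + (1 - \<delta>)" for Z
    using \<delta> by (simp add: distrib_left)
  have B: "B > 0" "d\<^sub>1 * C\<^sub>0 * tr / B \<le> (1 - \<delta>) / 3"
  proof -
    have "0 \<le> 3 * d\<^sub>1 * C\<^sub>0 * tr / (1 - \<delta>)" using d1 C0 tr0 \<delta> by simp
    then show "B > 0" by (simp add: B_def)
    moreover have "(1 - \<delta>) * B = 3 * d\<^sub>1 * C\<^sub>0 * tr + (1 - \<delta>)" unfolding B_def by (rule scale)
    then have "3 * d\<^sub>1 * C\<^sub>0 * tr \<le> (1 - \<delta>) * B" using \<delta> by linarith
    ultimately show "d\<^sub>1 * C\<^sub>0 * tr / B \<le> (1 - \<delta>) / 3" by (simp add: field_simps)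
  qed
  have V: "V > 0" "(C\<^sub>b + d' * C\<^sub>0) / V \<le> (1 - \<delta>) / 3"
  proof -
    have "0 \<le> 3 * (C\<^sub>b + d' * C\<^sub>0) / (1 - \<delta>)" using Cb d' C0 \<delta> by simp
    then show "V > 0" by (simp add: V_def)
    moreover have "(1 - \<delta>) * V = 3 * (C\<^sub>b + d' * C\<^sub>0) + (1 - \<delta>)" unfolding V_def by (rule scale)
    then have "3 * (C\<^sub>b + d' * C\<^sub>0) \<le> (1 - \<delta>) * V" using \<delta> by linarith
    ultimately show "(C\<^sub>b + d' * C\<^sub>0) / V \<le> (1 - \<delta>) / 3" by (simp add: field_simps)
  qed
  have main: "\<exists>F\<in>sets M. prob F \<ge> \<delta> \<and> (\<forall>\<omega>\<in>F. good_sample K B V q n (L n) (b n) \<omega>)"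
    if n: "1 \<le> n" for n
  proof -
    define w where "w = J (b n)"
    have wS: "w \<in> L2_on S" unfolding w_def by (rule J_mem)
    define \<rho> where "\<rho> = L n powr (2 * q + 1)"
    have \<rho>: "\<rho> > 0" using L(1)[OF n] by (simp add: \<rho>_def)
    define l where "l = K * L n"
    have l: "l > 0" "l \<ge> L n" using K L(1)[OF n] by (simp_all add: l_def)
    define Nl where "Nl = C\<^sub>0 * l powr (- (1 / \<gamma>))"
    have Nl: "(\<Sum>j<N. a j / (a j + l)) \<le> Nl" for N unfolding Nl_def by (rule C0(2)[OF l(1)])
    have Nl0: "0 \<le> Nl" using C0 by (simp add: Nl_def)
    have Nl1: "Nl / real n \<le> C\<^sub>0 * \<rho>"
    proof -
      have "l powr (- (1 / \<gamma>)) \<le> L n powr (- (1 / \<gamma>))"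
        using l L(1)[OF n] \<gamma> by (intro powr_mono2') auto
      then have "Nl / real n \<le> C\<^sub>0 * (L n powr (- (1 / \<gamma>)) / real n)"
        using C0 n by (simp add: Nl_def divide_right_mono mult_left_mono)
      then show ?thesis using L(2)[OF n] by (simp add: \<rho>_def \<gamma>_def)
    qed
    \<comment> \<open>The squared effective dimension at level \<open>L n\<close> is at most of
      order n, which cancels the sample size; hence no lower bound on n beyond 1 is needed.\<close>
    have Nl2: "d\<^sub>1 * Nl\<^sup>2 / real n * 4 \<le> (1 - \<delta>) / 3"
    proof -
      have "Nl\<^sup>2 = C\<^sub>0\<^sup>2 * (K powr (- (2 / \<gamma>)) * L n powr (- (2 / \<gamma>)))"
      proof -
        have "(l powr (- (1 / \<gamma>)))\<^sup>2 = l powr (- (2 / \<gamma>))"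
          by (simp add: power2_eq_square powr_add[symmetric])
        also have "\<dots> = K powr (- (2 / \<gamma>)) * L n powr (- (2 / \<gamma>))"
          using K L(1)[OF n] by (simp add: l_def powr_mult)
        finally show ?thesis by (simp add: Nl_def power_mult_distrib)
      qed
      also have "\<dots> \<le> C\<^sub>0\<^sup>2 * (K powr (- (2 / \<gamma>)) * real n)"
        using L(3)[OF n] by (intro mult_left_mono) (auto simp: \<gamma>_def)
      finally have "d\<^sub>1 * Nl\<^sup>2 / real n * 4 \<le> d\<^sub>1 * (C\<^sub>0\<^sup>2 * (K powr (- (2 / \<gamma>)) * real n)) / real n * 4"
        using d1 by (intro mult_right_mono divide_right_mono mult_left_mono) auto
      also have "\<dots> = 4 * d\<^sub>1 * C\<^sub>0\<^sup>2 * K powr (- (2 / \<gamma>))" using n by simp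
      finally show ?thesis using K2 by simp
    qed
    have Uw: "norm (\<beta>\<^sub>0 - w) \<le> U" unfolding w_def by (rule U[OF n])
    note rm = residual_moments[OF wS Uw, folded d'_def]
    have "\<exists>F\<in>sets M. prob F \<ge> 1 - (d\<^sub>1 * Nl\<^sup>2 / real n * 4 + d\<^sub>1 * Nl * tr / real n / (B * \<rho>)
        + (C\<^sub>b * \<rho> + d' * Nl / real n) / (V * \<rho>))
      \<and> (\<forall>\<omega>\<in>F.
       (\<exists>R. (\<forall>j N. (\<Sum>i<N. ((if j = i then a j else 0)
              - 1 / real n * (\<Sum>r=1..n. zf j (Xs r \<omega>, Ys r \<omega>) * zf i (Xs r \<omega>, Ys r \<omega>)))\<^sup>2 / (a i + l)) \<le> R j)
          \<and> (\<forall>N. (\<Sum>j<N. R j / (a j + l)) \<le> 1 / 4) \<and> (\<forall>N. (\<Sum>j<N. R j) \<le> B * \<rho>))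
       \<and> (\<forall>N. (\<Sum>j<N. (1 / real n * (\<Sum>r=1..n. yf w (Xs r \<omega>, Ys r \<omega>) * zf j (Xs r \<omega>, Ys r \<omega>)))\<^sup>2 / (a j + l)) \<le> V * \<rho>))"
    proof (rule sampling_event[where W = "\<lambda>i \<omega>. (Xs i \<omega>, Ys i \<omega>)" and ?W0.0 = "\<lambda>\<omega>. (X \<omega>, Y \<omega>)"
          and z = zf and y = "yf w", OF iid(1) _ W0_meas zf_meas yf_meas zf_moments rm(1,2) n a_pos l(1) d1 d' Nl tr])
      show "distr M (borel \<Otimes>\<^sub>M borel) (\<lambda>\<omega>. (Xs i \<omega>, Ys i \<omega>)) = distr M (borel \<Otimes>\<^sub>M borel) (\<lambda>\<omega>. (X \<omega>, Y \<omega>))"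
        if "1 \<le> i" for i using iid(2) that by blast
      fix N
      have "(\<Sum>j<N. (expectation (\<lambda>\<omega>. yf w (X \<omega>, Y \<omega>) * zf j (X \<omega>, Y \<omega>)))\<^sup>2 / (a j + l))
          \<le> (\<Sum>j<N. a j * x j * (inner (\<beta>\<^sub>0 - w) (\<psi> j))\<^sup>2 / (a j + L n))"
      proof (rule sum_mono)
        fix j
        have "(expectation (\<lambda>\<omega>. yf w (X \<omega>, Y \<omega>) * zf j (X \<omega>, Y \<omega>)))\<^sup>2 = a j * x j * (inner (\<beta>\<^sub>0 - w) (\<psi> j))\<^sup>2"
          unfolding rm(3) using m_pos[of j] by (simp add: power_mult_distrib a_def power2_eq_square[of "x j"])
        moreover have "a j * x j * (inner (\<beta>\<^sub>0 - w) (\<psi> j))\<^sup>2 / (a j + l) \<le> a j * x j * (inner (\<beta>\<^sub>0 - w) (\<psi> j))\<^sup>2 / (a j + L n)"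
          using a_pos[of j] x_pos[of j] l L(1)[OF n] by (intro divide_left_mono mult_pos_pos add_pos_pos) auto
        ultimately show "(expectation (\<lambda>\<omega>. yf w (X \<omega>, Y \<omega>) * zf j (X \<omega>, Y \<omega>)))\<^sup>2 / (a j + l)
            \<le> a j * x j * (inner (\<beta>\<^sub>0 - w) (\<psi> j))\<^sup>2 / (a j + L n)" by simp
      qed
      also have "\<dots> \<le> C\<^sub>b * \<rho>" unfolding w_def \<rho>_def by (rule bias[OF n])
      finally show "(\<Sum>j<N. (expectation (\<lambda>\<omega>. yf w (X \<omega>, Y \<omega>) * zf j (X \<omega>, Y \<omega>)))\<^sup>2 / (a j + l)) \<le> C\<^sub>b * \<rho>" .
    qed (use B V \<rho> in auto)
    then obtain F where F: "F \<in> sets M"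
      "prob F \<ge> 1 - (d\<^sub>1 * Nl\<^sup>2 / real n * 4 + d\<^sub>1 * Nl * tr / real n / (B * \<rho>) + (C\<^sub>b * \<rho> + d' * Nl / real n) / (V * \<rho>))"
      "\<forall>\<omega>\<in>F.
       (\<exists>R. (\<forall>j N. (\<Sum>i<N. ((if j = i then a j else 0)
              - 1 / real n * (\<Sum>r=1..n. zf j (Xs r \<omega>, Ys r \<omega>) * zf i (Xs r \<omega>, Ys r \<omega>)))\<^sup>2 / (a i + l)) \<le> R j)
          \<and> (\<forall>N. (\<Sum>j<N. R j / (a j + l)) \<le> 1 / 4) \<and> (\<forall>N. (\<Sum>j<N. R j) \<le> B * \<rho>))
       \<and> (\<forall>N. (\<Sum>j<N. (1 / real n * (\<Sum>r=1..n. yf w (Xs r \<omega>, Ys r \<omega>) * zf j (Xs r \<omega>, Ys r \<omega>)))\<^sup>2 / (a j + l)) \<le> V * \<rho>)"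
      by blast
    have "d\<^sub>1 * Nl * tr / real n / (B * \<rho>) \<le> (1 - \<delta>) / 3"
    proof -
      have "d\<^sub>1 * Nl * tr / real n / (B * \<rho>) = d\<^sub>1 * tr * (Nl / real n) / (B * \<rho>)" by simp
      also have "\<dots> \<le> d\<^sub>1 * tr * (C\<^sub>0 * \<rho>) / (B * \<rho>)"
        using d1 tr0 B \<rho> Nl1 by (intro divide_right_mono mult_left_mono) auto
      also have "\<dots> = d\<^sub>1 * C\<^sub>0 * tr / B" using \<rho> by simp
      also note B(2)
      finally show ?thesis .
    qed
    moreover have "(C\<^sub>b * \<rho> + d' * Nl / real n) / (V * \<rho>) \<le> (1 - \<delta>) / 3"
    proof -
      have "(C\<^sub>b * \<rho> + d' * Nl / real n) / (V * \<rho>) = (C\<^sub>b * \<rho> + d' * (Nl / real n)) / (V * \<rho>)" by simp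
      also have "\<dots> \<le> (C\<^sub>b * \<rho> + d' * (C\<^sub>0 * \<rho>)) / (V * \<rho>)"
        using d' V \<rho> Nl1 by (intro divide_right_mono add_left_mono mult_left_mono) auto
      also have "\<dots> = (C\<^sub>b + d' * C\<^sub>0) * \<rho> / (V * \<rho>)" by (simp add: distrib_right)
      also have "\<dots> = (C\<^sub>b + d' * C\<^sub>0) / V" using \<rho> by simp
      also note V(2)
      finally show ?thesis .
    qed
    moreover have "\<delta> \<le> p" if "p \<ge> 1 - (u + v + w)" "u \<le> (1 - \<delta>) / 3" "v \<le> (1 - \<delta>) / 3" "w \<le> (1 - \<delta>) / 3"
      for p u v w :: real using that by argo
    ultimately have F1: "\<delta> \<le> prob F" using F(2) Nl2 by blast
    have "AE \<omega> in M. (\<forall>s\<in>real_spectrum (RKHS_empirical_covariance S evalf Xs n \<omega>). 0 \<le> s \<and> ereal s \<le> \<eta>)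
        \<and> (\<forall>i\<in>{1..n}. expands e (adjoint J (Xs i \<omega>)))"
    proof -
      have "AE \<omega> in M. \<forall>i\<in>{1..n}. expands e (adjoint J (Xs i \<omega>))"
        using expands_sample by (intro AE_finite_allI) auto
      with spec n show ?thesis by auto
    qed
    then obtain H where H: "H \<in> sets M" "prob H = 1"
      "\<forall>\<omega>\<in>H. (\<forall>s\<in>real_spectrum (RKHS_empirical_covariance S evalf Xs n \<omega>). 0 \<le> s \<and> ereal s \<le> \<eta>)
        \<and> (\<forall>i\<in>{1..n}. expands e (adjoint J (Xs i \<omega>)))"
      using AE_event by blast
    have "prob (F \<inter> H) \<ge> 1 - ((1 - \<delta>) + 0)" using F1 F(1) H by (intro prob_Int_ge) auto
    moreover have "zf j (Xs r \<omega>, Ys r \<omega>) = inner (adjoint J (Xs r \<omega>)) (e j)"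
      "yf w (Xs r \<omega>, Ys r \<omega>) = Ys r \<omega> - inner (Xs r \<omega>) (J (b n))" for j r \<omega>
      by (simp_all add: zf_def yf_def inner_adjoint_e w_def)
    ultimately show ?thesis
      using F(1,3) H(1,3) unfolding good_sample_def l_def \<rho>_def by (intro bexI[of _ "F \<inter> H"] conjI ballI) auto
  qed
  show ?thesis
    by (intro exI[of _ K] exI[of _ B] exI[of _ V] conjI K B(1) V(1)) (use main in blast)
qed

end

section \<open>Applying the filter to the sample vector\<close>

context empirical_form
begin

lemma A_calc_comp: "A (calc f u) = calc (\<lambda>s. s * f s) u"
  by (simp add: A_calc calc_calc)

lemma expands_calc:
  assumes "f 0 = 0"
  shows "expands e (calc f u)"
proof -
  \<comment> \<open>A filter vanishing at 0 factors through \<open>A\<close>, whose range consists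
    of sample vectors; at \<open>s = 0\<close> both sides are 0 by the convention for
    division.\<close>
  have "A (calc (\<lambda>s. f s / s) u) = calc f u"
    unfolding A_calc_comp by (intro calc_cong) (use assms in auto)
  then show ?thesis using A_expands[of "calc (\<lambda>s. f s / s) u"] by simp
qed

text \<open>The form of \<open>A\<close> at \<open>w\<close> is the mean of the squared inner
  products with the sample, so it vanishes only if each of them does.\<close>

lemma kernel_orthogonal:
  assumes "A w = 0" "i \<in> {1..n}"
  shows "inner (z i) w = 0"
proof -
  have n: "n > 0" using assms(2) by simp
  have "inner (A w) w = (1 / real n) * (\<Sum>i=1..n. (inner (z i) w)\<^sup>2)"
    unfolding A_sample by (simp add: inner_sum_left power2_eq_square)
  then have "(\<Sum>i=1..n. (inner (z i) w)\<^sup>2) = 0" using assms(1) n by simp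
  then show ?thesis using assms(2) by (simp add: sum_nonneg_eq_0_iff)
qed

text \<open>The sample lies in the range of \<open>A\<close>, so the value of the filter at \<open>0\<close> is irrelevant.\<close>

lemma calc_sample_cong:
  assumes "\<And>s. s \<in> Sp \<Longrightarrow> s \<noteq> 0 \<Longrightarrow> f s = g s" and x: "x = (\<Sum>i=1..n. y i *\<^sub>R z i)"
  shows "calc f x = calc g x"
proof -
  define d where "d s = f s - g s" for s
  define w where "w = calc d x"
  have "calc (\<lambda>s. s * d s) u = calc (\<lambda>s. 0) u" for u
    by (rule calc_cong) (use assms(1) in \<open>auto simp: d_def\<close>)
  then have "A (calc d w) = 0" unfolding A_calc_comp by (simp add: calc_def)
  then have "inner x (calc d w) = 0" unfolding x by (simp add: inner_sum_left kernel_orthogonal)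
  then have "inner w w = 0" by (simp add: calc_sym w_def)
  then have "calc d x = 0" by (simp add: w_def)
  moreover have "calc f x - calc g x = calc d x" by (simp add: calc_diff d_def[abs_def])
  ultimately show ?thesis by simp
qed

end

text \<open>The two bounds on the filter combine to (s + K l)|g| <= A + K B. For p = 0 the leftover
  factor |g| costs 1/l, while for p = 1/2 the combined bound is simply squared; the extra
  \<open>B\<close> lets one constant serve both cases.\<close>

lemma filter_bound:
  fixes g A B K l s p :: real
  assumes l: "l > 0" and K: "K \<ge> 1" and s: "s > 0" and A: "A > 0" "\<bar>s * g\<bar> \<le> A" and B: "B > 0" "\<bar>g\<bar> \<le> B / l"
    and p: "p = 0 \<or> p = 1 / 2"
  shows "(s + K * l) * ((s + K * l) powr p * g)\<^sup>2 \<le> (A + K * B + B)\<^sup>2 * l powr (2 * p - 1)"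
proof -
  have Kl: "K * l > 0" using K l by simp
  have lg: "l * \<bar>g\<bar> \<le> B" using B(2) l by (simp add: le_divide_eq mult.commute)
  have "(s + K * l) * \<bar>g\<bar> = \<bar>s * g\<bar> + K * (l * \<bar>g\<bar>)" using s by (simp add: abs_mult algebra_simps)
  also have "\<dots> \<le> A + K * B" using A lg K by (intro add_mono mult_left_mono) auto
  finally have 1: "(s + K * l) * \<bar>g\<bar> \<le> A + K * B" .
  have KB: "0 \<le> A + K * B" using A B K by simp
  from p show ?thesis
  proof
    assume "p = 0"
    have "(s + K * l) * ((s + K * l) powr p * g)\<^sup>2 = ((s + K * l) * \<bar>g\<bar>) * \<bar>g\<bar>"
      using s Kl \<open>p = 0\<close> by (simp add: power2_eq_square)
    also have "\<dots> \<le> (A + K * B) * (B / l)" using 1 B KB by (intro mult_mono) auto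
    also have "\<dots> \<le> ((A + K * B + B) * (A + K * B + B)) / l"
      using A B K KB l by (simp add: divide_right_mono mult_mono)
    also have "\<dots> = (A + K * B + B)\<^sup>2 * l powr (2 * p - 1)"
      using l \<open>p = 0\<close> by (simp add: power2_eq_square powr_minus_divide)
    finally show ?thesis .
  next
    assume p: "p = 1 / 2"
    have "((s + K * l) powr p)\<^sup>2 = (s + K * l) powr (p + p)" by (simp only: power2_eq_square powr_add)
    also have "\<dots> = s + K * l" using s Kl by (simp add: p)
    finally have "(s + K * l) * ((s + K * l) powr p * g)\<^sup>2 = ((s + K * l) * \<bar>g\<bar>)\<^sup>2"
      by (simp add: power_mult_distrib power2_eq_square[of "s + K * l"])
    also have "\<dots> \<le> (A + K * B + B)\<^sup>2" using 1 s Kl B by (intro power_mono) auto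
    also have "\<dots> = (A + K * B + B)\<^sup>2 * l powr (2 * p - 1)" using l by (simp add: p)
    finally show ?thesis .
  qed
qed

section \<open>Deterministic error analysis on a good sample\<close>

context functional_regression
begin

lemma empirical_operator:
  "RKHS_empirical_covariance S evalf Xs n \<omega> f
    = (1 / real n) *\<^sub>R (\<Sum>i=1..n. inner (adjoint J (Xs i \<omega>)) f *\<^sub>R adjoint J (Xs i \<omega>))"
proof -
  note lin = bounded_linear.linear[OF bounded_linear_adjoint[OF bounded_linear_J]]
  have "inner (Xs i \<omega>) (J f) = inner (adjoint J (Xs i \<omega>)) f" for i
    using adjoint_inner[OF bounded_linear_J, of f "Xs i \<omega>"] by (simp add: inner_commute)
  then show ?thesis
    by (simp add: RKHS_empirical_covariance_def empirical_covariance_def tensor_square_def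
        linear_scale[OF lin] linear_sum[OF lin])
qed

lemma empirical_rhs:
  "adjoint J (empirical_cross_covariance Xs Ys n \<omega>) = (1 / real n) *\<^sub>R (\<Sum>i=1..n. Ys i \<omega> *\<^sub>R adjoint J (Xs i \<omega>))"
proof -
  note lin = bounded_linear.linear[OF bounded_linear_adjoint[OF bounded_linear_J]]
  show ?thesis by (simp add: empirical_cross_covariance_def linear_scale[OF lin] linear_sum[OF lin])
qed

lemma eigenvalue_in_spectrum:
  assumes "linear A" "eigenspace A s \<noteq> {0}"
  shows "s \<in> real_spectrum A"
proof -
  obtain v where v: "A v = s *\<^sub>R v" "v \<noteq> 0"
    using assms(2) subspace_0[OF subspace_eigenspace[OF assms(1), of s]] by (auto simp: eigenspace_def)
  have False if "bounded_linear B" "\<forall>v. B (A v - s *\<^sub>R v) = v" for B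
    using that(2)[rule_format, of v] v linear_0[OF bounded_linear.linear[OF that(1)]] by simp
  then show ?thesis unfolding real_spectrum_def by blast
qed

text \<open>The constant is fixed before the sample size, the sample and the target
  \<open>b\<close>. For q >= 0 the source condition is transferred to the empirical operator by
  \<open>source_form_bound\<close>; for q < 0 the norm bound on \<open>b\<close> is the only
  information, and the residual has to supply just the power \<open>p0\<close> of the target
  norm.\<close>

lemma path_error:
  fixes q p0 p' w A\<^sub>g B\<^sub>g D K B V H :: real
  assumes bounds: "0 < A\<^sub>g" "0 < B\<^sub>g" "0 < D" "1 \<le> K" "0 < B" "0 < V" "0 \<le> H"
    and reg': "\<And>l s. 0 < l \<Longrightarrow> ereal l \<le> \<eta> \<Longrightarrow> 0 < s \<Longrightarrow> ereal s \<le> \<eta> \<Longrightarrow>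
        \<bar>s * g l s\<bar> \<le> A\<^sub>g \<and> \<bar>g l s\<bar> \<le> B\<^sub>g / l \<and> \<bar>1 - s * g l s\<bar> \<le> D"
    and qual': "\<And>l s. 0 < l \<Longrightarrow> ereal l \<le> \<eta> \<Longrightarrow> 0 < s \<Longrightarrow> ereal s \<le> \<eta> \<Longrightarrow>
        \<bar>1 - s * g l s\<bar> * s powr p' \<le> w * l powr p'"
    and p: "p0 = 0 \<or> p0 = 1 / 2" "max q 0 + p0 \<le> p'"
  shows "\<exists>C\<^sub>e>0. \<forall>n\<ge>1. \<forall>L \<omega> b hh. 0 < L \<longrightarrow> L \<le> 1 \<longrightarrow> ereal L \<le> \<eta> \<longrightarrow>
      good_sample K B V q n L b \<omega> \<longrightarrow> expands e b \<longrightarrow>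
      (0 \<le> q \<longrightarrow> (\<forall>j. inner b (e j) = a j powr q * hh j) \<and> (\<forall>N. (\<Sum>j<N. (hh j)\<^sup>2) \<le> H)) \<longrightarrow>
      (q < 0 \<longrightarrow> (norm b)\<^sup>2 \<le> H * L powr (2 * q)) \<longrightarrow>
      small_error p0 C\<^sub>e q L (b - est n L \<omega>)"
proof -
  obtain am where am: "\<And>j. a j \<le> am"
    using power_decay_bounded[OF decay_a] decay(1,2) unfolding a_eq by (metis One_nat_def Suc_le_mono add_nonneg_nonneg le0 less_imp_le order_less_trans zero_less_one)
  define \<Lambda> where "\<Lambda> = am + K"
  define mm where "mm = nat \<lfloor>q\<rfloor> + 1"
  define \<theta> where "\<theta> = q / real mm"
  obtain G where G: "G > 0" "\<And>y J. 0 < q \<Longrightarrow> 0 < y \<Longrightarrow> finite J \<Longrightarrow>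
       (\<Sum>k\<in>J. (2 powr real_of_int k) powr \<theta> * min (y / 2 powr real_of_int k) 1) \<le> G * y powr \<theta>"
  proof (cases "0 < q")
    case True
    then have "real mm > q" unfolding mm_def by linarith
    then have "0 < \<theta>" "\<theta> < 1" using True by (auto simp: \<theta>_def)
    then show thesis
    proof (rule dyadic_min_sum_bound)
      fix G assume "G > 0" "\<And>y J. 0 < y \<Longrightarrow> finite J \<Longrightarrow>
        (\<Sum>k\<in>J. (2 powr real_of_int k) powr \<theta> * min (y / 2 powr real_of_int k) 1) \<le> G * y powr \<theta>"
      then show thesis by (intro that[of G])
    qed
  next
    case False
    then show thesis using that[of 1] by simp
  qed
  define Cc where "Cc = H * (1 + 8 * (1 + comparison_const \<Lambda> B mm) * G)"
  \<comment> \<open>The power of s + l that the residual must compensate: the source exponent, if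
    positive, plus the weight of the norm in which the error is measured.\<close>
  define P where "P = max q 0 + p0"
  have P0: "0 \<le> P" using p by (auto simp: P_def)
  define Cr where "Cr = 2 powr P * (\<bar>w\<bar> + (1 + D) * K powr P)"
  have Cr0: "0 \<le> Cr" using bounds by (simp add: Cr_def)
  define Cg where "Cg = A\<^sub>g + K * B\<^sub>g + B\<^sub>g"
  have Cg0: "0 \<le> Cg" using bounds by (simp add: Cg_def)
  define C1 where "C1 = sqrt (max Cc H) * Cr"
  define C2 where "C2 = sqrt (2 * V) * Cg"
  have mx: "0 \<le> max Cc H" using bounds by simp
  have C10: "0 \<le> C1" using mx Cr0 by (simp add: C1_def)
  have C20: "0 \<le> C2" using bounds Cg0 by (simp add: C2_def)
  \<comment> \<open>One constant for both norms: the linear term serves the RKHS norm, twice the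
    square serves the energy form, and 1 ensures positivity.\<close>
  define Ce where "Ce = (C1 + C2) + 2 * (C1 + C2)\<^sup>2 + 1"
  have Ce: "Ce > 0" using C10 C20 by (simp add: Ce_def add_nonneg_pos)
  show ?thesis
  proof (rule exI[of _ Ce], intro conjI allI impI Ce)
    fix n :: nat and L \<omega> b hh
    let ?est = "est n L \<omega>"
    assume n: "1 \<le> n" and L: "0 < L" "L \<le> 1" "ereal L \<le> \<eta>"
      and good: "good_sample K B V q n L b \<omega>"
      and b: "expands e b"
      and bq: "0 \<le> q \<longrightarrow> (\<forall>j. inner b (e j) = a j powr q * hh j) \<and> (\<forall>N. (\<Sum>j<N. (hh j)\<^sup>2) \<le> H)"
      and bn: "q < 0 \<longrightarrow> (norm b)\<^sup>2 \<le> H * L powr (2 * q)"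
    from good obtain R where
      sp: "\<forall>s\<in>real_spectrum (RKHS_empirical_covariance S evalf Xs n \<omega>). 0 \<le> s \<and> ereal s \<le> \<eta>"
      and zexp: "\<forall>i\<in>{1..n}. expands e (adjoint J (Xs i \<omega>))"
      and R1: "\<forall>j N. (\<Sum>i<N. ((if j = i then a j else 0) - 1 / real n * (\<Sum>r=1..n.
              inner (adjoint J (Xs r \<omega>)) (e j) * inner (adjoint J (Xs r \<omega>)) (e i)))\<^sup>2 / (a i + K * L)) \<le> R j"
      and R2: "\<forall>N. (\<Sum>j<N. R j / (a j + K * L)) \<le> 1 / 4" and R3: "\<forall>N. (\<Sum>j<N. R j) \<le> B * L powr (2 * q + 1)"
      and v: "\<forall>N. (\<Sum>j<N. (1 / real n * (\<Sum>r=1..n. (Ys r \<omega> - inner (Xs r \<omega>) (J b))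
              * inner (adjoint J (Xs r \<omega>)) (e j)))\<^sup>2 / (a j + K * L)) \<le> V * L powr (2 * q + 1)"
      unfolding good_sample_def by (elim exE conjE) (rule that)
    define A where "A = RKHS_empirical_covariance S evalf Xs n \<omega>"
    define zz where "zz i = adjoint J (Xs i \<omega>)" for i
    define l where "l = K * L"
    have l: "l > 0" "L \<le> l" using bounds L by (simp_all add: l_def)
    have emp_A: "A f = (1 / real n) *\<^sub>R (\<Sum>i=1..n. inner (zz i) f *\<^sub>R zz i)" for f
      unfolding A_def zz_def by (rule empirical_operator)
    define Sp where "Sp = {s. eigenspace A s \<noteq> {0}}"
    define E where "E = (\<lambda>s. orthogonal_projection (eigenspace A s))"
    interpret spectral_resolution A Sp E
      unfolding Sp_def E_def by (rule finite_rank_spectral_resolution(1)[OF _ _ emp_A]) auto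
    have linA: "linear A"
      unfolding A_calc[abs_def] by (rule linear_calc)
    have Sp0: "0 \<le> s" "ereal s \<le> \<eta>" if "s \<in> Sp" for s
      using sp eigenvalue_in_spectrum[OF linA, of s] that by (auto simp: Sp_def A_def)
    have aL: "a j + l \<le> \<Lambda>" for j
    proof -
      have "K * L \<le> K * 1" using bounds L by (intro mult_left_mono) auto
      then show ?thesis using am[of j] by (simp add: l_def \<Lambda>_def)
    qed
    interpret empirical_form A Sp E e a l \<Lambda> "B * L powr (2 * q + 1)" zz n R
      by unfold_locales
        (use orthonormal_e a_pos l aL Sp0 emp_A[folded zz_def] zexp R1 R2 R3 in \<open>simp_all only: zz_def l_def\<close>)
    \<comment> \<open>The bounds on the family say nothing about 0. Choosing the value 0 there keeps
      the estimate in the closed span of \<open>e\<close> and removes the zero eigenvalue from the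
      noise bound.\<close>
    define gg where "gg s = (if s = 0 then 0 else g L s)" for s
    define vv where "vv = (1 / real n) *\<^sub>R (\<Sum>i=1..n. (Ys i \<omega> - inner (Xs i \<omega>) (J b)) *\<^sub>R zz i)"
    have vexp: "expands e vv"
      unfolding vv_def using zexp by (intro expands_scaleR expands_sum) (auto simp: zz_def)
    \<comment> \<open>The data vector is the empirical operator at \<open>b\<close> plus the
      averaged residuals at \<open>b\<close>; this identity reduces the problem to an inverse
      problem with noise \<open>vv\<close>.\<close>
    have rhs: "A b + vv = (1 / real n) *\<^sub>R (\<Sum>i=1..n. Ys i \<omega> *\<^sub>R zz i)"
    proof -
      have "inner (zz i) b = inner (Xs i \<omega>) (J b)" for i
        using adjoint_inner[OF bounded_linear_J, of b "Xs i \<omega>"] by (simp add: zz_def inner_commute)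
      then show ?thesis
        unfolding emp_A vv_def by (simp add: scaleR_add_right[symmetric] sum.distrib[symmetric] scaleR_add_left[symmetric])
    qed
    have est_calc: "?est = calc gg (A b + vv)"
    proof -
      have "?est = functional_calculus (g L) A (A b + vv)"
        unfolding est_def spectral_estimator_def A_def[symmetric] empirical_rhs rhs zz_def by simp
      also have "\<dots> = calc (g L) (A b + vv)"
        unfolding functional_calculus_def Sp_def[symmetric] calc_def using finite_Sp by (simp add: E_def)
      also have "\<dots> = calc gg (A b + vv)"
        unfolding rhs
        by (rule calc_sample_cong[where y = "\<lambda>i. Ys i \<omega> / real n"])
          (auto simp: gg_def scaleR_sum_right)
      finally show ?thesis .
    qed
    define \<rho> where "\<rho> s = (s + l) powr p0" for s
    have sl: "s + l > 0" if "s \<in> Sp" for s using Sp0(1)[OF that] l by linarith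
    have resid: "(s + l) powr P * \<bar>1 - s * gg s\<bar> \<le> Cr * L powr P" if s: "s \<in> Sp" for s
      unfolding gg_def l_def Cr_def
      by (rule residual_bound[where \<eta> = \<eta> and p' = p']) (use L bounds reg' qual' P0 p Sp0[OF s] in \<open>auto simp: P_def\<close>)
    define \<Psi> where "\<Psi> s = (if 0 \<le> q then Cc * (s + l) powr (2 * q) else H * L powr (2 * q))" for s
    have bform: "(inner b u)\<^sup>2 \<le> wnorm2 \<Psi> u" for u
    proof (cases "0 \<le> q")
      case True
      have "(inner b u)\<^sup>2 \<le> wnorm2 (\<lambda>s. H * (1 + 8 * (1 + comparison_const \<Lambda> B mm) * G) * (s + l) powr (2 * q)) u"
      proof (rule source_form_bound[OF True b _ _ mm_def \<theta>_def G])
        show "inner b (e j) = a j powr q * hh j" for j using bq True by blast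
        show "(\<Sum>j<N. (hh j)\<^sup>2) \<le> H" for N using bq True by blast
        show "0 \<le> B" using bounds by simp
        \<comment> \<open>The integer steps stop at the integer part of \<open>q\<close>, so every k
          satisfies 2k + 1 <= 2q + 1; as \<open>L\<close> is at most 1, the deviation bound is small
          enough at each of them.\<close>
        fix k assume k: "k < mm"
        then have "real k \<le> q" using True unfolding mm_def by linarith
        then have "L powr (2 * q + 1) \<le> L powr real (2 * k + 1)" using L by (intro powr_mono') auto
        also have "\<dots> = L ^ (2 * k + 1)" using L by (simp only: powr_realpow)
        also have "\<dots> \<le> l ^ (2 * k + 1)" using l L by (intro power_mono) auto
        finally show "B * L powr (2 * q + 1) \<le> B * l ^ (2 * k + 1)" using bounds by (intro mult_left_mono) auto
      qed
      also have "(\<lambda>s. H * (1 + 8 * (1 + comparison_const \<Lambda> B mm) * G) * (s + l) powr (2 * q)) = \<Psi>"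
        using True by (simp add: \<Psi>_def Cc_def fun_eq_iff)
      finally show ?thesis .
    next
      case False
      have "\<bar>inner b u\<bar>\<^sup>2 \<le> (norm b * norm u)\<^sup>2" by (intro power_mono Cauchy_Schwarz_ineq2) auto
      also have "\<dots> = (norm b)\<^sup>2 * (norm u)\<^sup>2" by (simp add: power_mult_distrib)
      also have "\<dots> \<le> H * L powr (2 * q) * (norm u)\<^sup>2" using bn False by (intro mult_right_mono) auto
      also have "\<dots> = wnorm2 (\<lambda>s. H * L powr (2 * q) * 1) u" by (simp only: wnorm2_scale wnorm2_one)
      also have "(\<lambda>s. H * L powr (2 * q) * 1) = \<Psi>" using False by (simp add: \<Psi>_def fun_eq_iff)
      finally show ?thesis by simp
    qed
    have vform: "(inner vv u)\<^sup>2 \<le> wnorm2 (\<lambda>s. 2 * (V * L powr (2 * q + 1)) * (s + l)) u" for u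
    proof (rule noise_form_bound[OF vexp])
      fix N
      have "inner vv (e j) = 1 / real n * (\<Sum>r=1..n. (Ys r \<omega> - inner (Xs r \<omega>) (J b)) * inner (adjoint J (Xs r \<omega>)) (e j))" for j
        by (simp add: vv_def zz_def inner_sum_left)
      then show "(\<Sum>j<N. (inner vv (e j))\<^sup>2 / (a j + l)) \<le> V * L powr (2 * q + 1)"
        using v by (simp add: l_def)
    qed
    have "norm (calc \<rho> (b - calc gg (A b + vv))) \<le> C1 * L powr (q + p0) + C2 * L powr (q + p0)"
    proof (rule calc_error_bound[OF bform vform])
      show "0 \<le> C1 * L powr (q + p0)" "0 \<le> C2 * L powr (q + p0)" using C10 C20 by auto
      fix s assume s: "s \<in> Sp"
      have res2: "((s + l) powr P * (1 - s * gg s))\<^sup>2 \<le> (Cr * L powr P)\<^sup>2"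
      proof -
        have "\<bar>(s + l) powr P * (1 - s * gg s)\<bar> \<le> \<bar>Cr * L powr P\<bar>"
          using resid[OF s] Cr0 by (simp add: abs_mult)
        then show ?thesis by (simp only: abs_le_square_iff)
      qed
      have sq: "(x powr r)\<^sup>2 = x powr (2 * r)" for x r :: real
        by (simp add: power2_eq_square flip: powr_add)
      have C1sq: "(C1 * L powr (q + p0))\<^sup>2 = max Cc H * (Cr\<^sup>2 * L powr (2 * q + 2 * p0))"
        using mx by (simp add: C1_def power_mult_distrib sq distrib_left)
      show "\<Psi> s * (\<rho> s * (1 - s * gg s))\<^sup>2 \<le> (C1 * L powr (q + p0))\<^sup>2"
      proof (cases "0 \<le> q")
        case True
        then have P: "P = q + p0" by (simp add: P_def)
        have "\<Psi> s * (\<rho> s * (1 - s * gg s))\<^sup>2 = Cc * ((s + l) powr P * (1 - s * gg s))\<^sup>2"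
          using True by (simp add: \<Psi>_def \<rho>_def power_mult_distrib sq P powr_add distrib_left)
        also have "\<dots> \<le> max Cc H * ((s + l) powr P * (1 - s * gg s))\<^sup>2" by (intro mult_right_mono) auto
        also have "\<dots> \<le> max Cc H * (Cr * L powr P)\<^sup>2" using mx by (intro mult_left_mono res2)
        also have "\<dots> = (C1 * L powr (q + p0))\<^sup>2"
          unfolding C1sq by (simp add: power_mult_distrib sq P distrib_left)
        finally show ?thesis .
      next
        case False
        then have P: "P = p0" by (simp add: P_def)
        have "\<Psi> s * (\<rho> s * (1 - s * gg s))\<^sup>2 = H * L powr (2 * q) * ((s + l) powr P * (1 - s * gg s))\<^sup>2"
          using False by (simp add: \<Psi>_def \<rho>_def P)
        also have "\<dots> \<le> max Cc H * L powr (2 * q) * (Cr * L powr P)\<^sup>2"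
          using bounds mx by (intro mult_mono res2 mult_right_mono) auto
        also have "\<dots> = (C1 * L powr (q + p0))\<^sup>2"
          unfolding C1sq by (simp add: power_mult_distrib sq P powr_add)
        finally show ?thesis .
      qed
      show "2 * (V * L powr (2 * q + 1)) * (s + l) * (\<rho> s * gg s)\<^sup>2 \<le> (C2 * L powr (q + p0))\<^sup>2"
      proof (cases "s = 0")
        case True
        then show ?thesis by (simp add: gg_def)
      next
        case False
        then have s0: "s > 0" using Sp0(1)[OF s] by simp
        have r: "\<bar>s * g L s\<bar> \<le> A\<^sub>g" "\<bar>g L s\<bar> \<le> B\<^sub>g / L" using reg'[OF L(1,3) s0 Sp0(2)[OF s]] by auto
        have "(s + l) * (\<rho> s * gg s)\<^sup>2 \<le> Cg\<^sup>2 * L powr (2 * p0 - 1)"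
          unfolding \<rho>_def l_def Cg_def using filter_bound[OF L(1) bounds(4) s0 bounds(1) r(1) bounds(2) r(2) p(1)] False
          by (simp add: gg_def)
        then have "2 * (V * L powr (2 * q + 1)) * ((s + l) * (\<rho> s * gg s)\<^sup>2)
            \<le> 2 * (V * L powr (2 * q + 1)) * (Cg\<^sup>2 * L powr (2 * p0 - 1))"
          using bounds by (intro mult_left_mono) auto
        also have "\<dots> = 2 * V * Cg\<^sup>2 * (L powr (2 * q + 1) * L powr (2 * p0 - 1))" by simp
        also have "L powr (2 * q + 1) * L powr (2 * p0 - 1) = L powr (2 * (q + p0))"
          by (simp flip: powr_add)
        also have "2 * V * Cg\<^sup>2 * L powr (2 * (q + p0)) = (C2 * L powr (q + p0))\<^sup>2"
          using bounds by (simp add: C2_def power_mult_distrib sq)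
        finally show ?thesis by (simp only: mult.assoc)
      qed
    qed
    then have err: "norm (calc \<rho> (b - ?est)) \<le> (C1 + C2) * L powr (q + p0)"
      unfolding est_calc by (simp add: distrib_right)
    have 1: "expands e (b - ?est)"
      unfolding est_calc by (intro expands_diff b expands_calc) (simp add: gg_def)
    have 2: "norm (b - ?est) \<le> Ce * L powr q" if "p0 = 0"
    proof -
      have "calc \<rho> (b - ?est) = calc (\<lambda>s. 1) (b - ?est)"
        by (rule calc_cong) (use sl that in \<open>force simp: \<rho>_def\<close>)
      then have "norm (b - ?est) \<le> (C1 + C2) * L powr q" using err that by (simp add: calc_one)
      also have "\<dots> \<le> Ce * L powr q" by (intro mult_right_mono) (auto simp: Ce_def add_nonneg_nonneg)
      finally show ?thesis .
    qed
    have 3: "(\<Sum>j<N. (a j + L) * (inner (b - ?est) (e j))\<^sup>2) \<le> Ce * L powr (2 * q + 1)" if p0: "p0 = 1 / 2" for N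
    proof -
      have "(\<Sum>j<N. (a j + L) * (inner (b - ?est) (e j))\<^sup>2) \<le> (\<Sum>j<N. (a j + l) * (inner (b - ?est) (e j))\<^sup>2)"
        using l by (intro sum_mono mult_right_mono) auto
      also have "\<dots> \<le> 2 * wnorm2 (\<lambda>s. s + l) (b - ?est)" by (rule partial_le_wnorm2)
      also have "wnorm2 (\<lambda>s. s + l) (b - ?est) = wnorm2 (\<lambda>s. (\<rho> s)\<^sup>2) (b - ?est)"
      proof -
        have "(\<rho> s)\<^sup>2 = s + l" if "s \<in> Sp" for s
        proof -
          have "(\<rho> s)\<^sup>2 = (s + l) powr (p0 + p0)" by (simp only: \<rho>_def power2_eq_square powr_add)
          then show ?thesis using sl[OF that] by (simp add: p0)
        qed
        then show ?thesis by (simp add: wnorm2_def)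
      qed
      also have "\<dots> = (norm (calc \<rho> (b - ?est)))\<^sup>2" by (rule norm_calc[symmetric])
      also have "2 * \<dots> \<le> 2 * ((C1 + C2) * L powr (q + p0))\<^sup>2" by (intro mult_left_mono power_mono err) auto
      also have "\<dots> = 2 * (C1 + C2)\<^sup>2 * L powr (2 * q + 1)"
      proof -
        have "(L powr (q + p0))\<^sup>2 = L powr ((q + p0) + (q + p0))" by (simp only: power2_eq_square powr_add)
        also have "(q + p0) + (q + p0) = 2 * q + 1" by (simp add: p0)
        finally show ?thesis by (simp add: power_mult_distrib)
      qed
      also have "\<dots> \<le> Ce * L powr (2 * q + 1)" using C10 C20 by (intro mult_right_mono) (auto simp: Ce_def)
      finally show ?thesis .
    qed
    show "small_error p0 Ce q L (b - ?est)" unfolding small_error_def using 1 2 3 by blast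
  qed
qed

end

lemma expands_basis:
  fixes e :: "nat \<Rightarrow> 'v::{real_inner,banach}"
  assumes "orthonormal e"
  shows "expands e (e i)"
  unfolding expands_iff[OF assms] by (simp add: inner_commute)

lemma expands_norm_le:
  assumes v: "expands e v" and B: "\<And>N. (\<Sum>j<N. (inner v (e j))\<^sup>2) \<le> B"
  shows "(norm v)\<^sup>2 \<le> B"
proof -
  have "(\<lambda>N. \<Sum>j<N. inner v (e j) * inner (e j) v) \<longlonglongrightarrow> (norm v)\<^sup>2"
    using v unfolding expands_def sums_def power2_norm_eq_inner by blast
  moreover have "(\<Sum>j<N. inner v (e j) * inner (e j) v) \<le> B" for N
    using B[of N] by (simp add: inner_commute[of "e _" v] power2_eq_square)
  ultimately show ?thesis by (intro LIMSEQ_le_const2) auto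
qed

section \<open>From coefficient decay to the two rates\<close>

context functional_regression
begin

text \<open>The regularization constants and a sufficient qualification exponent are extracted
  before the events are chosen, so that the constant of \<open>path_error\<close> is independent of
  n. The targets \<open>b n\<close> may vary with n, which the truncation of part (a)
  requires.\<close>

lemma estimation_error:
  fixes L :: "nat \<Rightarrow> real" and b :: "nat \<Rightarrow> 'h" and hh :: "nat \<Rightarrow> nat \<Rightarrow> real" and q U C\<^sub>b H \<delta> p0 :: real
  assumes L: "\<And>n. 1 \<le> n \<Longrightarrow> 0 < L n" "\<And>n. 1 \<le> n \<Longrightarrow> L n \<le> 1"
      "\<And>n. 1 \<le> n \<Longrightarrow> L n powr (- (1 / (t + c))) / real n = L n powr (2 * q + 1)"
      "\<And>n. 1 \<le> n \<Longrightarrow> L n powr (- (2 / (t + c))) \<le> real n"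
    and U: "\<And>n. 1 \<le> n \<Longrightarrow> norm (\<beta>\<^sub>0 - J (b n)) \<le> U" and Cb: "0 \<le> C\<^sub>b"
    and bias: "\<And>n N. 1 \<le> n \<Longrightarrow>
      (\<Sum>j<N. a j * x j * (inner (\<beta>\<^sub>0 - J (b n)) (\<psi> j))\<^sup>2 / (a j + L n)) \<le> C\<^sub>b * L n powr (2 * q + 1)"
    and b: "\<And>n. 1 \<le> n \<Longrightarrow> expands e (b n)" and H: "0 \<le> H"
    and bq: "\<And>n. 1 \<le> n \<Longrightarrow> 0 \<le> q \<Longrightarrow>
      (\<forall>j. inner (b n) (e j) = a j powr q * hh n j) \<and> (\<forall>N. (\<Sum>j<N. (hh n j)\<^sup>2) \<le> H)"
    and bn: "\<And>n. 1 \<le> n \<Longrightarrow> q < 0 \<Longrightarrow> (norm (b n))\<^sup>2 \<le> H * L n powr (2 * q)"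
    and p0: "p0 = 0 \<or> p0 = 1 / 2" "ereal (max q 0 + p0) \<le> \<nu>" and \<delta>: "\<delta> < 1"
  shows "\<exists>C\<^sub>e>0. \<forall>n\<ge>1. ereal (L n) \<le> \<eta> \<longrightarrow> (\<exists>F\<in>sets M. prob F \<ge> \<delta> \<and>
      (\<forall>\<omega>\<in>F. small_error p0 C\<^sub>e q (L n) (b n - est n (L n) \<omega>)))"
proof -
  from reg(2) obtain A\<^sub>g B\<^sub>g D where ABD: "0 < A\<^sub>g" "0 < B\<^sub>g" "0 < D"
    and all: "\<forall>l. 0 < l \<and> ereal l \<le> \<eta> \<longrightarrow> (\<forall>s. 0 < s \<and> ereal s \<le> \<eta> \<longrightarrow>
        \<bar>s * g l s\<bar> \<le> A\<^sub>g \<and> \<bar>g l s\<bar> \<le> B\<^sub>g / l \<and> \<bar>1 - s * g l s\<bar> \<le> D)"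
    unfolding regularization_family_def by (elim exE conjE) (rule that)
  have reg': "\<bar>s * g l s\<bar> \<le> A\<^sub>g \<and> \<bar>g l s\<bar> \<le> B\<^sub>g / l \<and> \<bar>1 - s * g l s\<bar> \<le> D"
    if "0 < l" "ereal l \<le> \<eta>" "0 < s" "ereal s \<le> \<eta>" for l s
    using all that by blast
  have "0 \<le> max q 0 + p0" using p0(1) by auto
  then obtain p' where p': "max q 0 + p0 \<le> p'" "qualifies \<eta> g p'"
    using qualification_exponent[OF qual(1) p0(2)] by blast
  then obtain w where qual': "\<And>l s. 0 < l \<Longrightarrow> ereal l \<le> \<eta> \<Longrightarrow> 0 < s \<Longrightarrow> ereal s \<le> \<eta> \<Longrightarrow>
        \<bar>1 - s * g l s\<bar> * s powr p' \<le> w * l powr p'"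
    unfolding qualifies_def by blast
  obtain K B V where KBV: "1 \<le> K" "0 < B" "0 < V" and ev: "\<forall>n\<ge>1. \<exists>F\<in>sets M. prob F \<ge> \<delta> \<and> (\<forall>\<omega>\<in>F. good_sample K B V q n (L n) (b n) \<omega>)"
  proof -
    note ce = core_event[where L = L and b = b and q = q and U = U and C\<^sub>b = C\<^sub>b and \<delta> = \<delta>, OF L(1,3,4) U Cb bias \<delta>]
    show thesis by (rule exE[OF ce], assumption+, elim exE conjE, rule that)
  qed
  from path_error[OF ABD KBV H reg' qual' p0(1) p'(1)]
  obtain C\<^sub>e where Ce: "C\<^sub>e > 0" "\<forall>n\<ge>1. \<forall>L \<omega> b hh. 0 < L \<longrightarrow> L \<le> 1 \<longrightarrow> ereal L \<le> \<eta> \<longrightarrow>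
      good_sample K B V q n L b \<omega> \<longrightarrow> expands e b \<longrightarrow>
      (0 \<le> q \<longrightarrow> (\<forall>j. inner b (e j) = a j powr q * hh j) \<and> (\<forall>N. (\<Sum>j<N. (hh j)\<^sup>2) \<le> H)) \<longrightarrow>
      (q < 0 \<longrightarrow> (norm b)\<^sup>2 \<le> H * L powr (2 * q)) \<longrightarrow>
      small_error p0 C\<^sub>e q L (b - est n L \<omega>)"
    by blast
  show ?thesis
  proof (rule exI[of _ C\<^sub>e], intro conjI allI impI Ce(1))
    fix n :: nat assume n: "1 \<le> n" and \<eta>: "ereal (L n) \<le> \<eta>"
    obtain F where F: "F \<in> sets M" "prob F \<ge> \<delta>" "\<forall>\<omega>\<in>F. good_sample K B V q n (L n) (b n) \<omega>"
      using ev n by blast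
    then show "\<exists>F\<in>sets M. prob F \<ge> \<delta> \<and> (\<forall>\<omega>\<in>F. small_error p0 C\<^sub>e q (L n) (b n - est n (L n) \<omega>))"
      using Ce(2) L(1,2)[OF n] n \<eta> b[OF n] bq[OF n] bn[OF n] by (intro bexI[of _ F]) blast+
  qed
qed

text \<open>Both sequences decay polynomially, so powers of \<open>m\<close> and of \<open>a\<close>
  can be exchanged by matching exponents. The surplus \<open>p - p'\<close> is absorbed by
  boundedness of \<open>m\<close>; it is positive when the qualification limits the rate.\<close>

lemma m_powr_le:
  assumes "p' \<le> p"
  shows "\<exists>C>0. \<forall>j. m j powr p \<le> C * a j powr (p' * t / (t + c))"
proof -
  have tc: "t + c > 0" using decay by simp
  have "t * p' = (t + c) * (p' * t / (t + c))" using tc by simp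
  then have "power_decay (t * p') (\<lambda>i. (\<mu> i * \<xi> i) powr (p' * t / (t + c)))"
    using power_decay_powr[OF decay_a, of "p' * t / (t + c)"] by (simp only:)
  from power_decay_le[OF power_decay_powr[OF decay(3), of p'] this]
  obtain C where C: "C > 0" "\<And>i. 1 \<le> i \<Longrightarrow> \<mu> i powr p' \<le> C * (\<mu> i * \<xi> i) powr (p' * t / (t + c))" by blast
  obtain B where B: "B > 0" "\<And>i. 1 \<le> i \<Longrightarrow> \<mu> i \<le> B" using power_decay_bounded[OF decay(3)] decay(1) by auto
  have "m j powr p \<le> (C * B powr (p - p')) * a j powr (p' * t / (t + c))" for j
  proof -
    have "m j powr p = m j powr p' * m j powr (p - p')" by (simp flip: powr_add)
    also have "\<dots> \<le> (C * a j powr (p' * t / (t + c))) * B powr (p - p')"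
      using C(2)[of "Suc j"] B m_pos[of j] B(2)[of "Suc j"] assms
      by (intro mult_mono powr_mono2) (auto simp: m_def a_eq C(1) less_imp_le)
    finally show ?thesis by (simp add: mult_ac)
  qed
  then show ?thesis using C B by (intro exI[of _ "C * B powr (p - p')"]) auto
qed

lemma x_le: "\<exists>C>0. \<forall>j. x j \<le> C * a j powr (c / (t + c))"
proof -
  have tc: "t + c > 0" using decay by simp
  have "c = (t + c) * (c / (t + c))" using tc by simp
  then have "power_decay c (\<lambda>i. (\<mu> i * \<xi> i) powr (c / (t + c)))"
    using power_decay_powr[OF decay_a, of "c / (t + c)"] by (simp only:)
  from power_decay_le[OF decay(4) this] show ?thesis by (auto simp: x_def a_eq)
qed

definition h_coef :: "nat \<Rightarrow> real" where "h_coef j = inner h (\<psi> j)"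

lemma beta_sums: "(\<lambda>j. (m j powr \<alpha> * h_coef j) *\<^sub>R \<psi> j) sums \<beta>\<^sub>0"
proof -
  obtain B where B: "B > 0" "\<forall>i\<ge>1. \<mu> i \<le> B" using power_decay_bounded[OF decay(3)] decay(1) by auto
  have "(\<lambda>j. (\<mu> (Suc j) powr \<alpha> * inner h (normalized \<phi> j)) *\<^sub>R normalized \<phi> j) sums
      functional_calculus (\<lambda>s. s powr \<alpha>) T h"
    by (rule functional_calculus_powr_sums[OF linear_T T_sym decay(5) _ _ source(1), of B])
      (use B m_pos in \<open>auto simp: m_def\<close>)
  then show ?thesis by (simp add: source(3)[symmetric] m_def h_coef_def \<psi>_def)
qed

lemma h_coef_sum: "finite I \<Longrightarrow> (\<Sum>j\<in>I. (h_coef j)\<^sup>2) \<le> (norm h)\<^sup>2"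
  unfolding h_coef_def by (rule bessel[OF \<psi>])

lemma coef_sqrt: "m j powr (\<alpha> - 1 / 2) * sqrt (m j) = m j powr \<alpha>"
  using m_pos[of j] by (simp add: powr_half_sqrt[symmetric] less_imp_le flip: powr_add)

lemma powr_square: "(y powr p)\<^sup>2 = y powr (2 * p)" for y p :: real
  by (simp add: power2_eq_square flip: powr_add)

text \<open>The coefficient along \<open>e j\<close> that \<open>J\<close> maps to the coefficient
  of \<open>\<beta>\<^sub>0\<close> along \<open>\<psi> j\<close>: dividing by the singular value
  lowers the exponent by 1/2. For \<alpha> < 1/2 these numbers need not be square summable.\<close>

definition scaled_coef :: "nat \<Rightarrow> real" where "scaled_coef j = m j powr (\<alpha> - 1 / 2) * h_coef j"

lemma scaled_coef_le:
  assumes "r \<le> \<alpha>"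
  shows "\<exists>C. \<forall>j. (scaled_coef j)\<^sup>2 \<le> C\<^sup>2 * a j powr (2 * (t * (2 * r - 1) / (2 * (t + c)))) * (h_coef j)\<^sup>2"
proof -
  define q where "q = t * (2 * r - 1) / (2 * (t + c))"
  obtain C\<^sub>1 where C1: "C\<^sub>1 > 0" "\<And>j. m j powr (\<alpha> - 1 / 2) \<le> C\<^sub>1 * a j powr q"
  proof -
    have "(r - 1 / 2) * t / (t + c) = q" by (simp add: q_def field_simps)
    then show thesis using m_powr_le[of "r - 1 / 2" "\<alpha> - 1 / 2"] assms that by auto
  qed
  have scaled_coef_le: "(scaled_coef j)\<^sup>2 \<le> C\<^sub>1\<^sup>2 * a j powr (2 * q) * (h_coef j)\<^sup>2" for j
  proof -
    have "(m j powr (\<alpha> - 1 / 2))\<^sup>2 \<le> (C\<^sub>1 * a j powr q)\<^sup>2" by (intro power_mono C1) simp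
    then have "(m j powr (\<alpha> - 1 / 2))\<^sup>2 * (h_coef j)\<^sup>2 \<le> (C\<^sub>1 * a j powr q)\<^sup>2 * (h_coef j)\<^sup>2"
      by (intro mult_right_mono) auto
    then show ?thesis by (simp add: scaled_coef_def power_mult_distrib powr_square)
  qed
  then show ?thesis unfolding q_def by blast
qed

text \<open>The error is the part of \<open>\<beta>\<^sub>0\<close> cut off plus the image of the
  RKHS error against the truncated target. The former is small since a_j < L there; the latter is
  recovered from the energy form at weight 1/2. Truncating at a_j = L makes both contributions of
  order L^s.\<close>

lemma L2_rate:
  assumes r: "ereal r = min (ereal \<alpha>) (\<nu> + ereal (c / t) * (\<nu> - ereal (1 / 2)))" and \<delta>: "\<delta> < 1"
  shows "\<exists>C>0. \<forall>n\<ge>1. ereal (reg_param t c r n) \<le> \<eta> \<longrightarrow> (\<exists>F\<in>sets M. prob F \<ge> \<delta> \<and> (\<forall>\<omega>\<in>F.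
    norm (\<beta>\<^sub>0 - J (est n (reg_param t c r n) \<omega>))
      \<le> C * real n powr (- (r * t) / (1 + c + 2 * t * r))))"
proof -
  define \<gamma> where "\<gamma> = t + c"
  have \<gamma>: "\<gamma> > 0" "t < \<gamma>" using decay by (simp_all add: \<gamma>_def)
  define q where "q = t * (2 * r - 1) / (2 * (t + c))"
  have q2: "2 * q = (2 * t * r - t) / \<gamma>" using \<gamma> by (simp add: q_def \<gamma>_def field_simps)
  have r\<alpha>: "r \<le> \<alpha>" using r by (metis ereal_less_eq(3) min.cobounded1)
  have r0: "0 < r" and q\<nu>: "ereal (max q 0 + 1 / 2) \<le> \<nu>"
  proof -
    have "0 < r \<and> ereal (max q 0 + 1 / 2) \<le> \<nu>"
    proof (cases \<nu>)
      case (real v)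
      have v: "v \<ge> 1 / 2" using qual(2) real by simp
      have "\<nu> + ereal (c / t) * (\<nu> - ereal (1 / 2)) = ereal (v + c / t * (v - 1 / 2))" by (simp add: real)
      then have rr: "r = min \<alpha> (v + c / t * (v - 1 / 2))" using r by (simp add: min_def split: if_splits)
      have "0 \<le> c / t * (v - 1 / 2)" using decay v by simp
      then have "0 < r" using rr v source(1) by auto
      \<comment> \<open>This cap on \<open>r\<close> is precisely the condition q + 1/2 <= v: the
        energy form uses up half a power of the qualification.\<close>
      have "r \<le> v + c / t * (v - 1 / 2)" using rr by simp
      then have "t * r \<le> t * (v + c / t * (v - 1 / 2))" using decay by (intro mult_left_mono) auto
      also have "\<dots> = t * v + c * (v - 1 / 2)" using decay by (simp add: field_simps)
      finally have "2 * t * r - t \<le> (2 * v - 1) * \<gamma>" by (simp add: \<gamma>_def algebra_simps)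
      then have "2 * q \<le> 2 * v - 1" unfolding q2 using \<gamma> by (simp add: divide_le_eq)
      then show ?thesis using \<open>0 < r\<close> v real by simp
    next
      case PInf
      have "ereal (c / t) * \<infinity> = \<infinity>" using decay by simp
      then have "r = \<alpha>" using r PInf by simp
      then show ?thesis using source(1) PInf by simp
    next
      case MInf
      then show ?thesis using qual(2) by simp
    qed
    then show "0 < r" "ereal (max q 0 + 1 / 2) \<le> \<nu>" by auto
  qed
  define L where "L n = reg_param t c r n" for n
  note L = reg_param_facts[OF decay(1,2) less_imp_le[OF r0], folded L_def q_def]
  define s where "s = r * t / \<gamma>"
  have s0: "0 < s" using r0 decay \<gamma> by (simp add: s_def)
  obtain C\<^sub>2 where C2: "C\<^sub>2 > 0" "\<And>j. m j powr \<alpha> \<le> C\<^sub>2 * a j powr s"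
    using m_powr_le[OF r\<alpha>] unfolding s_def \<gamma>_def by blast
  obtain C\<^sub>3 where C3: "C\<^sub>3 > 0" "\<And>j. x j \<le> C\<^sub>3 * a j powr (c / \<gamma>)" using x_le unfolding \<gamma>_def by blast
  obtain C\<^sub>4 where C4: "C\<^sub>4 > 0" "\<And>j. m j \<le> C\<^sub>4 * a j powr (t / \<gamma>)"
    using m_powr_le[of 1 1] m_pos unfolding \<gamma>_def by (auto simp: less_imp_le)
  \<comment> \<open>The mean of the residual noise on the modes cut off combines a power c/\<gamma>
    from the covariance eigenvalue with the squared tail of power 2s; the identity says that this
    equals the noise level.\<close>
  have e1: "c / \<gamma> + 2 * s = 2 * q + 1"
  proof -
    have "2 * q + 1 = (2 * t * r - t + \<gamma>) / \<gamma>" using \<gamma> by (simp add: q2 add_divide_distrib)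
    also have "2 * t * r - t + \<gamma> = c + 2 * (r * t)" by (simp add: \<gamma>_def)
    also have "(c + 2 * (r * t)) / \<gamma> = c / \<gamma> + 2 * s" by (simp add: s_def add_divide_distrib)
    finally show ?thesis by simp
  qed
  have e2: "2 * q + t / \<gamma> = 2 * s" unfolding q2 s_def using \<gamma> by (simp add: field_simps)
  define I where "I n = {j. L n \<le> a j}" for n
  have finI: "finite (I n)" if n: "1 \<le> n" for n
  proof -
    have "a \<longlonglongrightarrow> 0" by (rule summable_LIMSEQ_zero[OF summable_a])
    then have "\<forall>\<^sub>F j in sequentially. a j < L n" using L(1)[OF n] by (intro order_tendstoD) auto
    then obtain N where "\<And>j. j \<ge> N \<Longrightarrow> a j < L n" unfolding eventually_sequentially by blast
    then have "I n \<subseteq> {..<N}" unfolding I_def by (force simp: not_le[symmetric])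
    then show ?thesis by (rule finite_subset) simp
  qed
  obtain C\<^sub>1 where k_le: "\<And>j. (scaled_coef j)\<^sup>2 \<le> C\<^sub>1\<^sup>2 * a j powr (2 * q) * (h_coef j)\<^sup>2"
    using scaled_coef_le[OF r\<alpha>] unfolding q_def by blast
  define b where "b n = (\<Sum>j\<in>I n. scaled_coef j *\<^sub>R e j)" for n
  have b_coef: "inner (b n) (e j) = (if j \<in> I n then scaled_coef j else 0)" if "1 \<le> n" for n j
    unfolding b_def using finI[OF that] by (simp add: inner_sum_left inner_orthonormal[OF orthonormal_e] if_distrib cong: if_cong)
  have b_exp: "expands e (b n)" for n
    unfolding b_def by (intro expands_sum expands_scaleR expands_basis orthonormal_e)
  define u where "u n = \<beta>\<^sub>0 - J (b n)" for n
  have u_coef: "inner (u n) (\<psi> j) = (if j \<in> I n then 0 else m j powr \<alpha> * h_coef j)" if n: "1 \<le> n" for n j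
  proof -
    have "inner (J (b n)) (\<psi> j) = sqrt (m j) * (if j \<in> I n then scaled_coef j else 0)"
      using inner_psi_J[of j "b n"] b_coef[OF n, of j] by (simp add: inner_commute)
    moreover have "sqrt (m j) * scaled_coef j = m j powr \<alpha> * h_coef j" using coef_sqrt[of j] by (simp add: scaled_coef_def mult_ac)
    ultimately show ?thesis
      using sums_inner_orthonormal[OF \<psi> beta_sums, of j] by (simp add: u_def inner_diff_left)
  qed
  have u_exp: "expands \<psi> (u n)" for n
  proof -
    have "J (b n) = (\<Sum>j\<in>I n. scaled_coef j *\<^sub>R J (e j))"
      unfolding b_def
      by (simp add: linear_sum[OF bounded_linear.linear[OF bounded_linear_J]] linear_scale[OF bounded_linear.linear[OF bounded_linear_J]])
    then have "expands \<psi> (J (b n))"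
      by (simp only: J_e) (intro expands_sum expands_scaleR expands_basis \<psi>)
    then show ?thesis unfolding u_def by (intro expands_diff sums_imp_expands[OF \<psi> beta_sums])
  qed
  have u_le: "(inner (u n) (\<psi> j))\<^sup>2 \<le> C\<^sub>2\<^sup>2 * a j powr (2 * s) * (h_coef j)\<^sup>2" if n: "1 \<le> n" for n j
  proof -
    have "(m j powr \<alpha>)\<^sup>2 \<le> (C\<^sub>2 * a j powr s)\<^sup>2" by (intro power_mono C2) simp
    then have "(m j powr \<alpha>)\<^sup>2 * (h_coef j)\<^sup>2 \<le> (C\<^sub>2 * a j powr s)\<^sup>2 * (h_coef j)\<^sup>2" by (intro mult_right_mono) auto
    then show ?thesis using C2 by (simp add: u_coef[OF n] power_mult_distrib powr_square)
  qed
  have u_norm: "(norm (u n))\<^sup>2 \<le> (C\<^sub>2 * norm h * L n powr s)\<^sup>2" if n: "1 \<le> n" for n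
  proof (rule expands_norm_le[OF u_exp])
    fix N
    have "(\<Sum>j<N. (inner (u n) (\<psi> j))\<^sup>2) \<le> (\<Sum>j<N. C\<^sub>2\<^sup>2 * L n powr (2 * s) * (h_coef j)\<^sup>2)"
    proof (rule sum_mono)
      fix j
      show "(inner (u n) (\<psi> j))\<^sup>2 \<le> C\<^sub>2\<^sup>2 * L n powr (2 * s) * (h_coef j)\<^sup>2"
      proof (cases "j \<in> I n")
        case False
        then have "a j powr (2 * s) \<le> L n powr (2 * s)"
          using s0 a_pos[of j] by (intro powr_mono2) (auto simp: I_def)
        then have "C\<^sub>2\<^sup>2 * a j powr (2 * s) * (h_coef j)\<^sup>2 \<le> C\<^sub>2\<^sup>2 * L n powr (2 * s) * (h_coef j)\<^sup>2"
          by (intro mult_right_mono mult_left_mono) auto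
        then show ?thesis using u_le[OF n, of j] by linarith
      qed (simp add: u_coef[OF n])
    qed
    also have "\<dots> = C\<^sub>2\<^sup>2 * L n powr (2 * s) * (\<Sum>j<N. (h_coef j)\<^sup>2)" by (simp add: sum_distrib_left)
    also have "\<dots> \<le> C\<^sub>2\<^sup>2 * L n powr (2 * s) * (norm h)\<^sup>2" by (intro mult_left_mono h_coef_sum) auto
    finally show "(\<Sum>j<N. (inner (u n) (\<psi> j))\<^sup>2) \<le> (C\<^sub>2 * norm h * L n powr s)\<^sup>2"
      by (simp add: power_mult_distrib powr_square mult_ac)
  qed
  have u_norm1: "norm (u n) \<le> C\<^sub>2 * norm h * L n powr s" if n: "1 \<le> n" for n
    using u_norm[OF n] C2 by (intro power2_le_imp_le[OF u_norm[OF n]]) auto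
  have "\<exists>C\<^sub>e>0. \<forall>n\<ge>1. ereal (L n) \<le> \<eta> \<longrightarrow> (\<exists>F\<in>sets M. prob F \<ge> \<delta> \<and> (\<forall>\<omega>\<in>F. small_error (1 / 2) C\<^sub>e q (L n) (b n - est n (L n) \<omega>)))"
  proof (rule estimation_error[where U = "C\<^sub>2 * norm h" and C\<^sub>b = "C\<^sub>3 * C\<^sub>2\<^sup>2 * (norm h)\<^sup>2" and H = "C\<^sub>1\<^sup>2 * (norm h)\<^sup>2"
        and hh = "\<lambda>n j. if j \<in> I n then scaled_coef j / a j powr q else 0"])
    show "0 < L n" "L n \<le> 1" "L n powr (- (1 / (t + c))) / real n = L n powr (2 * q + 1)"
      "L n powr (- (2 / (t + c))) \<le> real n" if "1 \<le> n" for n by (fact L(1-4)[OF that])+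
    show "norm (\<beta>\<^sub>0 - J (b n)) \<le> C\<^sub>2 * norm h" if n: "1 \<le> n" for n
    proof -
      have "L n powr s \<le> L n powr 0" using L(1,2)[OF n] s0 by (intro powr_mono') auto
      then have "C\<^sub>2 * norm h * L n powr s \<le> C\<^sub>2 * norm h * 1" using C2 L(1)[OF n] by (intro mult_left_mono) auto
      then show ?thesis using u_norm1[OF n] by (simp add: u_def)
    qed
    show "0 \<le> C\<^sub>3 * C\<^sub>2\<^sup>2 * (norm h)\<^sup>2" "0 \<le> C\<^sub>1\<^sup>2 * (norm h)\<^sup>2" using C3 by auto
    show "(\<Sum>j<N. a j * x j * (inner (\<beta>\<^sub>0 - J (b n)) (\<psi> j))\<^sup>2 / (a j + L n))
        \<le> C\<^sub>3 * C\<^sub>2\<^sup>2 * (norm h)\<^sup>2 * L n powr (2 * q + 1)" if n: "1 \<le> n" for n N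
    proof -
      have "a j * x j * (inner (u n) (\<psi> j))\<^sup>2 / (a j + L n) \<le> C\<^sub>3 * C\<^sub>2\<^sup>2 * L n powr (2 * q + 1) * (h_coef j)\<^sup>2" for j
      proof (cases "j \<in> I n")
        case False
        then have aL: "a j < L n" by (simp add: I_def)
        have "x j * (inner (u n) (\<psi> j))\<^sup>2 \<le> (C\<^sub>3 * a j powr (c / \<gamma>)) * (C\<^sub>2\<^sup>2 * a j powr (2 * s) * (h_coef j)\<^sup>2)"
          using C3 x_pos[of j] by (intro mult_mono C3 u_le n) auto
        also have "\<dots> = C\<^sub>3 * C\<^sub>2\<^sup>2 * (a j powr (c / \<gamma>) * a j powr (2 * s)) * (h_coef j)\<^sup>2" by simp
        also have "a j powr (c / \<gamma>) * a j powr (2 * s) = a j powr (2 * q + 1)" by (simp add: e1 flip: powr_add)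
        also have "C\<^sub>3 * C\<^sub>2\<^sup>2 * a j powr (2 * q + 1) * (h_coef j)\<^sup>2 \<le> C\<^sub>3 * C\<^sub>2\<^sup>2 * L n powr (2 * q + 1) * (h_coef j)\<^sup>2"
        proof (intro mult_right_mono mult_left_mono powr_mono2)
          have "0 \<le> c / \<gamma> + 2 * s" using decay \<gamma> s0 by simp
          then show "0 \<le> 2 * q + 1" by (simp only: e1)
        qed (use aL a_pos[of j] C3 in auto)
        finally have 1: "x j * (inner (u n) (\<psi> j))\<^sup>2 \<le> C\<^sub>3 * C\<^sub>2\<^sup>2 * L n powr (2 * q + 1) * (h_coef j)\<^sup>2" .
        have "a j / (a j + L n) \<le> 1" using a_pos[of j] L(1)[OF n] by simp
        then have "a j / (a j + L n) * (x j * (inner (u n) (\<psi> j))\<^sup>2) \<le> 1 * (x j * (inner (u n) (\<psi> j))\<^sup>2)"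
          using x_pos[of j] by (intro mult_right_mono) auto
        then show ?thesis using 1 by (simp add: mult_ac)
      qed (use C3 in \<open>simp add: u_coef[OF n]\<close>)
      then have "(\<Sum>j<N. a j * x j * (inner (u n) (\<psi> j))\<^sup>2 / (a j + L n))
          \<le> (\<Sum>j<N. C\<^sub>3 * C\<^sub>2\<^sup>2 * L n powr (2 * q + 1) * (h_coef j)\<^sup>2)" by (intro sum_mono)
      also have "\<dots> = C\<^sub>3 * C\<^sub>2\<^sup>2 * L n powr (2 * q + 1) * (\<Sum>j<N. (h_coef j)\<^sup>2)" by (simp add: sum_distrib_left)
      also have "\<dots> \<le> C\<^sub>3 * C\<^sub>2\<^sup>2 * L n powr (2 * q + 1) * (norm h)\<^sup>2" using C3 by (intro mult_left_mono h_coef_sum) auto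
      finally show ?thesis by (simp add: u_def mult_ac)
    qed
    show "expands e (b n)" if "1 \<le> n" for n by (rule b_exp)
    show "(\<forall>j. inner (b n) (e j) = a j powr q * (if j \<in> I n then scaled_coef j / a j powr q else 0))
        \<and> (\<forall>N. (\<Sum>j<N. (if j \<in> I n then scaled_coef j / a j powr q else 0)\<^sup>2) \<le> C\<^sub>1\<^sup>2 * (norm h)\<^sup>2)" if n: "1 \<le> n" "0 \<le> q" for n
    proof (intro conjI allI)
      show "inner (b n) (e j) = a j powr q * (if j \<in> I n then scaled_coef j / a j powr q else 0)" for j
        using a_pos[of j] by (simp add: b_coef[OF n(1)])
      fix N
      have "(\<Sum>j<N. (if j \<in> I n then scaled_coef j / a j powr q else 0)\<^sup>2) \<le> (\<Sum>j<N. C\<^sub>1\<^sup>2 * (h_coef j)\<^sup>2)"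
      proof (rule sum_mono)
        fix j
        have "(scaled_coef j / a j powr q)\<^sup>2 = (scaled_coef j)\<^sup>2 / a j powr (2 * q)" by (simp add: power_divide powr_square)
        also have "\<dots> \<le> C\<^sub>1\<^sup>2 * (h_coef j)\<^sup>2" using k_le[of j] a_pos[of j] by (simp add: divide_le_eq mult_ac)
        finally show "(if j \<in> I n then scaled_coef j / a j powr q else 0)\<^sup>2 \<le> C\<^sub>1\<^sup>2 * (h_coef j)\<^sup>2" by simp
      qed
      also have "\<dots> \<le> C\<^sub>1\<^sup>2 * (norm h)\<^sup>2" unfolding sum_distrib_left[symmetric] by (intro mult_left_mono h_coef_sum) auto
      finally show "(\<Sum>j<N. (if j \<in> I n then scaled_coef j / a j powr q else 0)\<^sup>2) \<le> C\<^sub>1\<^sup>2 * (norm h)\<^sup>2" .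
    qed
    \<comment> \<open>For negative q the weights a_j^(2q) are largest at the cut-off, where a_j is
      still at least \<open>L n\<close>; this yields the growing norm bound.\<close>
    show "(norm (b n))\<^sup>2 \<le> C\<^sub>1\<^sup>2 * (norm h)\<^sup>2 * L n powr (2 * q)" if n: "1 \<le> n" "q < 0" for n
    proof -
      have "(norm (b n))\<^sup>2 = (\<Sum>j\<in>I n. (scaled_coef j)\<^sup>2)"
        unfolding b_def by (rule norm_orthonormal_sum[OF orthonormal_e finI[OF n(1)]])
      also have "\<dots> \<le> (\<Sum>j\<in>I n. C\<^sub>1\<^sup>2 * L n powr (2 * q) * (h_coef j)\<^sup>2)"
      proof (rule sum_mono)
        fix j assume "j \<in> I n"
        then have "a j powr (2 * q) \<le> L n powr (2 * q)"
          using n L(1)[OF n(1)] by (intro powr_mono2') (auto simp: I_def)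
        then have "C\<^sub>1\<^sup>2 * a j powr (2 * q) * (h_coef j)\<^sup>2 \<le> C\<^sub>1\<^sup>2 * L n powr (2 * q) * (h_coef j)\<^sup>2"
          by (intro mult_right_mono mult_left_mono) auto
        then show "(scaled_coef j)\<^sup>2 \<le> C\<^sub>1\<^sup>2 * L n powr (2 * q) * (h_coef j)\<^sup>2" using k_le[of j] by linarith
      qed
      also have "\<dots> = C\<^sub>1\<^sup>2 * L n powr (2 * q) * (\<Sum>j\<in>I n. (h_coef j)\<^sup>2)" by (simp add: sum_distrib_left)
      also have "\<dots> \<le> C\<^sub>1\<^sup>2 * L n powr (2 * q) * (norm h)\<^sup>2" by (intro mult_left_mono h_coef_sum finI n) auto
      finally show ?thesis by (simp add: mult_ac)
    qed
    show "(1 / 2 :: real) = 0 \<or> (1 / 2 :: real) = 1 / 2" by simp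
  qed (use q\<nu> \<delta> in auto)
  then obtain C\<^sub>e where Ce: "C\<^sub>e > 0" and ev: "\<And>n. 1 \<le> n \<Longrightarrow> ereal (L n) \<le> \<eta> \<Longrightarrow> \<exists>F\<in>sets M. prob F \<ge> \<delta> \<and> (\<forall>\<omega>\<in>F.
      small_error (1 / 2) C\<^sub>e q (L n) (b n - est n (L n) \<omega>))"
    by blast
  define C where "C = C\<^sub>2 * norm h + sqrt (C\<^sub>4 * C\<^sub>e)"
  have C0: "C > 0" using C2 C4 Ce by (simp add: C_def add_nonneg_pos)
  have final: "norm (\<beta>\<^sub>0 - J f) \<le> C * L n powr s"
    if n: "1 \<le> n" and "small_error (1 / 2) C\<^sub>e q (L n) (b n - f)" for n f
  proof -
    from that(2) have f: "expands e (b n - f)"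
      "\<And>N. (\<Sum>j<N. (a j + L n) * (inner (b n - f) (e j))\<^sup>2) \<le> C\<^sub>e * L n powr (2 * q + 1)"
      unfolding small_error_def by auto
    define y where "y = b n - f"
    have "(norm (J y))\<^sup>2 \<le> (sqrt (C\<^sub>4 * C\<^sub>e) * L n powr s)\<^sup>2"
    proof (rule norm_J_le)
      show "expands e y" using f(1) by (simp add: y_def)
      fix N
      \<comment> \<open>Converts the energy weight to the L2 weight: m_j is of order
        a_j^(t/\<gamma>) with t/\<gamma> < 1, so the worst ratio to a_j + L occurs near a_j = L, on
        either side of which one of the two cases applies.\<close>
      have mj: "m j \<le> C\<^sub>4 * L n powr (t / \<gamma> - 1) * (a j + L n)" for j
      proof -
        have "a j powr (t / \<gamma>) \<le> L n powr (t / \<gamma> - 1) * (a j + L n)"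
        proof (cases "L n \<le> a j")
          case True
          have "a j powr (t / \<gamma>) = a j powr (t / \<gamma> - 1) * a j" using a_pos[of j] by (simp add: powr_diff)
          also have "\<dots> \<le> L n powr (t / \<gamma> - 1) * (a j + L n)"
            using True \<gamma> L(1)[OF n] a_pos[of j] by (intro mult_mono powr_mono2') auto
          finally show ?thesis .
        next
          case False
          then have "a j powr (t / \<gamma>) \<le> L n powr (t / \<gamma>)" using a_pos[of j] \<gamma> decay by (intro powr_mono2) auto
          also have "\<dots> = L n powr (t / \<gamma> - 1) * L n" using L(1)[OF n] by (simp add: powr_diff)
          also have "\<dots> \<le> L n powr (t / \<gamma> - 1) * (a j + L n)" using a_pos[of j] by (intro mult_left_mono) auto
          finally show ?thesis .
        qed
        then have "C\<^sub>4 * a j powr (t / \<gamma>) \<le> C\<^sub>4 * (L n powr (t / \<gamma> - 1) * (a j + L n))" using C4 by (intro mult_left_mono) auto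
        then show ?thesis using C4(2)[of j] by (simp add: mult.assoc)
      qed
      have "(\<Sum>j<N. m j * (inner y (e j))\<^sup>2) \<le> (\<Sum>j<N. C\<^sub>4 * L n powr (t / \<gamma> - 1) * (a j + L n) * (inner y (e j))\<^sup>2)"
        by (intro sum_mono mult_right_mono mj) auto
      also have "\<dots> = C\<^sub>4 * L n powr (t / \<gamma> - 1) * (\<Sum>j<N. (a j + L n) * (inner y (e j))\<^sup>2)"
        by (simp add: sum_distrib_left mult.assoc)
      also have "\<dots> \<le> C\<^sub>4 * L n powr (t / \<gamma> - 1) * (C\<^sub>e * L n powr (2 * q + 1))"
        using C4 f(2) by (intro mult_left_mono) (auto simp: y_def)
      also have "\<dots> = C\<^sub>4 * C\<^sub>e * (L n powr (t / \<gamma> - 1) * L n powr (2 * q + 1))" by simp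
      also have "L n powr (t / \<gamma> - 1) * L n powr (2 * q + 1) = L n powr (2 * s)"
        by (simp add: e2[symmetric] add.commute flip: powr_add)
      also have "C\<^sub>4 * C\<^sub>e * L n powr (2 * s) = (sqrt (C\<^sub>4 * C\<^sub>e) * L n powr s)\<^sup>2"
        using C4 Ce by (simp add: power_mult_distrib powr_square)
      finally show "(\<Sum>j<N. m j * (inner y (e j))\<^sup>2) \<le> (sqrt (C\<^sub>4 * C\<^sub>e) * L n powr s)\<^sup>2" .
    qed
    then have Jy: "norm (J y) \<le> sqrt (C\<^sub>4 * C\<^sub>e) * L n powr s"
      by (rule power2_le_imp_le) (use C4 Ce in auto)
    have "\<beta>\<^sub>0 - J f = u n + J y"
      by (simp add: u_def y_def linear_diff[OF bounded_linear.linear[OF bounded_linear_J]])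
    then have "norm (\<beta>\<^sub>0 - J f) \<le> norm (u n) + norm (J y)" by (simp add: norm_triangle_ineq)
    also have "\<dots> \<le> C * L n powr s" using u_norm1[OF n] Jy by (simp add: C_def distrib_right)
    finally show ?thesis .
  qed
  show ?thesis
  proof (rule exI[of _ C], intro conjI allI impI C0)
    fix n :: nat assume n: "1 \<le> n" and \<eta>: "ereal (reg_param t c r n) \<le> \<eta>"
    have rate: "L n powr s = real n powr (- (r * t) / (1 + c + 2 * t * r))"
      unfolding s_def \<gamma>_def by (rule L(5)[OF n])
    obtain F where F: "F \<in> sets M" "prob F \<ge> \<delta>" "\<forall>\<omega>\<in>F. small_error (1 / 2) C\<^sub>e q (L n) (b n - est n (L n) \<omega>)"
      using ev[OF n] \<eta> unfolding L_def by blast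
    show "\<exists>F\<in>sets M. prob F \<ge> \<delta> \<and> (\<forall>\<omega>\<in>F.
      norm (\<beta>\<^sub>0 - J (est n (reg_param t c r n) \<omega>))
        \<le> C * real n powr (- (r * t) / (1 + c + 2 * t * r)))"
      unfolding rate[symmetric] L_def[symmetric]
      by (rule bexI[OF _ F(1)]) (use F(2,3) final[OF n] in blast)
  qed
qed

text \<open>For \<alpha> >= 1/2 the scaled coefficients are square summable and define an RKHS
  element mapped to \<open>\<beta>\<^sub>0\<close>. Measuring in the RKHS norm needs no extra half
  power, so qualification q suffices, which is what the cap on \<open>r\<close> expresses.\<close>

lemma RKHS_rate:
  assumes r: "ereal r = min (ereal \<alpha>) (\<nu> + ereal (c / t) * \<nu> + ereal (1 / 2))" and \<alpha>: "\<alpha> \<ge> 1 / 2"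
  shows "\<exists>b. J b = \<beta>\<^sub>0 \<and> (\<forall>\<delta><1. \<exists>C>0. \<forall>n\<ge>1. ereal (reg_param t c r n) \<le> \<eta> \<longrightarrow> (\<exists>F\<in>sets M. prob F \<ge> \<delta> \<and> (\<forall>\<omega>\<in>F.
    norm (b - est n (reg_param t c r n) \<omega>)
      \<le> C * real n powr (- (t * (r - 1 / 2)) / (1 + c + 2 * t * r)))))"
proof -
  define \<gamma> where "\<gamma> = t + c"
  have \<gamma>: "\<gamma> > 0" using decay by (simp add: \<gamma>_def)
  define q where "q = t * (2 * r - 1) / (2 * (t + c))"
  have q2: "q = t * (r - 1 / 2) / \<gamma>" using \<gamma> by (simp add: q_def \<gamma>_def field_simps)
  have r\<alpha>: "r \<le> \<alpha>" using r by (metis ereal_less_eq(3) min.cobounded1)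
  have r2: "1 / 2 \<le> r" and q\<nu>: "ereal q \<le> \<nu>"
  proof -
    have "1 / 2 \<le> r \<and> ereal q \<le> \<nu>"
    proof (cases \<nu>)
      case (real v)
      have v: "v \<ge> 1 / 2" using qual(2) real by simp
      have "\<nu> + ereal (c / t) * \<nu> + ereal (1 / 2) = ereal (v + c / t * v + 1 / 2)" by (simp add: real)
      then have rr: "r = min \<alpha> (v + c / t * v + 1 / 2)" using r by (simp add: min_def split: if_splits)
      have "0 \<le> c / t * v" using decay v by simp
      then have "1 / 2 \<le> r" using rr v \<alpha> by auto
      have "r - 1 / 2 \<le> v + c / t * v" using rr by simp
      then have "t * (r - 1 / 2) \<le> t * (v + c / t * v)" using decay by (intro mult_left_mono) auto
      also have "\<dots> = v * \<gamma>" using decay by (simp add: field_simps \<gamma>_def)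
      finally have "q \<le> v" unfolding q2 using \<gamma> by (simp add: divide_le_eq)
      then show ?thesis using \<open>1 / 2 \<le> r\<close> real by simp
    next
      case PInf
      have "ereal (c / t) * \<infinity> = \<infinity>" using decay by simp
      then have "r = \<alpha>" using r PInf by simp
      then show ?thesis using \<alpha> PInf by simp
    next
      case MInf
      then show ?thesis using qual(2) by simp
    qed
    then show "1 / 2 \<le> r" "ereal q \<le> \<nu>" by auto
  qed
  have q0: "0 \<le> q" using r2 \<gamma> decay by (simp add: q2)
  have r0: "0 \<le> r" using r2 by simp
  define L where "L n = reg_param t c r n" for n
  note L = reg_param_facts[OF decay(1,2) r0, folded L_def q_def]
  obtain C\<^sub>1 where k_le: "\<And>j. (scaled_coef j)\<^sup>2 \<le> C\<^sub>1\<^sup>2 * a j powr (2 * q) * (h_coef j)\<^sup>2"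
    using scaled_coef_le[OF r\<alpha>] unfolding q_def by blast
  have "summable (\<lambda>j. (scaled_coef j)\<^sup>2)"
  proof -
    obtain B where B: "B > 0" "\<forall>i\<ge>1. \<mu> i \<le> B" using power_decay_bounded[OF decay(3)] decay(1) by auto
    show ?thesis
    proof (rule summable_comparison_test'[where N = 0])
      show "summable (\<lambda>j. (B powr (\<alpha> - 1 / 2))\<^sup>2 * (h_coef j)\<^sup>2)"
        unfolding h_coef_def by (intro summable_mult summable_power2_inner \<psi>)
      show "norm ((scaled_coef j)\<^sup>2) \<le> (B powr (\<alpha> - 1 / 2))\<^sup>2 * (h_coef j)\<^sup>2" for j
        using B(2)[rule_format, of "Suc j"] m_pos[of j] \<alpha>
        by (auto simp: scaled_coef_def m_def power_mult_distrib intro!: mult_right_mono power_mono powr_mono2)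
    qed
  qed
  then obtain b where b: "(\<lambda>j. scaled_coef j *\<^sub>R e j) sums b" using orthonormal_series_converges[OF orthonormal_e] by blast
  have Jb: "J b = \<beta>\<^sub>0"
  proof -
    have "(\<lambda>j. J (scaled_coef j *\<^sub>R e j)) sums J b" by (rule bounded_linear.sums[OF bounded_linear_J b])
    moreover have "J (scaled_coef j *\<^sub>R e j) = (m j powr \<alpha> * h_coef j) *\<^sub>R \<psi> j" for j
      using coef_sqrt[of j] by (simp add: linear_scale[OF bounded_linear.linear[OF bounded_linear_J]] J_e scaled_coef_def mult_ac)
    ultimately show ?thesis using sums_unique2[OF _ beta_sums] by simp
  qed
  have "\<exists>C>0. \<forall>n\<ge>1. ereal (reg_param t c r n) \<le> \<eta> \<longrightarrow> (\<exists>F\<in>sets M. prob F \<ge> \<delta> \<and> (\<forall>\<omega>\<in>F.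
    norm (b - est n (reg_param t c r n) \<omega>)
      \<le> C * real n powr (- (t * (r - 1 / 2)) / (1 + c + 2 * t * r))))" if \<delta>: "\<delta> < 1" for \<delta>
  proof -
    have "\<exists>C\<^sub>e>0. \<forall>n\<ge>1. ereal (L n) \<le> \<eta> \<longrightarrow> (\<exists>F\<in>sets M. prob F \<ge> \<delta> \<and> (\<forall>\<omega>\<in>F. small_error 0 C\<^sub>e q (L n) (b - est n (L n) \<omega>)))"
    \<comment> \<open>The target represents \<open>\<beta>\<^sub>0\<close> exactly, so the
      approximation error and the mean of the residual noise are both 0.\<close>
    proof (rule estimation_error[where U = 0 and C\<^sub>b = 0 and H = "C\<^sub>1\<^sup>2 * (norm h)\<^sup>2" and b = "\<lambda>_. b"
          and hh = "\<lambda>n j. scaled_coef j / a j powr q"])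
      show "0 < L n" "L n \<le> 1" "L n powr (- (1 / (t + c))) / real n = L n powr (2 * q + 1)"
        "L n powr (- (2 / (t + c))) \<le> real n" if "1 \<le> n" for n by (fact L(1-4)[OF that])+
      show "expands e b" by (rule sums_imp_expands[OF orthonormal_e b])
      show "(\<forall>j. inner b (e j) = a j powr q * (scaled_coef j / a j powr q))
        \<and> (\<forall>N. (\<Sum>j<N. (scaled_coef j / a j powr q)\<^sup>2) \<le> C\<^sub>1\<^sup>2 * (norm h)\<^sup>2)" for n :: nat
      proof (intro conjI allI)
        show "inner b (e j) = a j powr q * (scaled_coef j / a j powr q)" for j
          using a_pos[of j] by (simp add: sums_inner_orthonormal[OF orthonormal_e b])
        fix N
        have "(\<Sum>j<N. (scaled_coef j / a j powr q)\<^sup>2) \<le> (\<Sum>j<N. C\<^sub>1\<^sup>2 * (h_coef j)\<^sup>2)"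
        proof (rule sum_mono)
          fix j
          have "(scaled_coef j / a j powr q)\<^sup>2 = (scaled_coef j)\<^sup>2 / a j powr (2 * q)" by (simp add: power_divide powr_square)
          also have "\<dots> \<le> C\<^sub>1\<^sup>2 * (h_coef j)\<^sup>2" using k_le[of j] a_pos[of j] by (simp add: divide_le_eq mult_ac)
          finally show "(scaled_coef j / a j powr q)\<^sup>2 \<le> C\<^sub>1\<^sup>2 * (h_coef j)\<^sup>2" .
        qed
        also have "\<dots> \<le> C\<^sub>1\<^sup>2 * (norm h)\<^sup>2" unfolding sum_distrib_left[symmetric] by (intro mult_left_mono h_coef_sum) auto
        finally show "(\<Sum>j<N. (scaled_coef j / a j powr q)\<^sup>2) \<le> C\<^sub>1\<^sup>2 * (norm h)\<^sup>2" .
      qed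
    qed (use q0 q\<nu> \<delta> Jb in auto)
    then obtain C\<^sub>e where Ce: "C\<^sub>e > 0" and ev: "\<And>n. 1 \<le> n \<Longrightarrow> ereal (L n) \<le> \<eta> \<Longrightarrow> \<exists>F\<in>sets M. prob F \<ge> \<delta> \<and> (\<forall>\<omega>\<in>F.
        small_error 0 C\<^sub>e q (L n) (b - est n (L n) \<omega>))"
      by blast
    have rate: "L n powr q = real n powr (- (t * (r - 1 / 2)) / (1 + c + 2 * t * r))" if "1 \<le> n" for n
      by (rule L(6)[OF that])
    show ?thesis
    proof (rule exI[of _ C\<^sub>e], intro conjI allI impI Ce)
      fix n :: nat assume n: "1 \<le> n" and \<eta>: "ereal (reg_param t c r n) \<le> \<eta>"
      obtain F where F: "F \<in> sets M" "prob F \<ge> \<delta>" "\<forall>\<omega>\<in>F. small_error 0 C\<^sub>e q (L n) (b - est n (L n) \<omega>)"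
        using ev[OF n] \<eta> unfolding L_def by blast
      show "\<exists>F\<in>sets M. prob F \<ge> \<delta> \<and> (\<forall>\<omega>\<in>F.
          norm (b - est n (reg_param t c r n) \<omega>)
            \<le> C\<^sub>e * real n powr (- (t * (r - 1 / 2)) / (1 + c + 2 * t * r)))"
        unfolding rate[OF n, symmetric] L_def[symmetric]
        by (rule bexI[OF _ F(1)]) (use F(2,3) in \<open>auto simp: small_error_def\<close>)
    qed
  qed
  with Jb show ?thesis by blast
qed

end

lemma (in prob_space) lesssim_pI:
  assumes "\<And>\<delta>. 0 < \<delta> \<Longrightarrow> \<delta> < 1 \<Longrightarrow> \<exists>C>0. \<forall>n\<in>I. \<exists>F\<in>sets M. prob F \<ge> \<delta> \<and> (\<forall>\<omega>\<in>F. W n \<omega> \<le> C * b n)"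
  shows "lesssim_p M I W b"
  unfolding lesssim_p_def
proof (intro allI impI)
  fix \<delta> :: real assume "0 < \<delta> \<and> \<delta> < 1"
  then obtain C where C: "C > 0" "\<And>n. n \<in> I \<Longrightarrow> \<exists>F\<in>sets M. prob F \<ge> \<delta> \<and> (\<forall>\<omega>\<in>F. W n \<omega> \<le> C * b n)"
    using assms[of \<delta>] by blast
  show "\<exists>C>0. \<forall>n\<in>I. \<exists>E\<in>sets M. E \<subseteq> {\<omega> \<in> space M. W n \<omega> \<le> C * b n} \<and> measure M E \<ge> \<delta>"
  proof (rule exI[of _ C], intro conjI ballI C(1))
    fix n assume "n \<in> I"
    then obtain F where F: "F \<in> sets M" "prob F \<ge> \<delta>" "\<forall>\<omega>\<in>F. W n \<omega> \<le> C * b n" using C(2) by blast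
    then show "\<exists>E\<in>sets M. E \<subseteq> {\<omega> \<in> space M. W n \<omega> \<le> C * b n} \<and> measure M E \<ge> \<delta>"
      using sets.sets_into_space[OF F(1)] by (intro bexI[OF _ F(1)]) auto
  qed
qed

theorem theorem3p1:
  fixes M :: "'w measure"
    and S :: "'a::euclidean_space set"
    and X :: "'w \<Rightarrow> 'a L2" and \<epsilon> Y :: "'w \<Rightarrow> real"
    and Xs :: "nat \<Rightarrow> 'w \<Rightarrow> 'a L2" and Ys :: "nat \<Rightarrow> 'w \<Rightarrow> real"
    and \<beta>\<^sub>0 h :: "'a L2" and \<sigma> :: real
    and k :: "'a \<Rightarrow> 'a \<Rightarrow> real" and \<kappa> :: real
    and evalf :: "'h::{real_inner, banach} \<Rightarrow> 'a \<Rightarrow> real"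
    and g :: "real \<Rightarrow> real \<Rightarrow> real" and \<eta> \<nu> :: ereal
    and \<alpha> t c d\<^sub>1 :: real
    and \<mu> \<xi> :: "nat \<Rightarrow> real" and \<phi> :: "nat \<Rightarrow> 'a L2"
  assumes prob: "prob_space M" and S: "compact S"
    and X: "X \<in> borel_measurable M" "\<forall>\<omega>\<in>space M. X \<omega> \<in> L2_on S"
      "integrable M (\<lambda>\<omega>. (norm (X \<omega>))\<^sup>2)"
    and beta: "\<beta>\<^sub>0 \<in> L2_on S"
    and noise: "\<epsilon> \<in> borel_measurable M" "integrable M \<epsilon>" "prob_space.expectation M \<epsilon> = 0"
      "integrable M (\<lambda>\<omega>. (\<epsilon> \<omega>)\<^sup>2)" "prob_space.variance M \<epsilon> = \<sigma>\<^sup>2"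
      "prob_space.indep_set M {X -` A \<inter> space M |A. A \<in> sets borel}
         {\<epsilon> -` A \<inter> space M |A. A \<in> sets borel}"
    and model: "\<forall>\<omega>\<in>space M. Y \<omega> = inner (X \<omega>) \<beta>\<^sub>0 + \<epsilon> \<omega>"
    and iid: "prob_space.indep_vars M (\<lambda>_. borel \<Otimes>\<^sub>M borel) (\<lambda>i \<omega>. (Xs i \<omega>, Ys i \<omega>)) {1..}"
      "\<forall>i\<ge>1. distr M (borel \<Otimes>\<^sub>M borel) (\<lambda>\<omega>. (Xs i \<omega>, Ys i \<omega>)) =
              distr M (borel \<Otimes>\<^sub>M borel) (\<lambda>\<omega>. (X \<omega>, Y \<omega>))"
    and kernel: "bounded_pd_kernel S k \<kappa>" and RKHS: "is_RKHS S k evalf"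
    and reg: "0 < \<eta>" "regularization_family \<eta> g"
    and spec: "\<forall>n\<ge>1. AE \<omega> in M.
      \<forall>s\<in>real_spectrum (RKHS_empirical_covariance S evalf Xs n \<omega>). 0 \<le> s \<and> ereal s \<le> \<eta>"
    and commute: "kernel_operator S evalf \<circ> covariance M X = covariance M X \<circ> kernel_operator S evalf"
    and source: "\<alpha> > 0" "h \<in> L2_on S"
      "\<beta>\<^sub>0 = functional_calculus (\<lambda>s. s powr \<alpha>) (kernel_operator S evalf) h"
    and decay: "t > 1" "c > 1" "power_decay t \<mu>" "power_decay c \<xi>"
      "simple_eigenpairs (kernel_operator S evalf) \<mu> \<phi>" "simple_eigenpairs (covariance M X) \<xi> \<phi>"
    and moment: "d\<^sub>1 > 0"
      "\<forall>f\<in>L2_on S. integrable M (\<lambda>\<omega>. (inner (X \<omega>) f) ^ 4) \<and>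
         (LINT \<omega>|M. (inner (X \<omega>) f) ^ 4) \<le> d\<^sub>1 * (LINT \<omega>|M. (inner (X \<omega>) f)\<^sup>2)\<^sup>2"
    and qual: "has_qualification \<eta> g \<nu>" "\<nu> \<ge> ereal (1 / 2)"
  shows
    "(\<forall>r. ereal r = min (ereal \<alpha>) (\<nu> + ereal (c / t) * (\<nu> - ereal (1 / 2))) \<longrightarrow>
        lesssim_p M {n. n \<ge> 1 \<and> ereal (reg_param t c r n) \<le> \<eta>}
          (\<lambda>n \<omega>. norm (\<beta>\<^sub>0 -
             RKHS_inclusion S evalf (spectral_estimator S evalf (g (reg_param t c r n)) Xs Ys n \<omega>)))
          (\<lambda>n. real n powr (- (r * t) / (1 + c + 2 * t * r)))) \<and>
     (\<alpha> \<ge> 1 / 2 \<longrightarrow>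
       (\<forall>r. ereal r = min (ereal \<alpha>) (\<nu> + ereal (c / t) * \<nu> + ereal (1 / 2)) \<longrightarrow>
         (\<exists>b. RKHS_inclusion S evalf b = \<beta>\<^sub>0 \<and>
           lesssim_p M {n. n \<ge> 1 \<and> ereal (reg_param t c r n) \<le> \<eta>}
             (\<lambda>n \<omega>. norm (b - spectral_estimator S evalf (g (reg_param t c r n)) Xs Ys n \<omega>))
             (\<lambda>n. real n powr (- (t * (r - 1 / 2)) / (1 + c + 2 * t * r))))))"
proof -
  interpret prob_space M by (rule prob)
  interpret functional_regression M S k \<kappa> evalf X \<epsilon> Y Xs Ys \<beta>\<^sub>0 h \<sigma> g \<eta> \<nu> \<alpha> t c d\<^sub>1 \<mu> \<xi> \<phi>
    by (intro functional_regression.intro compact_RKHS.intro functional_regression_axioms.intro) (fact assms prob_space_axioms)+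
  show ?thesis
  proof (intro conjI allI impI)
    fix r assume r: "ereal r = min (ereal \<alpha>) (\<nu> + ereal (c / t) * (\<nu> - ereal (1 / 2)))"
    show "lesssim_p M {n. n \<ge> 1 \<and> ereal (reg_param t c r n) \<le> \<eta>}
          (\<lambda>n \<omega>. norm (\<beta>\<^sub>0 -
             RKHS_inclusion S evalf (spectral_estimator S evalf (g (reg_param t c r n)) Xs Ys n \<omega>)))
          (\<lambda>n. real n powr (- (r * t) / (1 + c + 2 * t * r)))"
      using L2_rate[OF r] unfolding est_def by (intro lesssim_pI) blast
  next
    fix r assume \<alpha>: "\<alpha> \<ge> 1 / 2" and r: "ereal r = min (ereal \<alpha>) (\<nu> + ereal (c / t) * \<nu> + ereal (1 / 2))"
    obtain b where b: "J b = \<beta>\<^sub>0" "\<And>\<delta>. \<delta> < 1 \<Longrightarrow> \<exists>C>0. \<forall>n\<ge>1. ereal (reg_param t c r n) \<le> \<eta> \<longrightarrow> (\<exists>F\<in>sets M. prob F \<ge> \<delta> \<and> (\<forall>\<omega>\<in>F.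
        norm (b - spectral_estimator S evalf (g (reg_param t c r n)) Xs Ys n \<omega>)
          \<le> C * real n powr (- (t * (r - 1 / 2)) / (1 + c + 2 * t * r))))"
      using RKHS_rate[OF r \<alpha>] unfolding est_def by blast
    have "lesssim_p M {n. n \<ge> 1 \<and> ereal (reg_param t c r n) \<le> \<eta>}
        (\<lambda>n \<omega>. norm (b - spectral_estimator S evalf (g (reg_param t c r n)) Xs Ys n \<omega>))
        (\<lambda>n. real n powr (- (t * (r - 1 / 2)) / (1 + c + 2 * t * r)))"
      using b(2) by (intro lesssim_pI) blast
    then show "\<exists>b. RKHS_inclusion S evalf b = \<beta>\<^sub>0 \<and>
           lesssim_p M {n. n \<ge> 1 \<and> ereal (reg_param t c r n) \<le> \<eta>}
             (\<lambda>n \<omega>. norm (b - spectral_estimator S evalf (g (reg_param t c r n)) Xs Ys n \<omega>))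
             (\<lambda>n. real n powr (- (t * (r - 1 / 2)) / (1 + c + 2 * t * r)))"
      using b(1) by blast
  qed
qed

end
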